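(* Let $X_j=\mu_1+\eta_{1,j}$ and $Y_j=\mu_2+\eta_{2,j}$ ($j\in\mathbb{N}$) with $\mu_1,\mu_2\in C([0,1])$, where $(\eta_{1,j})_{j\in\mathbb{N}}$ and $(\eta_{2,j})_{j\in\mathbb{N}}$ are independent, centred, strictly stationary $C([0,1])$-valued processes, each satisfying conditions (A1)--(A4) of the context with the metric $\rho(s,t)=|s-t|^\theta$ for some $\theta\in(0,1]$ with $J\theta>2$, and with constants $\nu_i,\bar\tau_i$ ($i=1,2$) in place of $\nu,\bar\tau$ for the $i$th process. Let $\frac m{m+n}\to\lambda\in(0,1)$ as $m,n\to\infty$, let $\alpha\in(0,1)$, and let the block lengths be $l_1=m^{\beta_1}$, $l_2=n^{\beta_2}$ (rounded to integers), where for $i=1,2$ $$0<\beta_i<\nu_i/(2+\nu_i),\qquad \bar\tau_i>(\beta_i(2+\nu_i)+1)/(2+2\nu_i).$$ Let $\hat d_\infty$ and the bootstrap quantile $T_{m,n}^{\{\lfloor R(1-\alpha)\rfloor\}}$ be as defined in the context. If $C_1=C_2$, then $$\lim_{m,n,R\to\infty}\mathbb{P}\Big(\hat d_\infty>\frac{T_{m,n}^{\{\lfloor R(1-\alpha)\rfloor\}}}{\sqrt{m+n}}\Big)=\alpha.$$ If $C_1\ne C_2$, then for any $R\in\mathbb{N}$ $$\liminf_{m,n\to\infty}\mathbb{P}\Big(\hat d_\infty>\frac{T_{m,n}^{\{\lfloor R(1-\alpha)\rfloor\}}}{\sqrt{m+n}}\Big)=1.$$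
   Context: $C([0,1])$, $C([0,1]^2)$ carry the sup-norm $\|\cdot\|_\infty$ and the Borel $\sigma$-field; the probability space is complete; $f^{\check\otimes2}(s,t)=f(s)f(t)$. Definitions: $C_1(s,t)=\mathbb{E}[\eta_{1,j}(s)\eta_{1,j}(t)]$, $C_2(s,t)=\mathbb{E}[\eta_{2,j}(s)\eta_{2,j}(t)]$. From samples $X_1,\dots,X_m$ and $Y_1,\dots,Y_n$ with means $\bar X_m,\bar Y_n$, put $\tilde X_{m,j}=X_j-\bar X_m$, $\tilde Y_{n,j}=Y_j-\bar Y_n$ and $$\hat d_\infty=\sup_{s,t\in[0,1]}\Big|\frac1{m-1}\sum_{j=1}^m\tilde X_{m,j}^{\check\otimes2}(s,t)-\frac1{n-1}\sum_{j=1}^n\tilde Y_{n,j}^{\check\otimes2}(s,t)\Big|.$$ Bootstrap: $(\xi^{(r)}_k)_{k\in\mathbb{N}}$, $(\zeta^{(r)}_k)_{k\in\mathbb{N}}$, $r=1,\dots,R$, are independent sequences of independent standard normal random variables, independent of the data, and $$\hat B_{m,n}^{(r)}=\sqrt{n+m}\Big\{\frac1m\sum_{k=1}^{m-l_1+1}\frac1{\sqrt{l_1}}\Big(\sum_{j=k}^{k+l_1-1}\tilde X_{m,j}^{\check\otimes2}-\frac{l_1}m\sum_{i=1}^m\tilde X_{m,i}^{\check\otimes2}\Big)\xi_k^{(r)}-\frac1n\sum_{k=1}^{n-l_2+1}\frac1{\sqrt{l_2}}\Big(\sum_{j=k}^{k+l_2-1}\tilde Y_{n,j}^{\check\otimes2}-\frac{l_2}n\sum_{i=1}^n\tilde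 Y_{n,i}^{\check\otimes2}\Big)\zeta_k^{(r)}\Big\}.$$ $T_{m,n}^{(r)}=\sup_{s,t\in[0,1]}|\hat B_{m,n}^{(r)}(s,t)|$, and $T_{m,n}^{\{\lfloor R(1-\alpha)\rfloor\}}$ is the empirical $(1-\alpha)$-quantile of $T_{m,n}^{(1)},\dots,T_{m,n}^{(R)}$, i.e. the $\lfloor R(1-\alpha)\rfloor$-th smallest value (the smallest value if $\lfloor R(1-\alpha)\rfloor=0$). For $\sigma$-fields $\mathcal F,\mathcal G$ let $\phi(\mathcal F,\mathcal G)=\sup\{|\mathbb{P}(G|F)-\mathbb{P}(G)|:F\in\mathcal F,G\in\mathcal G,\mathbb{P}(F)>0\}$. For a strictly stationary process $(\eta_j)_{j\in\mathbb{N}}$, with $\mathcal F_k^{k'}=\sigma(\eta_j:k\le j\le k')$, $\varphi(k)=\sup_{k'\in\mathbb{N}}\phi(\mathcal F_1^{k'},\mathcal F_{k'+k}^\infty)$; it is $\varphi$-mixing if $\varphi(k)\to0$. Let $\rho_{\max}((s,t),(s',t'))=\max\{\rho(s,s'),\rho(t,t')\}$ and $D(\omega,\rho_{\max})$ the maximal number of $\omega$-separated points in $([0,1]^2,\rho_{\max})$. Conditions on a process $(\eta_j)$ (the constants $\nu,K,\tilde K,\bar\tau$ and the variable $M$ may differ between the two processes): (A1) $\int_0^\tau D(\omega,\rho_{\max})^{1/J}d\omega<\infty$ for some $\tau>0$ and some even integer $J\ge2$. (A2) $\mathbb{E}[\|\eta_1\|_\infty^{4+\nu}]\le K$ for some constant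 $K$ and some $\nu>0$, and $\mathbb{E}[\|\eta_1\|_\infty^{2J}]<\infty$. (A3) There are a real-valued non-negative random variable $M$ and a constant $\tilde K$ such that, for any $j\in\mathbb{N}$, $\mathbb{E}[(\|\eta_j\|_\infty M)^J]<\tilde K<\infty$ and $|\eta_j(t)-\eta_j(t')|\le M\rho(t,t')$ almost surely for all $t,t'\in[0,1]$. (A4) $(\eta_j)$ is $\varphi$-mixing with, for some $\bar\tau\in(1/(2+2\nu),1/2)$, $\sum_{k\ge1}k^{1/(1/2-\bar\tau)}\varphi(k)^{1/2}<\infty$ and $\sum_{k\ge1}(k+1)^{J/2-1}\varphi(k)^{1/J}<\infty$. Here $J,\nu$ are the same throughout (A1)--(A4).
   Formalization: The claim for C_1 = C_2 is proved under the added assumption that the limiting Gaussian process is not identically zero (some (s,t) has positive limiting variance); without it the claim fails, e.g. for η_1 = η_2 = 0, where the rejection probability is 0. *)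

theory Defs
  imports "HOL-Probability.Probability" "HOL-Analysis.Bounded_Continuous_Function"
begin

section \<open>The spaces \<open>C([0,1])\<close> and \<open>C([0,1]\<^sup>2)\<close>\<close>

text \<open>
  The unit interval is made a (compact) metric type, so that \<open>C([0,1])\<close> is the library's Banach
  space of bounded continuous functions on it, with its sup-norm and its Borel \<open>\<sigma>\<close>-field
  \<open>borel\<close>. The lemmas below show that nothing is lost: every continuous function is bounded, and
  \<open>norm\<close> is the sup-norm.
\<close>

typedef unit_interval = "{0..1::real}"
  morphisms real_of_ui ui_of_real
  by (rule exI[of _ 0]) simp

instantiation unit_interval :: metric_space
begin

definition dist_unit_interval :: "unit_interval \<Rightarrow> unit_interval \<Rightarrow> real" where
  "dist_unit_interval s t = \<bar>real_of_ui s - real_of_ui t\<bar>"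

definition uniformity_unit_interval :: "(unit_interval \<times> unit_interval) filter" where
  "uniformity_unit_interval = (INF e\<in>{0 <..}. principal {(x, y). dist x y < e})"

definition open_unit_interval :: "unit_interval set \<Rightarrow> bool" where
  "open_unit_interval S = (\<forall>x\<in>S. \<forall>\<^sub>F (x', y) in uniformity. x' = x \<longrightarrow> y \<in> S)"

instance
proof
  fix x y z :: unit_interval
  show "dist x y = 0 \<longleftrightarrow> x = y"
    by (simp add: dist_unit_interval_def real_of_ui_inject)
  show "dist x y \<le> dist x z + dist y z"
    by (simp add: dist_unit_interval_def)
qed (rule open_unit_interval_def uniformity_unit_interval_def)+

end

lemma compact_UNIV_unit_interval: "compact (UNIV :: unit_interval set)"
proof -
  have "continuous_on {0..1} ui_of_real"
    unfolding continuous_on_iff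
    by (auto simp: dist_unit_interval_def dist_real_def ui_of_real_inverse)
  then have "compact (ui_of_real ` {0..1})"
    by (rule compact_continuous_image) simp
  moreover have "ui_of_real ` {0..1} = UNIV"
    using real_of_ui real_of_ui_inverse by (metis UNIV_eq_I image_eqI)
  ultimately show ?thesis by simp
qed

type_synonym C01 = "unit_interval \<Rightarrow>\<^sub>C real"
type_synonym C01sq = "(unit_interval \<times> unit_interval) \<Rightarrow>\<^sub>C real"

lemma continuous_imp_C01: "continuous_on UNIV f \<Longrightarrow> f \<in> bcontfun"
  for f :: "unit_interval \<Rightarrow> real"
  unfolding bcontfun_def
  by (auto intro: compact_imp_bounded compact_continuous_image compact_UNIV_unit_interval)

lemma continuous_imp_C01sq: "continuous_on UNIV f \<Longrightarrow> f \<in> bcontfun"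
  for f :: "unit_interval \<times> unit_interval \<Rightarrow> real"
  unfolding bcontfun_def
  by (auto intro!: compact_imp_bounded compact_continuous_image
      compact_Times compact_UNIV_unit_interval simp flip: UNIV_Times_UNIV)

lemma norm_eq_SUP: "norm f = (SUP x. \<bar>apply_bcontfun f x\<bar>)"
  for f :: "'a::topological_space \<Rightarrow>\<^sub>C real"
  by (simp add: norm_bcontfun_def dist_bcontfun_def)

definition tensor_sq :: "C01 \<Rightarrow> C01sq" where
  "tensor_sq f = Bcontfun (\<lambda>(s, t). f s * f t)"

lemma tensor_sq_apply: "tensor_sq f (s, t) = f s * f t"
proof -
  have "continuous_on UNIV (\<lambda>p. apply_bcontfun f (fst p) * apply_bcontfun f (snd p))"
    by (intro continuous_on_mult
        continuous_on_compose2[OF continuous_on_apply_bcontfun[of UNIV f]])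
      (auto intro: continuous_intros)
  then have "(\<lambda>(s, t). f s * f t) \<in> bcontfun"
    by (intro continuous_imp_C01sq) (simp add: case_prod_beta)
  then show ?thesis
    by (simp add: tensor_sq_def Bcontfun_inverse)
qed


section \<open>Processes\<close>

text \<open>
  Sequences are functions on \<open>nat\<close> of which only the entries with index at least \<open>1\<close> matter.
\<close>

definition strictly_stationary :: "'a measure \<Rightarrow> (nat \<Rightarrow> 'a \<Rightarrow> C01) \<Rightarrow> bool" where
  "strictly_stationary P \<eta> \<longleftrightarrow>
     (\<forall>I h. finite I \<and> I \<subseteq> {1..} \<longrightarrow>
        distr P (\<Pi>\<^sub>M i\<in>I. borel) (\<lambda>\<omega>. \<lambda>i\<in>I. \<eta> (i + h) \<omega>) =
        distr P (\<Pi>\<^sub>M i\<in>I. borel) (\<lambda>\<omega>. \<lambda>i\<in>I. \<eta> i \<omega>))"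

definition centred_stationary_process :: "'a measure \<Rightarrow> (nat \<Rightarrow> 'a \<Rightarrow> C01) \<Rightarrow> bool" where
  "centred_stationary_process P \<eta> \<longleftrightarrow>
     (\<forall>j\<ge>1. \<eta> j \<in> borel_measurable P) \<and>
     (\<forall>j\<ge>1. \<forall>t. integrable P (\<lambda>\<omega>. \<eta> j \<omega> t) \<and> (\<integral>\<omega>. \<eta> j \<omega> t \<partial>P) = 0) \<and>
     strictly_stationary P \<eta>"

text \<open>By stationarity the index \<open>j\<close> in \<open>E[\<eta>\<^sub>j(s) \<eta>\<^sub>j(t)]\<close> is immaterial.\<close>

definition cov_kernel :: "'a measure \<Rightarrow> (nat \<Rightarrow> 'a \<Rightarrow> C01) \<Rightarrow> unit_interval \<Rightarrow> unit_interval \<Rightarrow> real" where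
  "cov_kernel P \<eta> s t = (\<integral>\<omega>. \<eta> 1 \<omega> s * \<eta> 1 \<omega> t \<partial>P)"


section \<open>\<open>\<phi>\<close>-mixing\<close>

definition phi_dep :: "'a measure \<Rightarrow> 'a set set \<Rightarrow> 'a set set \<Rightarrow> real" where
  "phi_dep P \<F> \<G> =
     Sup {\<bar>measure P (G \<inter> F) / measure P F - measure P G\<bar> |F G.
            F \<in> \<F> \<and> G \<in> \<G> \<and> measure P F > 0}"

text \<open>The \<open>\<sigma>\<close>-field generated by the random variables \<open>Z i\<close>, \<open>i \<in> I\<close>.\<close>

definition gen_sigma ::
  "'a measure \<Rightarrow> ('i \<Rightarrow> 'a \<Rightarrow> 'b::topological_space) \<Rightarrow> 'i set \<Rightarrow> 'a set set" where
  "gen_sigma P Z I =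
     sigma_sets (space P) (\<Union>i\<in>I. {Z i -` A \<inter> space P |A. A \<in> sets borel})"

definition phi_coeff :: "'a measure \<Rightarrow> (nat \<Rightarrow> 'a \<Rightarrow> C01) \<Rightarrow> nat \<Rightarrow> real" where
  "phi_coeff P \<eta> k =
     (SUP k'\<in>{1..}. phi_dep P (gen_sigma P \<eta> {1..k'}) (gen_sigma P \<eta> {k' + k..}))"

definition phi_mixing :: "'a measure \<Rightarrow> (nat \<Rightarrow> 'a \<Rightarrow> C01) \<Rightarrow> bool" where
  "phi_mixing P \<eta> \<longleftrightarrow> phi_coeff P \<eta> \<longlonglongrightarrow> 0"


section \<open>Conditions (A1)--(A4)\<close>

definition rho_theta :: "real \<Rightarrow> unit_interval \<Rightarrow> unit_interval \<Rightarrow> real" where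
  "rho_theta \<theta> s t = \<bar>real_of_ui s - real_of_ui t\<bar> powr \<theta>"

definition rho_max ::
  "(unit_interval \<Rightarrow> unit_interval \<Rightarrow> real) \<Rightarrow>
   unit_interval \<times> unit_interval \<Rightarrow> unit_interval \<times> unit_interval \<Rightarrow> real" where
  "rho_max \<rho> p q = max (\<rho> (fst p) (fst q)) (\<rho> (snd p) (snd q))"

text \<open>Points are \<open>\<omega>\<close>-separated if their pairwise distances exceed \<open>\<omega>\<close> strictly.\<close>

definition packing_number :: "real \<Rightarrow> ('b \<Rightarrow> 'b \<Rightarrow> real) \<Rightarrow> enat" where
  "packing_number w d =
     (SUP A\<in>{A. finite A \<and> (\<forall>p\<in>A. \<forall>q\<in>A. p \<noteq> q \<longrightarrow> d p q > w)}. enat (card A))"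

definition cond_A1 :: "(unit_interval \<Rightarrow> unit_interval \<Rightarrow> real) \<Rightarrow> nat \<Rightarrow> bool" where
  "cond_A1 \<rho> J \<longleftrightarrow> even J \<and> J \<ge> 2 \<and>
     (\<exists>\<tau>>0. (\<integral>\<^sup>+w\<in>{0<..<\<tau>}.
        (case packing_number w (rho_max \<rho>) of enat N \<Rightarrow> ennreal (real N powr (1 / real J)) | \<infinity> \<Rightarrow> \<infinity>)
        \<partial>lborel) < \<infinity>)"

definition cond_A2 :: "'a measure \<Rightarrow> (nat \<Rightarrow> 'a \<Rightarrow> C01) \<Rightarrow> nat \<Rightarrow> real \<Rightarrow> bool" where
  "cond_A2 P \<eta> J \<nu> \<longleftrightarrow> \<nu> > 0 \<and>
     (\<exists>K. integrable P (\<lambda>\<omega>. norm (\<eta> 1 \<omega>) powr (4 + \<nu>)) \<and>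
          (\<integral>\<omega>. norm (\<eta> 1 \<omega>) powr (4 + \<nu>) \<partial>P) \<le> K) \<and>
     integrable P (\<lambda>\<omega>. norm (\<eta> 1 \<omega>) ^ (2 * J))"

definition cond_A3 ::
  "'a measure \<Rightarrow> (nat \<Rightarrow> 'a \<Rightarrow> C01) \<Rightarrow> (unit_interval \<Rightarrow> unit_interval \<Rightarrow> real) \<Rightarrow> nat \<Rightarrow> bool" where
  "cond_A3 P \<eta> \<rho> J \<longleftrightarrow>
     (\<exists>M K. M \<in> borel_measurable P \<and> (\<forall>\<omega>\<in>space P. 0 \<le> M \<omega>) \<and>
        (\<forall>j\<ge>1. integrable P (\<lambda>\<omega>. (norm (\<eta> j \<omega>) * M \<omega>) ^ J) \<and>
               (\<integral>\<omega>. (norm (\<eta> j \<omega>) * M \<omega>) ^ J \<partial>P) < K \<and>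
               (AE \<omega> in P. \<forall>t t'. \<bar>\<eta> j \<omega> t - \<eta> j \<omega> t'\<bar> \<le> M \<omega> * \<rho> t t')))"

definition cond_A4 :: "'a measure \<Rightarrow> (nat \<Rightarrow> 'a \<Rightarrow> C01) \<Rightarrow> nat \<Rightarrow> real \<Rightarrow> real \<Rightarrow> bool" where
  "cond_A4 P \<eta> J \<nu> \<tau> \<longleftrightarrow>
     phi_mixing P \<eta> \<and> 1 / (2 + 2 * \<nu>) < \<tau> \<and> \<tau> < 1 / 2 \<and>
     summable (\<lambda>i. let k = Suc i in real k powr (1 / (1 / 2 - \<tau>)) * phi_coeff P \<eta> k powr (1 / 2)) \<and>
     summable (\<lambda>i. let k = Suc i in
        real (k + 1) powr (real J / 2 - 1) * phi_coeff P \<eta> k powr (1 / real J))"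

definition conds_A ::
  "'a measure \<Rightarrow> (nat \<Rightarrow> 'a \<Rightarrow> C01) \<Rightarrow> (unit_interval \<Rightarrow> unit_interval \<Rightarrow> real) \<Rightarrow>
   nat \<Rightarrow> real \<Rightarrow> real \<Rightarrow> bool" where
  "conds_A P \<eta> \<rho> J \<nu> \<tau> \<longleftrightarrow>
     cond_A1 \<rho> J \<and> cond_A2 P \<eta> J \<nu> \<and> cond_A3 P \<eta> \<rho> J \<and> cond_A4 P \<eta> J \<nu> \<tau>"


section \<open>The test statistic and its bootstrap quantile\<close>

definition sample_mean :: "(nat \<Rightarrow> 'a \<Rightarrow> C01) \<Rightarrow> nat \<Rightarrow> 'a \<Rightarrow> C01" where
  "sample_mean X m \<omega> = (1 / real m) *\<^sub>R (\<Sum>j=1..m. X j \<omega>)"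

definition centred_sq :: "(nat \<Rightarrow> 'a \<Rightarrow> C01) \<Rightarrow> nat \<Rightarrow> nat \<Rightarrow> 'a \<Rightarrow> C01sq" where
  "centred_sq X m j \<omega> = tensor_sq (X j \<omega> - sample_mean X m \<omega>)"

definition d_hat ::
  "(nat \<Rightarrow> 'a \<Rightarrow> C01) \<Rightarrow> (nat \<Rightarrow> 'a \<Rightarrow> C01) \<Rightarrow> nat \<Rightarrow> nat \<Rightarrow> 'a \<Rightarrow> real" where
  "d_hat X Y m n \<omega> =
     norm ((1 / (real m - 1)) *\<^sub>R (\<Sum>j=1..m. centred_sq X m j \<omega>) -
           (1 / (real n - 1)) *\<^sub>R (\<Sum>j=1..n. centred_sq Y n j \<omega>))"

definition block_multiplier_sum ::
  "(nat \<Rightarrow> 'a \<Rightarrow> C01) \<Rightarrow> nat \<Rightarrow> nat \<Rightarrow> (nat \<Rightarrow> 'a \<Rightarrow> real) \<Rightarrow> 'a \<Rightarrow> C01sq" where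
  "block_multiplier_sum X m l x \<omega> =
     (1 / real m) *\<^sub>R (\<Sum>k=1..m + 1 - l.
        x k \<omega> *\<^sub>R ((1 / sqrt (real l)) *\<^sub>R
          ((\<Sum>j=k..k + l - 1. centred_sq X m j \<omega>) -
           (real l / real m) *\<^sub>R (\<Sum>i=1..m. centred_sq X m i \<omega>))))"

text \<open>
  \<open>T_boot X Y m n l1 l2 \<xi> \<zeta> r\<close> is the sup-norm of the \<open>r\<close>-th bootstrap replicate; \<open>\<xi> r k\<close> and
  \<open>\<zeta> r k\<close> are the \<open>k\<close>-th multipliers of that replicate.
\<close>

definition T_boot ::
  "(nat \<Rightarrow> 'a \<Rightarrow> C01) \<Rightarrow> (nat \<Rightarrow> 'a \<Rightarrow> C01) \<Rightarrow> nat \<Rightarrow> nat \<Rightarrow> nat \<Rightarrow> nat \<Rightarrow>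
   (nat \<Rightarrow> nat \<Rightarrow> 'a \<Rightarrow> real) \<Rightarrow> (nat \<Rightarrow> nat \<Rightarrow> 'a \<Rightarrow> real) \<Rightarrow> nat \<Rightarrow> 'a \<Rightarrow> real" where
  "T_boot X Y m n l1 l2 \<xi> \<zeta> r \<omega> =
     norm (sqrt (real n + real m) *\<^sub>R
       (block_multiplier_sum X m l1 (\<xi> r) \<omega> - block_multiplier_sum Y n l2 (\<zeta> r) \<omega>))"

text \<open>
  The \<open>q\<close>-th smallest value is entry \<open>q - 1\<close> of the sorted list; truncated subtraction on \<open>nat\<close>
  yields the smallest value for \<open>q = 0\<close>.
\<close>

definition boot_quantile :: "(nat \<Rightarrow> 'a \<Rightarrow> real) \<Rightarrow> nat \<Rightarrow> real \<Rightarrow> 'a \<Rightarrow> real" where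
  "boot_quantile T R \<alpha> \<omega> =
     sort (map (\<lambda>r. T r \<omega>) [1..<R + 1]) ! (nat \<lfloor>real R * (1 - \<alpha>)\<rfloor> - 1)"

definition rejection_prob ::
  "'a measure \<Rightarrow> (nat \<Rightarrow> 'a \<Rightarrow> C01) \<Rightarrow> (nat \<Rightarrow> 'a \<Rightarrow> C01) \<Rightarrow> nat \<Rightarrow> nat \<Rightarrow> nat \<Rightarrow> nat \<Rightarrow>
   (nat \<Rightarrow> nat \<Rightarrow> 'a \<Rightarrow> real) \<Rightarrow> (nat \<Rightarrow> nat \<Rightarrow> 'a \<Rightarrow> real) \<Rightarrow> nat \<Rightarrow> real \<Rightarrow> real" where
  "rejection_prob P X Y m n l1 l2 \<xi> \<zeta> R \<alpha> =
     measure P {\<omega> \<in> space P.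
       d_hat X Y m n \<omega> >
       boot_quantile (T_boot X Y m n l1 l2 \<xi> \<zeta>) R \<alpha> \<omega> / sqrt (real m + real n)}"

definition std_normal_var :: "'a measure \<Rightarrow> ('a \<Rightarrow> real) \<Rightarrow> bool" where
  "std_normal_var P x \<longleftrightarrow> distributed P lborel x (\<lambda>y. ennreal (std_normal_density y))"

text \<open>
  The index set of all multipliers: \<open>Inl (r, k)\<close> stands for \<open>\<xi> r k\<close> and \<open>Inr (r, k)\<close> for \<open>\<zeta> r k\<close>.
\<close>

abbreviation mult_index :: "(nat \<times> nat + nat \<times> nat) set" where
  "mult_index \<equiv> ({1..} \<times> {1..}) <+> ({1..} \<times> {1..})"

definition all_multipliers ::
  "(nat \<Rightarrow> nat \<Rightarrow> 'a \<Rightarrow> real) \<Rightarrow> (nat \<Rightarrow> nat \<Rightarrow> 'a \<Rightarrow> real) \<Rightarrow> (nat \<times> nat + nat \<times> nat) \<Rightarrow> 'a \<Rightarrow> real" where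
  "all_multipliers \<xi> \<zeta> = case_sum (case_prod \<xi>) (case_prod \<zeta>)"

definition independent_processes ::
  "'a measure \<Rightarrow> (nat \<Rightarrow> 'a \<Rightarrow> C01) \<Rightarrow> (nat \<Rightarrow> 'a \<Rightarrow> C01) \<Rightarrow> bool" where
  "independent_processes P \<eta>1 \<eta>2 \<longleftrightarrow>
     prob_space.indep_set P (gen_sigma P \<eta>1 {1..}) (gen_sigma P \<eta>2 {1..})"

definition bootstrap_multipliers ::
  "'a measure \<Rightarrow> (nat \<Rightarrow> 'a \<Rightarrow> C01) \<Rightarrow> (nat \<Rightarrow> 'a \<Rightarrow> C01) \<Rightarrow>
   (nat \<Rightarrow> nat \<Rightarrow> 'a \<Rightarrow> real) \<Rightarrow> (nat \<Rightarrow> nat \<Rightarrow> 'a \<Rightarrow> real) \<Rightarrow> bool" where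
  "bootstrap_multipliers P X Y \<xi> \<zeta> \<longleftrightarrow>
     (\<forall>r\<ge>1. \<forall>k\<ge>1. std_normal_var P (\<xi> r k) \<and> std_normal_var P (\<zeta> r k)) \<and>
     prob_space.indep_vars P (\<lambda>_. borel) (all_multipliers \<xi> \<zeta>) mult_index \<and>
     prob_space.indep_set P
       (gen_sigma P (case_sum X Y) ({1..} <+> {1..}))
       (gen_sigma P (all_multipliers \<xi> \<zeta>) mult_index)"

text \<open>
  \<open>l m\<close> is \<open>m\<^sup>\<beta>\<close> rounded to an integer; rounding down, up and to the nearest integer are all covered.
\<close>

definition rounded_power :: "(nat \<Rightarrow> nat) \<Rightarrow> real \<Rightarrow> bool" where
  "rounded_power l \<beta> \<longleftrightarrow> (\<forall>m\<ge>1. \<bar>real (l m) - real m powr \<beta>\<bar> < 1)"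


section \<open>Non-degeneracy of the limit\<close>

text \<open>
  Long-run variance of the sequence \<open>\<eta>\<^sub>j(s) \<eta>\<^sub>j(t)\<close>, \<open>j \<ge> 1\<close>. Under (A2) and (A4) the series
  converges absolutely.
\<close>

definition sq_cov :: "'a measure \<Rightarrow> (nat \<Rightarrow> 'a \<Rightarrow> C01) \<Rightarrow> nat \<Rightarrow> unit_interval \<Rightarrow> unit_interval \<Rightarrow> real" where
  "sq_cov P \<eta> h s t =
     (\<integral>\<omega>. (\<eta> 1 \<omega> s * \<eta> 1 \<omega> t - cov_kernel P \<eta> s t) *
          (\<eta> (1 + h) \<omega> s * \<eta> (1 + h) \<omega> t - cov_kernel P \<eta> s t) \<partial>P)"

definition long_run_var :: "'a measure \<Rightarrow> (nat \<Rightarrow> 'a \<Rightarrow> C01) \<Rightarrow> unit_interval \<Rightarrow> unit_interval \<Rightarrow> real" where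
  "long_run_var P \<eta> s t = sq_cov P \<eta> 0 s t + 2 * (\<Sum>h. sq_cov P \<eta> (Suc h) s t)"

text \<open>
  The weak limit of \<open>\<surd>(m+n)\<close> times the difference of the two empirical covariance kernels, centred
  at its mean, is a centred Gaussian process on \<open>[0,1]\<^sup>2\<close> with variance
  \<open>long_run_var P \<eta>1 s t / lam + long_run_var P \<eta>2 s t / (1 - lam)\<close> at \<open>(s, t)\<close>. The condition says that
  this process is not identically zero. Without it the rejection
  probability need not converge to the level: for \<open>\<eta>1 = \<eta>2 = 0\<close> all of (A1)--(A4) hold, but the statistic
  and the bootstrap quantile both vanish, so that the rejection probability is \<open>0\<close>.
\<close>

definition nondegenerate_limit ::
  "'a measure \<Rightarrow> (nat \<Rightarrow> 'a \<Rightarrow> C01) \<Rightarrow> (nat \<Rightarrow> 'a \<Rightarrow> C01) \<Rightarrow> real \<Rightarrow> bool" where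
  "nondegenerate_limit P \<eta>1 \<eta>2 lam \<longleftrightarrow>
     (\<exists>s t. long_run_var P \<eta>1 s t / lam + long_run_var P \<eta>2 s t / (1 - lam) > 0)"

end

theory Submission
  imports Defs "HOL-Real_Asymp.Real_Asymp"
begin

text \<open>
For functionals of the past and the future of a \<open>\<phi>\<close>-mixing sequence, a layer cake representation bounds the covariance by
\<open>8 c \<phi>(h) powr (1 - 1 / J)\<close>; telescoping over the partial sums then bounds their \<open>J\<close>-th moments. Second moments give the convergence
of the block variances to the long-run variance, Bernstein blocks give the central limit theorem, and conditionally on the data
the multiplier sums are Gaussian with the block variances, so that their characteristic functions converge as well, jointly for several replicates.

The increments of the empirical covariance field and of its multiplier version have \<open>J\<close>-th moments of order \<open>d powr (J \<theta>)\<close>.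
As \<open>J \<theta> > 2\<close>, chaining along the dyadic points of the unit square yields stochastic equicontinuity, and the suprema converge to
that of a Gaussian field. Its distribution function is continuous on the positive half-line: rescaling finitely many coordinates of the underlying
Gaussian sequence would turn an atom into infinitely many disjoint events of comparable probability.
Two bootstrap replicates are asymptotically independent copies of the limit, hence by Chebyshev's inequality the empirical distribution function of the
replicates, and with it their quantile, converges. Under the alternative the statistic diverges while the replicates stay bounded.
\<close>

text \<open>The supremum of a continuous function over the square is its supremum over the countable
  set \<open>dyads\<close>. Hence no weak convergence in a function space is formed: the object
  followed throughout is P(maximum over \<open>dyads\<close> <= x) for x > 0, and the limit field is
  needed at dyadic points only, without continuous paths. It is built on the given probability space
  out of the multipliers themselves, one independent copy for each replicate considered.
  Characteristic functions reach such probabilities because a product of exp(i t x) with a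
  polynomial in cosines is again a combination of exponentials; continuous functions of cosines then
  approximate indicators of boxes, and tightness removes the periodicity. R grows together with m
  and n, so the limits for pairs of replicates are needed uniformly in the pair. They are therefore
  proved along arbitrary sequences of replicate numbers. Condition (A3) controls the norm times M
  rather than M; products of two values fit it directly, single values only through their squared
  increments, whence moments of order J for products and 2 J for single values.\<close>

lemmas integrable_bound = Bochner_Integration.integrable_bound
lemmas integrable_add = Bochner_Integration.integrable_add
lemmas integrable_diff = Bochner_Integration.integrable_diff
lemmas integrable_sum = Bochner_Integration.integrable_sum
lemmas integral_add = Bochner_Integration.integral_add
lemmas integral_diff = Bochner_Integration.integral_diff
lemmas integral_sum = Bochner_Integration.integral_sum
lemmas integral_cong = Bochner_Integration.integral_cong
lemmas integral_nonneg = Bochner_Integration.integral_nonneg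
lemmas bm_intros = borel_measurable_times borel_measurable_diff borel_measurable_add borel_measurable_divide borel_measurable_sum
 borel_measurable_const borel_measurable_power borel_measurable_abs

type_synonym pt = "unit_interval \<times> unit_interval"

context prob_space
begin

abbreviation expect :: "('a => 'b::{banach,second_countable_topology}) => 'b" (binder "\<E>" 10) where
 "expect X \<equiv> expectation X"

text \<open>Failure is covered by an event instead of being measured itself, so \<open>R\<close> may
  be any predicate, such as a bound uniform over an index set, and finitely many such statements
  combine by uniting the exceptional events.\<close>

abbreviation whp :: "real => (nat => 'a => bool) => bool" where
 "whp e R \<equiv> \<forall>\<^sub>F i in sequentially. \<exists>A\<in>events. prob A \<le> e \<and> (\<forall>w\<in>space M - A. R i w)"

lemma integrable_le:
 fixes f g :: "'a => real"
 shows "integrable M g ==> f \<in> borel_measurable M ==> (!!x. \<bar>f x\<bar> \<le> g x) ==> integrable M f"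
 by (rule integrable_bound, assumption+, rule AE_I2) (simp add: order_trans[OF _ abs_ge_self])

end

section \<open>Covariance and moment inequalities under mixing\<close>

text \<open>Lebesgue measure on [0, infinity), kept on all of \<open>borel\<close>: the ray
  \<open>{..<z}\<close> then has mass max(z, 0), so the layer cake formulas need no sign condition
  on the random variable.\<close>

definition half_line :: "real measure" where
 "half_line = density lborel (indicator {0..})"

lemma sets_half_line [simp, measurable_cong]: "sets half_line = sets borel"
 and space_half_line [simp]: "space half_line = UNIV"
 by (simp_all add: half_line_def)

lemma emeasure_half_line: "emeasure half_line {..<z} = ennreal z"
proof -
 have "emeasure half_line {..<z} = (\<integral>\<^sup>+x. indicator {0..} x * indicator {..<z} x \<partial>lborel)"
  unfolding half_line_def by (rule emeasure_density) auto
 also have "... = (\<integral>\<^sup>+x. indicator {0..<z} x \<partial>lborel)" by (intro nn_integral_cong) (auto split: split_indicator)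
 finally show ?thesis by (cases "0 \<le> z") (auto simp: ennreal_neg)
qed

interpretation half_line: sigma_finite_measure half_line
 unfolding half_line_def by (subst sigma_finite_measure.sigma_finite_iff_density_finite[OF lborel.sigma_finite_measure_axioms]) (auto simp: indicator_def)

interpretation quadrant: pair_sigma_finite half_line half_line ..

abbreviation "quadrant \<equiv> half_line \<Otimes>\<^sub>M half_line"

lemma emeasure_quadrant: "emeasure quadrant ({..<y} \<times> {..<z}) = ennreal y * ennreal z"
 by (subst half_line.emeasure_pair_measure_Times) (auto simp: emeasure_half_line)

context prob_space
begin

text \<open>Fubini for the indicator of \<open>Q\<close>. With \<open>N\<close> the half line or the
  quadrant it gives the layer cake formulas; restricting \<open>Q\<close> further gives integrals of
  tails over part of the quadrant.\<close>

lemma tail_Fubini: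
 assumes N: "sigma_finite_measure N" and Q [measurable]: "Measurable.pred (M \<Otimes>\<^sub>M N) (\<lambda>p. Q (fst p) (snd p))"
 shows "(\<integral>\<^sup>+w. emeasure N {x\<in>space N. Q w x} \<partial>M) = (\<integral>\<^sup>+x. emeasure M {w\<in>space M. Q w x} \<partial>N)"
proof -
 interpret N: sigma_finite_measure N by (rule N)
 interpret pair_sigma_finite M N ..
 let ?S = "{p\<in>space (M \<Otimes>\<^sub>M N). Q (fst p) (snd p)}"
 have S: "?S \<in> sets (M \<Otimes>\<^sub>M N)" by measurable
 have "(\<integral>\<^sup>+w. emeasure N {x\<in>space N. Q w x} \<partial>M) = (\<integral>\<^sup>+w. emeasure N (Pair w -` ?S) \<partial>M)"
  by (intro nn_integral_cong arg_cong[where f = "emeasure N"]) (auto simp: space_pair_measure)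
 also have "... = (\<integral>\<^sup>+x. emeasure M ((\<lambda>w. (w, x)) -` ?S) \<partial>N)"
  using N.emeasure_pair_measure_alt[OF S] emeasure_pair_measure_alt2[OF S] by simp
 also have "... = (\<integral>\<^sup>+x. emeasure M {w\<in>space M. Q w x} \<partial>N)"
  by (intro nn_integral_cong arg_cong[where f = "emeasure M"]) (auto simp: space_pair_measure)
 finally show ?thesis .
qed

lemma layer_cake:
 assumes [measurable]: "Z \<in> borel_measurable M"
 shows "(\<integral>\<^sup>+w. ennreal (Z w) \<partial>M) = (\<integral>\<^sup>+s. emeasure M {w\<in>space M. s < Z w} \<partial>half_line)"
 using tail_Fubini[OF half_line.sigma_finite_measure_axioms, of "\<lambda>w s. s < Z w"]
 by (simp add: emeasure_half_line flip: lessThan_def)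

lemma layer_cake_product:
 assumes [measurable]: "Z \<in> borel_measurable M" "W \<in> borel_measurable M"
 shows "(\<integral>\<^sup>+w. ennreal (Z w) * ennreal (W w) \<partial>M) = (\<integral>\<^sup>+x. emeasure M {w\<in>space M. fst x < Z w \<and> snd x < W w} \<partial>quadrant)"
proof -
 have "{x. fst x < Z w \<and> snd x < W w} = {..<Z w} \<times> {..<W w}" for w by auto
 then show ?thesis using tail_Fubini[OF quadrant.P.sigma_finite_measure_axioms, of "\<lambda>w x. fst x < Z w \<and> snd x < W w"]
  by (simp add: emeasure_quadrant space_pair_measure)
qed

text \<open>The covariance is the integral over s, t of P(Z > s, W > t) - P(Z > s) P(W > t). This
  difference is at most \<open>\<phi>\<close> P(Z > s) by mixing and at most P(W > t) trivially.
  Using the first bound for t below k s^(1/r) and the second above gives \<open>\<phi>\<close> k c +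
  c / k^r for every k > 0, and the choice of k balances both terms. \<open>Y\<close> is an envelope
  whose r-th power dominates \<open>Z\<close>, so that only moments of order r + 1 occur.\<close>

lemma mixing_covariance_nonneg:
 fixes Z W Y :: "'a => real" and r :: nat
 assumes sub: "subalgebra M F" "subalgebra M G"
  and mix: "!!A B. A \<in> sets F ==> B \<in> sets G ==> \<bar>prob (A \<inter> B) - prob A * prob B\<bar> \<le> \<phi> * prob A"
  and phi: "0 \<le> \<phi>" and r: "1 \<le> r"
  and Z: "Z \<in> borel_measurable F" and W: "W \<in> borel_measurable G"
  and Y[measurable]: "Y \<in> borel_measurable M"
  and nn: "!!x. 0 \<le> Z x" "!!x. 0 \<le> W x" "!!x. 0 \<le> Y x"
  and ZY: "!!x. Z x \<le> Y x ^ r"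
  and iY: "integrable M (\<lambda>x. Y x ^ Suc r)" and iW: "integrable M (\<lambda>x. W x ^ Suc r)"
  and cY: "(\<E> x. Y x ^ Suc r) \<le> c" and cW: "(\<E> x. W x ^ Suc r) \<le> c"
 shows "\<bar>(\<E> x. Z x * W x) - expectation Z * expectation W\<bar> \<le> 2 * c * \<phi> powr (real r / real (Suc r))"
  and "integrable M (\<lambda>x. Z x * W x)" "integrable M Z" "integrable M W"
proof -
 have m [measurable]: "Z \<in> borel_measurable M" "W \<in> borel_measurable M"
  using Z W sub by (auto intro: measurable_from_subalg)
 have c0: "0 \<le> c" using cY by (rule order_trans[rotated]) (simp add: nn)
 have pw: "y ^ r * w \<le> y ^ Suc r + w ^ Suc r" if "0 \<le> y" "0 \<le> w" for y w :: real
 proof (cases "y \<le> w")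
  case True
  then have "y ^ r * w \<le> w ^ r * w" using that by (intro mult_right_mono power_mono) auto
  then show ?thesis using that by (simp add: mult.commute add_increasing)
 next
  case False
  then have "y ^ r * w \<le> y ^ r * y" using that by (intro mult_left_mono) auto
  then show ?thesis using that by (simp add: mult.commute add_increasing2)
 qed
 have int: "integrable M U" if "U \<in> borel_measurable M" "integrable M (\<lambda>x. f x ^ Suc r + g x ^ Suc r)"
  "!!x. 0 \<le> f x" "!!x. 0 \<le> g x" "!!x. 0 \<le> U x" "!!x. U x \<le> f x ^ r * g x" for U f g :: "'a => real"
  by (rule integrable_bound[OF that(2,1)], rule AE_I2)
   (use that(5) order_trans[OF that(6) pw[OF that(3,4)]] in \<open>simp add: abs_of_nonneg del: power_Suc, fast intro: order_trans abs_ge_self\<close>)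
 show iZW: "integrable M (\<lambda>x. Z x * W x)"
  by (rule int[of _ Y W, OF _ integrable_add[OF iY iW] nn(3,2)]) (simp_all add: nn ZY mult_right_mono)
 show iZ: "integrable M Z" by (rule int[of _ Y "\<lambda>_. 1", OF m(1) _ nn(3) zero_le_one nn(1)]) (simp_all add: iY ZY del: power_Suc)
 show iWW: "integrable M W" by (rule int[of _ "\<lambda>_. 1" W, OF m(2) _ zero_le_one nn(2) nn(2)]) (simp_all add: iW del: power_Suc)
 define a b where "a s = {w\<in>space M. s < Z w}" and "b t = {w\<in>space M. t < W w}" for s t
 have ab [measurable]: "a s \<in> events" "b t \<in> events" for s t unfolding a_def b_def by measurable
 have eq: "{w\<in>space M. fst x < Z w \<and> snd x < W w} = a (fst x) \<inter> b (snd x)" for x by (auto simp: a_def b_def)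
 have bound: "\<bar>(\<E> x. Z x * W x) - expectation Z * expectation W\<bar> \<le> \<phi> * k * c + c / k ^ r" if k: "0 < k" for k
 proof -
  define D where "D = \<phi> * k * c + c / k ^ r"
  \<comment> \<open>The curve t = k s^(1/r). Below it s < Z forces t < k Y because Z <= Y^r; above
    it t < W forces s < (W / k)^r. These two implications turn the split integrals into
    moments.\<close>
  define R where "R x \<longleftrightarrow> (max 0 (snd x) / k) ^ r \<le> fst x" for x :: "real \<times> real"
  have R [measurable]: "Measurable.pred quadrant R" unfolding R_def by measurable
  define d where "d x = (if R x then \<phi> * prob (a (fst x)) else prob (b (snd x)))" for x
  let ?p = "\<lambda>x. prob (a (fst x) \<inter> b (snd x))" and ?q = "\<lambda>x. prob (a (fst x)) * prob (b (snd x))"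
  have d0: "0 \<le> d x" for x using phi by (simp add: d_def)
  have d: "\<bar>?p x - ?q x\<bar> \<le> d x" for x
  proof -
   have "a (fst x) \<in> sets F" "b (snd x) \<in> sets G"
    using measurable_sets[OF Z, of "{fst x<..}"] measurable_sets[OF W, of "{snd x<..}"] sub
    by (auto simp: a_def b_def subalgebra_def vimage_def Int_def conj_commute)
   note 1 = mix[OF this]
   have 2: "?p x \<le> prob (b (snd x))" by (rule finite_measure_mono) auto
   have "?q x \<le> prob (b (snd x))" "0 \<le> ?q x" by (simp_all add: mult_left_le_one_le)
   with 1 2 show ?thesis unfolding d_def using measure_nonneg[of M "a (fst x) \<inter> b (snd x)"] by (auto simp del: measure_nonneg)
  qed
  have [measurable]: "(\<lambda>s. prob (a s)) \<in> borel_measurable borel" "(\<lambda>t. prob (b t)) \<in> borel_measurable borel"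
   unfolding a_def b_def by measurable
  have "(\<lambda>x. prob {w\<in>space M. fst x < Z w \<and> snd x < W w}) \<in> borel_measurable quadrant" by measurable
  then have [measurable]: "?p \<in> borel_measurable quadrant" unfolding eq .
  have [measurable]: "d \<in> borel_measurable quadrant" unfolding d_def by measurable
  have "(\<integral>\<^sup>+x. ennreal (d x) \<partial>quadrant) = (\<integral>\<^sup>+x. ennreal \<phi> * emeasure M {w\<in>space M. R x \<and> fst x < Z w}
   + emeasure M {w\<in>space M. \<not> R x \<and> snd x < W w} \<partial>quadrant)"
   using phi by (intro nn_integral_cong) (auto simp: d_def emeasure_eq_measure ennreal_mult a_def b_def)
  also have "... = ennreal \<phi> * (\<integral>\<^sup>+w. emeasure quadrant {x. R x \<and> fst x < Z w} \<partial>M) + (\<integral>\<^sup>+w. emeasure quadrant {x. \<not> R x \<and> snd x < W w} \<partial>M)"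
   using tail_Fubini[OF quadrant.P.sigma_finite_measure_axioms, of "\<lambda>w x. R x \<and> fst x < Z w"]
    tail_Fubini[OF quadrant.P.sigma_finite_measure_axioms, of "\<lambda>w x. \<not> R x \<and> snd x < W w"]
   by (subst nn_integral_add, measurable, subst nn_integral_cmult, measurable) (simp add: space_pair_measure)
  also have "... \<le> ennreal \<phi> * (\<integral>\<^sup>+w. emeasure quadrant ({..<Z w} \<times> {..<k * Y w}) \<partial>M) + (\<integral>\<^sup>+w. emeasure quadrant ({..<(W w / k) ^ r} \<times> {..<W w}) \<partial>M)"
  proof (intro add_mono mult_left_mono nn_integral_mono emeasure_mono)
   fix w
   show "{x. R x \<and> fst x < Z w} \<subseteq> {..<Z w} \<times> {..<k * Y w}"
   proof clarsimp
    fix s t assume "R (s, t)" "s < Z w"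
    then have "(max 0 t / k) ^ r < Y w ^ r" using ZY[of w] by (simp add: R_def)
    then have "max 0 t / k < Y w" using nn by (metis power_less_imp_less_base)
    then show "t < k * Y w" using k by (simp add: divide_simps mult.commute)
   qed
   show "{x. \<not> R x \<and> snd x < W w} \<subseteq> {..<(W w / k) ^ r} \<times> {..<W w}"
   proof clarsimp
    fix s t assume "\<not> R (s, t)" "t < W w"
    moreover from this have "(max 0 t / k) ^ r \<le> (W w / k) ^ r" using k nn(2)[of w] by (intro power_mono divide_right_mono) auto
    ultimately show "s < (W w / k) ^ r" by (simp add: R_def)
   qed
  qed auto
  also have "... = (\<integral>\<^sup>+w. ennreal (\<phi> * (Z w * (k * Y w)) + (W w / k) ^ r * W w) \<partial>M)"
   using nn k phi unfolding emeasure_quadrant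
   by (subst nn_integral_cmult[symmetric], measurable, subst nn_integral_add[symmetric], measurable) (simp add: ennreal_mult)
  also have "... \<le> (\<integral>\<^sup>+w. ennreal (\<phi> * k * Y w ^ Suc r + W w ^ Suc r / k ^ r) \<partial>M)"
  proof (intro nn_integral_mono ennreal_leI)
   fix w
   have "Z w * Y w \<le> Y w ^ r * Y w" using nn ZY by (intro mult_right_mono) auto
   then have "\<phi> * k * (Z w * Y w) \<le> \<phi> * k * Y w ^ Suc r" using phi k by (intro mult_left_mono) (auto simp: mult.commute)
   then show "\<phi> * (Z w * (k * Y w)) + (W w / k) ^ r * W w \<le> \<phi> * k * Y w ^ Suc r + W w ^ Suc r / k ^ r"
    by (simp add: power_divide ac_simps)
  qed
  also have "... = ennreal (\<E> w. \<phi> * k * Y w ^ Suc r + W w ^ Suc r / k ^ r)"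
   using iY iW nn phi k by (intro nn_integral_eq_integral) (auto simp del: power_Suc)
  also have "... \<le> ennreal D"
   using iY iW cY cW phi k unfolding D_def
   by (intro ennreal_leI) (simp add: add_mono mult_left_mono divide_right_mono del: power_Suc)
  finally have dD: "(\<integral>\<^sup>+x. ennreal (d x) \<partial>quadrant) \<le> ennreal D" .
  have D0: "0 \<le> D" unfolding D_def using c0 phi k by simp
  have le: "x \<le> y + D" if "ennreal x = (\<integral>\<^sup>+x. ennreal (f x) \<partial>quadrant)" "ennreal y = (\<integral>\<^sup>+x. ennreal (g x) \<partial>quadrant)"
   "!!x. f x \<le> g x + d x" "!!x. 0 \<le> g x" "0 \<le> y" and [measurable]: "g \<in> borel_measurable quadrant" for x y f g
  proof -
   have "ennreal x \<le> (\<integral>\<^sup>+x. ennreal (g x) + ennreal (d x) \<partial>quadrant)"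
    unfolding that(1) using that(3,4) d0 by (intro nn_integral_mono) (simp add: ennreal_leI flip: ennreal_plus)
   also have "... \<le> ennreal y + ennreal D" unfolding that(2) using dD by (subst nn_integral_add) (auto intro: add_left_mono)
   finally show ?thesis using that(5) D0 by (simp add: ennreal_le_iff flip: ennreal_plus)
  qed
  have p: "ennreal (\<E> w. Z w * W w) = (\<integral>\<^sup>+x. ennreal (?p x) \<partial>quadrant)"
   using layer_cake_product[OF m] nn iZW unfolding eq by (simp add: nn_integral_eq_integral emeasure_eq_measure flip: ennreal_mult')
  have "ennreal (expectation Z * expectation W) = (\<integral>\<^sup>+s. emeasure M (a s) \<partial>half_line) * (\<integral>\<^sup>+t. emeasure M (b t) \<partial>half_line)"
   unfolding a_def b_def layer_cake[OF m(1), symmetric] layer_cake[OF m(2), symmetric]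
   using nn iZ iWW by (simp add: nn_integral_eq_integral ennreal_mult')
  also have "... = (\<integral>\<^sup>+s. \<integral>\<^sup>+t. ennreal (?q (s, t)) \<partial>half_line \<partial>half_line)"
   by (simp add: emeasure_eq_measure ennreal_mult nn_integral_cmult nn_integral_multc)
  also have "... = (\<integral>\<^sup>+x. ennreal (?q x) \<partial>quadrant)" by (rule half_line.nn_integral_fst) measurable
  finally have q: "ennreal (expectation Z * expectation W) = (\<integral>\<^sup>+x. ennreal (?q x) \<partial>quadrant)" .
  have E0: "0 \<le> (\<E> w. Z w * W w)" "0 \<le> expectation Z * expectation W" using nn by (auto intro!: integral_nonneg mult_nonneg_nonneg)
  have dd: "?p x \<le> ?q x + d x" "?q x \<le> ?p x + d x" for x using d[of x] by linarith+
  have "(\<E> w. Z w * W w) \<le> expectation Z * expectation W + D" by (rule le[OF p q dd(1) _ E0(2)]) auto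
  moreover have "expectation Z * expectation W \<le> (\<E> w. Z w * W w) + D" by (rule le[OF q p dd(2) _ E0(1)]) auto
  ultimately show ?thesis unfolding D_def by linarith
 qed
 show "\<bar>(\<E> x. Z x * W x) - expectation Z * expectation W\<bar> \<le> 2 * c * \<phi> powr (real r / real (Suc r))"
 proof (cases "\<phi> = 0")
  case True
  \<comment> \<open>For \<open>\<phi>\<close> = 0 the bound c / k^r has no optimal k; k tends to
    infinity instead.\<close>
  have l: "((\<lambda>k. c / k ^ r) \<longlongrightarrow> 0) at_top"
   using r by (intro tendsto_divide_0[OF tendsto_const] filterlim_at_top_imp_at_infinity filterlim_pow_at_top filterlim_ident) auto
  have "\<forall>\<^sub>F k in at_top. \<bar>(\<E> x. Z x * W x) - expectation Z * expectation W\<bar> \<le> c / k ^ r"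
   using eventually_gt_at_top[of 0] by eventually_elim (use bound True in simp)
  from tendsto_lowerbound[OF l this] True show ?thesis by simp
 next
  case False
  \<comment> \<open>The solution of \<open>\<phi>\<close> k = k^(-r).\<close>
  define k where "k = \<phi> powr (- 1 / real (Suc r))"
  have k: "0 < k" using False by (simp add: k_def)
  have "\<phi> * k = \<phi> powr (1 + - 1 / real (Suc r))"
   unfolding powr_add using phi False by (simp add: k_def)
  also have "1 + - 1 / real (Suc r) = real r / real (Suc r)" by (simp add: field_simps)
  finally have 1: "\<phi> * k = \<phi> powr (real r / real (Suc r))" .
  have "k ^ r = \<phi> powr (- (real r / real (Suc r)))"
   using False by (simp add: k_def powr_power)
  then have "c / k ^ r = c * \<phi> powr (real r / real (Suc r))"
   by (simp add: powr_minus divide_inverse)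
  with 1 bound[OF k] show ?thesis by simp
 qed
qed

text \<open>Splitting \<open>Z\<close> and \<open>W\<close> into positive and negative parts gives
  four covariances of nonnegative variables with the same envelope, each at most 2 c times the power
  of \<open>\<phi>\<close>; hence the constant 8.\<close>

lemma mixing_covariance:
 fixes Z W Y :: "'a => real" and r :: nat
 assumes sub: "subalgebra M F" "subalgebra M G"
  and mix: "!!A B. A \<in> sets F ==> B \<in> sets G ==> \<bar>prob (A \<inter> B) - prob A * prob B\<bar> \<le> \<phi> * prob A"
  and phi: "0 \<le> \<phi>" and r: "1 \<le> r"
  and Z: "Z \<in> borel_measurable F" and W: "W \<in> borel_measurable G"
  and Y[measurable]: "Y \<in> borel_measurable M"
  and ZY: "!!x. \<bar>Z x\<bar> \<le> Y x ^ r" and Y0: "!!x. 0 \<le> Y x"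
  and iY: "integrable M (\<lambda>x. Y x ^ Suc r)" and iW: "integrable M (\<lambda>x. \<bar>W x\<bar> ^ Suc r)"
  and cY: "(\<E> x. Y x ^ Suc r) \<le> c" and cW: "(\<E> x. \<bar>W x\<bar> ^ Suc r) \<le> c"
 shows "integrable M (\<lambda>x. Z x * W x)" "integrable M Z" "integrable M W"
  "\<bar>(\<E> x. Z x * W x) - expectation Z * expectation W\<bar> \<le> 8 * c * \<phi> powr (real r / real (Suc r))"
proof -
 have [measurable]: "Z \<in> borel_measurable M" "W \<in> borel_measurable M"
  using Z W sub by (auto intro: measurable_from_subalg)
 define p where "p b x = max 0 (if b then x else - x)" for b and x :: real
 have p0: "0 \<le> p b x" and pa: "p b x \<le> \<bar>x\<bar>" for b x by (auto simp: p_def)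
 have px: "p True x - p False x = x" for x by (auto simp: p_def)
 have pm: "(\<lambda>x. p b (f x)) \<in> borel_measurable N" if "f \<in> borel_measurable N" for b f N
  using that unfolding p_def by (cases b) auto
 have iWb: "integrable M (\<lambda>x. p b (W x) ^ Suc r)" for b
  by (rule integrable_bound[OF iW])
   (use pm[of W] in \<open>auto intro!: AE_I2 power_mono simp: p0 pa simp del: power_Suc\<close>)
 have cWb: "(\<E> x. p b (W x) ^ Suc r) \<le> c" for b
  by (rule order_trans[OF _ cW], rule integral_mono[OF iWb iW]) (rule power_mono[OF pa p0])
 have ZYb: "p b (Z x) \<le> Y x ^ r" for b x using pa ZY by (rule order_trans)
 let ?D = "2 * c * \<phi> powr (real r / real (Suc r))"
 let ?e = "\<lambda>a b. (\<E> x. p a (Z x) * p b (W x))"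
 let ?z = "\<lambda>a. (\<E> x. p a (Z x))" and ?w = "\<lambda>b. (\<E> x. p b (W x))"
 note i = mixing_covariance_nonneg[OF sub mix phi r pm[OF Z] pm[OF W] Y p0 p0 Y0 ZYb iY iWb cY cWb]
 have b: "\<bar>?e a b - ?z a * ?w b\<bar> \<le> ?D" for a b by (rule i(1))
 have Zeq: "Z = (\<lambda>x. p True (Z x) - p False (Z x))" and Weq: "W = (\<lambda>x. p True (W x) - p False (W x))"
  by (simp_all add: px)
 have ZWeq: "(\<lambda>x. Z x * W x) = (\<lambda>x. p True (Z x) * p True (W x) - p True (Z x) * p False (W x)
   - p False (Z x) * p True (W x) + p False (Z x) * p False (W x))"
 proof
  fix x
  have "Z x * W x = (p True (Z x) - p False (Z x)) * (p True (W x) - p False (W x))" by (simp only: px)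
  then show "Z x * W x = p True (Z x) * p True (W x) - p True (Z x) * p False (W x)
   - p False (Z x) * p True (W x) + p False (Z x) * p False (W x)" by (simp add: algebra_simps)
 qed
 show "integrable M Z" by (subst Zeq) (intro integrable_diff i(2-))
 show "integrable M W" by (subst Weq) (intro integrable_diff i(2-))
 show "integrable M (\<lambda>x. Z x * W x)"
  by (subst ZWeq) (intro integrable_diff integrable_add i(2-))
 have EZ: "expectation Z = ?z True - ?z False"
  by (subst Zeq) (intro integral_diff i(2-))
 have EW: "expectation W = ?w True - ?w False"
  by (subst Weq) (intro integral_diff i(2-))
 have EZW: "(\<E> x. Z x * W x) = ?e True True - ?e True False - ?e False True + ?e False False"
  unfolding ZWeq by (simp add: i(2-))
 have "(\<E> x. Z x * W x) - expectation Z * expectation W =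
  (?e True True - ?z True * ?w True) - (?e True False - ?z True * ?w False)
  - (?e False True - ?z False * ?w True) + (?e False False - ?z False * ?w False)"
  unfolding EZ EW EZW by (simp add: algebra_simps)
 also have "\<bar>...\<bar> \<le> 4 * ?D"
  using b[of True True] b[of True False] b[of False True] b[of False False] by linarith
 finally show "\<bar>(\<E> x. Z x * W x) - expectation Z * expectation W\<bar> \<le> 8 * c * \<phi> powr (real r / real (Suc r))"
  by simp
qed

end

text \<open>\<open>gen_sigma\<close> is a bare family of sets. As the sigma-field of a measure on
  the same space it becomes accessible to \<open>subalgebra\<close> and to measurability of
  functions.\<close>

definition vsig :: "'a measure => ('i => 'a => 'b::topological_space) => 'i set => 'a measure" where
 "vsig P Z I = sigma (space P) (\<Union>i\<in>I. {Z i -` A \<inter> space P |A. A \<in> sets borel})"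

lemma space_vsig[simp]: "space (vsig P Z I) = space P"
 by (simp add: vsig_def space_measure_of_conv)

lemma sets_vsig: "sets (vsig P Z I) = gen_sigma P Z I"
 unfolding vsig_def gen_sigma_def by (rule sets_measure_of) auto

lemma measurable_vsig: "i \<in> I ==> Z i \<in> borel_measurable (vsig P Z I)"
 by (rule measurableI) (auto simp: sets_vsig gen_sigma_def intro!: sigma_sets.Basic)

lemma subalgebra_vsig:
 assumes "!!i. i \<in> I ==> Z i \<in> borel_measurable P"
 shows "subalgebra P (vsig P Z I)"
 unfolding subalgebra_def sets_vsig gen_sigma_def
 using assms by (auto intro!: sets.sigma_sets_subset simp: measurable_sets)

lemma vsig_mono: "I \<subseteq> I' ==> subalgebra (vsig P Z I') (vsig P Z I)"
 unfolding subalgebra_def sets_vsig gen_sigma_def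
 by (auto intro!: sigma_sets_mono')

lemma measurable_vsig_mono:
 "f \<in> borel_measurable (vsig P Z I) ==> I \<subseteq> I' ==> f \<in> borel_measurable (vsig P Z I')"
 using measurable_from_subalg[OF vsig_mono] .

section \<open>Moments of partial sums under mixing\<close>

lemma abs_power_diff_bound:
 fixes x w :: real
 shows "\<bar>(x + w) ^ n - x ^ n\<bar> \<le> real n * \<bar>w\<bar> * (\<bar>x\<bar> + \<bar>w\<bar>) ^ (n - 1)"
proof -
 have "(x + w) ^ n - x ^ n = w * (\<Sum>i<n. (x + w) ^ i * x ^ (n - Suc i))"
  using power_diff_sumr2[of "x + w" n x] by (simp add: mult.commute)
 also have "\<bar>...\<bar> \<le> \<bar>w\<bar> * (\<Sum>i<n. (\<bar>x\<bar> + \<bar>w\<bar>) ^ (n - 1))"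
  unfolding abs_mult
 proof (intro mult_left_mono order_trans[OF sum_abs] sum_mono)
  fix i assume i: "i \<in> {..<n}"
  have "\<bar>(x + w) ^ i * x ^ (n - Suc i)\<bar> \<le> (\<bar>x\<bar> + \<bar>w\<bar>) ^ i * (\<bar>x\<bar> + \<bar>w\<bar>) ^ (n - Suc i)"
   unfolding abs_mult power_abs by (intro mult_mono power_mono) auto
  also have "... = (\<bar>x\<bar> + \<bar>w\<bar>) ^ (n - 1)"
   using i by (simp flip: power_add)
  finally show "\<bar>(x + w) ^ i * x ^ (n - Suc i)\<bar> \<le> (\<bar>x\<bar> + \<bar>w\<bar>) ^ (n - 1)" .
 qed auto
 finally show ?thesis by (simp add: ac_simps)
qed

text \<open>The factorisation of a^n - b^n is applied twice. The first-order term is kept exact,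
  since its expectation is a covariance that mixing makes small; only the quadratic remainder is
  estimated in absolute value. Truncated subtraction makes n = 0 and n = 1 fit.\<close>

lemma power_add_second_order_bound:
 fixes x w :: real
 shows "(x + w) ^ n \<le> x ^ n + real n * x ^ (n - 1) * w + (real n)\<^sup>2 * w\<^sup>2 * (\<bar>x\<bar> + \<bar>w\<bar>) ^ (n - 2)"
proof -
 have "(x + w) ^ n - x ^ n - real n * x ^ (n - 1) * w = w * (\<Sum>i<n. x ^ (n - Suc i) * ((x + w) ^ i - x ^ i))"
 proof -
  have 1: "(x + w) ^ n - x ^ n = w * (\<Sum>i<n. (x + w) ^ i * x ^ (n - Suc i))"
   using power_diff_sumr2[of "x + w" n x] by (simp add: mult.commute)
  have "(\<Sum>i<n. x ^ (n - Suc i) * x ^ i) = (\<Sum>i<n. x ^ (n - 1))"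
   by (intro sum.cong) (auto simp flip: power_add)
  then have 2: "real n * x ^ (n - 1) * w = w * (\<Sum>i<n. x ^ (n - Suc i) * x ^ i)"
   by simp
  show ?thesis unfolding 1 2 by (simp add: right_diff_distrib sum_subtractf mult.commute)
 qed
 also have "... \<le> \<bar>w\<bar> * (\<Sum>i<n. real n * \<bar>w\<bar> * (\<bar>x\<bar> + \<bar>w\<bar>) ^ (n - 2))"
 proof (rule order_trans[OF abs_ge_self], unfold abs_mult, intro mult_left_mono order_trans[OF sum_abs] sum_mono)
  fix i assume i: "i \<in> {..<n}"
  show "\<bar>x ^ (n - Suc i) * ((x + w) ^ i - x ^ i)\<bar> \<le> real n * \<bar>w\<bar> * (\<bar>x\<bar> + \<bar>w\<bar>) ^ (n - 2)"
  proof (cases "i = 0")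
   case False
   have "\<bar>x ^ (n - Suc i) * ((x + w) ^ i - x ^ i)\<bar> \<le> (\<bar>x\<bar> + \<bar>w\<bar>) ^ (n - Suc i) * (real i * \<bar>w\<bar> * (\<bar>x\<bar> + \<bar>w\<bar>) ^ (i - 1))"
    unfolding abs_mult power_abs by (intro mult_mono power_mono abs_power_diff_bound) auto
   also have "... = real i * \<bar>w\<bar> * (\<bar>x\<bar> + \<bar>w\<bar>) ^ ((n - Suc i) + (i - 1))"
    by (simp add: power_add)
   also have "(n - Suc i) + (i - 1) = n - 2" using False i by auto
   also have "real i * \<bar>w\<bar> * (\<bar>x\<bar> + \<bar>w\<bar>) ^ (n - 2) \<le> real n * \<bar>w\<bar> * (\<bar>x\<bar> + \<bar>w\<bar>) ^ (n - 2)"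
    using i by (intro mult_right_mono) auto
   finally show ?thesis .
  qed simp
 qed simp
 also have "... = (real n)\<^sup>2 * w\<^sup>2 * (\<bar>x\<bar> + \<bar>w\<bar>) ^ (n - 2)"
  by (simp add: power2_eq_square)
 finally show ?thesis by simp
qed

lemma abs_add_power_le:
 fixes x y :: real
 shows "(\<bar>x\<bar> + \<bar>y\<bar>) ^ n \<le> 2 ^ n * (\<bar>x\<bar> ^ n + \<bar>y\<bar> ^ n)"
proof -
 have "(\<bar>x\<bar> + \<bar>y\<bar>) ^ n \<le> (2 * max \<bar>x\<bar> \<bar>y\<bar>) ^ n" by (intro power_mono) auto
 also have "... = 2 ^ n * max \<bar>x\<bar> \<bar>y\<bar> ^ n" by (simp add: power_mult_distrib)
 also have "... \<le> 2 ^ n * (\<bar>x\<bar> ^ n + \<bar>y\<bar> ^ n)"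
  by (intro mult_left_mono) (auto simp: max_def)
 finally show ?thesis .
qed

text \<open>Mixing is stated in product form, without conditional probabilities, so that null events
  \<open>A\<close> need no exception.\<close>

locale mixing_process = prob_space P for P :: "'a measure" +
 fixes \<eta> :: "nat => 'a => 'b::topological_space" and \<phi> :: "nat => real"
 assumes meas_eta: "!!j. 1 \<le> j ==> \<eta> j \<in> borel_measurable P"
  and mixing: "!!i h A B. 1 \<le> i ==> 1 \<le> h ==> A \<in> gen_sigma P \<eta> {1..i} ==> B \<in> gen_sigma P \<eta> {i + h..} ==>
    \<bar>prob (A \<inter> B) - prob A * prob B\<bar> \<le> \<phi> h * prob A"
  and phi_nonneg: "!!h. 0 \<le> \<phi> h"
begin

notation expect (binder "\<E>" 10)

lemma subalgebra_eta: "I \<subseteq> {1..} ==> subalgebra P (vsig P \<eta> I)"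
 by (rule subalgebra_vsig, rule meas_eta) auto

lemma measurable_eta: "f \<in> borel_measurable (vsig P \<eta> I) ==> I \<subseteq> {1..} ==> f \<in> borel_measurable P"
 using measurable_from_subalg[OF subalgebra_eta] .

lemma covariance_bound:
 fixes Z W Y :: "'a => real" and r :: nat
 assumes ih: "1 \<le> i" "1 \<le> h" and r: "1 \<le> r"
  and Z: "Z \<in> borel_measurable (vsig P \<eta> {1..i})" and W: "W \<in> borel_measurable (vsig P \<eta> {i + h..})"
  and Y: "Y \<in> borel_measurable P"
  and ZY: "!!x. \<bar>Z x\<bar> \<le> Y x ^ r" and Y0: "!!x. 0 \<le> Y x"
  and iY: "integrable P (\<lambda>x. Y x ^ Suc r)" and iW: "integrable P (\<lambda>x. \<bar>W x\<bar> ^ Suc r)"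
  and cY: "(\<E> x. Y x ^ Suc r) \<le> c" and cW: "(\<E> x. \<bar>W x\<bar> ^ Suc r) \<le> c"
 shows "integrable P (\<lambda>x. Z x * W x)" "integrable P Z" "integrable P W"
  "\<bar>(\<E> x. Z x * W x) - expectation Z * expectation W\<bar> \<le> 8 * c * \<phi> h powr (real r / real (Suc r))"
proof -
 have 1: "{1..i} \<subseteq> {1..}" "{i + h..} \<subseteq> {1..}" using ih by auto
 note * = mixing_covariance[OF subalgebra_eta[OF 1(1)] subalgebra_eta[OF 1(2)] mixing[OF ih, folded sets_vsig] phi_nonneg r Z W Y ZY Y0 iY iW cY cW]
 show "integrable P (\<lambda>x. Z x * W x)" "integrable P Z" "integrable P W"
  "\<bar>(\<E> x. Z x * W x) - expectation Z * expectation W\<bar> \<le> 8 * c * \<phi> h powr (real r / real (Suc r))"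
  using * by blast+
qed

lemma integrable_sum_power:
 fixes W :: "'i => 'a => real"
 assumes "finite I" "!!j. j \<in> I ==> W j \<in> borel_measurable P"
  and "!!j. j \<in> I ==> integrable P (\<lambda>x. \<bar>W j x\<bar> ^ n)"
 shows "integrable P (\<lambda>x. \<bar>\<Sum>j\<in>I. W j x\<bar> ^ n)"
 using assms
proof (induction I rule: finite_induct)
 case (insert i I)
 have [measurable]: "!!j. j \<in> insert i I ==> W j \<in> borel_measurable P" by (fact insert.prems)
 have i: "integrable P (\<lambda>x. 2 ^ n * (\<bar>W i x\<bar> ^ n + \<bar>\<Sum>j\<in>I. W j x\<bar> ^ n))"
  using insert by auto
 show ?case
 proof (rule integrable_le[OF i])
  show "(\<lambda>x. \<bar>\<Sum>j\<in>insert i I. W j x\<bar> ^ n) \<in> borel_measurable P" by measurable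
  fix x
  have "\<bar>\<Sum>j\<in>insert i I. W j x\<bar> ^ n \<le> (\<bar>W i x\<bar> + \<bar>\<Sum>j\<in>I. W j x\<bar>) ^ n"
   using insert.hyps by (intro power_mono) auto
  also note abs_add_power_le
  finally show "\<bar>\<bar>\<Sum>j\<in>insert i I. W j x\<bar> ^ n\<bar> \<le> 2 ^ n * (\<bar>W i x\<bar> ^ n + \<bar>\<Sum>j\<in>I. W j x\<bar> ^ n)" by simp
 qed
qed simp

text \<open>Let b^J be the largest J-th moment among the first n partial sums, at least 1. In the
  expansion of S_k^J the linear term has coefficient S_(k-1)^(J-1), which telescopes into increments
  measurable at times i < k. Each increment is at most (J - 1) b^(J-2) times the (J-1)-th power of
  an envelope with bounded J-th moment, so the covariance inequality applies with gap k - i. Every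
  step therefore adds at most C b^(J-2) to the J-th moment, and b^J <= n C b^(J-2) settles all even
  J at once, without induction on J.\<close>

lemma moment_inequality_unit:
 fixes W :: "nat => 'a => real" and J :: nat
 assumes J: "even J" "2 \<le> J"
  and W: "!!j. 1 \<le> j ==> W j \<in> borel_measurable (vsig P \<eta> {j})"
  and i0: "!!j. 1 \<le> j ==> expectation (W j) = 0"
  and iJ: "!!j. 1 \<le> j ==> integrable P (\<lambda>x. W j x ^ J)"
  and cJ: "!!j. 1 \<le> j ==> (\<E> x. W j x ^ J) \<le> 1"
  and Phi: "!!n. (\<Sum>h=1..n. \<phi> h powr (real (J - 1) / real J)) \<le> \<Phi>"
 shows "(\<E> x. (\<Sum>j=a+1..a+n. W j x) ^ J) \<le> (real n * ((real J)\<^sup>2 * 2 ^ Suc J * (8 * \<Phi> + 1))) ^ (J div 2)"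
proof (cases "n = 0")
 case True
 then show ?thesis using J by (simp add: zero_power)
next
 case n: False
 define r where "r = J - 1"
 have r: "J = Suc r" "1 \<le> r" "r - 1 = J - 2" using J by (auto simp: r_def)
 define S where "S k x = (\<Sum>j=a+1..a+k. W j x)" for k x
 have WP[measurable]: "W j \<in> borel_measurable P" if "1 \<le> j" for j
  by (rule measurable_eta[OF W[OF that]]) (use that in auto)
 have SF: "S k \<in> borel_measurable (vsig P \<eta> {1..a+k})" for k
  unfolding S_def by (intro borel_measurable_sum measurable_vsig_mono[OF W]) auto
 have [measurable]: "S k \<in> borel_measurable P" for k by (rule measurable_eta[OF SF]) auto
 have evabs: "\<bar>x\<bar> ^ J = x ^ J" for x :: real by (rule power_even_abs[OF J(1)])
 have pJ: "x\<^sup>2 * x ^ (J - 2) = x ^ J" for x :: real using J by (metis le_add_diff_inverse power_add)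
 have SJ: "integrable P (\<lambda>x. S k x ^ J)" for k
  using integrable_sum_power[of "{a+1..a+k}" W J] iJ unfolding S_def evabs by auto
 define m where "m = Max ((\<lambda>k. (\<E> x. S k x ^ J)) ` {0..n})"
 define b where "b = root J (max 1 m)"
 have b1: "1 \<le> b" unfolding b_def using J by (subst real_root_ge_1_iff) auto
 have bJ: "b ^ J = max 1 m" unfolding b_def using J by (subst real_root_pow_pos2) auto
 have Sb: "(\<E> x. S k x ^ J) \<le> b ^ J" if "k \<le> n" for k
 proof -
  have "(\<E> x. S k x ^ J) \<le> m" unfolding m_def using that by (intro Max_ge) auto
  then show ?thesis unfolding bJ by simp
 qed
 define c where "c = (2::real) ^ Suc J"
 have c1: "1 \<le> c" unfolding c_def by (rule one_le_power) simp
 \<comment> \<open>Dividing the partial sum by b normalises it: both summands have J-th moment at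
   most 1, whence the bound 2^J (1 + 1) = c.\<close>
 define Y where "Y k x = \<bar>S (k - 1) x\<bar> / b + \<bar>W (a + k) x\<bar>" for k x
 have Y0: "0 \<le> Y k x" for k x unfolding Y_def using b1 by simp
 have [measurable]: "Y k \<in> borel_measurable P" if "1 \<le> k" for k
 proof -
  have "1 \<le> a + k" using that by simp
  note [measurable] = WP[OF this]
  show ?thesis unfolding Y_def by measurable
 qed
 have Sk: "S k x = S (k - 1) x + W (a + k) x" if "1 \<le> k" for k x
 proof -
  obtain l where "k = Suc l" using \<open>1 \<le> k\<close> by (cases k) auto
  then show ?thesis unfolding S_def by simp
 qed
 have YJ: "integrable P (\<lambda>x. Y k x ^ J)" "(\<E> x. Y k x ^ J) \<le> c" if k: "1 \<le> k" "k \<le> n" for k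
 proof -
  let ?f = "\<lambda>x. 2 ^ J * (S (k - 1) x ^ J / b ^ J + W (a + k) x ^ J)"
  have i: "integrable P ?f" using SJ iJ k by auto
  have le: "Y k x ^ J \<le> ?f x" for x
   using abs_add_power_le[of "S (k - 1) x / b" "W (a + k) x" J] b1
   unfolding Y_def evabs by (simp add: power_divide)
  show "integrable P (\<lambda>x. Y k x ^ J)"
   by (rule integrable_bound[OF i])
    (use Y0 k in \<open>auto intro!: AE_I2 simp del: One_nat_def simp: order_trans[OF le abs_ge_self]\<close>)
  then have "(\<E> x. Y k x ^ J) \<le> expectation ?f"
   using i le by (intro integral_mono) auto
  also have "... = 2 ^ J * ((\<E> x. S (k - 1) x ^ J) / b ^ J + (\<E> x. W (a + k) x ^ J))"
   using SJ iJ k by simp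
  also have "... \<le> 2 ^ J * (1 + 1)"
   using Sb[of "k - 1"] k b1 cJ[of "a + k"] by (intro mult_left_mono add_mono) (auto simp: divide_simps)
  finally show "(\<E> x. Y k x ^ J) \<le> c" unfolding c_def by simp
 qed
 \<comment> \<open>The increment of the power r = J - 1 of the partial sum, scaled so that it has
   the envelope Y^r.\<close>
 define Z where "Z k x = (S k x ^ r - S (k - 1) x ^ r) / (real r * b ^ (J - 2))" for k x
 have bb: "b ^ (J - 2) > 0" using b1 by simp
 have scale: "(\<bar>S (k - 1) x\<bar> + \<bar>W (a + k) x\<bar>) ^ l \<le> b ^ l * Y k x ^ l" for k l x
 proof -
  have "\<bar>S (k - 1) x\<bar> + \<bar>W (a + k) x\<bar> \<le> \<bar>S (k - 1) x\<bar> + b * \<bar>W (a + k) x\<bar>"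
   using b1 mult_right_mono[of 1 b "\<bar>W (a + k) x\<bar>"] by simp
  also have "... = b * Y k x" unfolding Y_def using b1 by (simp add: field_simps)
  finally show ?thesis by (simp flip: power_mult_distrib add: power_mono)
 qed
 have WY: "\<bar>W (a + k) x\<bar> \<le> Y k x" for k x unfolding Y_def using b1 by simp
 have ZY: "\<bar>Z k x\<bar> \<le> Y k x ^ r" if k: "1 \<le> k" for k x
 proof -
  have "\<bar>S k x ^ r - S (k - 1) x ^ r\<bar> \<le> real r * \<bar>W (a + k) x\<bar> * (\<bar>S (k - 1) x\<bar> + \<bar>W (a + k) x\<bar>) ^ (J - 2)"
   unfolding Sk[OF k] using abs_power_diff_bound[of _ _ r] r by simp
  also have "... \<le> real r * Y k x * (b ^ (J - 2) * Y k x ^ (J - 2))"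
   using WY scale Y0 by (intro mult_mono) auto
  also have "... = real r * b ^ (J - 2) * (Y k x * Y k x ^ (J - 2))" by simp
  also have "Y k x * Y k x ^ (J - 2) = Y k x ^ r"
   using r by (metis Suc_pred' add.commute le_add_diff_inverse plus_1_eq_Suc power_Suc)
  finally show ?thesis unfolding Z_def using bb r by (simp add: abs_mult divide_simps) (simp add: ac_simps)
 qed
 have cov: "integrable P (\<lambda>x. Z i x * W (a + k) x)"
  "\<bar>(\<E> x. Z i x * W (a + k) x)\<bar> \<le> 8 * c * \<phi> (k - i) powr (real r / real J)"
  if ik: "1 \<le> i" "i < k" "k \<le> n" for i k
 proof -
  have Zm: "Z i \<in> borel_measurable (vsig P \<eta> {1..a+i})"
  proof -
   have [measurable]: "S i \<in> borel_measurable (vsig P \<eta> {1..a+i})" "S (i - 1) \<in> borel_measurable (vsig P \<eta> {1..a+i})"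
    by (auto intro!: SF measurable_vsig_mono[OF SF])
   show ?thesis unfolding Z_def by measurable
  qed
  have Wm: "W (a + k) \<in> borel_measurable (vsig P \<eta> {(a + i) + (k - i)..})"
   using ik by (intro measurable_vsig_mono[OF W]) auto
  have 1: "1 \<le> a + i" "1 \<le> k - i" and Ym: "Y i \<in> borel_measurable P" and ilen: "i \<le> n" and k1: "1 \<le> a + k"
   using ik by auto
  have cW: "(\<E> x. W (a + k) x ^ J) \<le> c" using cJ[of "a + k"] ik c1 by simp
  note C = covariance_bound[OF 1 r(2) Zm Wm Ym ZY[OF ik(1)] Y0, folded r(1), unfolded evabs,
    OF YJ(1)[OF ik(1) ilen] iJ[OF k1] YJ(2)[OF ik(1) ilen] cW]
  show "integrable P (\<lambda>x. Z i x * W (a + k) x)" by (rule C(1))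
  show "\<bar>(\<E> x. Z i x * W (a + k) x)\<bar> \<le> 8 * c * \<phi> (k - i) powr (real r / real J)"
   using C(4) i0[OF k1] by simp
 qed
 define C where "C = (real J)\<^sup>2 * c * (8 * \<Phi> + 1)"
 have Phi0: "0 \<le> \<Phi>" using Phi[of 0] by simp
 have step: "(\<E> x. S k x ^ J) \<le> (\<E> x. S (k - 1) x ^ J) + C * b ^ (J - 2)"
  if k: "1 \<le> k" "k \<le> n" for k
 proof -
  have tele: "S (k - 1) x ^ r = (\<Sum>i=1..<k. real r * b ^ (J - 2) * Z i x)" for x
  proof -
   have "(\<Sum>i=1..<k. real r * b ^ (J - 2) * Z i x) = (\<Sum>i=1..<k. S i x ^ r - S (i - 1) x ^ r)"
    unfolding Z_def using b1 r by (intro sum.cong) auto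
   also have "... = (\<Sum>i=0..<k-1. S (Suc i) x ^ r - S i x ^ r)"
    by (rule sum.reindex_bij_witness[of _ Suc "\<lambda>i. i - 1"]) auto
   also have "... = S (k - 1) x ^ r - S 0 x ^ r"
    unfolding atLeast0LessThan by (rule sum_lessThan_telescope[of "\<lambda>i. S i x ^ r"])
   finally show ?thesis using r by (simp add: S_def)
  qed
  have SW: "S (k - 1) x ^ r * W (a + k) x = (\<Sum>i=1..<k. real r * b ^ (J - 2) * (Z i x * W (a + k) x))" for x
   unfolding tele sum_distrib_right by (simp add: ac_simps)
  have iSW: "integrable P (\<lambda>x. S (k - 1) x ^ r * W (a + k) x)"
   unfolding SW using cov(1) k by (intro integrable_sum integrable_mult_right) auto
  have "(\<E> x. S (k - 1) x ^ r * W (a + k) x) = (\<Sum>i=1..<k. real r * b ^ (J - 2) * (\<E> x. Z i x * W (a + k) x))"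
   unfolding SW using cov(1) k by (subst integral_sum) auto
  also have "... \<le> (\<Sum>i=1..<k. real r * b ^ (J - 2) * (8 * c * \<phi> (k - i) powr (real r / real J)))"
   using cov(2) k b1 by (intro sum_mono mult_left_mono) (auto intro: order_trans[OF abs_ge_self])
  also have "... = real r * b ^ (J - 2) * 8 * c * (\<Sum>i=1..<k. \<phi> (k - i) powr (real r / real J))"
   by (simp add: sum_distrib_left ac_simps)
  also have "(\<Sum>i=1..<k. \<phi> (k - i) powr (real r / real J)) = (\<Sum>h=1..k-1. \<phi> h powr (real (J - 1) / real J))"
   by (rule sum.reindex_bij_witness[of _ "\<lambda>i. k - i" "\<lambda>i. k - i"]) (auto simp: r)
  also have "real r * b ^ (J - 2) * 8 * c * (\<Sum>h=1..k-1. \<phi> h powr (real (J - 1) / real J)) \<le> real J * b ^ (J - 2) * 8 * c * \<Phi>"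
   using Phi c1 bb r by (intro mult_mono) (auto intro!: sum_nonneg)
  finally have ESW: "(\<E> x. S (k - 1) x ^ r * W (a + k) x) \<le> real J * b ^ (J - 2) * 8 * c * \<Phi>" .
  have pt: "S k x ^ J \<le> S (k - 1) x ^ J + real J * (S (k - 1) x ^ r * W (a + k) x) + (real J)\<^sup>2 * b ^ (J - 2) * Y k x ^ J" for x
  proof -
   have "(W (a + k) x)\<^sup>2 * (\<bar>S (k - 1) x\<bar> + \<bar>W (a + k) x\<bar>) ^ (J - 2) \<le> (Y k x)\<^sup>2 * (b ^ (J - 2) * Y k x ^ (J - 2))"
    using WY[of k x] Y0 scale by (intro mult_mono) (auto simp flip: abs_le_square_iff)
   also have "... = b ^ (J - 2) * Y k x ^ J"
    using pJ[of "Y k x"] by (simp add: mult.left_commute)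
   finally have "(real J)\<^sup>2 * ((W (a + k) x)\<^sup>2 * (\<bar>S (k - 1) x\<bar> + \<bar>W (a + k) x\<bar>) ^ (J - 2)) \<le> (real J)\<^sup>2 * (b ^ (J - 2) * Y k x ^ J)"
    by (intro mult_left_mono) auto
   then show ?thesis
    using power_add_second_order_bound[of "S (k - 1) x" "W (a + k) x" J] Sk[OF k(1), of x]
    by (simp add: r_def mult.assoc)
  qed
  have "(\<E> x. S k x ^ J) \<le> (\<E> x. S (k - 1) x ^ J + real J * (S (k - 1) x ^ r * W (a + k) x) + (real J)\<^sup>2 * b ^ (J - 2) * Y k x ^ J)"
   using SJ iSW YJ(1)[OF k] pt by (intro integral_mono) auto
  also have "... = (\<E> x. S (k - 1) x ^ J) + real J * (\<E> x. S (k - 1) x ^ r * W (a + k) x) + (real J)\<^sup>2 * b ^ (J - 2) * (\<E> x. Y k x ^ J)"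
   using SJ iSW YJ(1)[OF k] by simp
  also have "... \<le> (\<E> x. S (k - 1) x ^ J) + real J * (real J * b ^ (J - 2) * 8 * c * \<Phi>) + (real J)\<^sup>2 * b ^ (J - 2) * c"
   using ESW YJ(2)[OF k] b1 by (intro add_mono mult_left_mono) auto
  also have "... = (\<E> x. S (k - 1) x ^ J) + C * b ^ (J - 2)"
   unfolding C_def by (simp add: power2_eq_square algebra_simps)
  finally show ?thesis .
 qed
 have C1: "1 \<le> C"
 proof -
  have "1 * 1 * 1 \<le> (real J)\<^sup>2 * c * (8 * \<Phi> + 1)"
   using c1 Phi0 J by (intro mult_mono) auto
  then show ?thesis by (simp add: C_def)
 qed
 have lin: "(\<E> x. S k x ^ J) \<le> real k * (C * b ^ (J - 2))" if "k \<le> n" for k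
  using that
 proof (induction k)
  case 0
  then show ?case using J by (simp add: S_def zero_power)
 next
  case (Suc k)
  then show ?case using step[of "Suc k"] by (simp add: algebra_simps)
 qed
 have "m \<le> real n * (C * b ^ (J - 2))"
  unfolding m_def
 proof (subst Max_le_iff, safe)
  fix k assume "k \<in> {0..n}"
  then have "real k * (C * b ^ (J - 2)) \<le> real n * (C * b ^ (J - 2))" using C1 bb by (intro mult_right_mono) auto
  with lin[of k] \<open>k \<in> {0..n}\<close> show "(\<E> x. S k x ^ J) \<le> real n * (C * b ^ (J - 2))" by auto
 qed auto
 moreover have "1 \<le> real n * (C * b ^ (J - 2))"
 proof -
  have "1 * (1 * 1) \<le> real n * (C * b ^ (J - 2))"
   using C1 b1 n by (intro mult_mono) auto
  then show ?thesis by simp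
 qed
 \<comment> \<open>The quantity being estimated occurs on the right at the lower power J - 2.
   Cancelling it leaves b^2 <= n C, and the power \<open>J div 2\<close> of this is the
   claim.\<close>
 ultimately have "b ^ J \<le> real n * C * b ^ (J - 2)" unfolding bJ by simp
 moreover have "b ^ J = b\<^sup>2 * b ^ (J - 2)" by (rule pJ[symmetric])
 ultimately have "b\<^sup>2 \<le> real n * C" using bb by simp
 then have "(b\<^sup>2) ^ (J div 2) \<le> (real n * C) ^ (J div 2)" by (intro power_mono) auto
 also have "(b\<^sup>2) ^ (J div 2) = b ^ J" using J by (simp flip: power_mult)
 finally have "(\<E> x. S n x ^ J) \<le> (real n * C) ^ (J div 2)" using Sb[of n] by simp
 then show ?thesis unfolding S_def C_def c_def .
qed

lemma moment_inequality:
 fixes W :: "nat => 'a => real" and J :: nat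
 assumes J: "even J" "2 \<le> J"
  and W: "!!j. 1 \<le> j ==> W j \<in> borel_measurable (vsig P \<eta> {j})"
  and i0: "!!j. 1 \<le> j ==> expectation (W j) = 0"
  and iJ: "!!j. 1 \<le> j ==> integrable P (\<lambda>x. W j x ^ J)"
  and K: "0 < K" and cJ: "!!j. 1 \<le> j ==> (\<E> x. W j x ^ J) \<le> K"
  and Phi: "!!n. (\<Sum>h=1..n. \<phi> h powr (real (J - 1) / real J)) \<le> \<Phi>"
 shows "(\<E> x. (\<Sum>j=a+1..a+n. W j x) ^ J) \<le> (real n * ((real J)\<^sup>2 * 2 ^ Suc J * (8 * \<Phi> + 1))) ^ (J div 2) * K"
proof -
 define k where "k = root J K"
 have k: "k > 0" "k ^ J = K" unfolding k_def using K J by (auto simp: real_root_pow_pos2)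
 have "(\<E> x. (\<Sum>j=a+1..a+n. W j x / k) ^ J) \<le> (real n * ((real J)\<^sup>2 * 2 ^ Suc J * (8 * \<Phi> + 1))) ^ (J div 2)"
 proof (rule moment_inequality_unit[OF J _ _ _ _ Phi])
  fix j :: nat assume j: "1 \<le> j"
  show "(\<lambda>x. W j x / k) \<in> borel_measurable (vsig P \<eta> {j})" using W[OF j] by measurable
  show "(\<E> x. W j x / k) = 0" using i0[OF j] by simp
  show "integrable P (\<lambda>x. (W j x / k) ^ J)" using iJ[OF j] by (simp add: power_divide)
  show "(\<E> x. (W j x / k) ^ J) \<le> 1" using cJ[OF j] K by (simp add: power_divide k)
 qed
 also have "(\<lambda>x. (\<Sum>j=a+1..a+n. W j x / k) ^ J) = (\<lambda>x. (\<Sum>j=a+1..a+n. W j x) ^ J / K)"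
  by (simp add: power_divide k flip: sum_divide_distrib)
 finally show ?thesis using K by (simp add: divide_simps)
qed

end

section \<open>Stationarity and the long-run variance\<close>

lemma Cesaro_mean_tendsto:
 fixes v :: "nat => real"
 assumes "v \<longlonglongrightarrow> L"
 shows "(\<lambda>n. (\<Sum>k<n. v k) / real n) \<longlonglongrightarrow> L"
proof (rule LIMSEQ_I)
 fix e :: real assume e: "0 < e"
 obtain N where N: "!!k. k \<ge> N ==> \<bar>v k - L\<bar> < e / 2"
  using LIMSEQ_D[OF assms, of "e / 2"] e by auto
 define B where "B = (\<Sum>k<N. \<bar>v k - L\<bar>)"
 have B: "0 \<le> B" unfolding B_def by (simp add: sum_nonneg)
 obtain M :: nat where M: "2 * B / e < real M" using reals_Archimedean2 by blast
 show "\<exists>no. \<forall>n\<ge>no. norm ((\<Sum>k<n. v k) / real n - L) < e"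
 proof (intro exI allI impI)
  fix n assume n: "Suc (max M N) \<le> n"
  have "(\<Sum>k<n. v k) / real n - L = (\<Sum>k<n. v k - L) / real n"
   using n by (simp add: sum_subtractf field_simps)
  also have "norm ... \<le> (\<Sum>k<n. \<bar>v k - L\<bar>) / real n"
   by (simp add: divide_right_mono)
  also have "(\<Sum>k<n. \<bar>v k - L\<bar>) = B + (\<Sum>k=N..<n. \<bar>v k - L\<bar>)"
   unfolding B_def using n by (simp add: sum.atLeastLessThan_concat lessThan_atLeast0)
  also have "(\<Sum>k=N..<n. \<bar>v k - L\<bar>) \<le> (\<Sum>k=N..<n. e / 2)"
   using N by (intro sum_mono less_imp_le) auto
  also have "... \<le> real n * (e / 2)" using e by (simp add: mult_right_mono)
  also have "(B + real n * (e / 2)) / real n = B / real n + e / 2"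
   using n by (simp add: add_divide_distrib)
  also have "B / real n < e / 2"
  proof -
   have "2 * B / e < real n" using M n by simp
   then show ?thesis using e n by (simp add: divide_simps mult.commute)
  qed
  finally show "norm ((\<Sum>k<n. v k) / real n - L) < e" using n by (simp add: divide_right_mono)
 qed
qed

text \<open>The single exponent 1/2 serves every moment order: \<open>\<phi>\<close> <= 1 and (J -
  1) / J >= 1/2 make all powers that occur summable. The product of h and
  \<open>\<phi>\<close>(h)^(1/2) is the cost of decoupling h blocks separated by gaps of length h in
  the central limit theorem, hence \<open>phi_decay\<close>.\<close>

locale stationary_mixing = mixing_process P \<eta> \<phi> for P :: "'a measure" and \<eta> :: "nat => 'a => 'b::topological_space" and \<phi> +
 assumes stationary: "!!I h. finite I ==> I \<subseteq> {1..} ==>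
    distr P (\<Pi>\<^sub>M i\<in>I. borel) (\<lambda>w. \<lambda>i\<in>I. \<eta> (i + h) w) =
    distr P (\<Pi>\<^sub>M i\<in>I. borel) (\<lambda>w. \<lambda>i\<in>I. \<eta> i w)"
  and summable_phi: "summable (\<lambda>h. \<phi> (Suc h) powr (1 / 2))"
  and phi_decay: "(\<lambda>h. real h * \<phi> h powr (1 / 2)) \<longlonglongrightarrow> 0"
  and phi_le_1: "!!h. \<phi> h \<le> 1"
begin

lemma measurable_eta_family:
 assumes "I \<subseteq> {1..}"
 shows "(\<lambda>w. \<lambda>i\<in>I. \<eta> (i + h) w) \<in> measurable P (\<Pi>\<^sub>M i\<in>I. borel)"
proof (rule measurable_restrict)
 fix i assume "i \<in> I"
 then have "1 \<le> i + h" using assms by auto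
 then show "\<eta> (i + h) \<in> borel_measurable P" by (rule meas_eta)
qed

lemma expectation_shift:
 fixes F :: "(nat => 'b) => 'c :: {banach, second_countable_topology}"
 assumes I: "finite I" "I \<subseteq> {1..}" and F: "F \<in> borel_measurable (\<Pi>\<^sub>M i\<in>I. borel)"
 shows "(\<E> w. F (\<lambda>i\<in>I. \<eta> (i + h) w)) = (\<E> w. F (\<lambda>i\<in>I. \<eta> i w))"
  and "integrable P (\<lambda>w. F (\<lambda>i\<in>I. \<eta> (i + h) w)) = integrable P (\<lambda>w. F (\<lambda>i\<in>I. \<eta> i w))"
proof -
 note m = measurable_eta_family[OF I(2), of h] and m0 = measurable_eta_family[OF I(2), of 0]
 show "(\<E> w. F (\<lambda>i\<in>I. \<eta> (i + h) w)) = (\<E> w. F (\<lambda>i\<in>I. \<eta> i w))"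
  using integral_distr[OF m F] integral_distr[OF m0 F] stationary[OF I, of h] by simp
 show "integrable P (\<lambda>w. F (\<lambda>i\<in>I. \<eta> (i + h) w)) = integrable P (\<lambda>w. F (\<lambda>i\<in>I. \<eta> i w))"
  using integrable_distr_eq[OF m F] integrable_distr_eq[OF m0 F] stationary[OF I, of h] by simp
qed

lemma functional_shift:
 fixes g :: "'b => 'c :: {banach, second_countable_topology}"
 assumes g: "g \<in> borel_measurable borel" and j: "1 \<le> j"
 shows "(\<E> w. g (\<eta> j w)) = (\<E> w. g (\<eta> 1 w))"
  and "integrable P (\<lambda>w. g (\<eta> j w)) = integrable P (\<lambda>w. g (\<eta> 1 w))"
proof -
 have F: "(\<lambda>x. g (x 1)) \<in> borel_measurable (\<Pi>\<^sub>M i\<in>{1}. borel)"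
  using g by measurable
 have 1: "finite {1::nat}" "{1::nat} \<subseteq> {1..}" by auto
 show "(\<E> w. g (\<eta> j w)) = (\<E> w. g (\<eta> 1 w))"
  using expectation_shift(1)[OF 1 F, of "j - 1"] j by simp
 show "integrable P (\<lambda>w. g (\<eta> j w)) = integrable P (\<lambda>w. g (\<eta> 1 w))"
  using expectation_shift(2)[OF 1 F, of "j - 1"] j by simp
qed

lemma sum_shift:
 fixes f :: "real => 'c :: {banach, second_countable_topology}"
 assumes g: "g \<in> borel_measurable borel" and f: "f \<in> borel_measurable borel"
 shows "(\<E> w. f (\<Sum>j=a+1..a+n. g (\<eta> j w))) = (\<E> w. f (\<Sum>j=1..n. g (\<eta> j w)))"
proof -
 have F: "(\<lambda>x. f (\<Sum>j=1..n. g (x j))) \<in> borel_measurable (\<Pi>\<^sub>M i\<in>{1..n}. borel)"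
  using g f by measurable
 have eq: "(\<Sum>j=a+1..a+n. g (\<eta> j w)) = (\<Sum>j=1..n. g (\<eta> (j + a) w))" for w
  by (rule sum.reindex_bij_witness[of _ "\<lambda>j. j + a" "\<lambda>j. j - a"]) auto
 show ?thesis
  unfolding eq using expectation_shift(1)[OF _ _ F, of a] by simp
qed

definition lag_cov :: "('b => real) => nat => real" where
 "lag_cov g h = (\<E> w. g (\<eta> 1 w) * g (\<eta> (1 + h) w))"

definition lrv :: "('b => real) => real" where
 "lrv g = lag_cov g 0 + 2 * (\<Sum>h. lag_cov g (Suc h))"

lemma expectation_product_lag:
 assumes g: "g \<in> borel_measurable borel" and j: "1 \<le> j"
 shows "(\<E> w. g (\<eta> j w) * g (\<eta> (j + h) w)) = lag_cov g h"
  and "integrable P (\<lambda>w. g (\<eta> j w) * g (\<eta> (j + h) w)) = integrable P (\<lambda>w. g (\<eta> 1 w) * g (\<eta> (1 + h) w))"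
proof -
 let ?I = "{1, 1 + h}"
 have F: "(\<lambda>x. g (x 1) * g (x (1 + h))) \<in> borel_measurable (\<Pi>\<^sub>M i\<in>?I. borel)"
  using g by measurable
 have I: "finite ?I" "?I \<subseteq> {1..}" by auto
 show "(\<E> w. g (\<eta> j w) * g (\<eta> (j + h) w)) = lag_cov g h"
  using expectation_shift(1)[OF I F, of "j - 1"] j by (simp add: lag_cov_def ac_simps)
 show "integrable P (\<lambda>w. g (\<eta> j w) * g (\<eta> (j + h) w)) = integrable P (\<lambda>w. g (\<eta> 1 w) * g (\<eta> (1 + h) w))"
  using expectation_shift(2)[OF I F, of "j - 1"] j by (simp add: ac_simps)
qed

text \<open>The fourth moment is part of the notion because it controls the Taylor remainder of
  characteristic functions as well as the variance of squared block sums.\<close>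

definition centred_functional :: "('b => real) => bool" where
 "centred_functional g \<longleftrightarrow> g \<in> borel_measurable borel \<and> integrable P (\<lambda>w. g (\<eta> 1 w) ^ 4) \<and> (\<E> w. g (\<eta> 1 w)) = 0"

lemma integrable_power_le:
 fixes X :: "'a => real"
 assumes X: "X \<in> borel_measurable P" and i: "integrable P (\<lambda>x. \<bar>X x\<bar> ^ n)" and k: "k \<le> n"
 shows "integrable P (\<lambda>x. X x ^ k)"
proof (rule integrable_le[of "\<lambda>x. 1 + \<bar>X x\<bar> ^ n"])
 fix x
 have "\<bar>X x\<bar> ^ k \<le> 1 + \<bar>X x\<bar> ^ n"
 proof (cases "\<bar>X x\<bar> \<le> 1")
  case True
  then have "\<bar>X x\<bar> ^ k \<le> 1" by (simp add: power_le_one)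
  then show ?thesis by (simp add: add_increasing2)
 next
  case False
  then have "\<bar>X x\<bar> ^ k \<le> \<bar>X x\<bar> ^ n" using k by (intro power_increasing) auto
  then show ?thesis by simp
 qed
 then show "\<bar>X x ^ k\<bar> \<le> 1 + \<bar>X x\<bar> ^ n" by (simp add: power_abs)
qed (use X i in auto)

lemma centred_functionalD:
 assumes "centred_functional g" "1 \<le> j"
 shows "g \<in> borel_measurable borel" "(\<lambda>w. g (\<eta> j w)) \<in> borel_measurable (vsig P \<eta> {j})"
  "(\<lambda>w. g (\<eta> j w)) \<in> borel_measurable P"
  "(\<E> w. g (\<eta> j w)) = 0"
  "k \<le> 4 ==> integrable P (\<lambda>w. g (\<eta> j w) ^ k)"
  "integrable P (\<lambda>w. g (\<eta> j w))"
  "(\<E> w. g (\<eta> j w) ^ k) = (\<E> w. g (\<eta> 1 w) ^ k)"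
proof -
 show g: "g \<in> borel_measurable borel" using assms by (simp add: centred_functional_def)
 show "(\<lambda>w. g (\<eta> j w)) \<in> borel_measurable (vsig P \<eta> {j})"
  by (rule measurable_compose[OF measurable_vsig g]) simp
 show m: "(\<lambda>w. g (\<eta> j w)) \<in> borel_measurable P"
  by (rule measurable_compose[OF meas_eta[OF assms(2)] g])
 show "(\<E> w. g (\<eta> j w)) = 0"
  using functional_shift(1)[OF g assms(2)] assms(1) by (simp add: centred_functional_def)
 have gk: "(\<lambda>x. g x ^ k) \<in> borel_measurable borel" for k using g by measurable
 have "integrable P (\<lambda>w. g (\<eta> j w) ^ 4)"
  using functional_shift(2)[OF gk[of 4] assms(2)] assms(1) by (simp add: centred_functional_def)
 then have 4: "integrable P (\<lambda>w. \<bar>g (\<eta> j w)\<bar> ^ 4)" by (simp add: power_even_abs)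
 show *: "integrable P (\<lambda>w. g (\<eta> j w) ^ k)" if "k \<le> 4" for k
  by (rule integrable_power_le[OF m 4 that])
 show "integrable P (\<lambda>w. g (\<eta> j w))" using *[of 1] by simp
 show "(\<E> w. g (\<eta> j w) ^ k) = (\<E> w. g (\<eta> 1 w) ^ k)"
  by (rule functional_shift(1)[OF gk assms(2)])
qed

lemma lag_cov_bound:
 assumes g: "centred_functional g"
 shows "\<bar>lag_cov g (Suc h)\<bar> \<le> 8 * (\<E> w. (g (\<eta> 1 w))\<^sup>2) * \<phi> (Suc h) powr (1 / 2)"
  and "integrable P (\<lambda>w. g (\<eta> 1 w) * g (\<eta> (1 + h) w))"
proof -
 have 1: "1 \<le> 1 + Suc h" "(1::nat) \<le> 1" "(1::nat) \<le> Suc h" by auto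
 have m1: "(\<lambda>w. g (\<eta> 1 w)) \<in> borel_measurable (vsig P \<eta> {1..1})" using centred_functionalD(2)[OF g, of 1] by simp
 have m2: "(\<lambda>w. g (\<eta> (1 + Suc h) w)) \<in> borel_measurable (vsig P \<eta> {1 + Suc h..})" for h
  by (rule measurable_vsig_mono[OF centred_functionalD(2)[OF g]]) auto
 have i: "integrable P (\<lambda>w. \<bar>g (\<eta> j w)\<bar> ^ Suc 1)" if "1 \<le> j" for j
  using centred_functionalD(5)[OF g that, of 2] by (simp add: power2_eq_square)
 have e: "(\<E> w. \<bar>g (\<eta> j w)\<bar> ^ Suc 1) = (\<E> w. (g (\<eta> 1 w))\<^sup>2)" if "1 \<le> j" for j
  using centred_functionalD(7)[OF g that, of 2] by (simp add: power2_eq_square)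
 have a: "!!x. \<bar>g (\<eta> 1 x)\<bar> \<le> \<bar>g (\<eta> 1 x)\<bar> ^ 1" by simp
 have mm: "(\<lambda>w. \<bar>g (\<eta> 1 w)\<bar>) \<in> borel_measurable P" using centred_functionalD(3)[OF g, of 1] by measurable
 have suc: "(1::nat) \<le> Suc 0" "1 \<le> 1 + Suc h" for h by auto
 note C = covariance_bound[where h = "Suc h" for h, OF 1(2) _ 1(2) m1 m2 mm a abs_ge_zero i[OF 1(2)] i[OF suc(2)]
   eq_refl[OF e[OF 1(2)]] eq_refl[OF e[OF suc(2)]]]
 show "\<bar>lag_cov g (Suc h)\<bar> \<le> 8 * (\<E> w. (g (\<eta> 1 w))\<^sup>2) * \<phi> (Suc h) powr (1 / 2)"
  using C(4)[of h] centred_functionalD(4)[OF g, of 1] by (simp add: lag_cov_def)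
 show "integrable P (\<lambda>w. g (\<eta> 1 w) * g (\<eta> (1 + h) w))"
 proof (cases h)
  case 0
  then show ?thesis using centred_functionalD(5)[OF g, of 1 2] by (simp add: power2_eq_square)
 next
  case (Suc k)
  then show ?thesis using C(1)[of k] by simp
 qed
qed

lemma summable_lag_cov: "centred_functional g ==> summable (\<lambda>h. lag_cov g (Suc h))"
 by (rule summable_comparison_test'[OF summable_mult[OF summable_phi]]) (use lag_cov_bound(1) in auto)

lemma variance_sum_step:
 assumes g: "centred_functional g"
 shows "(\<E> w. (\<Sum>j=1..Suc n. g (\<eta> j w))\<^sup>2) =
  (\<E> w. (\<Sum>j=1..n. g (\<eta> j w))\<^sup>2) + (lag_cov g 0 + 2 * (\<Sum>h<n. lag_cov g (Suc h)))"
  and "integrable P (\<lambda>w. (\<Sum>j=1..n. g (\<eta> j w))\<^sup>2)"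
proof -
 let ?W = "\<lambda>j w. g (\<eta> j w)"
 have i: "integrable P (\<lambda>w. (\<Sum>j=1..n. ?W j w)\<^sup>2)" for n
  using integrable_sum_power[of "{1..n}" ?W 2] centred_functionalD(3)[OF g] centred_functionalD(5)[OF g, of _ 2] by auto
 then show "integrable P (\<lambda>w. (\<Sum>j=1..n. ?W j w)\<^sup>2)" .
 have p: "integrable P (\<lambda>w. ?W j w * ?W (Suc n) w)"
  "(\<E> w. ?W j w * ?W (Suc n) w) = lag_cov g (Suc n - j)" if "j \<in> {1..Suc n}" for j
 proof -
  have eq: "Suc n = j + (Suc n - j)" using that by auto
  show "integrable P (\<lambda>w. ?W j w * ?W (Suc n) w)"
   by (subst (1) eq, subst expectation_product_lag(2)) (use that lag_cov_bound(2)[OF g] centred_functionalD(1)[OF g, of 1] in auto)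
  show "(\<E> w. ?W j w * ?W (Suc n) w) = lag_cov g (Suc n - j)"
   by (subst (1) eq, subst expectation_product_lag(1)) (use that centred_functionalD(1)[OF g, of 1] in auto)
 qed
 have "(\<E> w. (\<Sum>j=1..Suc n. ?W j w)\<^sup>2) = (\<E> w. (\<Sum>j=1..n. ?W j w)\<^sup>2 +
   (?W (Suc n) w * ?W (Suc n) w + 2 * (\<Sum>j=1..n. ?W j w * ?W (Suc n) w)))"
  by (simp add: power2_sum power2_eq_square sum_distrib_left algebra_simps)
 also have "... = (\<E> w. (\<Sum>j=1..n. ?W j w)\<^sup>2) + (lag_cov g 0 + 2 * (\<Sum>j=1..n. lag_cov g (Suc n - j)))"
 proof -
  have "(\<E> w. \<Sum>j=1..n. ?W j w * ?W (Suc n) w) = (\<Sum>j=1..n. lag_cov g (Suc n - j))"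
   by (subst integral_sum) (use p in auto)
  moreover have "integrable P (\<lambda>w. \<Sum>j=1..n. ?W j w * ?W (Suc n) w)"
   by (intro integrable_sum p) auto
  ultimately show ?thesis using i p[of "Suc n"] by simp
 qed
 also have "(\<Sum>j=1..n. lag_cov g (Suc n - j)) = (\<Sum>h<n. lag_cov g (Suc h))"
  by (rule sum.reindex_bij_witness[of _ "\<lambda>h. n - h" "\<lambda>j. n - j"]) (auto simp: Suc_diff_le)
 finally show "(\<E> w. (\<Sum>j=1..Suc n. g (\<eta> j w))\<^sup>2) =
  (\<E> w. (\<Sum>j=1..n. g (\<eta> j w))\<^sup>2) + (lag_cov g 0 + 2 * (\<Sum>h<n. lag_cov g (Suc h)))" .
qed

text \<open>The increments of the variance in n are the partial sums of the covariance series, so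
  the normalised variance is a Cesaro mean of a convergent sequence.\<close>

theorem variance_limit:
 assumes g: "centred_functional g"
 shows "(\<lambda>n. (\<E> w. (\<Sum>j=1..n. g (\<eta> j w))\<^sup>2) / real n) \<longlonglongrightarrow> lrv g"
proof -
 define v where "v n = lag_cov g 0 + 2 * (\<Sum>h<n. lag_cov g (Suc h))" for n
 have "v \<longlonglongrightarrow> lrv g"
  unfolding v_def lrv_def by (intro tendsto_intros summable_LIMSEQ summable_lag_cov g)
 moreover have "(\<E> w. (\<Sum>j=1..n. g (\<eta> j w))\<^sup>2) = (\<Sum>k<n. v k)" for n
 proof (induction n)
  case (Suc n)
  show ?case unfolding variance_sum_step(1)[OF g] Suc.IH by (simp add: v_def)
 qed simp
 ultimately show ?thesis using Cesaro_mean_tendsto[of v] by simp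
qed

lemma lrv_nonneg: "centred_functional g ==> 0 \<le> lrv g"
 by (rule tendsto_lowerbound[OF variance_limit]) (auto intro!: always_eventually divide_nonneg_nonneg integral_nonneg)

end

section \<open>Central limit theorem\<close>

lemma norm_iexp_diff_le: "cmod (iexp x - iexp y) \<le> \<bar>x - y\<bar>"
proof -
 have "iexp x - iexp y = iexp y * (iexp (x - y) - 1)"
  by (simp add: right_diff_distrib flip: exp_add of_real_diff) (simp add: algebra_simps)
 then have "cmod (iexp x - iexp y) = cmod (iexp (x - y) - 1)"
  by (simp add: norm_mult)
 also have "... \<le> \<bar>x - y\<bar>" using iexp_approx1[of "x - y" 0] by simp
 finally show ?thesis .
qed

context prob_space
begin

lemma integrable_iexp_measurable:
 "X \<in> borel_measurable M ==> integrable M (\<lambda>w. iexp (X w))"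
 by (rule integrable_const_bound[of _ 1]) auto

lemma expectation_iexp_diff_le:
 assumes [measurable]: "X \<in> borel_measurable M" "Y \<in> borel_measurable M"
  and "integrable M (\<lambda>w. \<bar>X w - Y w\<bar>)"
 shows "cmod ((\<E> w. iexp (X w)) - (\<E> w. iexp (Y w))) \<le> (\<E> w. \<bar>X w - Y w\<bar>)"
proof -
 have "(\<E> w. iexp (X w)) - (\<E> w. iexp (Y w)) = (\<E> w. iexp (X w) - iexp (Y w))"
  by (rule integral_diff[symmetric]) (auto intro!: integrable_iexp_measurable)
 also have "cmod ... \<le> (\<E> w. cmod (iexp (X w) - iexp (Y w)))"
  by (rule integral_norm_bound)
 also have "... \<le> (\<E> w. \<bar>X w - Y w\<bar>)"
  by (rule integral_mono) (auto intro!: assms(3) norm_iexp_diff_le integrable_iexp_measurable integrable_diff integrable_norm)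
 finally show ?thesis .
qed

lemma cmod_expectation_iexp_le_1:
 assumes [measurable]: "X \<in> borel_measurable M"
 shows "cmod ((\<E> w. iexp (X w))) \<le> 1"
proof -
 have "cmod ((\<E> w. iexp (X w))) \<le> (\<E> w. cmod (iexp (X w)))"
  by (rule integral_norm_bound)
 then show ?thesis by (simp add: prob_space)
qed

lemma expectation_abs_le_sqrt:
 fixes X :: "'a => real"
 assumes [measurable]: "X \<in> borel_measurable M" and i: "integrable M (\<lambda>w. (X w)\<^sup>2)"
 shows "(\<E> w. \<bar>X w\<bar>) \<le> sqrt ((\<E> w. (X w)\<^sup>2))"
  and "integrable M (\<lambda>w. \<bar>X w\<bar>)"
proof -
 have iX: "integrable M X" by (rule square_integrable_imp_integrable) (use i in auto)
 then show ia: "integrable M (\<lambda>w. \<bar>X w\<bar>)" by simp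
 have "0 \<le> variance (\<lambda>w. \<bar>X w\<bar>)" by (rule variance_positive)
 also have "... = (\<E> w. (X w)\<^sup>2) - ((\<E> w. \<bar>X w\<bar>))\<^sup>2"
  by (subst variance_eq) (use ia i in auto)
 finally have "((\<E> w. \<bar>X w\<bar>))\<^sup>2 \<le> (\<E> w. (X w)\<^sup>2)" by simp
 then show "(\<E> w. \<bar>X w\<bar>) \<le> sqrt ((\<E> w. (X w)\<^sup>2))"
  by (rule real_le_rsqrt)
qed

text \<open>Only even moments of partial sums are under control. The cubic Taylor remainder is
  therefore dominated through |x|^3 <= a x^2 + x^4 / a, with \<open>a\<close> on the scale of the
  standard deviation, so that both terms are of order a^3.\<close>

lemma iexp_quadratic_approx:
 fixes X :: "'a => real"
 assumes [measurable]: "X \<in> borel_measurable M" and i4: "integrable M (\<lambda>w. X w ^ 4)" and i2: "integrable M (\<lambda>w. (X w)\<^sup>2)"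
  and m: "expectation X = 0" and iX: "integrable M X"
  and a: "0 < a" and c2: "(\<E> w. (X w)\<^sup>2) \<le> c * a\<^sup>2" and c4: "(\<E> w. X w ^ 4) \<le> c * a ^ 4"
 shows "cmod ((\<E> w. iexp (s * X w)) - (1 - s\<^sup>2 * (\<E> w. (X w)\<^sup>2) / 2)) \<le> c * \<bar>s * a\<bar> ^ 3"
proof -
 let ?T = "\<lambda>w. complex_of_real (1 - s\<^sup>2 * (X w)\<^sup>2 / 2) + \<i> * complex_of_real (s * X w)"
 have j1: "integrable M (\<lambda>w. complex_of_real (1 - s\<^sup>2 * (X w)\<^sup>2 / 2))"
  by (intro integrable_of_real integrable_diff integrable_divide_zero integrable_mult_right) (use i2 in auto)
 have j2: "integrable M (\<lambda>w. \<i> * complex_of_real (s * X w))"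
  by (intro integrable_mult_right integrable_of_real) (use iX in auto)
 have iT: "integrable M ?T" by (rule integrable_add[OF j1 j2])
 have eT: "expectation ?T = complex_of_real (1 - s\<^sup>2 * (\<E> w. (X w)\<^sup>2) / 2)"
 proof -
  have "expectation ?T = (\<E> w. complex_of_real (1 - s\<^sup>2 * (X w)\<^sup>2 / 2)) + \<i> * (\<E> w. complex_of_real (s * X w))"
   by (simp only: integral_add[OF j1 j2] integral_mult_right_zero)
  also have "(\<E> w. complex_of_real (s * X w)) = complex_of_real ((\<E> w. s * X w))"
   by (rule integral_complex_of_real)
  also have "(\<E> w. complex_of_real (1 - s\<^sup>2 * (X w)\<^sup>2 / 2)) = complex_of_real ((\<E> w. 1 - s\<^sup>2 * (X w)\<^sup>2 / 2))"
   by (rule integral_complex_of_real)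
  also have "(\<E> w. 1 - s\<^sup>2 * (X w)\<^sup>2 / 2) = 1 - s\<^sup>2 * (\<E> w. (X w)\<^sup>2) / 2"
   using i2 by (simp add: prob_space)
  finally show ?thesis using m by simp
 qed
 have cub: "\<bar>x\<bar> ^ 3 \<le> a * x\<^sup>2 + x ^ 4 / a" for x
 proof -
  have "0 \<le> x\<^sup>2 * (a - \<bar>x\<bar>)\<^sup>2" by simp
  also have "... = x\<^sup>2 * a\<^sup>2 + x ^ 4 - 2 * a * \<bar>x\<bar> ^ 3"
   by (simp add: power2_diff algebra_simps power2_eq_square power3_eq_cube power4_eq_xxxx)
  finally have "2 * (a * \<bar>x\<bar> ^ 3) \<le> a * (a * x\<^sup>2 + x ^ 4 / a)"
   using a by (simp add: algebra_simps power2_eq_square)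
  then have "a * \<bar>x\<bar> ^ 3 \<le> a * (a * x\<^sup>2 + x ^ 4 / a)"
   using mult_nonneg_nonneg[OF less_imp_le[OF a] zero_le_power_abs[of x 3]] by linarith
  then show ?thesis using a by simp
 qed
 have ie: "integrable M (\<lambda>w. iexp (s * X w))" by (rule integrable_iexp_measurable) measurable
 have "cmod ((\<E> w. iexp (s * X w)) - expectation ?T) = cmod ((\<E> w. iexp (s * X w) - ?T w))"
  by (simp only: integral_diff[OF ie iT])
 also have "... \<le> (\<E> w. cmod (iexp (s * X w) - ?T w))" by (rule integral_norm_bound)
 also have "... \<le> (\<E> w. \<bar>s\<bar> ^ 3 / 6 * (a * (X w)\<^sup>2 + X w ^ 4 / a))"
 proof (rule integral_mono)
  show "integrable M (\<lambda>w. cmod (iexp (s * X w) - ?T w))"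
   by (intro integrable_norm integrable_diff integrable_iexp_measurable iT) simp
  show "integrable M (\<lambda>w. \<bar>s\<bar> ^ 3 / 6 * (a * (X w)\<^sup>2 + X w ^ 4 / a))" using i2 i4 by auto
  fix w
  have sumeq: "(\<Sum>k\<le>2. (\<i> * complex_of_real (s * X w)) ^ k / fact k) = ?T w"
   by (simp add: numeral_2_eq_2 power2_eq_square power_mult_distrib algebra_simps)
  have f: "Suc 2 = 3" "fact 3 = (6::real)" by (simp_all add: fact_numeral)
  have "cmod (iexp (s * X w) - ?T w) \<le> \<bar>s * X w\<bar> ^ 3 / 6"
   using iexp_approx1[of "s * X w" 2] unfolding sumeq f .
  also have "... = \<bar>s\<bar> ^ 3 / 6 * \<bar>X w\<bar> ^ 3" by (simp add: abs_mult power_mult_distrib)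
  also have "... \<le> \<bar>s\<bar> ^ 3 / 6 * (a * (X w)\<^sup>2 + X w ^ 4 / a)" by (intro mult_left_mono cub) auto
  finally show "cmod (iexp (s * X w) - ?T w) \<le> \<bar>s\<bar> ^ 3 / 6 * (a * (X w)\<^sup>2 + X w ^ 4 / a)" .
 qed
 also have "... = \<bar>s\<bar> ^ 3 / 6 * (a * (\<E> w. (X w)\<^sup>2) + (\<E> w. X w ^ 4) / a)"
  using i2 i4 by simp
 also have "... \<le> \<bar>s\<bar> ^ 3 / 6 * (a * (c * a\<^sup>2) + c * a ^ 4 / a)"
  using c2 c4 a by (intro mult_left_mono add_mono divide_right_mono) auto
 also have "... = c * \<bar>s * a\<bar> ^ 3 / 3"
  using a by (simp add: abs_mult power_mult_distrib power2_eq_square power3_eq_cube power4_eq_xxxx field_simps)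
 also have "... \<le> c * \<bar>s * a\<bar> ^ 3"
 proof -
  have "0 \<le> (\<E> w. (X w)\<^sup>2)" by (intro integral_nonneg) simp
  then have "0 \<le> c * a\<^sup>2" using c2 by linarith
  then have "0 \<le> c" using a by (simp add: zero_le_mult_iff)
  then show ?thesis by simp
 qed
 finally show ?thesis unfolding eT by simp
qed

end

context mixing_process
begin

text \<open>Real and imaginary parts give four real covariances, each at most 8
  \<open>\<phi>\<close>^(1/2) by the covariance inequality with r = 1 and constant envelope 1; the
  modulus is at most the sum of all four.\<close>

lemma covariance_bound_unit:
 fixes Z W :: "'a => complex"
 assumes ih: "1 \<le> i" "1 \<le> h"
  and Z: "Z \<in> borel_measurable (vsig P \<eta> {1..i})" and W: "W \<in> borel_measurable (vsig P \<eta> {i + h..})"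
  and Z1: "!!w. cmod (Z w) \<le> 1" and W1: "!!w. cmod (W w) \<le> 1"
 shows "cmod ((\<E> w. Z w * W w) - expectation Z * expectation W) \<le> 32 * \<phi> h powr (1 / 2)"
proof -
 have sub: "{1..i} \<subseteq> {1..}" "{i + h..} \<subseteq> {1..}" using ih by auto
 have [measurable]: "Z \<in> borel_measurable P" "W \<in> borel_measurable P"
  using measurable_eta[OF _ sub(1)] measurable_eta[OF _ sub(2)] Z W
  by (auto intro: measurable_from_subalg[OF subalgebra_eta[OF sub(1)]] measurable_from_subalg[OF subalgebra_eta[OF sub(2)]])
 have iZ: "integrable P Z" and iW: "integrable P W"
  by (rule integrable_const_bound[of _ 1], auto intro!: AE_I2 Z1 W1)+
 have real: "\<bar>(\<E> x. f x * g x) - expectation f * expectation g\<bar> \<le> 8 * \<phi> h powr (1 / 2)"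
  and int: "integrable P (\<lambda>x. f x * g x)" "integrable P f" "integrable P g"
  if f: "f \<in> borel_measurable (vsig P \<eta> {1..i})" and g: "g \<in> borel_measurable (vsig P \<eta> {i + h..})"
   and f1: "!!x. \<bar>f x\<bar> \<le> 1" and g1: "!!x. \<bar>g x\<bar> \<le> 1" for f g :: "'a => real"
 proof -
  have [measurable]: "g \<in> borel_measurable P" using measurable_eta[OF g sub(2)] .
  have g2: "\<bar>g x\<bar> ^ Suc 1 \<le> 1" for x by (rule power_le_one) (use g1 in auto)
  have i: "integrable P (\<lambda>x. \<bar>g x\<bar> ^ Suc 1)"
   by (rule integrable_const_bound[of _ 1]) (use g2 in \<open>auto intro!: AE_I2 simp del: power_Suc\<close>)
  have e: "(\<E> x. \<bar>g x\<bar> ^ Suc 1) \<le> 1"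
   using integral_mono[OF i, of "\<lambda>_. 1"] g2 by (simp add: prob_space del: power_Suc)
  have f1': "!!x. \<bar>f x\<bar> \<le> 1 ^ 1" and one: "(1::nat) \<le> 1" "(\<lambda>x. 1::real) \<in> borel_measurable P" "!!x. 0 \<le> (1::real)"
   "integrable P (\<lambda>x. 1 ^ Suc 1 :: real)" "(\<E> x. 1 ^ Suc 1 :: real) \<le> 1" using f1 by (auto simp: prob_space)
  note C = covariance_bound[OF ih one(1) f g one(2) f1' one(3) one(4) i one(5) e]
  show "\<bar>(\<E> x. f x * g x) - expectation f * expectation g\<bar> \<le> 8 * \<phi> h powr (1 / 2)" using C(4) by simp
  show "integrable P (\<lambda>x. f x * g x)" "integrable P f" "integrable P g" using C(1-3) by auto
 qed
 have mm: "(\<lambda>x. Re (Z x)) \<in> borel_measurable (vsig P \<eta> {1..i})" "(\<lambda>x. Im (Z x)) \<in> borel_measurable (vsig P \<eta> {1..i})"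
  "(\<lambda>x. Re (W x)) \<in> borel_measurable (vsig P \<eta> {i + h..})" "(\<lambda>x. Im (W x)) \<in> borel_measurable (vsig P \<eta> {i + h..})"
  using Z W by measurable
 have b: "\<bar>Re (Z x)\<bar> \<le> 1" "\<bar>Im (Z x)\<bar> \<le> 1" "\<bar>Re (W x)\<bar> \<le> 1" "\<bar>Im (W x)\<bar> \<le> 1" for x
  using abs_Re_le_cmod abs_Im_le_cmod Z1 W1 order_trans by blast+
 let ?c = "\<lambda>f g. (\<E> x. f (Z x) * g (W x)) - (\<E> x. f (Z x)) * (\<E> x. g (W x))"
 have iZW: "integrable P (\<lambda>x. Z x * W x)"
  by (rule integrable_const_bound[of _ 1]) (auto intro!: AE_I2 mult_le_one Z1 W1 simp: norm_mult)
 have int1: "integrable P (\<lambda>x. Re (Z x) * Re (W x))" "integrable P (\<lambda>x. Im (Z x) * Im (W x))"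
  "integrable P (\<lambda>x. Re (Z x) * Im (W x))" "integrable P (\<lambda>x. Im (Z x) * Re (W x))"
  by (rule int(1), fact mm b, fact mm b, rule b, rule b)+
 have EZ: "Re (expectation Z) = (\<E> x. Re (Z x))" "Im (expectation Z) = (\<E> x. Im (Z x))"
  using integral_Re[OF iZ] integral_Im[OF iZ] by simp_all
 have EW: "Re (expectation W) = (\<E> x. Re (W x))" "Im (expectation W) = (\<E> x. Im (W x))"
  using integral_Re[OF iW] integral_Im[OF iW] by simp_all
 have EZW: "Re ((\<E> x. Z x * W x)) = (\<E> x. Re (Z x) * Re (W x)) - (\<E> x. Im (Z x) * Im (W x))"
  "Im ((\<E> x. Z x * W x)) = (\<E> x. Re (Z x) * Im (W x)) + (\<E> x. Im (Z x) * Re (W x))"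
  using integral_Re[OF iZW] integral_Im[OF iZW] int1 by simp_all
 have re: "Re ((\<E> w. Z w * W w) - expectation Z * expectation W) = ?c Re Re - ?c Im Im"
  unfolding minus_complex.simps times_complex.simps EZ EW EZW by (simp add: algebra_simps)
 have im: "Im ((\<E> w. Z w * W w) - expectation Z * expectation W) = ?c Re Im + ?c Im Re"
  unfolding minus_complex.simps times_complex.simps EZ EW EZW by (simp add: algebra_simps)
 have "cmod ((\<E> w. Z w * W w) - expectation Z * expectation W) \<le> \<bar>?c Re Re - ?c Im Im\<bar> + \<bar>?c Re Im + ?c Im Re\<bar>"
  using cmod_le unfolding re[symmetric] im[symmetric] .
 also have "... \<le> 32 * \<phi> h powr (1 / 2)"
  using real[OF mm(1,3) b(1,3)] real[OF mm(2,4) b(2,4)] real[OF mm(1,4) b(1,4)] real[OF mm(2,3) b(2,3)] by linarith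
 finally show ?thesis .
qed

end

context stationary_mixing
begin

definition moment_const :: "nat => real" where
 "moment_const J = ((real J)\<^sup>2 * 2 ^ Suc J * (8 * (\<Sum>h. \<phi> (Suc h) powr (1 / 2)) + 1)) ^ (J div 2)"

lemma moment_const_nonneg: "0 \<le> moment_const J"
 unfolding moment_const_def by (intro zero_le_power mult_nonneg_nonneg add_nonneg_nonneg suminf_nonneg summable_phi) auto

lemma functional_moment:
 fixes g :: "'b => real"
 assumes J: "even J" "2 \<le> J" and g: "g \<in> borel_measurable borel" and e: "(\<E> w. g (\<eta> 1 w)) = 0"
  and i: "integrable P (\<lambda>w. g (\<eta> 1 w) ^ J)" and K: "0 < K" "(\<E> w. g (\<eta> 1 w) ^ J) \<le> K"
 shows "(\<E> w. (\<Sum>j=a+1..a+n. g (\<eta> j w)) ^ J) \<le> moment_const J * real n ^ (J div 2) * K"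
  and "integrable P (\<lambda>w. (\<Sum>j=a+1..a+n. g (\<eta> j w)) ^ J)"
proof -
 have gJ: "(\<lambda>x. g x ^ J) \<in> borel_measurable borel" using g by measurable
 have m: "(\<lambda>w. g (\<eta> j w)) \<in> borel_measurable P" if "1 \<le> j" for j
  by (rule measurable_compose[OF meas_eta[OF that] g])
 have Phi: "(\<Sum>h=1..n. \<phi> h powr (real (J - 1) / real J)) \<le> (\<Sum>h. \<phi> (Suc h) powr (1 / 2))" for n
 proof -
  have "(\<Sum>h=1..n. \<phi> h powr (real (J - 1) / real J)) \<le> (\<Sum>h=1..n. \<phi> h powr (1 / 2))"
  proof (intro sum_mono powr_mono')
   show "1 / 2 \<le> real (J - 1) / real J" using J by (simp add: field_simps of_nat_diff)
  qed (auto simp: phi_nonneg phi_le_1)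
  also have "... = (\<Sum>h<n. \<phi> (Suc h) powr (1 / 2))"
   by (rule sum.reindex_bij_witness[of _ Suc "\<lambda>i. i - 1"]) auto
  also have "... \<le> (\<Sum>h. \<phi> (Suc h) powr (1 / 2))"
   by (rule sum_le_suminf[OF summable_phi]) auto
  finally show ?thesis .
 qed
 have ij: "integrable P (\<lambda>w. g (\<eta> j w) ^ J)" if "1 \<le> j" for j
  using functional_shift(2)[OF gJ that] i by simp
 have "(\<E> w. (\<Sum>j=a+1..a+n. g (\<eta> j w)) ^ J)
  \<le> (real n * ((real J)\<^sup>2 * 2 ^ Suc J * (8 * (\<Sum>h. \<phi> (Suc h) powr (1 / 2)) + 1))) ^ (J div 2) * K"
 proof (rule moment_inequality[OF J _ _ ij K(1) _ Phi])
  fix j :: nat assume j: "1 \<le> j"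
  show "(\<lambda>w. g (\<eta> j w)) \<in> borel_measurable (vsig P \<eta> {j})"
   by (rule measurable_compose[OF measurable_vsig g]) simp
  show "(\<E> w. g (\<eta> j w)) = 0" using functional_shift(1)[OF g j] e by simp
  show "(\<E> w. g (\<eta> j w) ^ J) \<le> K" using functional_shift(1)[OF gJ j] K by simp
 qed
 then show "(\<E> w. (\<Sum>j=a+1..a+n. g (\<eta> j w)) ^ J) \<le> moment_const J * real n ^ (J div 2) * K"
  unfolding moment_const_def by (simp add: power_mult_distrib ac_simps)
 have "integrable P (\<lambda>w. \<bar>\<Sum>j=a+1..a+n. g (\<eta> j w)\<bar> ^ J)"
  by (rule integrable_sum_power) (use m ij J in \<open>auto simp: power_even_abs\<close>)
 then show "integrable P (\<lambda>w. (\<Sum>j=a+1..a+n. g (\<eta> j w)) ^ J)" by (simp add: power_even_abs[OF J(1)])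
qed

lemma centred_functional_moments:
 assumes g: "centred_functional g"
 obtains c where "0 < c"
  "!!a n. integrable P (\<lambda>w. (\<Sum>j=a+1..a+n. g (\<eta> j w))\<^sup>2)" "!!a n. (\<E> w. (\<Sum>j=a+1..a+n. g (\<eta> j w))\<^sup>2) \<le> c * real n"
  "!!a n. integrable P (\<lambda>w. (\<Sum>j=a+1..a+n. g (\<eta> j w)) ^ 4)" "!!a n. (\<E> w. (\<Sum>j=a+1..a+n. g (\<eta> j w)) ^ 4) \<le> c * (real n)\<^sup>2"
proof -
 let ?e = "\<lambda>k::nat. \<bar>(\<E> w. g (\<eta> 1 w) ^ k)\<bar> + 1"
 note gD = centred_functionalD[OF g order_refl]
 have p: "0 < ?e k" "(\<E> w. g (\<eta> 1 w) ^ k) \<le> ?e k" for k by linarith+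
 have ev: "even (2::nat)" "(2::nat) \<le> 2" "even (4::nat)" "(2::nat) \<le> 4" "(2::nat) \<le> 4" "(4::nat) \<le> 4" by auto
 note m2 = functional_moment[OF ev(1,2) gD(1,4) gD(5)[OF ev(5)] p]
 note m4 = functional_moment[OF ev(3,4) gD(1,4) gD(5)[OF ev(6)] p]
 define c where "c = 1 + moment_const 2 * ?e 2 + moment_const 4 * ?e 4"
 have nn: "0 \<le> moment_const 2 * ?e 2" "0 \<le> moment_const 4 * ?e 4" using moment_const_nonneg by simp_all
 show ?thesis
 proof (rule that)
  show "0 < c" using nn unfolding c_def by linarith
  fix a n
  show "integrable P (\<lambda>w. (\<Sum>j=a+1..a+n. g (\<eta> j w))\<^sup>2)" by (rule m2)
  show "integrable P (\<lambda>w. (\<Sum>j=a+1..a+n. g (\<eta> j w)) ^ 4)" by (rule m4)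
  have "(\<E> w. (\<Sum>j=a+1..a+n. g (\<eta> j w))\<^sup>2) \<le> moment_const 2 * ?e 2 * real n" using m2(1)[of a n] by (simp add: ac_simps)
  also have "... \<le> c * real n" unfolding c_def using nn by (intro mult_right_mono) auto
  finally show "(\<E> w. (\<Sum>j=a+1..a+n. g (\<eta> j w))\<^sup>2) \<le> c * real n" .
  have "(\<E> w. (\<Sum>j=a+1..a+n. g (\<eta> j w)) ^ 4) \<le> moment_const 4 * ?e 4 * (real n)\<^sup>2" using m4(1)[of a n] by (simp add: ac_simps)
  also have "... \<le> c * (real n)\<^sup>2" unfolding c_def using nn by (intro mult_right_mono) auto
  finally show "(\<E> w. (\<Sum>j=a+1..a+n. g (\<eta> j w)) ^ 4) \<le> c * (real n)\<^sup>2" .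
 qed
qed

text \<open>Blocks are split off from the right. Removing one block costs one covariance of
  variables of modulus at most 1, and multiplying the remaining error by a characteristic function
  does not enlarge it, so the errors add up linearly in \<open>K\<close>.\<close>

lemma iexp_block_decoupling:
 fixes g :: "'b => real" and u :: real and p q :: nat
 assumes g: "g \<in> borel_measurable borel" and p: "1 \<le> p"
 shows "cmod ((\<E> w. iexp (u * (\<Sum>k<K. \<Sum>j=k*(p+q)+1..k*(p+q)+p. g (\<eta> j w)))) -
   (\<E> w. iexp (u * (\<Sum>j=1..p. g (\<eta> j w)))) ^ K) \<le> real K * (32 * \<phi> (Suc q) powr (1 / 2))"
proof (induction K)
 case (Suc K)
 define X where "X k w = (\<Sum>j=k*(p+q)+1..k*(p+q)+p. g (\<eta> j w))" for k w
 define Z where "Z w = iexp (u * (\<Sum>k<K. X k w))" for w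
 define W where "W w = iexp (u * X K w)" for w
 define f where "f = (\<E> w. iexp (u * (\<Sum>j=1..p. g (\<eta> j w))))"
 have mg: "(\<lambda>w. g (\<eta> j w)) \<in> borel_measurable (vsig P \<eta> {j})" for j
  by (rule measurable_compose[OF measurable_vsig g]) simp
 have m: "X k \<in> borel_measurable (vsig P \<eta> I)" if "{k*(p+q)+1..k*(p+q)+p} \<subseteq> I" for k I
  unfolding X_def by (intro borel_measurable_sum measurable_vsig_mono[OF mg]) (use that in auto)
 have mP[measurable]: "X k \<in> borel_measurable P" for k
  by (rule measurable_eta[OF m[OF order_refl]]) auto
 have EW: "expectation W = f"
 proof -
  have "(\<lambda>x. iexp (u * x)) \<in> borel_measurable borel" by measurable
  from sum_shift[OF g this, of "K*(p+q)" p] show ?thesis unfolding W_def X_def f_def .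
 qed
 have ff: "cmod f \<le> 1" unfolding f_def
 proof (rule cmod_expectation_iexp_le_1)
  show "(\<lambda>w. u * (\<Sum>j=1..p. g (\<eta> j w))) \<in> borel_measurable P"
   using mP[of 0] unfolding X_def by (simp del: One_nat_def)
 qed
 have dec: "cmod ((\<E> w. Z w * W w) - expectation Z * expectation W) \<le> 32 * \<phi> (Suc q) powr (1 / 2)"
 proof (cases "K = 0")
  case True
  then have "Z = (\<lambda>_. 1)" by (simp add: Z_def fun_eq_iff)
  then show ?thesis by (simp add: prob_space)
 next
  case False
  \<comment> \<open>The last index before the gap. The next block starts at K (p + q) + 1 = i + Suc
    q, so a gap of q indices is a mixing distance of q + 1.\<close>
  define i where "i = K*(p+q) - q"
  have iq: "i + Suc q = K * (p+q) + 1" "1 \<le> i"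
  proof -
   have "1 * (p+q) \<le> K * (p+q)" using False by (intro mult_right_mono) auto
   then obtain d where "K * (p+q) = p + q + d" using le_Suc_ex by fastforce
   then show "i + Suc q = K * (p+q) + 1" "1 \<le> i" using p unfolding i_def by simp_all
  qed
  have sub: "k*(p+q) + p \<le> i" if "k < K" for k
  proof -
   have "Suc k * (p+q) \<le> K * (p+q)" using that by (intro mult_right_mono) auto
   then show ?thesis unfolding i_def by simp
  qed
  have mX: "X k \<in> borel_measurable (vsig P \<eta> {1..i})" if "k \<in> {..<K}" for k
   using sub that by (intro m) force
  have mK: "X K \<in> borel_measurable (vsig P \<eta> {i + Suc q..})" using iq by (intro m) auto
  have "(\<lambda>w. \<Sum>k<K. X k w) \<in> borel_measurable (vsig P \<eta> {1..i})"
   using mX by (rule borel_measurable_sum)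
  then have mZ: "Z \<in> borel_measurable (vsig P \<eta> {1..i})" unfolding Z_def by measurable
  have mW: "W \<in> borel_measurable (vsig P \<eta> {i + Suc q..})" using mK unfolding W_def by measurable
  show ?thesis
   by (rule covariance_bound_unit[OF iq(2) _ mZ mW]) (auto simp: Z_def W_def)
 qed
 have IH: "cmod (expectation Z - f ^ K) \<le> real K * (32 * \<phi> (Suc q) powr (1 / 2))"
  using Suc.IH unfolding Z_def X_def f_def .
 have "(\<E> w. Z w * W w) - f ^ Suc K = ((\<E> w. Z w * W w) - expectation Z * expectation W) + (expectation Z - f ^ K) * f"
  by (simp add: EW algebra_simps)
 also have "cmod ... \<le> 32 * \<phi> (Suc q) powr (1 / 2) + real K * (32 * \<phi> (Suc q) powr (1 / 2)) * 1"
  using mult_mono[OF IH ff _ norm_ge_zero] IH norm_ge_zero[of "expectation Z - f ^ K"]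
  by (intro order_trans[OF norm_triangle_ineq] add_mono dec) (simp only: norm_mult)
 also have "(\<lambda>w. Z w * W w) = (\<lambda>w. iexp (u * (\<Sum>k<Suc K. X k w)))"
  unfolding Z_def W_def by (simp add: distrib_left exp_add)
 finally show ?case unfolding X_def f_def by (simp add: algebra_simps)
qed (simp add: prob_space)

text \<open>The number of blocks and the length of the gaps are both r, about n^(1/4). The r
  discarded gaps and the tail have mean size at most (r + 1) sqrt(c r), negligible against sqrt n >=
  r^2; decoupling costs r \<open>\<phi>\<close>(r + 1)^(1/2) up to a constant; and replacing the
  characteristic function of each block costs r times O(r^(-3/2)). All errors thus depend on r
  alone.\<close>

theorem central_limit:
 fixes g :: "'b => real" and s :: real
 assumes g: "centred_functional g"
 shows "(\<lambda>n. (\<E> w. iexp (s * ((\<Sum>j=1..n. g (\<eta> j w)) / sqrt (real n))))) \<longlonglongrightarrow> exp (- (s\<^sup>2 * lrv g / 2))"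
proof -
 note gD = centred_functionalD[OF g]
 obtain c where c: "0 < c"
  and i2: "!!a n. integrable P (\<lambda>w. (\<Sum>j=a+1..a+n. g (\<eta> j w))\<^sup>2)" and e2: "!!a n. (\<E> w. (\<Sum>j=a+1..a+n. g (\<eta> j w))\<^sup>2) \<le> c * real n"
  and i4: "!!a n. integrable P (\<lambda>w. (\<Sum>j=a+1..a+n. g (\<eta> j w)) ^ 4)" and e4: "!!a n. (\<E> w. (\<Sum>j=a+1..a+n. g (\<eta> j w)) ^ 4) \<le> c * (real n)\<^sup>2"
  using centred_functional_moments[OF g] by blast
 define S where "S a n w = (\<Sum>j=a+1..a+n. g (\<eta> j w))" for a n w
 have [measurable]: "S a n \<in> borel_measurable P" for a n
  unfolding S_def by (intro borel_measurable_sum gD(3)) auto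
 have S1: "(\<E> w. \<bar>S a n w\<bar>) \<le> sqrt (c * real n)" "integrable P (\<lambda>w. \<bar>S a n w\<bar>)" for a n
 proof -
  have i: "integrable P (\<lambda>w. (S a n w)\<^sup>2)" unfolding S_def by (rule i2)
  show "integrable P (\<lambda>w. \<bar>S a n w\<bar>)" by (rule expectation_abs_le_sqrt(2)[OF _ i]) simp
  have "(\<E> w. \<bar>S a n w\<bar>) \<le> sqrt ((\<E> w. (S a n w)\<^sup>2))" by (rule expectation_abs_le_sqrt(1)[OF _ i]) simp
  also have "... \<le> sqrt (c * real n)" unfolding S_def using e2[of a n] by simp
  finally show "(\<E> w. \<bar>S a n w\<bar>) \<le> sqrt (c * real n)" .
 qed
 \<comment> \<open>Rounding down guarantees r^4 <= n, hence r^2 <= sqrt n.\<close>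
 define r where "r n = nat \<lfloor>real n powr (1/4)\<rfloor>" for n
 define L where "L n = n div r n" for n
 define p where "p n = L n - r n" for n
 define v where "v n = (\<E> w. (\<Sum>j=1..n. g (\<eta> j w))\<^sup>2)" for n
 define x where "x n = s\<^sup>2 * v (p n) / (2 * real n)" for n
 define err where "err r = \<bar>s\<bar> * ((real r + 1) * sqrt (c * real r)) / (real r)\<^sup>2 + 32 * (real r * \<phi> (Suc r) powr (1 / 2))
   + real r * (c * (\<bar>s\<bar> / sqrt (real r)) ^ 3 + (s\<^sup>2 * c / (2 * real r))\<^sup>2)" for r
 have r_lim: "filterlim r at_top sequentially"
 proof -
  have "filterlim (\<lambda>n. real n powr (1/4)) at_top sequentially" by real_asymp
  then have "filterlim (\<lambda>n. \<lfloor>real n powr (1/4)\<rfloor>) at_top sequentially"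
   by (rule filterlim_compose[OF filterlim_floor_sequentially])
  then show ?thesis unfolding r_def by (rule filterlim_compose[OF filterlim_nat_sequentially])
 qed
 have r4: "real (r n) ^ 4 \<le> real n" for n
 proof -
  have "real (r n) \<le> real n powr (1/4)" unfolding r_def by simp
  then have "real (r n) ^ 4 \<le> (real n powr (1/4)) ^ 4" by (intro power_mono) auto
  also have "... = real n" by (cases "n = 0") (auto simp: powr_power)
  finally show ?thesis .
 qed
 have ev2: "\<forall>\<^sub>F n in sequentially. 2 \<le> r n" using r_lim by (auto simp: filterlim_at_top)
 have L3: "real (r n) ^ 3 - 1 \<le> real (L n)" if "2 \<le> r n" for n
 proof -
  have "n < r n * (L n + 1)" unfolding L_def using that by (simp add: dividend_less_times_div mult.commute)
  then have "real n < real (r n) * (real (L n) + 1)" by (metis of_nat_1 of_nat_add of_nat_less_iff of_nat_mult)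
  with r4[of n] have "real (r n) * real (r n) ^ 3 \<le> real (r n) * (real (L n) + 1)" by (simp add: power4_eq_xxxx power3_eq_cube ac_simps)
  then show ?thesis using that by simp
 qed
 have rL: "r n + 1 \<le> L n" if "2 \<le> r n" for n
 proof -
  have "real (r n) * 4 \<le> real (r n) * (real (r n))\<^sup>2" using that power_mono[of 2 "real (r n)" 2] by (intro mult_left_mono) auto
  also have "... = real (r n) ^ 3" by (simp add: power3_eq_cube power2_eq_square)
  finally have "real (r n) + 1 \<le> real (L n)" using L3[OF that] that by linarith
  then show ?thesis by linarith
 qed
 have main: "cmod ((\<E> w. iexp (s * ((\<Sum>j=1..n. g (\<eta> j w)) / sqrt (real n)))) - exp (- (real (r n) * x n))) \<le> err (r n)"
  if r2: "2 \<le> r n" for n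
 proof -
  let ?r = "r n" and ?L = "L n" and ?p = "p n"
  have Lp: "?L = ?p + ?r" and p1: "1 \<le> ?p" using rL[OF r2] unfolding p_def by auto
  have rLn: "?r * ?L \<le> n" unfolding L_def by simp
  have rest: "n - ?r * ?L < ?r" unfolding L_def using r2 by (simp add: minus_mult_div_eq_mod)
  have n0: "0 < real n" using rLn p1 r2 Lp by (cases n) auto
  define u where "u = s / sqrt (real n)"
  define A where "A w = (\<Sum>k<?r. S (k*?L) ?p w)" for w
  define B where "B w = (\<Sum>k<?r. S (k*?L + ?p) ?r w) + S (?r*?L) (n - ?r*?L) w" for w
  have Sadd: "S a (m + m') w = S a m w + S (a + m) m' w" for a m m' w
   unfolding S_def using sum.ub_add_nat[of "a+1" "a+m" "\<lambda>j. g (\<eta> j w)" m'] by (simp add: add.assoc)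
  have blocks: "S 0 (K * ?L) w = (\<Sum>k<K. S (k*?L) ?p w) + (\<Sum>k<K. S (k*?L + ?p) ?r w)" for K w
  proof (induction K)
   case 0
   then show ?case by (simp add: S_def)
  next
   case (Suc K)
   have "S 0 (Suc K * ?L) w = S 0 (K * ?L + ?L) w" by (simp add: add.commute)
   also have "... = S 0 (K * ?L) w + S (K * ?L) (?p + ?r) w" unfolding Sadd Lp[symmetric] by simp
   also have "... = S 0 (K * ?L) w + (S (K * ?L) ?p w + S (K * ?L + ?p) ?r w)" unfolding Sadd ..
   finally show ?case using Suc.IH by simp
  qed
  have split: "S 0 n w = A w + B w" for w
   using Sadd[of 0 "?r * ?L" "n - ?r * ?L" w] blocks[of ?r w] rLn unfolding A_def B_def by simp
  have [measurable]: "A \<in> borel_measurable P" "B \<in> borel_measurable P" unfolding A_def B_def by measurable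
  have B1: "(\<E> w. \<bar>B w\<bar>) \<le> (real ?r + 1) * sqrt (c * real ?r)" and iB: "integrable P (\<lambda>w. \<bar>B w\<bar>)"
  proof -
   have i: "integrable P (\<lambda>w. (\<Sum>k<?r. \<bar>S (k*?L + ?p) ?r w\<bar>) + \<bar>S (?r*?L) (n - ?r*?L) w\<bar>)" using S1 by auto
   have le: "\<bar>B w\<bar> \<le> (\<Sum>k<?r. \<bar>S (k*?L + ?p) ?r w\<bar>) + \<bar>S (?r*?L) (n - ?r*?L) w\<bar>" for w
    unfolding B_def by (rule order_trans[OF abs_triangle_ineq]) (simp add: sum_abs)
   show iB: "integrable P (\<lambda>w. \<bar>B w\<bar>)"
    by (rule integrable_bound[OF i]) (auto intro!: AE_I2 le)
   have "(\<E> w. \<bar>B w\<bar>) \<le> (\<E> w. (\<Sum>k<?r. \<bar>S (k*?L + ?p) ?r w\<bar>) + \<bar>S (?r*?L) (n - ?r*?L) w\<bar>)"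
    using iB i le by (intro integral_mono) auto
   also have "... = (\<Sum>k<?r. (\<E> w. \<bar>S (k*?L + ?p) ?r w\<bar>)) + (\<E> w. \<bar>S (?r*?L) (n - ?r*?L) w\<bar>)"
    using S1(2) by (simp add: integral_sum)
   also have "... \<le> (\<Sum>k<?r. sqrt (c * real ?r)) + sqrt (c * real (n - ?r*?L))"
    by (intro add_mono sum_mono S1(1))
   also have "... \<le> (\<Sum>k<?r. sqrt (c * real ?r)) + sqrt (c * real ?r)"
    using rest c by (intro add_mono order_refl real_sqrt_le_mono mult_left_mono) auto
   finally show "(\<E> w. \<bar>B w\<bar>) \<le> (real ?r + 1) * sqrt (c * real ?r)" by (simp add: algebra_simps)
  qed
  have 1: "cmod ((\<E> w. iexp (u * S 0 n w)) - (\<E> w. iexp (u * A w))) \<le> \<bar>s\<bar> * ((real ?r + 1) * sqrt (c * real ?r)) / (real ?r)\<^sup>2"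
  proof -
   have eq: "(\<lambda>w. \<bar>u * S 0 n w - u * A w\<bar>) = (\<lambda>w. \<bar>u\<bar> * \<bar>B w\<bar>)"
    unfolding split by (simp add: algebra_simps abs_mult)
   have "cmod ((\<E> w. iexp (u * S 0 n w)) - (\<E> w. iexp (u * A w))) \<le> (\<E> w. \<bar>u * S 0 n w - u * A w\<bar>)"
    by (rule expectation_iexp_diff_le) (use iB in \<open>auto simp: eq\<close>)
   also have "... = \<bar>u\<bar> * (\<E> w. \<bar>B w\<bar>)" unfolding eq by simp
   also have "... \<le> (\<bar>s\<bar> / (real ?r)\<^sup>2) * ((real ?r + 1) * sqrt (c * real ?r))"
   proof (intro mult_mono B1)
    have "(real ?r)\<^sup>2 \<le> sqrt (real n)" using r4[of n] by (intro real_le_rsqrt) simp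
    then show "\<bar>u\<bar> \<le> \<bar>s\<bar> / (real ?r)\<^sup>2" unfolding u_def using r2 by (simp add: abs_divide frac_le)
   qed auto
   finally show ?thesis by (simp add: ac_simps)
  qed
  define f where "f = (\<E> w. iexp (u * (\<Sum>j=1..?p. g (\<eta> j w))))"
  have 2: "cmod ((\<E> w. iexp (u * A w)) - f ^ ?r) \<le> 32 * (real ?r * \<phi> (Suc ?r) powr (1 / 2))"
   using iexp_block_decoupling[OF gD(1)[OF order_refl] p1, of u ?r ?r] unfolding A_def S_def f_def Lp by (simp add: ac_simps)
  have p_n: "real ?p / real n \<le> 1 / real ?r"
  proof -
   have "real ?p * real ?r \<le> real n" using rLn unfolding Lp
    by (metis add.commute add_leE distrib_left mult.commute of_nat_le_iff of_nat_mult)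
   then show ?thesis using n0 r2 by (simp add: field_simps)
  qed
  have ua: "(\<bar>u * sqrt (real ?p)\<bar>) \<le> \<bar>s\<bar> / sqrt (real ?r)"
  proof -
   have "\<bar>u * sqrt (real ?p)\<bar> = \<bar>s\<bar> * sqrt (real ?p / real n)" unfolding u_def by (simp add: abs_mult real_sqrt_divide)
   also have "... \<le> \<bar>s\<bar> * sqrt (1 / real ?r)" by (intro mult_left_mono real_sqrt_le_mono p_n) auto
   finally show ?thesis by (simp add: real_sqrt_divide)
  qed
  have xeq: "x n = u\<^sup>2 * v ?p / 2" unfolding x_def u_def using n0 by (simp add: power_divide)
  have v0: "0 \<le> v ?p" unfolding v_def by (intro integral_nonneg) simp
  have x0: "0 \<le> x n" unfolding xeq using v0 by simp
  have xle: "x n \<le> s\<^sup>2 * c / (2 * real ?r)"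
  proof -
   have "x n \<le> s\<^sup>2 * (c * real ?p) / (2 * real n)" unfolding x_def v_def using e2[of 0 ?p] n0
    by (intro divide_right_mono mult_left_mono) auto
   also have "... = s\<^sup>2 * c / 2 * (real ?p / real n)" by simp
   also have "... \<le> s\<^sup>2 * c / 2 * (1 / real ?r)" using c p_n by (intro mult_left_mono) auto
   finally show ?thesis by simp
  qed
  have 3: "cmod (f - (1 - x n)) \<le> c * (\<bar>s\<bar> / sqrt (real ?r)) ^ 3"
  proof -
   have a: "0 < sqrt (real ?p)" using p1 by simp
   have mm: "(\<lambda>w. \<Sum>j=1..?p. g (\<eta> j w)) \<in> borel_measurable P" by (intro borel_measurable_sum gD(3)) auto
   have "cmod (f - (1 - u\<^sup>2 * (\<E> w. (\<Sum>j=1..?p. g (\<eta> j w))\<^sup>2) / 2)) \<le> c * \<bar>u * sqrt (real ?p)\<bar> ^ 3"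
    unfolding f_def
   proof (rule iexp_quadratic_approx[OF mm _ _ _ _ a])
    show "integrable P (\<lambda>w. (\<Sum>j=1..?p. g (\<eta> j w)) ^ 4)" using i4[of 0 ?p] by simp
    show "integrable P (\<lambda>w. (\<Sum>j=1..?p. g (\<eta> j w))\<^sup>2)" using i2[of 0 ?p] by simp
    show "(\<E> w. \<Sum>j=1..?p. g (\<eta> j w)) = 0"
     using gD(4,6) by (subst integral_sum) auto
    show "integrable P (\<lambda>w. \<Sum>j=1..?p. g (\<eta> j w))" using gD(6) by (intro integrable_sum) auto
    show "(\<E> w. (\<Sum>j=1..?p. g (\<eta> j w))\<^sup>2) \<le> c * (sqrt (real ?p))\<^sup>2" using e2[of 0 ?p] by simp
    have "sqrt (real ?p) ^ 4 = (real ?p)\<^sup>2" by (simp add: power4_eq_xxxx power2_eq_square)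
    then show "(\<E> w. (\<Sum>j=1..?p. g (\<eta> j w)) ^ 4) \<le> c * sqrt (real ?p) ^ 4" using e4[of 0 ?p] by simp
   qed
   also have "... \<le> c * (\<bar>s\<bar> / sqrt (real ?r)) ^ 3" using c ua by (intro mult_left_mono power_mono) auto
   finally show ?thesis unfolding xeq v_def by simp
  qed
  have f1: "cmod f \<le> 1" unfolding f_def
   by (intro cmod_expectation_iexp_le_1 bm_intros gD(3)) auto
  have ex: "\<bar>exp (- y) - (1 - y)\<bar> \<le> y\<^sup>2" if "0 \<le> y" for y :: real
  proof -
   have l: "1 - y \<le> exp (- y)" using exp_ge_add_one_self[of "-y"] by simp
   have "exp (- y) \<le> 1 - y + y\<^sup>2"
   proof -
    have "exp (-y) * (1 + y) \<le> exp (-y) * exp y" by (intro mult_left_mono exp_ge_add_one_self) auto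
    then have "exp (-y) * (1 + y) \<le> 1" by (simp flip: exp_add)
    also have "1 \<le> (1 - y + y\<^sup>2) * (1 + y)" using that by (simp add: algebra_simps power2_eq_square)
    finally show ?thesis using that by simp
   qed
   with l show ?thesis by simp
  qed
  have 4: "cmod (f - exp (- x n)) \<le> c * (\<bar>s\<bar> / sqrt (real ?r)) ^ 3 + (s\<^sup>2 * c / (2 * real ?r))\<^sup>2"
  proof -
   have "cmod ((1 - x n) - exp (- x n)) = \<bar>exp (- x n) - (1 - x n)\<bar>"
    by (metis abs_minus_commute norm_of_real of_real_1 of_real_diff)
   also have "... \<le> (x n)\<^sup>2" by (rule ex[OF x0])
   also have "... \<le> (s\<^sup>2 * c / (2 * real ?r))\<^sup>2" using x0 xle by (intro power_mono) auto
   finally have "cmod ((1 - x n) - exp (- x n)) \<le> (s\<^sup>2 * c / (2 * real ?r))\<^sup>2" .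
   with 3 show ?thesis using norm_triangle_le[of "f - (1 - x n)" "(1 - x n) - exp (- x n)"] by simp
  qed
  have 5: "cmod (f ^ ?r - exp (- (real ?r * x n))) \<le> real ?r * (c * (\<bar>s\<bar> / sqrt (real ?r)) ^ 3 + (s\<^sup>2 * c / (2 * real ?r))\<^sup>2)"
  proof -
   have "complex_of_real (exp (- (real ?r * x n))) = complex_of_real (exp (- x n)) ^ ?r"
    by (metis exp_of_nat_mult mult_minus_right of_real_power)
   moreover have "cmod (f ^ ?r - complex_of_real (exp (- x n)) ^ ?r) \<le> real ?r * cmod (f - exp (- x n))"
    using x0 f1 by (intro norm_power_diff) auto
   ultimately show ?thesis using 4 mult_left_mono[OF 4, of "real ?r"] by simp
  qed
  have "(\<E> w. iexp (s * ((\<Sum>j=1..n. g (\<eta> j w)) / sqrt (real n)))) = (\<E> w. iexp (u * S 0 n w))"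
   unfolding u_def S_def by simp
  then show ?thesis unfolding err_def using norm_triangle_le[OF add_mono[OF norm_triangle_le[OF add_mono[OF 1 2]] 5]] by simp
 qed
 have err: "err \<longlonglongrightarrow> 0"
 proof -
  have e1: "(\<lambda>r. real r * \<phi> (Suc r) powr (1 / 2)) \<longlonglongrightarrow> 0"
   by (rule Lim_null_comparison[OF _ LIMSEQ_Suc[OF phi_decay]])
    (auto intro!: always_eventually mult_right_mono simp: abs_mult)
  have e2: "(\<lambda>r. \<bar>s\<bar> * ((real r + 1) * sqrt (c * real r)) / (real r)\<^sup>2) \<longlonglongrightarrow> 0"
   using c by real_asymp
  have e3: "(\<lambda>r. real r * (c * (\<bar>s\<bar> / sqrt (real r)) ^ 3 + (s\<^sup>2 * c / (2 * real r))\<^sup>2)) \<longlonglongrightarrow> 0"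
  proof -
   have "(\<lambda>r. real r * (1 / sqrt (real r)) ^ 3) \<longlonglongrightarrow> 0" "(\<lambda>r. real r * (1 / (2 * real r))\<^sup>2) \<longlonglongrightarrow> 0"
    by real_asymp+
   from tendsto_add[OF tendsto_mult_left[OF this(1), of "c * \<bar>s\<bar> ^ 3"] tendsto_mult_left[OF this(2), of "(s\<^sup>2 * c)\<^sup>2"]]
   show ?thesis by (simp add: power_divide power_mult_distrib distrib_left ac_simps)
  qed
  show ?thesis
   using tendsto_add[OF tendsto_add[OF e2 tendsto_mult_left[OF e1, of 32]] e3] unfolding err_def by simp
 qed
 \<comment> \<open>The exponent r x_n is s^2 / 2 times r p / n times v(p) / p. The blocks fill n
   asymptotically, and the variance limit applies along p.\<close>
 have xlim: "(\<lambda>n. real (r n) * x n) \<longlonglongrightarrow> s\<^sup>2 * lrv g / 2"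
 proof -
  have plim: "filterlim p at_top sequentially"
  proof -
   have "filterlim (\<lambda>r. real r ^ 3 - 1 - real r) at_top sequentially" by real_asymp
   then have "filterlim (\<lambda>n. real (r n) ^ 3 - 1 - real (r n)) at_top sequentially"
    by (rule filterlim_compose[OF _ r_lim])
   then have "filterlim (\<lambda>n. real (p n)) at_top sequentially"
   proof (rule filterlim_at_top_mono)
    show "\<forall>\<^sub>F n in sequentially. real (r n) ^ 3 - 1 - real (r n) \<le> real (p n)"
     using ev2
    proof eventually_elim
     case (elim n)
     then show ?case using L3[OF elim] rL[OF elim] unfolding p_def by (simp add: of_nat_diff)
    qed
   qed
   then show ?thesis by (simp add: filterlim_sequentially_iff_filterlim_real)
  qed
  have 1: "(\<lambda>n. v (p n) / real (p n)) \<longlonglongrightarrow> lrv g"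
   unfolding v_def by (rule filterlim_compose[OF variance_limit[OF g] plim])
  have 2: "(\<lambda>n. real (r n) * real (p n) / real n) \<longlonglongrightarrow> 1"
  proof (rule tendsto_sandwich)
   have "(\<lambda>r. 1 - (real r + (real r)\<^sup>2) / real r ^ 4) \<longlonglongrightarrow> 1" by real_asymp
   then show "(\<lambda>n. 1 - (real (r n) + (real (r n))\<^sup>2) / real (r n) ^ 4) \<longlonglongrightarrow> 1"
    by (rule filterlim_compose[OF _ r_lim])
   show "\<forall>\<^sub>F n in sequentially. 1 - (real (r n) + (real (r n))\<^sup>2) / real (r n) ^ 4 \<le> real (r n) * real (p n) / real n"
    using ev2
   proof eventually_elim
    case (elim n)
    have "n = r n * L n + n mod r n" unfolding L_def by simp
    also have "L n = p n + r n" using rL[OF elim] unfolding p_def by simp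
    finally have "real n = real (r n) * real (p n) + (real (r n))\<^sup>2 + real (n mod r n)"
     by (metis distrib_left of_nat_add of_nat_mult power2_eq_square)
    moreover have "real (n mod r n) \<le> real (r n)" using elim by simp
    ultimately have "real n - (real (r n) + (real (r n))\<^sup>2) \<le> real (r n) * real (p n)" by linarith
    moreover have pos: "0 < real (r n) ^ 4" using elim by simp
    ultimately have n0: "0 < real n" and "(real n - (real (r n) + (real (r n))\<^sup>2)) / real n \<le> real (r n) * real (p n) / real n"
     using order_less_le_trans[OF pos r4[of n]] by (auto intro!: divide_right_mono)
    then have "1 - (real (r n) + (real (r n))\<^sup>2) / real n \<le> real (r n) * real (p n) / real n"
     by (simp add: diff_divide_distrib)
    moreover have "(real (r n) + (real (r n))\<^sup>2) / real n \<le> (real (r n) + (real (r n))\<^sup>2) / real (r n) ^ 4"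
     using r4[of n] mult_pos_pos[OF n0 pos] by (intro divide_left_mono) auto
    ultimately show ?case by linarith
   qed
   show "\<forall>\<^sub>F n in sequentially. real (r n) * real (p n) / real n \<le> 1"
   proof (intro always_eventually allI)
    fix n
    have "r n * p n \<le> r n * L n" unfolding p_def by simp
    also have "... \<le> n" unfolding L_def by simp
    finally have "real (r n) * real (p n) \<le> real n" by (metis of_nat_le_iff of_nat_mult)
    then show "real (r n) * real (p n) / real n \<le> 1" by (cases "n = 0") auto
   qed
  qed simp
  have "(\<lambda>n. s\<^sup>2 / 2 * ((real (r n) * real (p n) / real n) * (v (p n) / real (p n)))) \<longlonglongrightarrow> s\<^sup>2 / 2 * (1 * lrv g)"
   by (intro tendsto_intros 1 2)
  moreover have "\<forall>\<^sub>F n in sequentially. s\<^sup>2 / 2 * ((real (r n) * real (p n) / real n) * (v (p n) / real (p n))) = real (r n) * x n"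
   using ev2
  proof eventually_elim
   case (elim n)
   then show ?case using rL[OF elim] unfolding x_def p_def by simp
  qed
  ultimately show ?thesis by (simp add: tendsto_cong)
 qed
 have "(\<lambda>n. complex_of_real (exp (- (real (r n) * x n)))) \<longlonglongrightarrow> complex_of_real (exp (- (s\<^sup>2 * lrv g / 2)))"
  by (intro tendsto_intros xlim)
 moreover have "(\<lambda>n. (\<E> w. iexp (s * ((\<Sum>j=1..n. g (\<eta> j w)) / sqrt (real n)))) - complex_of_real (exp (- (real (r n) * x n)))) \<longlonglongrightarrow> 0"
 proof (rule Lim_null_comparison)
  show "\<forall>\<^sub>F n in sequentially. cmod ((\<E> w. iexp (s * ((\<Sum>j=1..n. g (\<eta> j w)) / sqrt (real n)))) - complex_of_real (exp (- (real (r n) * x n)))) \<le> err (r n)"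
   using ev2 by eventually_elim (rule main)
  show "(\<lambda>n. err (r n)) \<longlonglongrightarrow> 0" by (rule filterlim_compose[OF err r_lim])
 qed
 ultimately show ?thesis using tendsto_add by fastforce
qed

section \<open>Averages of squared overlapping block sums\<close>

lemma sum_squares_covariance_bound:
 fixes X :: "nat => 'a => real" and \<psi> :: "nat => real"
 assumes m: "!!k. k \<in> {1..N} ==> X k \<in> borel_measurable P"
  and i: "!!k. k \<in> {1..N} ==> integrable P (\<lambda>w. (X k w)\<^sup>2)"
  and e: "!!k. k \<in> {1..N} ==> expectation (X k) = \<mu>"
  and cov: "!!k d. 1 \<le> k ==> k + d \<le> N ==> \<bar>(\<E> w. X k w * X (k + d) w) - \<mu>\<^sup>2\<bar> \<le> \<psi> d"
  and psi: "!!d. 0 \<le> \<psi> d"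
 shows "(\<E> w. (\<Sum>k=1..N. X k w - \<mu>)\<^sup>2) \<le> 2 * real N * (\<Sum>d<N. \<psi> d)"
  and "integrable P (\<lambda>w. (\<Sum>k=1..N. X k w - \<mu>)\<^sup>2)"
proof -
 have i1: "integrable P (X k)" if "k \<in> {1..N}" for k
  by (rule square_integrable_imp_integrable) (use m i that in auto)
 have iXY: "integrable P (\<lambda>w. X k w * X k' w)" if k: "k \<in> {1..N}" "k' \<in> {1..N}" for k k'
 proof (rule integrable_le[of "\<lambda>w. (X k w)\<^sup>2 + (X k' w)\<^sup>2"])
  show "integrable P (\<lambda>w. (X k w)\<^sup>2 + (X k' w)\<^sup>2)" using i k by auto
  show "(\<lambda>w. X k w * X k' w) \<in> borel_measurable P" using m k by auto
  have "2 * (\<bar>x\<bar> * \<bar>y\<bar>) \<le> x\<^sup>2 + y\<^sup>2" for x y :: real using sum_squares_bound[of "\<bar>x\<bar>" "\<bar>y\<bar>"] by simp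
  then show "\<bar>X k w * X k' w\<bar> \<le> (X k w)\<^sup>2 + (X k' w)\<^sup>2" for w
   unfolding abs_mult by (smt (verit) mult_nonneg_nonneg abs_ge_zero)
 qed
 have prod: "(\<E> w. (X k w - \<mu>) * (X k' w - \<mu>)) = (\<E> w. X k w * X k' w) - \<mu>\<^sup>2"
  "integrable P (\<lambda>w. (X k w - \<mu>) * (X k' w - \<mu>))" if k: "k \<in> {1..N}" "k' \<in> {1..N}" for k k'
 proof -
  have eq: "(\<lambda>w. (X k w - \<mu>) * (X k' w - \<mu>)) = (\<lambda>w. X k w * X k' w - \<mu> * X k w - \<mu> * X k' w + \<mu>\<^sup>2)"
   by (simp add: fun_eq_iff algebra_simps power2_eq_square)
  show "integrable P (\<lambda>w. (X k w - \<mu>) * (X k' w - \<mu>))" unfolding eq using iXY[OF k] i1 k by auto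
  show "(\<E> w. (X k w - \<mu>) * (X k' w - \<mu>)) = (\<E> w. X k w * X k' w) - \<mu>\<^sup>2"
   unfolding eq using iXY[OF k] i1 k e by (simp add: prob_space power2_eq_square)
 qed
 have sq: "(\<lambda>w. (\<Sum>k=1..N. X k w - \<mu>)\<^sup>2) = (\<lambda>w. \<Sum>k=1..N. \<Sum>k'=1..N. (X k w - \<mu>) * (X k' w - \<mu>))"
  unfolding power2_eq_square sum_product ..
 show "integrable P (\<lambda>w. (\<Sum>k=1..N. X k w - \<mu>)\<^sup>2)"
  unfolding sq by (intro integrable_sum prod)
 have "(\<E> w. (\<Sum>k=1..N. X k w - \<mu>)\<^sup>2) = (\<Sum>k=1..N. \<Sum>k'=1..N. (\<E> w. X k w * X k' w) - \<mu>\<^sup>2)"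
  unfolding sq by (subst integral_sum, (intro integrable_sum prod; assumption))
   (intro sum.cong refl, subst integral_sum, auto intro!: sum.cong simp: prod)
 also have "... \<le> (\<Sum>k=1..N. 2 * (\<Sum>d<N. \<psi> d))"
 proof (intro sum_mono)
  fix k assume k: "k \<in> {1..N}"
  have b: "(\<E> w. X k w * X k' w) - \<mu>\<^sup>2 \<le> \<psi> (if k \<le> k' then k' - k else k - k')" if k': "k' \<in> {1..N}" for k'
  proof (cases "k \<le> k'")
   case True
   then show ?thesis using cov[of k "k' - k"] k k' by auto
  next
   case False
   then show ?thesis using cov[of k' "k - k'"] k k' by (auto simp: mult.commute)
  qed
  have "(\<Sum>k'=1..N. (\<E> w. X k w * X k' w) - \<mu>\<^sup>2) \<le> (\<Sum>k'=1..N. \<psi> (if k \<le> k' then k' - k else k - k'))"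
   by (intro sum_mono b)
  also have "... = (\<Sum>k'\<in>{1..<k} \<union> {k..N}. \<psi> (if k \<le> k' then k' - k else k - k'))"
   using k by (intro sum.cong) auto
  also have "(\<Sum>k'\<in>{1..<k} \<union> {k..N}. \<psi> (if k \<le> k' then k' - k else k - k')) = (\<Sum>k'\<in>{1..<k}. \<psi> (k - k')) + (\<Sum>k'\<in>{k..N}. \<psi> (k' - k))"
   by (subst sum.union_disjoint) (auto intro!: arg_cong2[of _ _ _ _ "(+)"] sum.cong)
  also have "(\<Sum>k'\<in>{1..<k}. \<psi> (k - k')) = (\<Sum>d\<in>{1..<k}. \<psi> d)"
   by (rule sum.reindex_bij_witness[of _ "\<lambda>d. k - d" "\<lambda>d. k - d"]) auto
  also have "... \<le> (\<Sum>d<N. \<psi> d)" using k psi by (intro sum_mono2) auto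
  also have "(\<Sum>k'\<in>{k..N}. \<psi> (k' - k)) = (\<Sum>d\<in>{0..<Suc N - k}. \<psi> d)"
   by (rule sum.reindex_bij_witness[of _ "\<lambda>d. d + k" "\<lambda>k'. k' - k"]) auto
  also have "... \<le> (\<Sum>d<N. \<psi> d)" using k psi by (intro sum_mono2) auto
  finally show "(\<Sum>k'=1..N. (\<E> w. X k w * X k' w) - \<mu>\<^sup>2) \<le> 2 * (\<Sum>d<N. \<psi> d)" by simp
 qed
 finally show "(\<E> w. (\<Sum>k=1..N. X k w - \<mu>)\<^sup>2) \<le> 2 * real N * (\<Sum>d<N. \<psi> d)" by simp
qed

text \<open>The mean of a squared block sum over l is the normalised variance of a partial sum and
  tends to \<open>lrv g\<close>. For the fluctuation, blocks at a lag below l overlap and are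
  bounded by fourth moments, while for larger lags mixing applies. The variance of the average is
  then of order l / m, which is why blocks must be short compared with the sample.\<close>

theorem block_variance_limit:
 fixes g :: "'b => real" and l :: "nat => nat"
 assumes g: "centred_functional g"
  and l: "filterlim l at_top sequentially" and lm: "(\<lambda>m. real (l m) / real m) \<longlonglongrightarrow> 0"
 shows "(\<lambda>m. (\<E> w. \<bar>(\<Sum>k=1..m + 1 - l m. (\<Sum>j=k..k + l m - 1. g (\<eta> j w))\<^sup>2 / real (l m)) / real m - lrv g\<bar>)) \<longlonglongrightarrow> 0"
proof -
 note gD = centred_functionalD[OF g]
 obtain c where c: "0 < c"
  and i2: "!!a n. integrable P (\<lambda>w. (\<Sum>j=a+1..a+n. g (\<eta> j w))\<^sup>2)" and e2: "!!a n. (\<E> w. (\<Sum>j=a+1..a+n. g (\<eta> j w))\<^sup>2) \<le> c * real n"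
  and i4: "!!a n. integrable P (\<lambda>w. (\<Sum>j=a+1..a+n. g (\<eta> j w)) ^ 4)" and e4: "!!a n. (\<E> w. (\<Sum>j=a+1..a+n. g (\<eta> j w)) ^ 4) \<le> c * (real n)\<^sup>2"
  using centred_functional_moments[OF g] by blast
 define \<Phi> where "\<Phi> = (\<Sum>h. \<phi> (Suc h) powr (1 / 2))"
 have Phi0: "0 \<le> \<Phi>" unfolding \<Phi>_def by (intro suminf_nonneg summable_phi) auto
 define v where "v n = (\<E> w. (\<Sum>j=1..n. g (\<eta> j w))\<^sup>2)" for n
 have v0: "0 \<le> v n" for n unfolding v_def by (intro integral_nonneg) simp
 have vc: "v n \<le> c * real n" for n using e2[of 0 n] unfolding v_def by simp
 have main: "(\<E> w. \<bar>(\<Sum>k=1..m + 1 - l m. (\<Sum>j=k..k + l m - 1. g (\<eta> j w))\<^sup>2 / real (l m)) / real m - lrv g\<bar>)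
   \<le> sqrt (16 * c * ((real (l m) + \<Phi>) / real m)) + \<bar>real (m + 1 - l m) / real m * (v (l m) / real (l m)) - lrv g\<bar>"
  if lm: "1 \<le> l m" "l m \<le> m" for m
 proof -
  define b where "b = l m"
  define N where "N = m + 1 - b"
  have b: "1 \<le> b" "b \<le> m" "N \<le> m" "1 \<le> N" using lm unfolding b_def N_def by auto
  define U where "U k w = (\<Sum>j=k..k + b - 1. g (\<eta> j w))" for k w
  have Ueq: "U k w = (\<Sum>j=(k-1)+1..(k-1)+b. g (\<eta> j w))" if "1 \<le> k" for k w
   unfolding U_def using that b by (intro sum.cong) auto
  have mg: "(\<lambda>w. g (\<eta> j w)) \<in> borel_measurable (vsig P \<eta> {j})" for j
   by (rule measurable_compose[OF measurable_vsig gD(1)[OF order_refl]]) simp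
  have mU: "U k \<in> borel_measurable (vsig P \<eta> I)" if "{k..k+b-1} \<subseteq> I" for k I
   unfolding U_def by (intro borel_measurable_sum measurable_vsig_mono[OF mg]) (use that in auto)
  have mP: "U k \<in> borel_measurable P" if "1 \<le> k" for k
   by (rule measurable_eta[OF mU[OF order_refl]]) (use that in auto)
  have iU2: "integrable P (\<lambda>w. (U k w)\<^sup>2)" if "1 \<le> k" for k using i2[of "k-1" b] Ueq[OF that] by simp
  have iU4: "integrable P (\<lambda>w. ((U k w)\<^sup>2)\<^sup>2)" if "1 \<le> k" for k using i4[of "k-1" b] Ueq[OF that] by simp
  have eU4: "(\<E> w. ((U k w)\<^sup>2)\<^sup>2) \<le> c * (real b)\<^sup>2" if "1 \<le> k" for k using e4[of "k-1" b] Ueq[OF that] by simp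
  have eU2: "(\<E> w. (U k w)\<^sup>2) = v b" if "1 \<le> k" for k
   using sum_shift[OF gD(1)[OF order_refl], of "\<lambda>x. x\<^sup>2" "k-1" b] Ueq[OF that] by (simp add: v_def)
  \<comment> \<open>Covariance bound at lag d: blocks of length b at lag d >= b are at mixing
    distance d + 1 - b. The factor (real b)^2 is the order of the fourth moment of a block
    sum.\<close>
  define \<psi> where "\<psi> d = 8 * (c * (real b)\<^sup>2) * (if d < b then 1 else \<phi> (d + 1 - b) powr (1/2))" for d
  have psi0: "0 \<le> \<psi> d" for d unfolding \<psi>_def using c by simp
  have cov: "\<bar>(\<E> w. (U k w)\<^sup>2 * (U (k + d) w)\<^sup>2) - (v b)\<^sup>2\<bar> \<le> \<psi> d" if k: "1 \<le> k" for k d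
  proof (cases "d < b")
   case True
   let ?E = "(\<E> w. (U k w)\<^sup>2 * (U (k + d) w)\<^sup>2)"
   have kd: "1 \<le> k + d" using k by simp
   have am: "(U k w)\<^sup>2 * (U (k + d) w)\<^sup>2 \<le> (((U k w)\<^sup>2)\<^sup>2 + ((U (k + d) w)\<^sup>2)\<^sup>2) / 2" for w
    using sum_squares_bound[of "(U k w)\<^sup>2" "(U (k + d) w)\<^sup>2"] by simp
   have iE: "integrable P (\<lambda>w. (((U k w)\<^sup>2)\<^sup>2 + ((U (k + d) w)\<^sup>2)\<^sup>2) / 2)" using iU4[OF k] iU4[OF kd] by simp
   have "?E \<le> (\<E> w. (((U k w)\<^sup>2)\<^sup>2 + ((U (k + d) w)\<^sup>2)\<^sup>2) / 2)"
    by (intro integral_mono_AE' iE AE_I2 am) auto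
   also have "... \<le> c * (real b)\<^sup>2" using iU4[OF k] iU4[OF kd] eU4[OF k] eU4[OF kd] by simp
   finally have 1: "?E \<le> c * (real b)\<^sup>2" .
   have 2: "0 \<le> ?E" by (intro integral_nonneg) simp
   have "0 \<le> variance (\<lambda>w. (U k w)\<^sup>2)" by (rule variance_positive)
   also have "... = (\<E> w. ((U k w)\<^sup>2)\<^sup>2) - (v b)\<^sup>2"
    by (subst variance_eq[OF iU2[OF k] iU4[OF k]]) (simp only: eU2[OF k])
   finally have 3: "(v b)\<^sup>2 \<le> c * (real b)\<^sup>2" using eU4[OF k] by linarith
   have "\<bar>?E - (v b)\<^sup>2\<bar> \<le> c * (real b)\<^sup>2" using 1 2 3 zero_le_power2[of "v b"] by linarith
   also have "... \<le> 8 * (c * (real b)\<^sup>2)" using c by simp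
   finally show ?thesis using True by (simp add: \<psi>_def)
  next
   case False
   define i h where "i = k + b - 1" and "h = d + 1 - b"
   have ih: "1 \<le> i" "1 \<le> h" "i + h = k + d" using False k b unfolding i_def h_def by auto
   have kd: "1 \<le> k + d" using k by simp
   have Z: "(\<lambda>w. (U k w)\<^sup>2) \<in> borel_measurable (vsig P \<eta> {1..i})"
    using k unfolding i_def by (intro borel_measurable_power mU) auto
   have W: "(\<lambda>w. (U (k + d) w)\<^sup>2) \<in> borel_measurable (vsig P \<eta> {i + h..})"
    unfolding ih by (intro borel_measurable_power mU) auto
   have Y: "(\<lambda>w. (U k w)\<^sup>2) \<in> borel_measurable P" by (intro borel_measurable_power mP k)
   have ab: "\<bar>y\<^sup>2\<bar> ^ Suc 1 = (y\<^sup>2)\<^sup>2" "(y\<^sup>2) ^ Suc 1 = (y\<^sup>2)\<^sup>2" for y :: real by (simp_all add: power2_eq_square)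
   have iY: "integrable P (\<lambda>w. ((U k w)\<^sup>2) ^ Suc 1)" and iW: "integrable P (\<lambda>w. \<bar>(U (k + d) w)\<^sup>2\<bar> ^ Suc 1)"
    unfolding ab by (rule iU4[OF k], rule iU4[OF kd])
   have cY: "(\<E> w. ((U k w)\<^sup>2) ^ Suc 1) \<le> c * (real b)\<^sup>2" and cW: "(\<E> w. \<bar>(U (k + d) w)\<^sup>2\<bar> ^ Suc 1) \<le> c * (real b)\<^sup>2"
    unfolding ab by (rule eU4[OF k], rule eU4[OF kd])
   have t: "!!w. \<bar>(U k w)\<^sup>2\<bar> \<le> ((U k w)\<^sup>2) ^ 1" "!!w. 0 \<le> (U k w)\<^sup>2" by auto
   have "\<bar>(\<E> w. (U k w)\<^sup>2 * (U (k + d) w)\<^sup>2) - v b * v b\<bar> \<le> 8 * (c * (real b)\<^sup>2) * \<phi> h powr (real 1 / real (Suc 1))"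
    using covariance_bound(4)[OF ih(1,2) order_refl Z W Y t iY iW cY cW] unfolding eU2[OF k] eU2[OF kd] .
   then show ?thesis using False by (simp add: \<psi>_def h_def power2_eq_square)
  qed
  have psisum: "(\<Sum>d<N. \<psi> d) \<le> 8 * (c * (real b)\<^sup>2) * (real b + \<Phi>)"
  proof -
   have "(\<Sum>d<N. \<psi> d) \<le> (\<Sum>d<b+N. \<psi> d)" by (intro sum_mono2 psi0) auto
   also have "{..<b+N} = {..<b} \<union> {b..<b+N}" by auto
   also have "(\<Sum>d\<in>{..<b} \<union> {b..<b+N}. \<psi> d) = (\<Sum>d<b. \<psi> d) + (\<Sum>d=b..<b+N. \<psi> d)"
    by (rule sum.union_disjoint) auto
   also have "(\<Sum>d=b..<b+N. \<psi> d) = (\<Sum>h<N. 8 * (c * (real b)\<^sup>2) * \<phi> (Suc h) powr (1/2))"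
    by (rule sum.reindex_bij_witness[of _ "\<lambda>h. h + b" "\<lambda>d. d - b"]) (auto simp: \<psi>_def Suc_diff_le)
   also have "... = 8 * (c * (real b)\<^sup>2) * (\<Sum>h<N. \<phi> (Suc h) powr (1/2))" by (simp add: sum_distrib_left)
   also have "... \<le> 8 * (c * (real b)\<^sup>2) * \<Phi>"
    unfolding \<Phi>_def using c by (intro mult_left_mono sum_le_suminf summable_phi) auto
   also have "(\<Sum>d<b. \<psi> d) = 8 * (c * (real b)\<^sup>2) * real b" by (simp add: \<psi>_def)
   finally show ?thesis by (simp add: algebra_simps)
  qed
  have mU2: "(\<lambda>w. (U k w)\<^sup>2) \<in> borel_measurable P" if "k \<in> {1..N}" for k
   using mP that by (intro borel_measurable_power) auto
  note S = sum_squares_covariance_bound[of N "\<lambda>k w. (U k w)\<^sup>2" "v b" \<psi>, OF mU2 iU4 eU2 cov psi0]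
  define D where "D w = (\<Sum>k=1..N. (U k w)\<^sup>2 - v b) / (real m * real b)" for w
  have mD: "D \<in> borel_measurable P" unfolding D_def
   by (intro bm_intros mU2 borel_measurable_const)
  have iD: "integrable P (\<lambda>w. (D w)\<^sup>2)" unfolding D_def power_divide by (intro integrable_divide_zero S(2)) auto
  have "(\<E> w. (D w)\<^sup>2) = (\<E> w. (\<Sum>k=1..N. (U k w)\<^sup>2 - v b)\<^sup>2) / (real m * real b)\<^sup>2"
   unfolding D_def power_divide by simp
  also have "... \<le> (2 * real N * (8 * (c * (real b)\<^sup>2) * (real b + \<Phi>))) / (real m * real b)\<^sup>2"
   by (intro divide_right_mono order_trans[OF S(1)] mult_left_mono psisum) auto
  also have "... = 16 * c * (real b + \<Phi>) * real N / (real m)\<^sup>2" using b by (simp add: power_mult_distrib)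
  also have "... \<le> 16 * c * (real b + \<Phi>) * real m / (real m)\<^sup>2" using b c Phi0 by (intro divide_right_mono mult_left_mono) auto
  also have "... = 16 * c * ((real b + \<Phi>) / real m)" using b by (simp add: power2_eq_square)
  finally have D2: "(\<E> w. (D w)\<^sup>2) \<le> 16 * c * ((real b + \<Phi>) / real m)" .
  let ?e = "real N / real m * (v b / real b) - lrv g"
  have eq: "(\<Sum>k=1..N. (U k w)\<^sup>2 / real b) / real m - lrv g = D w + ?e" for w
   unfolding D_def using b by (simp add: sum_subtractf field_simps flip: sum_divide_distrib)
  have "(\<E> w. \<bar>D w + ?e\<bar>) \<le> (\<E> w. \<bar>D w\<bar> + \<bar>?e\<bar>)"
   using expectation_abs_le_sqrt(2)[OF mD iD] mD by (intro integral_mono_AE' AE_I2 abs_triangle_ineq) auto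
  also have "... = (\<E> w. \<bar>D w\<bar>) + \<bar>?e\<bar>" using expectation_abs_le_sqrt(2)[OF mD iD] by (simp add: prob_space)
  also have "... \<le> sqrt (16 * c * ((real b + \<Phi>) / real m)) + \<bar>?e\<bar>"
   using expectation_abs_le_sqrt(1)[OF mD iD] real_sqrt_le_mono[OF D2] by linarith
  finally show ?thesis unfolding b_def[symmetric] N_def[symmetric] U_def[symmetric] eq .
 qed
 have lim: "(\<lambda>m. sqrt (16 * c * ((real (l m) + \<Phi>) / real m)) + \<bar>real (m + 1 - l m) / real m * (v (l m) / real (l m)) - lrv g\<bar>) \<longlonglongrightarrow> 0"
 proof -
  have "(\<lambda>m. \<Phi> / real m) \<longlonglongrightarrow> 0" by real_asymp
  then have 1: "(\<lambda>m. (real (l m) + \<Phi>) / real m) \<longlonglongrightarrow> 0" using tendsto_add[OF lm] by (simp add: add_divide_distrib)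
  have 2: "(\<lambda>m. v (l m) / real (l m)) \<longlonglongrightarrow> lrv g" unfolding v_def by (rule filterlim_compose[OF variance_limit[OF g] l])
  have "(\<lambda>m. 1 + 1 / real m - real (l m) / real m) \<longlonglongrightarrow> 1 + 0 - 0"
   by (intro tendsto_diff tendsto_add tendsto_const lm) real_asymp
  moreover have "\<forall>\<^sub>F m in sequentially. 1 + 1 / real m - real (l m) / real m = real (m + 1 - l m) / real m"
   using order_tendstoD(2)[OF lm zero_less_one] eventually_gt_at_top[of 0]
  proof eventually_elim
   case (elim m)
   then have "l m < m" by simp
   then show ?case using elim by (simp add: of_nat_diff field_simps)
  qed
  ultimately have 3: "(\<lambda>m. real (m + 1 - l m) / real m) \<longlonglongrightarrow> 1" by (simp add: tendsto_cong)
  have "(\<lambda>m. sqrt (16 * c * ((real (l m) + \<Phi>) / real m)) + \<bar>real (m + 1 - l m) / real m * (v (l m) / real (l m)) - lrv g\<bar>) \<longlonglongrightarrow> sqrt (16 * c * 0) + \<bar>1 * lrv g - lrv g\<bar>"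
   by (intro tendsto_intros 1 2 3)
  then show ?thesis by simp
 qed
 show ?thesis
 proof (rule tendsto_sandwich[OF _ _ tendsto_const lim])
  show "\<forall>\<^sub>F m in sequentially. 0 \<le> (\<E> w. \<bar>(\<Sum>k=1..m + 1 - l m. (\<Sum>j=k..k + l m - 1. g (\<eta> j w))\<^sup>2 / real (l m)) / real m - lrv g\<bar>)"
   by (intro always_eventually allI integral_nonneg) simp
  have "\<forall>\<^sub>F m in sequentially. 1 \<le> l m" using l by (simp add: filterlim_at_top)
  then show "\<forall>\<^sub>F m in sequentially. (\<E> w. \<bar>(\<Sum>k=1..m + 1 - l m. (\<Sum>j=k..k + l m - 1. g (\<eta> j w))\<^sup>2 / real (l m)) / real m - lrv g\<bar>)
   \<le> sqrt (16 * c * ((real (l m) + \<Phi>) / real m)) + \<bar>real (m + 1 - l m) / real m * (v (l m) / real (l m)) - lrv g\<bar>"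
   using order_tendstoD(2)[OF lm zero_less_one] eventually_gt_at_top[of 0]
  proof eventually_elim
   case (elim m)
   then have "l m \<le> m" by simp
   with elim show ?case by (intro main)
  qed
 qed
qed

end

section \<open>Dyadic chaining\<close>

text \<open>Rounding down, not to the nearest grid point, makes the projections nested: projecting
  first to a fine and then to a coarse grid is the same as projecting to the coarse grid. The right
  endpoint 1 is fixed at every level.\<close>

definition dyad :: "nat => unit_interval => unit_interval" where
 "dyad N s = ui_of_real (real_of_int \<lfloor>2 ^ N * real_of_ui s\<rfloor> / 2 ^ N)"

definition dyad2 :: "nat => pt => pt" where
 "dyad2 N = map_prod (dyad N) (dyad N)"

text \<open>Countable and dense: events about suprema over this set are measurable, and a limit
  field is needed only here.\<close>

definition dyads :: "(pt) set" where
 "dyads = (\<Union>N. range (dyad2 N))"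

lemma real_of_ui_bounds: "0 \<le> real_of_ui s" "real_of_ui s \<le> 1"
 using real_of_ui[of s] by auto

lemma real_of_ui_dyad: "real_of_ui (dyad N s) = real_of_int \<lfloor>2 ^ N * real_of_ui s\<rfloor> / 2 ^ N"
proof -
 have "real_of_int \<lfloor>2 ^ N * real_of_ui s\<rfloor> \<le> 2 ^ N * real_of_ui s" by simp
 also have "... \<le> 2 ^ N * 1" using real_of_ui_bounds by (intro mult_left_mono) auto
 finally show ?thesis unfolding dyad_def using real_of_ui_bounds by (subst ui_of_real_inverse) auto
qed

lemma dist_dyad: "dist (dyad N s) s \<le> 1 / 2 ^ N"
proof -
 have f: "real_of_int \<lfloor>2 ^ N * real_of_ui s\<rfloor> \<le> 2 ^ N * real_of_ui s" "2 ^ N * real_of_ui s \<le> real_of_int \<lfloor>2 ^ N * real_of_ui s\<rfloor> + 1"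
  by linarith+
 then have "real_of_int \<lfloor>2 ^ N * real_of_ui s\<rfloor> / 2 ^ N \<le> real_of_ui s" "real_of_ui s \<le> real_of_int \<lfloor>2 ^ N * real_of_ui s\<rfloor> / 2 ^ N + 1 / 2 ^ N"
  by (simp_all add: field_simps)
 then show ?thesis unfolding dist_unit_interval_def real_of_ui_dyad by linarith
qed

lemma dyad_dyad: "N \<le> M ==> dyad N (dyad M s) = dyad N s"
proof -
 assume "N \<le> M"
 then obtain k where M: "M = N + k" using le_Suc_ex by blast
 have "\<lfloor>real_of_int \<lfloor>2 ^ (N + k) * real_of_ui s\<rfloor> / 2 ^ k\<rfloor> = \<lfloor>2 ^ N * real_of_ui s\<rfloor>"
 proof (rule floor_unique)
  let ?x = "2 ^ N * real_of_ui s"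
  have "2 ^ k * real_of_int \<lfloor>?x\<rfloor> \<le> 2 ^ k * ?x" by (intro mult_left_mono) auto
  then have "real_of_int (2 ^ k * \<lfloor>?x\<rfloor>) \<le> 2 ^ (N + k) * real_of_ui s" by (simp add: power_add ac_simps)
  then have "real_of_int (2 ^ k * \<lfloor>?x\<rfloor>) \<le> real_of_int \<lfloor>2 ^ (N + k) * real_of_ui s\<rfloor>" by (simp only: of_int_le_iff le_floor_iff)
  then show "real_of_int \<lfloor>?x\<rfloor> \<le> real_of_int \<lfloor>2 ^ (N + k) * real_of_ui s\<rfloor> / 2 ^ k" by (simp add: field_simps)
  have "real_of_int \<lfloor>2 ^ (N + k) * real_of_ui s\<rfloor> / 2 ^ k \<le> 2 ^ (N + k) * real_of_ui s / 2 ^ k" by (intro divide_right_mono) auto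
  also have "... = ?x" by (simp add: power_add)
  also have "... < real_of_int \<lfloor>?x\<rfloor> + 1" by linarith
  finally show "real_of_int \<lfloor>2 ^ (N + k) * real_of_ui s\<rfloor> / 2 ^ k < real_of_int \<lfloor>?x\<rfloor> + 1" .
 qed
 moreover have "2 ^ N * (real_of_int \<lfloor>2 ^ (N + k) * real_of_ui s\<rfloor> / 2 ^ (N + k)) = real_of_int \<lfloor>2 ^ (N + k) * real_of_ui s\<rfloor> / 2 ^ k"
  by (simp add: power_add)
 ultimately show ?thesis unfolding M dyad_def[of N] real_of_ui_dyad by simp
qed

lemma dyad2_dyad2: "N \<le> M ==> dyad2 N (dyad2 M p) = dyad2 N p"
 by (cases p) (simp add: dyad2_def dyad_dyad)

lemma dyad2_dyad2_coarse: "N \<le> M ==> dyad2 M (dyad2 N p) = dyad2 N p"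
proof -
 assume "N \<le> M"
 then obtain k where M: "M = N + k" using le_Suc_ex by blast
 have "dyad M (dyad N s) = dyad N s" for s
 proof -
  have "2 ^ M * (real_of_int \<lfloor>2 ^ N * real_of_ui s\<rfloor> / 2 ^ N) = real_of_int (2 ^ k * \<lfloor>2 ^ N * real_of_ui s\<rfloor>)"
   by (simp add: M power_add)
  then have "real_of_ui (dyad M (dyad N s)) = real_of_ui (dyad N s)"
   unfolding real_of_ui_dyad by (simp only: floor_of_int) (simp add: M power_add)
  then show ?thesis by (simp add: real_of_ui_inject)
 qed
 then show ?thesis by (cases p) (simp add: dyad2_def)
qed

text \<open>The chain of a dyadic point is eventually constant, so chaining there is a finite
  telescoping sum and involves no continuity of paths.\<close>

lemma dyads_fix:
 assumes "p \<in> dyads"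
 obtains N where "!!M. N \<le> M ==> dyad2 M p = p"
proof -
 obtain N q where p: "p = dyad2 N q" using assms unfolding dyads_def by auto
 show ?thesis by (rule that[of N]) (simp add: p dyad2_dyad2_coarse)
qed

lemma dyad2_in_dyads[simp]: "dyad2 N p \<in> dyads"
 unfolding dyads_def by auto

lemma dyad_range: "finite (range (dyad N))" "card (range (dyad N)) \<le> 2 * 2 ^ N"
proof -
 have sub: "range (dyad N) \<subseteq> (\<lambda>i. ui_of_real (real_of_int i / 2 ^ N)) ` {0..2 ^ N}"
 proof (rule image_subsetI)
  fix s
  have "2 ^ N * real_of_ui s \<le> 2 ^ N * 1" using real_of_ui_bounds by (intro mult_left_mono) auto
  then have "\<lfloor>2 ^ N * real_of_ui s\<rfloor> \<le> 2 ^ N" by (metis mult.right_neutral floor_mono floor_numeral_power)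
  moreover have "0 \<le> \<lfloor>2 ^ N * real_of_ui s\<rfloor>" using real_of_ui_bounds by simp
  ultimately show "dyad N s \<in> (\<lambda>i. ui_of_real (real_of_int i / 2 ^ N)) ` {0..2 ^ N}" unfolding dyad_def by auto
 qed
 show "finite (range (dyad N))" by (rule finite_subset[OF sub]) simp
 have "card (range (dyad N)) \<le> card ((\<lambda>i. ui_of_real (real_of_int i / 2 ^ N)) ` {0..(2::int) ^ N})"
  by (rule card_mono[OF _ sub]) simp
 also have "... \<le> card {0..(2::int) ^ N}" by (rule card_image_le) simp
 also have "... = nat (2 ^ N + 1)" by simp
 also have "... = 2 ^ N + 1" by (simp add: nat_add_distrib nat_power_eq)
 also have "... \<le> 2 * 2 ^ N" by simp
 finally show "card (range (dyad N)) \<le> 2 * 2 ^ N" .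
qed

lemma dyad2_range: "finite (range (dyad2 N))" "card (range (dyad2 N)) \<le> 4 * 4 ^ N"
proof -
 have eq: "range (dyad2 N) = range (dyad N) \<times> range (dyad N)"
  unfolding dyad2_def by (simp add: map_prod_surj_on flip: UNIV_Times_UNIV)
 show "finite (range (dyad2 N))" unfolding eq using dyad_range by simp
 have "card (range (dyad2 N)) \<le> (2 * 2 ^ N) * (2 * 2 ^ N)"
  unfolding eq card_cartesian_product by (intro mult_mono dyad_range) auto
 also have "... = 4 * 4 ^ N" by (simp flip: power_mult_distrib)
 finally show "card (range (dyad2 N)) \<le> 4 * 4 ^ N" .
qed

lemma countable_dyads: "countable dyads"
 unfolding dyads_def using dyad2_range(1) by (intro countable_UN) (auto intro: countable_finite)

text \<open>With M = N + j, level j of the chain has at most 16 4^M points and increments whose k-th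
  moment is at most C 2^(-M g). Since 4^M 2^(-M g) = q^(2 M), thresholds proportional to q^(j / k)
  leave q^(2 N) q^j to be summed over j. The factor 1 - root k q normalises the sum of the
  thresholds.\<close>

definition chain_bound :: "real => nat => nat => real" where
 "chain_bound g k N = (let q = 2 powr (- ((g - 2) / 2)) in 16 * q ^ (2 * N) / ((1 - root k q) ^ k * (1 - q)))"

lemma chain_bound_props:
 assumes "2 < g" "0 < k"
 shows "0 \<le> chain_bound g k N" "chain_bound g k \<longlonglongrightarrow> 0"
proof -
 define q where "q = (2::real) powr (- ((g - 2) / 2))"
 have q: "0 < q" "q < 1" unfolding q_def using assms by (auto simp: powr_less_one)
 have d: "root k q < 1" using q assms by simp
 show "0 \<le> chain_bound g k N" unfolding chain_bound_def Let_def q_def[symmetric] using q d by simp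
 have "(\<lambda>N. (q\<^sup>2) ^ N) \<longlonglongrightarrow> 0" using q power_strict_mono[of q 1 2] by (intro LIMSEQ_realpow_zero) auto
 then have "(\<lambda>N. 16 * (q\<^sup>2) ^ N / ((1 - root k q) ^ k * (1 - q))) \<longlonglongrightarrow> 16 * 0 / ((1 - root k q) ^ k * (1 - q))"
  using q d by (intro tendsto_divide tendsto_mult tendsto_const) auto
 then show "chain_bound g k \<longlonglongrightarrow> 0"
  unfolding chain_bound_def Let_def q_def[symmetric] by (simp add: power_mult)
qed

context prob_space
begin

lemma prob_power_Markov:
 fixes Z :: "'a => real"
 assumes [measurable]: "Z \<in> borel_measurable M" and i: "integrable M (\<lambda>w. \<bar>Z w\<bar> ^ k)" and e: "0 < e"
 shows "prob {w\<in>space M. e < \<bar>Z w\<bar>} \<le> (\<E> w. \<bar>Z w\<bar> ^ k) / e ^ k"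
proof -
 have "prob {w\<in>space M. e < \<bar>Z w\<bar>} \<le> prob {w\<in>space M. e ^ k \<le> \<bar>Z w\<bar> ^ k}"
  using e by (intro finite_measure_mono) (auto intro!: power_mono)
 also have "... \<le> (\<E> w. \<bar>Z w\<bar> ^ k) / e ^ k"
  using integral_Markov_inequality_measure[OF i, of "space M" "e ^ k"] e by auto
 finally show ?thesis .
qed

text \<open>At each level a union bound over the grid succeeds because g exceeds 2, the dimension of
  the square. Half of the surplus g - 2 pays for geometrically decreasing thresholds, the other half
  makes the probabilities summable.\<close>

lemma dyadic_chaining:
 fixes X :: "'a => pt => real"
 assumes X: "!!p. p \<in> dyads ==> (\<lambda>u. X u p) \<in> borel_measurable M"
  and i: "!!N p. integrable M (\<lambda>u. \<bar>X u (dyad2 (Suc N) p) - X u (dyad2 N p)\<bar> ^ k)"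
  and m: "!!N p. (\<E> u. \<bar>X u (dyad2 (Suc N) p) - X u (dyad2 N p)\<bar> ^ k) \<le> C * (1 / 2 ^ N) powr g"
  and g: "2 < g" and k: "0 < k" and e: "0 < e" and C: "0 \<le> C"
 obtains A where "A \<in> events" "prob A \<le> C * chain_bound g k N / e ^ k"
  "!!u p. u \<in> space M ==> u \<notin> A ==> p \<in> dyads ==> \<bar>X u p - X u (dyad2 N p)\<bar> \<le> e"
proof -
 define q where "q = (2::real) powr (- ((g - 2) / 2))"
 have q: "0 < q" "q < 1" unfolding q_def using g by (auto simp: powr_less_one)
 define \<delta> where "\<delta> = root k q"
 have d: "0 < \<delta>" "\<delta> < 1" "\<delta> ^ k = q" unfolding \<delta>_def using q k by auto
 define c where "c = e * (1 - \<delta>)"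
 have c: "0 < c" unfolding c_def using e d by simp
 define B where "B j p = {u\<in>space M. c * \<delta> ^ j < \<bar>X u (dyad2 (Suc (N + j)) p) - X u (dyad2 (N + j) p)\<bar>}" for j p
 define A where "A = (\<Union>j. \<Union>p\<in>range (dyad2 (Suc (N + j))). B j p)"
 have Bm: "B j p \<in> events" for j p
 proof -
  have [measurable]: "(\<lambda>u. X u (dyad2 N p)) \<in> borel_measurable M" for N by (rule X) simp
  show ?thesis unfolding B_def by measurable
 qed
 have B: "prob (B j p) \<le> C * (1 / 2 ^ (N + j)) powr g / (c * \<delta> ^ j) ^ k" for j p
 proof -
  have [measurable]: "(\<lambda>u. X u (dyad2 N p)) \<in> borel_measurable M" for N by (rule X) simp
  have "prob (B j p) \<le> (\<E> u. \<bar>X u (dyad2 (Suc (N + j)) p) - X u (dyad2 (N + j) p)\<bar> ^ k) / (c * \<delta> ^ j) ^ k"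
   unfolding B_def using c d by (intro prob_power_Markov i) auto
  also have "... \<le> C * (1 / 2 ^ (N + j)) powr g / (c * \<delta> ^ j) ^ k"
   using c d by (intro divide_right_mono m) auto
  finally show ?thesis .
 qed
 define Bj where "Bj j = (\<Union>p\<in>range (dyad2 (Suc (N + j))). B j p)" for j
 have Bjm: "Bj j \<in> events" for j unfolding Bj_def using dyad2_range(1) Bm by (intro sets.finite_UN) auto
 have Bj: "prob (Bj j) \<le> (16 * C * q ^ (2 * N) / c ^ k) * q ^ j" for j
 proof -
  have "prob (Bj j) \<le> (\<Sum>p\<in>range (dyad2 (Suc (N + j))). prob (B j p))"
   unfolding Bj_def by (intro measure_UNION_le dyad2_range Bm)
  also have "... \<le> (\<Sum>p\<in>range (dyad2 (Suc (N + j))). C * (1 / 2 ^ (N + j)) powr g / (c * \<delta> ^ j) ^ k)"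
   by (intro sum_mono B)
  also have "... = real (card (range (dyad2 (Suc (N + j))))) * (C * (1 / 2 ^ (N + j)) powr g / (c * \<delta> ^ j) ^ k)" by simp
  also have "... \<le> real (4 * 4 ^ Suc (N + j)) * (C * (1 / 2 ^ (N + j)) powr g / (c * \<delta> ^ j) ^ k)"
   using C c d dyad2_range(2)[of "Suc (N + j)"] by (intro mult_right_mono) (auto simp only: of_nat_le_iff divide_nonneg_pos mult_nonneg_nonneg powr_ge_zero zero_less_power mult_pos_pos)
  also have "... = 16 * C / c ^ k * (4 ^ (N + j) * (1 / 2 ^ (N + j)) powr g) / q ^ j"
   by (simp add: power_mult_distrib d(3)[symmetric] power_mult[symmetric] mult.commute)
  also have "4 ^ (N + j) * (1 / 2 ^ (N + j)) powr g = (q ^ (N + j))\<^sup>2"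
  proof -
   have a: "(4::real) ^ (N + j) = 2 powr (2 * real (N + j))"
   proof -
    have "(4::real) ^ (N + j) = 2 ^ (2 * (N + j))" unfolding power_mult by simp
    then show ?thesis by (simp add: powr_realpow[symmetric])
   qed
   have b: "(1 / 2 ^ (N + j)) powr g = (2::real) powr (- (real (N + j) * g))"
   proof -
    have "1 / 2 ^ (N + j) = (2::real) powr (- real (N + j))"
     by (simp add: powr_minus powr_realpow divide_inverse del: of_nat_add)
    then show ?thesis by (simp only: powr_powr) (simp add: algebra_simps)
   qed
   have "q ^ (N + j) = 2 powr (- ((g - 2) / 2) * real (N + j))"
    unfolding q_def by (simp add: powr_realpow[symmetric] powr_powr del: of_nat_add)
   then have "(q ^ (N + j))\<^sup>2 = 2 powr (2 * (- ((g - 2) / 2) * real (N + j)))"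
    by (simp only: power2_eq_square powr_add[symmetric] mult_2)
   moreover have "2 * real (N + j) + - (real (N + j) * g) = 2 * (- ((g - 2) / 2) * real (N + j))" by (simp add: field_simps)
   ultimately show ?thesis unfolding a b powr_add[symmetric] by (simp only:)
  qed
  also have "16 * C / c ^ k * (q ^ (N + j))\<^sup>2 / q ^ j = (16 * C * q ^ (2 * N) / c ^ k) * q ^ j"
   using q by (simp add: power_add power_mult power2_eq_square power_mult_distrib mult_2)
  finally show ?thesis .
 qed
 show ?thesis
 proof (rule that)
  show "A \<in> events" unfolding A_def Bj_def[symmetric] using Bjm by (intro sets.countable_UN) auto
  have s: "summable (\<lambda>j. (16 * C * q ^ (2 * N) / c ^ k) * q ^ j)" using q by (intro summable_mult summable_geometric) auto
  have "prob A \<le> (\<Sum>j. prob (Bj j))"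
   unfolding A_def Bj_def[symmetric] using Bjm Bj
   by (intro finite_measure_subadditive_countably summable_comparison_test'[OF s]) auto
  also have "... \<le> (\<Sum>j. (16 * C * q ^ (2 * N) / c ^ k) * q ^ j)"
   using Bj by (intro suminf_le s summable_comparison_test'[OF s]) auto
  also have "... = (16 * C * q ^ (2 * N) / c ^ k) * (1 / (1 - q))"
   using q by (subst suminf_mult) (auto simp: suminf_geometric)
  also have "... = C * chain_bound g k N / e ^ k"
   unfolding chain_bound_def Let_def q_def[symmetric] \<delta>_def[symmetric] c_def by (simp add: power_mult_distrib ac_simps)
  finally show "prob A \<le> C * chain_bound g k N / e ^ k" .
 next
  fix u p assume w: "u \<in> space M" "u \<notin> A" and p: "p \<in> dyads"
  obtain M0 where M0: "!!M. M0 \<le> M ==> dyad2 M p = p" using dyads_fix[OF p] by blast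
  have st: "\<bar>X u (dyad2 (Suc (N + j)) p) - X u (dyad2 (N + j) p)\<bar> \<le> c * \<delta> ^ j" for j
  proof -
   have "u \<notin> B j (dyad2 (Suc (N + j)) p)" using w unfolding A_def by blast
   then show ?thesis unfolding B_def using w by (auto simp: dyad2_dyad2 not_less)
  qed
  have "X u p - X u (dyad2 N p) = (\<Sum>j<M0. X u (dyad2 (Suc (N + j)) p) - X u (dyad2 (N + j) p))"
   using sum_lessThan_telescope[of "\<lambda>j. X u (dyad2 (N + j) p)" M0] M0[of "N + M0"] by simp
  also have "\<bar>...\<bar> \<le> (\<Sum>j<M0. c * \<delta> ^ j)" by (intro order_trans[OF sum_abs] sum_mono st)
  also have "... = c * (\<Sum>j<M0. \<delta> ^ j)" by (simp add: sum_distrib_left)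
  also have "... \<le> c * (1 / (1 - \<delta>))"
   using c d by (intro mult_left_mono) (auto simp: suminf_geometric[symmetric] intro!: sum_le_suminf summable_geometric)
  also have "... = e" unfolding c_def using d by simp
  finally show "\<bar>X u p - X u (dyad2 N p)\<bar> \<le> e" .
 qed
qed

end

section \<open>Weak convergence of maxima\<close>

context prob_space
begin

definition tight_on :: "'q set => (nat => 'a => 'q => real) => bool" where
 "tight_on I X \<longleftrightarrow> (\<forall>e>0. \<exists>K. whp e (\<lambda>i w. \<forall>p\<in>I. \<bar>X i w p\<bar> \<le> K))"

text \<open>Uniform convergence to 0 in probability, with one number for both level and probability;
  \<open>null_onD\<close> separates the two.\<close>

definition null_on :: "'q set => (nat => 'a => 'q => real) => bool" where
 "null_on I X \<longleftrightarrow> (\<forall>e>0. whp e (\<lambda>i w. \<forall>p\<in>I. \<bar>X i w p\<bar> \<le> e))"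

lemma prob_Un_le: "A \<in> events ==> B \<in> events ==> prob A \<le> a ==> prob B \<le> b ==> prob (A \<union> B) \<le> a + b"
 using measure_Un_le[of A M B] by linarith

lemma whp_conj:
 assumes "whp a Q" "whp b R" "!!i w. Q i w ==> R i w ==> S i w" "a + b \<le> e"
 shows "whp e S"
 using assms(1,2)
proof eventually_elim
 case (elim i)
 from elim(1) obtain A where A: "A \<in> events" "prob A \<le> a" "\<forall>w\<in>space M - A. Q i w" by blast
 from elim(2) obtain B where B: "B \<in> events" "prob B \<le> b" "\<forall>w\<in>space M - B. R i w" by blast
 have "prob (A \<union> B) \<le> e" using prob_Un_le[OF A(1) B(1) A(2) B(2)] assms(4) by simp
 then show ?case using A B assms(3) by (intro bexI[of _ "A \<union> B"]) auto
qed

lemma whp_mono: "whp a Q ==> (!!i w. Q i w ==> S i w) ==> a \<le> e ==> whp e S"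
 by (erule whp_conj[where R = "\<lambda>_ _. True" and b = 0]) (auto intro!: always_eventually bexI[of _ "{}"])

lemma null_onD:
 assumes "null_on I X" "0 < e" "0 < d"
 shows "whp e (\<lambda>i w. \<forall>p\<in>I. \<bar>X i w p\<bar> \<le> d)"
proof -
 have "0 < min e d" using assms by simp
 from assms(1)[unfolded null_on_def, rule_format, OF this] show ?thesis by (rule whp_mono) auto
qed

lemma null_onI:
 assumes "!!e d. 0 < e ==> 0 < d ==> whp e (\<lambda>i w. \<forall>p\<in>I. \<bar>X i w p\<bar> \<le> d)"
 shows "null_on I X"
 using assms unfolding null_on_def by blast

lemma tight_onD: "tight_on I X ==> 0 < e ==> \<exists>K\<ge>0. whp e (\<lambda>i w. \<forall>p\<in>I. \<bar>X i w p\<bar> \<le> K)"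
proof -
 assume "tight_on I X" "0 < e"
 then obtain K where K: "whp e (\<lambda>i w. \<forall>p\<in>I. \<bar>X i w p\<bar> \<le> K)" unfolding tight_on_def by blast
 have "whp e (\<lambda>i w. \<forall>p\<in>I. \<bar>X i w p\<bar> \<le> \<bar>K\<bar>)" by (rule whp_mono[OF K]) (auto intro: order_trans[OF _ abs_ge_self])
 then show ?thesis by (intro exI[of _ "\<bar>K\<bar>"]) simp
qed

lemma null_on_add:
 assumes "null_on I X" "null_on I Y"
 shows "null_on I (\<lambda>i w p. X i w p + Y i w p)"
proof (rule null_onI)
 fix e d :: real assume "0 < e" "0 < d"
 then have h: "0 < e / 2" "0 < d / 2" by auto
 show "whp e (\<lambda>i w. \<forall>p\<in>I. \<bar>X i w p + Y i w p\<bar> \<le> d)"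
  by (rule whp_conj[OF null_onD[OF assms(1) h] null_onD[OF assms(2) h]]) (intro ballI, (drule (1) bspec)+, linarith, simp)
qed

lemma tight_on_add:
 assumes "tight_on I X" "tight_on I Y"
 shows "tight_on I (\<lambda>i w p. X i w p + Y i w p)"
 unfolding tight_on_def
proof (intro allI impI)
 fix e :: real assume "0 < e"
 then have h: "0 < e / 2" by auto
 obtain K L where K: "whp (e / 2) (\<lambda>i w. \<forall>p\<in>I. \<bar>X i w p\<bar> \<le> K)" and L: "whp (e / 2) (\<lambda>i w. \<forall>p\<in>I. \<bar>Y i w p\<bar> \<le> L)"
  using tight_onD[OF assms(1) h] tight_onD[OF assms(2) h] by (elim exE conjE)
 have "whp e (\<lambda>i w. \<forall>p\<in>I. \<bar>X i w p + Y i w p\<bar> \<le> K + L)"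
  by (rule whp_conj[OF K L]) (intro ballI, (drule (1) bspec)+, linarith, simp)
 then show "\<exists>K. whp e (\<lambda>i w. \<forall>p\<in>I. \<bar>X i w p + Y i w p\<bar> \<le> K)" ..
qed

lemma null_on_mult_tight:
 assumes "null_on I X" "tight_on I Y"
 shows "null_on I (\<lambda>i w p. X i w p * Y i w p)"
proof (rule null_onI)
 fix e d :: real assume e: "0 < e" "0 < d"
 then have h: "0 < e / 2" by auto
 obtain L where L: "0 \<le> L" "whp (e / 2) (\<lambda>i w. \<forall>p\<in>I. \<bar>Y i w p\<bar> \<le> L)" using tight_onD[OF assms(2) h] by (elim exE conjE)
 have d: "0 < d / (L + 1)" using e L(1) by (auto intro!: divide_pos_pos)
 have le: "\<bar>x * y\<bar> \<le> d" if "\<bar>x\<bar> \<le> d / (L + 1)" "\<bar>y\<bar> \<le> L" for x y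
 proof -
  have "\<bar>x * y\<bar> \<le> d / (L + 1) * (L + 1)" unfolding abs_mult using that d by (intro mult_mono) auto
  then show ?thesis using L(1) by simp
 qed
 show "whp e (\<lambda>i w. \<forall>p\<in>I. \<bar>X i w p * Y i w p\<bar> \<le> d)"
  by (rule whp_conj[OF null_onD[OF assms(1) h d] L(2)]) (use le in auto)
qed

lemma tight_on_mult:
 assumes "tight_on I X" "tight_on I Y"
 shows "tight_on I (\<lambda>i w p. X i w p * Y i w p)"
 unfolding tight_on_def
proof (intro allI impI)
 fix e :: real assume "0 < e"
 then have h: "0 < e / 2" by auto
 obtain K L where K: "0 \<le> K" "whp (e / 2) (\<lambda>i w. \<forall>p\<in>I. \<bar>X i w p\<bar> \<le> K)" and L: "whp (e / 2) (\<lambda>i w. \<forall>p\<in>I. \<bar>Y i w p\<bar> \<le> L)"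
  using tight_onD[OF assms(1) h] tight_onD[OF assms(2) h] by (elim exE conjE)
 have "whp e (\<lambda>i w. \<forall>p\<in>I. \<bar>X i w p * Y i w p\<bar> \<le> K * L)"
  by (rule whp_conj[OF K(2) L]) (use K(1) in \<open>auto simp: abs_mult intro!: mult_mono\<close>)
 then show "\<exists>K. whp e (\<lambda>i w. \<forall>p\<in>I. \<bar>X i w p * Y i w p\<bar> \<le> K)" ..
qed

lemma tight_on_deterministic:
 assumes "!!i p. p \<in> I ==> \<bar>c i p\<bar> \<le> K"
 shows "tight_on I (\<lambda>i w p. c i p)"
 unfolding tight_on_def by (intro allI impI exI[of _ K] always_eventually bexI[of _ "{}"]) (use assms in auto)

lemma tight_on_convergent:
 assumes "c \<longlonglongrightarrow> (L::real)"
 shows "tight_on I (\<lambda>i w p. c i)"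
proof -
 have "Bseq c" using assms by (intro convergent_imp_Bseq convergentI)
 then obtain K where "\<forall>i. norm (c i) \<le> K" by (rule BseqE)
 then show ?thesis by (intro tight_on_deterministic[of I _ K]) auto
qed

lemma null_on_deterministic: "c \<longlonglongrightarrow> (0::real) ==> null_on I (\<lambda>i w p. c i)"
 unfolding null_on_def
proof (intro allI impI)
 fix e :: real assume c: "c \<longlonglongrightarrow> 0" and e: "0 < e"
 have "\<forall>\<^sub>F i in sequentially. \<bar>c i\<bar> < e" using tendstoD[OF c e] by (simp add: dist_real_def)
 then show "whp e (\<lambda>i w. \<forall>p\<in>I. \<bar>c i\<bar> \<le> e)"
  by eventually_elim (use e in \<open>auto intro!: bexI[of _ "{}"]\<close>)
qed

lemma null_on_mult_tight': "null_on I X ==> tight_on I Y ==> null_on I (\<lambda>i w p. Y i w p * X i w p)"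
 using null_on_mult_tight[of I X Y] by (simp add: mult.commute)

lemma tight_on_uminus: "tight_on I X ==> tight_on I (\<lambda>i w p. - X i w p)"
 unfolding tight_on_def by simp

lemma null_on_compose: "null_on I X ==> filterlim m sequentially sequentially ==> null_on I (\<lambda>i. X (m i))"
 unfolding null_on_def
 using eventually_compose_filterlim[where f = m and F = sequentially and G = sequentially] by blast

lemma tight_on_compose: "tight_on I X ==> filterlim m sequentially sequentially ==> tight_on I (\<lambda>i. X (m i))"
 unfolding tight_on_def
 using eventually_compose_filterlim[where f = m and F = sequentially and G = sequentially] by blast

lemma null_on_cong:
 assumes "null_on I X" "\<forall>\<^sub>F i in sequentially. \<forall>w\<in>space M. \<forall>p\<in>I. X i w p = Y i w p"
 shows "null_on I Y"
 unfolding null_on_def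
proof (intro allI impI)
 fix e :: real assume "0 < e"
 with assms(1) have "whp e (\<lambda>i w. \<forall>p\<in>I. \<bar>X i w p\<bar> \<le> e)"
  unfolding null_on_def by blast
 with assms(2) show "whp e (\<lambda>i w. \<forall>p\<in>I. \<bar>Y i w p\<bar> \<le> e)"
  by eventually_elim (metis DiffD1)
qed

lemma null_on_imp_tight_on: "null_on I X ==> tight_on I X"
 unfolding null_on_def tight_on_def by blast

end

section \<open>From characteristic functions to test functions of cosines\<close>

locale fdd_convergence = prob_space M for M :: "'a measure" +
 fixes A :: "nat => 'a => 'q => real" and G :: "'a => 'q => real" and I :: "'q set"
 assumes A_meas[measurable]: "!!i q. q \<in> I ==> (\<lambda>w. A i w q) \<in> borel_measurable M"
  and G_meas[measurable]: "!!q. q \<in> I ==> (\<lambda>w. G w q) \<in> borel_measurable M"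
  and fdd: "!!Q t. finite Q ==> Q \<subseteq> I ==>
   (\<lambda>i. (\<E> w. iexp (\<Sum>q\<in>Q. t q * A i w q))) \<longlonglongrightarrow> (\<E> w. iexp (\<Sum>q\<in>Q. t q * G w q))"
begin

abbreviation "twist Q t f X \<equiv> (\<E> w. iexp (\<Sum>q\<in>Q. t q * X w q) * complex_of_real (f (X w)))"

text \<open>Expectations twisted by an exponential have to converge, not only those of
  \<open>f\<close> itself: multiplying \<open>f\<close> by a cosine then merely shifts the frequency
  of the twist, so the class is closed under such products. The constant 1 belongs to it by the
  convergence of characteristic functions.\<close>

definition testfun :: "(('q => real) => real) => bool" where
 "testfun f \<longleftrightarrow> (\<exists>K. \<forall>x. \<bar>f x\<bar> \<le> K) \<and> (\<forall>i. (\<lambda>w. f (A i w)) \<in> borel_measurable M) \<and> (\<lambda>w. f (G w)) \<in> borel_measurable M \<and>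
   (\<forall>Q t. finite Q \<longrightarrow> Q \<subseteq> I \<longrightarrow>
   (\<lambda>i. twist Q t f (A i)) \<longlonglongrightarrow> twist Q t f G)"

lemma testfunD:
 assumes "testfun f"
 shows "(\<lambda>w. f (A i w)) \<in> borel_measurable M" "(\<lambda>w. f (G w)) \<in> borel_measurable M"
  "finite Q ==> Q \<subseteq> I ==>
   (\<lambda>i. twist Q t f (A i)) \<longlonglongrightarrow> twist Q t f G"
  "\<exists>K. \<forall>x. \<bar>f x\<bar> \<le> K"
 using assms unfolding testfun_def by blast+

lemma integrable_iexp_mult:
 fixes f :: "'a => real"
 assumes [measurable]: "f \<in> borel_measurable M" "X \<in> borel_measurable M" and K: "!!w. \<bar>f w\<bar> \<le> K"
 shows "integrable M (\<lambda>w. iexp (X w) * complex_of_real (f w))"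
 by (rule integrable_const_bound[of _ K]) (auto simp: norm_mult K)

lemma sum_meas[measurable]:
 assumes "Q \<subseteq> I"
 shows "(\<lambda>w. \<Sum>q\<in>Q. t q * A i w q) \<in> borel_measurable M" "(\<lambda>w. \<Sum>q\<in>Q. t q * G w q) \<in> borel_measurable M"
proof -
 have "q \<in> I" if "q \<in> Q" for q using assms that by auto
 note [measurable] = A_meas[OF this] G_meas[OF this]
 show "(\<lambda>w. \<Sum>q\<in>Q. t q * A i w q) \<in> borel_measurable M" "(\<lambda>w. \<Sum>q\<in>Q. t q * G w q) \<in> borel_measurable M" by measurable
qed

lemma testfun_one: "testfun (\<lambda>_. 1)"
 unfolding testfun_def using fdd by (auto intro!: exI[of _ 1])

lemma testfun_scale:
 assumes "testfun f"
 shows "testfun (\<lambda>x. c * f x)"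
proof -
 obtain K where K: "!!x. \<bar>f x\<bar> \<le> K" using testfunD(4)[OF assms] by blast
 have b: "\<bar>c * f x\<bar> \<le> \<bar>c\<bar> * K" for x unfolding abs_mult by (intro mult_left_mono K) auto
 have [measurable]: "(\<lambda>w. f (A i w)) \<in> borel_measurable M" "(\<lambda>w. f (G w)) \<in> borel_measurable M" for i
  by (rule testfunD[OF assms])+
 have eq: "(\<E> w. iexp (\<Sum>q\<in>Q. t q * X w q) * complex_of_real (c * f (X w))) = complex_of_real c * twist Q t f X"
  for Q t X unfolding of_real_mult[of c] mult.left_commute[of _ "complex_of_real c"] by (rule integral_mult_right_zero)
 show ?thesis unfolding testfun_def eq
 proof (intro conjI allI impI exI[of _ "\<bar>c\<bar> * K"] b tendsto_mult_left)
  fix Q t assume Q: "finite Q" "Q \<subseteq> I"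
  show "(\<lambda>i. twist Q t f (A i)) \<longlonglongrightarrow> twist Q t f G" by (rule testfunD(3)[OF assms Q])
 qed measurable
qed

lemma testfun_add:
 assumes f: "testfun f" and g: "testfun g"
 shows "testfun (\<lambda>x. f x + g x)"
proof -
 obtain K where K: "!!x. \<bar>f x\<bar> \<le> K" using testfunD(4)[OF f] by blast
 obtain L where L: "!!x. \<bar>g x\<bar> \<le> L" using testfunD(4)[OF g] by blast
 have [measurable]: "(\<lambda>w. f (A i w)) \<in> borel_measurable M" "(\<lambda>w. f (G w)) \<in> borel_measurable M"
  "(\<lambda>w. g (A i w)) \<in> borel_measurable M" "(\<lambda>w. g (G w)) \<in> borel_measurable M" for i
  by (rule testfunD[OF f] testfunD[OF g])+
 have b: "\<bar>f x + g x\<bar> \<le> K + L" for x using K[of x] L[of x] by linarith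
 show ?thesis unfolding testfun_def
 proof (intro conjI allI impI exI[of _ "K + L"] b)
  fix Q t assume Q: "finite Q" "Q \<subseteq> I"
  have eq: "(\<E> w. iexp (\<Sum>q\<in>Q. t q * X w q) * complex_of_real (f (X w) + g (X w))) =
    twist Q t f X + twist Q t g X"
   if m: "(\<lambda>w. \<Sum>q\<in>Q. t q * X w q) \<in> borel_measurable M" "(\<lambda>w. f (X w)) \<in> borel_measurable M" "(\<lambda>w. g (X w)) \<in> borel_measurable M" for X
   unfolding of_real_add distrib_left
   by (rule integral_add[OF integrable_iexp_mult[OF m(2) m(1) K] integrable_iexp_mult[OF m(3) m(1) L]])
  have fm: "(\<lambda>w. f (A i w)) \<in> borel_measurable M" "(\<lambda>w. f (G w)) \<in> borel_measurable M"
   "(\<lambda>w. g (A i w)) \<in> borel_measurable M" "(\<lambda>w. g (G w)) \<in> borel_measurable M" for i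
   by (rule testfunD[OF f] testfunD[OF g])+
  show "(\<lambda>i. (\<E> w. iexp (\<Sum>q\<in>Q. t q * A i w q) * complex_of_real (f (A i w) + g (A i w)))) \<longlonglongrightarrow>
   (\<E> w. iexp (\<Sum>q\<in>Q. t q * G w q) * complex_of_real (f (G w) + g (G w)))"
   unfolding eq[of "A i" for i, OF sum_meas(1)[OF Q(2)] fm(1,3)] eq[of G, OF sum_meas(2)[OF Q(2)] fm(2,4)]
   by (intro tendsto_add testfunD(3)[OF f Q] testfunD(3)[OF g Q])
 qed measurable
qed

text \<open>The cosine is half the sum of two exponentials, which move the frequency at
  \<open>q\<close> by \<open>a\<close> and by \<open>- a\<close>.\<close>

lemma testfun_mult_cos:
 assumes f: "testfun f" and q: "q \<in> I"
 shows "testfun (\<lambda>x. f x * cos (a * x q))"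
proof -
 note [measurable] = A_meas[OF q] G_meas[OF q]
 obtain K where K: "!!x. \<bar>f x\<bar> \<le> K" using testfunD(4)[OF f] by blast
 have [measurable]: "(\<lambda>w. f (A i w)) \<in> borel_measurable M" "(\<lambda>w. f (G w)) \<in> borel_measurable M" for i
  by (rule testfunD[OF f])+
 have b: "\<bar>f x * cos (a * x q)\<bar> \<le> K" for x
  using mult_mono[OF K[of x] abs_cos_le_one[of "a * x q"]] order_trans[OF abs_ge_zero K] by (simp add: abs_mult)
 show ?thesis unfolding testfun_def
 proof (intro conjI allI impI exI[of _ K] b)
  fix Q t assume Q: "finite Q" "Q \<subseteq> I"
  define R where "R = insert q Q"
  have R: "finite R" "R \<subseteq> I" using Q q unfolding R_def by auto
  \<comment> \<open>\<open>q\<close> may already belong to \<open>Q\<close>; the shift is then added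
    to the frequency that it carries.\<close>
  define u :: "real => 'q => real" where "u s r = (if r \<in> Q then t r else 0) + (if r = q then s else 0)" for s r
  have us: "(\<Sum>r\<in>R. u s r * x r) = (\<Sum>r\<in>Q. t r * x r) + s * x q" for s and x :: "'q => real"
  proof -
   have "(\<Sum>r\<in>R. u s r * x r) = (\<Sum>r\<in>R. (if r \<in> Q then t r * x r else 0)) + (\<Sum>r\<in>R. if r = q then s * x r else 0)"
    unfolding u_def by (subst sum.distrib[symmetric]) (auto intro!: sum.cong simp: algebra_simps)
   also have "(\<Sum>r\<in>R. (if r \<in> Q then t r * x r else 0)) = (\<Sum>r\<in>Q. t r * x r)"
    using R(1) unfolding R_def by (auto simp: sum.If_cases Int_absorb1 subset_insertI intro!: sum.mono_neutral_cong_right)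
   finally show ?thesis using R(1) by (simp add: R_def)
  qed
  have eq: "iexp (\<Sum>r\<in>Q. t r * x r) * complex_of_real (f x * cos (a * x q)) =
    (iexp (\<Sum>r\<in>R. u a r * x r) * f x + iexp (\<Sum>r\<in>R. u (- a) r * x r) * f x) / 2" for x
  proof -
   have c: "complex_of_real (cos (a * x q)) = (iexp (a * x q) + iexp (- a * x q)) / 2"
    by (simp add: cos_of_real[symmetric] cos_exp_eq)
   have e: "iexp (S + y) = iexp S * iexp y" for S y :: real by (simp add: distrib_left exp_add)
   have "E * (F * ((C + D) / 2)) = (E * C * F + E * D * F) / 2" for C D E F :: complex by (simp add: algebra_simps)
   then show ?thesis unfolding us e of_real_mult[of "f x"] c .
  qed
  have lim: "(\<lambda>i. (twist R (u a) f (A i) + twist R (u (- a)) f (A i)) / 2) \<longlonglongrightarrow>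
   (twist R (u a) f G + twist R (u (- a)) f G) / 2"
   by (intro tendsto_divide tendsto_add tendsto_const testfunD(3)[OF f R]) simp
  have i: "integrable M (\<lambda>w. iexp (\<Sum>r\<in>R. u s r * A i w r) * f (A i w))" "integrable M (\<lambda>w. iexp (\<Sum>r\<in>R. u s r * G w r) * f (G w))" for s i
   by (rule integrable_iexp_mult[OF testfunD(1)[OF f] sum_meas(1)[OF R(2)] K] integrable_iexp_mult[OF testfunD(2)[OF f] sum_meas(2)[OF R(2)] K])+
  show "(\<lambda>i. (\<E> w. iexp (\<Sum>q\<in>Q. t q * A i w q) * complex_of_real (f (A i w) * cos (a * A i w q)))) \<longlonglongrightarrow>
   (\<E> w. iexp (\<Sum>q\<in>Q. t q * G w q) * complex_of_real (f (G w) * cos (a * G w q)))"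
   unfolding eq using lim by (simp only: integral_divide_zero integral_add[OF i(1) i(1)] integral_add[OF i(2) i(2)])
 qed measurable
qed

lemma testfun_mult_polynomial:
 assumes q: "q \<in> I" and p: "real_polynomial_function (p :: real => real)" and f: "testfun f"
 shows "testfun (\<lambda>x. f x * p (cos (a * x q)))"
 using p f
proof (induction p arbitrary: f rule: real_polynomial_function.induct)
 case (linear h)
 have hy: "h y = y * h 1" for y using linear(1) linear_scale[OF bounded_linear.linear, of h y 1] by simp
 have eq: "(\<lambda>x. f x * h (cos (a * x q))) = (\<lambda>x. h 1 * (f x * cos (a * x q)))"
  by (rule ext, subst hy) simp
 show ?case unfolding eq by (intro testfun_scale testfun_mult_cos linear q)
next
 case (const c)
 then show ?case using testfun_scale[of f c] by (simp add: mult.commute)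
next
 case (add p1 p2)
 then show ?case using testfun_add[OF add(3)[of f] add(4)[of f]] by (simp add: distrib_left)
next
 case (mult p1 p2)
 then show ?case using mult(4)[OF mult(3)[OF mult(5)]] by (simp add: mult.assoc)
qed

text \<open>Stone-Weierstrass on the range of the cosine: a uniform error d in \<open>g\<close>
  changes the twisted expectations by at most K d, uniformly in the index.\<close>

lemma testfun_mult_continuous:
 assumes q: "q \<in> I" and g: "continuous_on {-1..1} (g :: real => real)" and f: "testfun f"
 shows "testfun (\<lambda>x. f x * g (cos (a * x q)))"
proof -
 note [measurable] = A_meas[OF q] G_meas[OF q]
 obtain K where K: "!!x. \<bar>f x\<bar> \<le> K" using testfunD(4)[OF f] by blast
 have K0: "0 \<le> K" using K[of undefined] abs_ge_zero[of "f undefined"] by linarith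
 have [measurable]: "(\<lambda>u. f (A i u)) \<in> borel_measurable M" "(\<lambda>u. f (G u)) \<in> borel_measurable M" for i
  by (rule testfunD[OF f])+
 have "compact (g ` {-1..1})" by (intro compact_continuous_image g) auto
 then have "bounded (g ` {-1..1})" by (rule compact_imp_bounded)
 then obtain B where "\<forall>z\<in>g ` {-1..1}. norm z \<le> B" unfolding bounded_iff ..
 then have B: "\<bar>g y\<bar> \<le> B" if "y \<in> {-1..1}" for y using that by auto
 have gm: "(\<lambda>y. g (cos y)) \<in> borel_measurable borel"
  by (intro borel_measurable_continuous_onI continuous_on_compose2[OF g]) (auto intro: continuous_intros)
 have mA: "(\<lambda>u. g (cos (a * A i u q))) \<in> borel_measurable M" and mG: "(\<lambda>u. g (cos (a * G u q))) \<in> borel_measurable M" for i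
  using measurable_compose[where f = "\<lambda>u. a * A i u q", OF _ gm] measurable_compose[where f = "\<lambda>u. a * G u q", OF _ gm]
   A_meas[OF q] G_meas[OF q] by auto
 have b: "\<bar>f x * g (cos (a * x q))\<bar> \<le> K * B" for x
  unfolding abs_mult by (intro mult_mono K B K0) auto
 show ?thesis unfolding testfun_def
 proof (intro conjI allI impI exI[of _ "K * B"] b)
  show "(\<lambda>u. f (A i u) * g (cos (a * A i u q))) \<in> borel_measurable M" for i using mA by measurable
  show "(\<lambda>u. f (G u) * g (cos (a * G u q))) \<in> borel_measurable M" using mG by measurable
  fix Q t assume Q: "finite Q" "Q \<subseteq> I"
  let ?E = "\<lambda>h X. (\<E> u. iexp (\<Sum>q\<in>Q. t q * X u q) * complex_of_real (f (X u) * h (cos (a * X u q))))"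
  show "(\<lambda>i. ?E g (A i)) \<longlonglongrightarrow> ?E g G"
  proof (rule LIMSEQ_I)
   fix r :: real assume r: "0 < r"
   define d where "d = r / (4 * (K + 1))"
   have d: "0 < d" unfolding d_def using r K0 by simp
   have Kd: "K * d \<le> r / 4" unfolding d_def using r K0 by (simp add: divide_simps)
   obtain p where p: "real_polynomial_function p" and pg: "!!y. y \<in> {-1..1} ==> \<bar>g y - p y\<bar> < d"
    using Stone_Weierstrass_real_polynomial_function[OF compact_Icc g d] by auto
   note T = testfun_mult_polynomial[OF q p f, of a]
   obtain L where L: "!!x. \<bar>f x * p (cos (a * x q))\<bar> \<le> L" using testfunD(4)[OF T] by blast
   have [measurable]: "(\<lambda>u. f (A i u) * p (cos (a * A i u q))) \<in> borel_measurable M" "(\<lambda>u. f (G u) * p (cos (a * G u q))) \<in> borel_measurable M" for i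
    by (rule testfunD[OF T])+
   have close: "cmod (?E g X - ?E p X) \<le> r / 4"
    if m: "(\<lambda>u. \<Sum>q\<in>Q. t q * X u q) \<in> borel_measurable M" "(\<lambda>u. f (X u) * g (cos (a * X u q))) \<in> borel_measurable M" "(\<lambda>u. f (X u) * p (cos (a * X u q))) \<in> borel_measurable M" for X
   proof -
    have i: "integrable M (\<lambda>u. iexp (\<Sum>q\<in>Q. t q * X u q) * complex_of_real (f (X u) * g (cos (a * X u q))))"
     "integrable M (\<lambda>u. iexp (\<Sum>q\<in>Q. t q * X u q) * complex_of_real (f (X u) * p (cos (a * X u q))))"
     by (rule integrable_iexp_mult[OF m(2) m(1) b], rule integrable_iexp_mult[OF m(3) m(1) L])
    have "?E g X - ?E p X = (\<E> u. iexp (\<Sum>q\<in>Q. t q * X u q) * complex_of_real (f (X u) * g (cos (a * X u q)))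
      - iexp (\<Sum>q\<in>Q. t q * X u q) * complex_of_real (f (X u) * p (cos (a * X u q))))"
     by (rule integral_diff[OF i, symmetric])
    also have "cmod ... \<le> (\<E> u. K * d)"
    proof (rule order_trans[OF integral_norm_bound], rule integral_mono)
     show "integrable M (\<lambda>u. cmod (iexp (\<Sum>q\<in>Q. t q * X u q) * complex_of_real (f (X u) * g (cos (a * X u q)))
      - iexp (\<Sum>q\<in>Q. t q * X u q) * complex_of_real (f (X u) * p (cos (a * X u q)))))"
      by (rule integrable_norm[OF integrable_diff[OF i]])
     show "integrable M (\<lambda>u. K * d)" by simp
     fix u
     have "cmod (iexp (\<Sum>q\<in>Q. t q * X u q) * complex_of_real (f (X u) * g (cos (a * X u q)))
      - iexp (\<Sum>q\<in>Q. t q * X u q) * complex_of_real (f (X u) * p (cos (a * X u q)))) = \<bar>f (X u) * (g (cos (a * X u q)) - p (cos (a * X u q)))\<bar>"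
      unfolding right_diff_distrib[symmetric] of_real_diff[symmetric] by (simp add: norm_mult del: of_real_mult of_real_diff)
     also have "... \<le> K * d" unfolding abs_mult by (intro mult_mono K K0 less_imp_le[OF pg]) auto
     finally show "cmod (iexp (\<Sum>q\<in>Q. t q * X u q) * complex_of_real (f (X u) * g (cos (a * X u q)))
      - iexp (\<Sum>q\<in>Q. t q * X u q) * complex_of_real (f (X u) * p (cos (a * X u q)))) \<le> K * d" .
    qed
    finally show ?thesis using Kd by (simp add: prob_space)
   qed
   have "(\<lambda>i. ?E p (A i)) \<longlonglongrightarrow> ?E p G" by (rule testfunD(3)[OF T Q])
   from LIMSEQ_D[OF this, of "r / 4"] r obtain n0 where n0: "!!i. n0 \<le> i ==> cmod (?E p (A i) - ?E p G) < r / 4" by auto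
   show "\<exists>no. \<forall>i\<ge>no. cmod (?E g (A i) - ?E g G) < r"
   proof (intro exI allI impI)
    fix i assume i: "n0 \<le> i"
    have 1: "cmod (?E g (A i) - ?E p (A i)) \<le> r / 4" using mA Q by (intro close) auto
    have 2: "cmod (?E g G - ?E p G) \<le> r / 4" using mG Q by (intro close) auto
    have tri: "cmod (x - w) \<le> cmod (x - y) + cmod (y - z) + cmod (w - z)" for x y z w :: complex
     using norm_triangle_ineq4[of "(x - y) + (y - z)" "w - z"] norm_triangle_ineq[of "x - y" "y - z"] by simp
    show "cmod (?E g (A i) - ?E g G) < r"
     using tri[of "?E g (A i)" "?E g G" "?E p (A i)" "?E p G"] 1 2 n0[OF i] r by linarith
   qed
  qed
 qed
qed

lemma testfun_prod:
 assumes "finite Q" "Q \<subseteq> I" and g: "continuous_on {-1..1} (g :: real => real)"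
 shows "testfun (\<lambda>x. \<Prod>q\<in>Q. g (cos (a * x q)))"
 using assms(1,2)
proof (induction Q rule: finite_induct)
 case (insert q Q)
 then show ?case using testfun_mult_continuous[OF _ g insert.IH, of q a] by (simp add: mult.commute)
qed (simp add: testfun_one)

lemma expectation_testfun_tendsto:
 assumes "testfun f"
 shows "(\<lambda>i. (\<E> w. f (A i w))) \<longlonglongrightarrow> (\<E> w. f (G w))"
proof -
 have "(\<lambda>i. (\<E> w. iexp (\<Sum>q\<in>{}. 0 * A i w q) * f (A i w))) \<longlonglongrightarrow> (\<E> w. iexp (\<Sum>q\<in>{}. 0 * G w q) * f (G w))"
  by (rule testfunD(3)[OF assms]) auto
 then have "(\<lambda>i. complex_of_real ((\<E> w. f (A i w)))) \<longlonglongrightarrow> complex_of_real ((\<E> w. f (G w)))"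
  by simp
 then show ?thesis by (simp only: tendsto_of_real_iff)
qed

end

section \<open>Box probabilities and maxima over an infinite index set\<close>

lemma box_event:
 assumes "countable I" "!!q. q \<in> I ==> (\<lambda>w. X w q) \<in> borel_measurable M"
 shows "{w\<in>space M. \<forall>q\<in>I. \<bar>X w q :: real\<bar> \<le> z} \<in> sets M"
proof -
 have "{w\<in>space M. \<not> \<bar>X w q\<bar> \<le> z} \<in> sets M" if "q \<in> I" for q
 proof -
  note [measurable] = assms(2)[OF that]
  show ?thesis by measurable
 qed
 then have "(\<Union>q\<in>I. {w\<in>space M. \<not> \<bar>X w q\<bar> \<le> z}) \<in> sets M" using assms(1) by (intro sets.countable_UN'') auto
 moreover have "{w\<in>space M. \<forall>q\<in>I. \<bar>X w q\<bar> \<le> z} = space M - (\<Union>q\<in>I. {w\<in>space M. \<not> \<bar>X w q\<bar> \<le> z})" by blast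
 ultimately show ?thesis by auto
qed

text \<open>On [-L, L] the cosine of pi x / L is a decreasing function of |x|, so a ramp in the
  cosine is a ramp in |x|. Beyond that interval periodicity destroys the information, which is why
  the range is later confined by tightness.\<close>

lemma cosine_ramp:
 fixes y e L :: real
 assumes "0 < y" "0 < e" "y + e < L"
 obtains g :: "real => real" where "continuous_on {-1..1} g" "!!u. 0 \<le> g u" "!!u. g u \<le> 1"
  "!!x. \<bar>x\<bar> \<le> y ==> g (cos (pi / L * x)) = 1" "!!x. y + e \<le> \<bar>x\<bar> ==> \<bar>x\<bar> \<le> L ==> g (cos (pi / L * x)) = 0"
proof -
 define c where "c x = cos (pi / L * x)" for x
 have cabs: "c x = c \<bar>x\<bar>" for x unfolding c_def by (cases "0 \<le> x") auto
 have mono: "c b \<le> c a" if "0 \<le> a" "a \<le> b" "b \<le> L" for a b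
 proof -
  have "pi / L * b \<le> pi / L * L" using that assms by (intro mult_left_mono) auto
  then have "pi / L * b \<le> pi" using assms by simp
  then show ?thesis unfolding c_def using that assms by (intro cos_monotone_0_pi_le mult_left_mono) auto
 qed
 have strict: "c (y + e) < c y"
 proof -
  have "pi / L * (y + e) \<le> pi / L * L" using assms by (intro mult_left_mono) auto
  then have "pi / L * (y + e) \<le> pi" using assms by simp
  then show ?thesis unfolding c_def using assms by (intro cos_monotone_0_pi mult_strict_left_mono) auto
 qed
 define g where "g u = max 0 (min 1 ((u - c (y + e)) / (c y - c (y + e))))" for u
 show ?thesis
 proof (rule that)
  show "continuous_on {-1..1} g" unfolding g_def using strict by (intro continuous_intros) auto
  show "0 \<le> g u" "g u \<le> 1" for u unfolding g_def by auto
  show "g (cos (pi / L * x)) = 1" if "\<bar>x\<bar> \<le> y" for x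
   unfolding g_def c_def[symmetric] using mono[of "\<bar>x\<bar>" y] cabs[of x] that strict assms by (simp add: min_def le_divide_eq)
  show "g (cos (pi / L * x)) = 0" if "y + e \<le> \<bar>x\<bar>" "\<bar>x\<bar> \<le> L" for x
  proof -
   have "c x \<le> c (y + e)" using mono[of "y + e" "\<bar>x\<bar>"] cabs[of x] that assms by simp
   then have "(c x - c (y + e)) / (c y - c (y + e)) \<le> 0" using strict by (intro divide_nonpos_pos) auto
   then show ?thesis unfolding g_def c_def[symmetric] by simp
  qed
 qed
qed

context prob_space
begin

text \<open>The projections are meant to have finite images. Closeness to them replaces a modulus of
  continuity and needs no metric on the index set, so products with a finite set of replicates are
  covered as well.\<close>

definition equicont_on :: "(nat => 'q => 'q) => 'q set => (nat => 'a => 'q => real) => bool" where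
 "equicont_on \<pi> I X \<longleftrightarrow> (\<forall>e>0. \<exists>N0. \<forall>N\<ge>N0. whp e (\<lambda>i w. \<forall>p\<in>I. \<bar>X i w p - X i w (\<pi> N p)\<bar> \<le> e))"

lemma equicont_onD:
 assumes "equicont_on \<pi> I X" "0 < e" "0 < d"
 shows "\<exists>N0. \<forall>N\<ge>N0. whp e (\<lambda>i w. \<forall>p\<in>I. \<bar>X i w p - X i w (\<pi> N p)\<bar> \<le> d)"
proof -
 have "0 < min e d" using assms by simp
 then obtain N0 where N0: "!!N. N \<ge> N0 ==> whp (min e d) (\<lambda>i w. \<forall>p\<in>I. \<bar>X i w p - X i w (\<pi> N p)\<bar> \<le> min e d)"
  using assms(1) unfolding equicont_on_def by blast
 show ?thesis by (intro exI[of _ N0] allI impI whp_mono[OF N0]) auto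
qed

text \<open>If some coordinate is at least y + e in absolute value but within [-L, L], the product
  contains a zero factor. The event \<open>E\<close>, on which a coordinate may leave [-L, L], is
  paid for separately and only in the upper bound.\<close>

lemma box_sandwich:
 fixes X :: "'a => 'q => real"
 assumes Q: "finite Q" and X: "!!q. q \<in> Q ==> (\<lambda>v. X v q) \<in> borel_measurable M"
  and g: "continuous_on {-1..1} g" "!!u. 0 \<le> g u" "!!u. g u \<le> (1::real)"
  "!!x. \<bar>x\<bar> \<le> y ==> g (cos (pi / L * x)) = 1" "!!x. y + e \<le> \<bar>x\<bar> ==> \<bar>x\<bar> \<le> L ==> g (cos (pi / L * x)) = 0"
  and E: "E \<in> events" "!!v q. v \<in> space M ==> v \<notin> E ==> q \<in> Q ==> \<bar>X v q\<bar> \<le> L"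
 shows "prob {v\<in>space M. \<forall>q\<in>Q. \<bar>X v q\<bar> \<le> y} \<le> (\<E> v. \<Prod>q\<in>Q. g (cos (pi / L * X v q)))"
  and "(\<E> v. \<Prod>q\<in>Q. g (cos (pi / L * X v q))) \<le> prob {v\<in>space M. \<forall>q\<in>Q. \<bar>X v q\<bar> \<le> y + e} + prob E"
proof -
 note [measurable] = E(1)
 have gm: "(\<lambda>y. g (cos (pi / L * y))) \<in> borel_measurable borel"
  by (intro borel_measurable_continuous_onI continuous_on_compose2[OF g(1)] continuous_on_cos continuous_on_mult_left continuous_on_id) auto
 let ?f = "\<lambda>v. \<Prod>q\<in>Q. g (cos (pi / L * X v q))"
 have m: "?f \<in> borel_measurable M" using measurable_compose[OF X gm] by (intro borel_measurable_prod)
 have f01: "0 \<le> ?f v" "?f v \<le> 1" for v using g(2,3) by (auto intro!: prod_nonneg prod_le_1)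
 have i: "integrable M ?f" by (rule integrable_const_bound[of _ 1]) (use m f01 in auto)
 have box[measurable]: "{v\<in>space M. \<forall>q\<in>Q. \<bar>X v q\<bar> \<le> z} \<in> events" for z
 proof (rule sets.sets_Collect_finite_All[OF _ Q])
  fix q assume "q \<in> Q"
  note [measurable] = X[OF this]
  show "{v\<in>space M. \<bar>X v q\<bar> \<le> z} \<in> events" by measurable
 qed
 have "prob {v\<in>space M. \<forall>q\<in>Q. \<bar>X v q\<bar> \<le> y} = expectation (indicator {v\<in>space M. \<forall>q\<in>Q. \<bar>X v q\<bar> \<le> y})" by simp
 also have "... \<le> expectation ?f"
 proof (rule integral_mono)
  fix v show "indicator {v\<in>space M. \<forall>q\<in>Q. \<bar>X v q\<bar> \<le> y} v \<le> ?f v"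
   using f01[of v] g(4) by (auto simp: indicator_def)
 qed (use i box in \<open>auto simp: emeasure_eq_measure\<close>)
 finally show "prob {v\<in>space M. \<forall>q\<in>Q. \<bar>X v q\<bar> \<le> y} \<le> expectation ?f" .
 have "expectation ?f \<le> (\<E> v. indicator {v\<in>space M. \<forall>q\<in>Q. \<bar>X v q\<bar> \<le> y + e} v + indicator E v)"
 proof (rule integral_mono)
  show "integrable M (\<lambda>v. indicator {v\<in>space M. \<forall>q\<in>Q. \<bar>X v q\<bar> \<le> y + e} v + indicator E v :: real)"
   using box E by (intro integrable_add) (auto simp: emeasure_eq_measure)
  fix v assume w: "v \<in> space M"
  show "?f v \<le> indicator {v\<in>space M. \<forall>q\<in>Q. \<bar>X v q\<bar> \<le> y + e} v + indicator E v"
  proof (cases "v \<in> E \<or> (\<forall>q\<in>Q. \<bar>X v q\<bar> \<le> y + e)")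
   case True
   then show ?thesis using f01[of v] w by (auto simp: indicator_def)
  next
   case False
   then obtain q where q: "q \<in> Q" "y + e \<le> \<bar>X v q\<bar>" "v \<notin> E" by force
   then have "g (cos (pi / L * X v q)) = 0" using E(2)[OF w] by (intro g(5)) auto
   then have "?f v = 0" using q Q by (intro prod_zero) auto
   then show ?thesis by simp
  qed
 qed (rule i)
 also have "... = prob {v\<in>space M. \<forall>q\<in>Q. \<bar>X v q\<bar> \<le> y + e} + prob E"
  using box E by (subst integral_add) (auto simp: emeasure_eq_measure Int_absorb1 sets.sets_into_space)
 finally show "expectation ?f \<le> prob {v\<in>space M. \<forall>q\<in>Q. \<bar>X v q\<bar> \<le> y + e} + prob E" .
qed

end

context fdd_convergence
begin

lemma box_probability:
 assumes Q: "finite Q" "Q \<subseteq> I" and y: "0 < y" and e: "0 < e" and d: "0 < d"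
  and tA: "tight_on I A" and tG: "tight_on I (\<lambda>_. G)"
 shows "\<forall>\<^sub>F i in sequentially. prob {w\<in>space M. \<forall>q\<in>Q. \<bar>A i w q\<bar> \<le> y} \<le> prob {w\<in>space M. \<forall>q\<in>Q. \<bar>G w q\<bar> \<le> y + e} + d"
  and "\<forall>\<^sub>F i in sequentially. prob {w\<in>space M. \<forall>q\<in>Q. \<bar>G w q\<bar> \<le> y} \<le> prob {w\<in>space M. \<forall>q\<in>Q. \<bar>A i w q\<bar> \<le> y + e} + d"
proof -
 have d2: "0 < d / 2" using d by simp
 obtain K1 where K1: "whp (d / 2) (\<lambda>i w. \<forall>p\<in>I. \<bar>A i w p\<bar> \<le> K1)"
  using tA d2 unfolding tight_on_def by blast
 obtain K2 where "whp (d / 2) (\<lambda>i w. \<forall>p\<in>I. \<bar>G w p\<bar> \<le> K2)"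
  using tG d2 unfolding tight_on_def by blast
 then obtain E where E: "E \<in> events" "prob E \<le> d / 2" "!!w p. w \<in> space M ==> w \<notin> E ==> p \<in> I ==> \<bar>G w p\<bar> \<le> K2"
  by auto
 define L where "L = max (y + e + 1) (max K1 K2)"
 have L: "y + e < L" "K1 \<le> L" "K2 \<le> L" unfolding L_def by auto
 obtain g where g: "continuous_on {-1..1} g" "!!u. 0 \<le> g u" "!!u. g u \<le> (1::real)"
  "!!x. \<bar>x\<bar> \<le> y ==> g (cos (pi / L * x)) = 1" "!!x. y + e \<le> \<bar>x\<bar> ==> \<bar>x\<bar> \<le> L ==> g (cos (pi / L * x)) = 0"
  using cosine_ramp[OF y e L(1)] by blast
 let ?E = "\<lambda>X. (\<E> w. \<Prod>q\<in>Q. g (cos (pi / L * X w q)))"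
 have lim: "(\<lambda>i. ?E (A i)) \<longlonglongrightarrow> ?E G"
  by (rule expectation_testfun_tendsto[OF testfun_prod[OF Q g(1)]])
 have EG: "!!w q. w \<in> space M ==> w \<notin> E ==> q \<in> Q ==> \<bar>G w q\<bar> \<le> L" using E(3) L(3) Q by force
 have mA: "!!q. q \<in> Q ==> (\<lambda>w. A i w q) \<in> borel_measurable M" for i using Q by auto
 have mG: "!!q. q \<in> Q ==> (\<lambda>w. G w q) \<in> borel_measurable M" using Q by auto
 note GG = box_sandwich[where X = G and y = y and e = e, OF Q(1) mG g E(1) EG]
 have "\<forall>\<^sub>F i in sequentially. ?E (A i) < ?E G + d / 2" using order_tendstoD(2)[OF lim, of "?E G + d / 2"] d by simp
 then show "\<forall>\<^sub>F i in sequentially. prob {w\<in>space M. \<forall>q\<in>Q. \<bar>A i w q\<bar> \<le> y} \<le> prob {w\<in>space M. \<forall>q\<in>Q. \<bar>G w q\<bar> \<le> y + e} + d"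
  using K1
 proof eventually_elim
  case (elim i)
  obtain F where F: "F \<in> events" "\<forall>w\<in>space M - F. \<forall>p\<in>I. \<bar>A i w p\<bar> \<le> K1" using elim(2) by blast
  have "!!w q. w \<in> space M ==> w \<notin> F ==> q \<in> Q ==> \<bar>A i w q\<bar> \<le> L" using F(2) L(2) Q by force
  from box_sandwich(1)[where X = "A i" and y = y and e = e, OF Q(1) mA g F(1) this] GG(2) E(2) elim(1) show ?case by linarith
 qed
 have "\<forall>\<^sub>F i in sequentially. ?E G - d / 2 < ?E (A i)" using order_tendstoD(1)[OF lim, of "?E G - d / 2"] d by simp
 then show "\<forall>\<^sub>F i in sequentially. prob {w\<in>space M. \<forall>q\<in>Q. \<bar>G w q\<bar> \<le> y} \<le> prob {w\<in>space M. \<forall>q\<in>Q. \<bar>A i w q\<bar> \<le> y + e} + d"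
  using K1
 proof eventually_elim
  case (elim i)
  obtain F where F: "F \<in> events" "prob F \<le> d / 2" "\<forall>w\<in>space M - F. \<forall>p\<in>I. \<bar>A i w p\<bar> \<le> K1" using elim(2) by blast
  have "!!w q. w \<in> space M ==> w \<notin> F ==> q \<in> Q ==> \<bar>A i w q\<bar> \<le> L" using F(3) L(2) Q by force
  from box_sandwich(2)[where X = "A i" and y = y and e = e, OF Q(1) mA g F(1) this] GG(1) F(2) elim(1) show ?case by linarith
 qed
qed

lemma (in prob_space) prob_le_outside:
 assumes "A \<in> events" "B \<in> events" "E \<in> events" "A - E \<subseteq> B"
 shows "prob A \<le> prob B + prob E"
proof -
 have "prob A \<le> prob (B \<union> E)" using assms by (intro finite_measure_mono) auto
 also have "... \<le> prob B + prob E" using assms by (intro measure_Un_le)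
 finally show ?thesis .
qed

text \<open>The maximum over \<open>I\<close> is compared with that over the finite net
  \<open>Q\<close>: restricting to the net is free in one direction and costs e by equicontinuity in
  the other. On the net the box estimates apply, and continuity of the limit at x absorbs the
  enlargements.\<close>

theorem sup_convergence:
 fixes B :: "nat => 'a => 'q => real"
 assumes I: "countable I" and \<pi>: "!!N. \<pi> N ` I \<subseteq> I" "!!N. finite (\<pi> N ` I)"
  and B: "!!i q. q \<in> I ==> (\<lambda>u. B i u q) \<in> borel_measurable M"
  and tA: "tight_on I A" and tG: "tight_on I (\<lambda>_. G)"
  and eA: "equicont_on \<pi> I A" and eG: "equicont_on \<pi> I (\<lambda>_. G)"
  and null: "null_on I (\<lambda>i u q. B i u q - A i u q)"
  and x: "0 < x" and cont: "isCont (\<lambda>x. prob {u\<in>space M. \<forall>q\<in>I. \<bar>G u q\<bar> \<le> x}) x"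
 shows "(\<lambda>i. prob {u\<in>space M. \<forall>q\<in>I. \<bar>B i u q\<bar> \<le> x}) \<longlonglongrightarrow> prob {u\<in>space M. \<forall>q\<in>I. \<bar>G u q\<bar> \<le> x}"
proof -
 define F where "F x = prob {u\<in>space M. \<forall>q\<in>I. \<bar>G u q\<bar> \<le> x}" for x
 have evB: "{u\<in>space M. \<forall>q\<in>I. \<bar>B i u q\<bar> \<le> z} \<in> events" for i z by (rule box_event[OF I B])
 have evG: "{u\<in>space M. \<forall>q\<in>J. \<bar>G u q\<bar> \<le> z} \<in> events" if "J \<subseteq> I" for J z
  using that by (intro box_event[OF countable_subset[OF that I]]) auto
 have evA: "{u\<in>space M. \<forall>q\<in>J. \<bar>A i u q\<bar> \<le> z} \<in> events" if "J \<subseteq> I" for J i z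
  using that by (intro box_event[OF countable_subset[OF that I]]) auto
 have "\<forall>\<^sub>F i in sequentially. \<bar>prob {u\<in>space M. \<forall>q\<in>I. \<bar>B i u q\<bar> \<le> x} - F x\<bar> < r" if r: "0 < r" for r
 proof -
  obtain s where s: "0 < s" "!!z. \<bar>z - x\<bar> < s ==> \<bar>F z - F x\<bar> < r / 2"
  proof -
   have "isCont F x" using cont unfolding F_def .
   then have "0 < r / 2 \<longrightarrow> (\<exists>s>0. \<forall>z. dist z x < s \<longrightarrow> dist (F z) (F x) < r / 2)" unfolding continuous_at_eps_delta by (rule spec)
   then have "\<exists>s>0. \<forall>z. dist z x < s \<longrightarrow> dist (F z) (F x) < r / 2" using r by simp
   then show ?thesis using that unfolding dist_real_def by blast
  qed
  \<comment> \<open>The losses are 3 e above x and 4 e below. This e keeps both within the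
    continuity radius s and keeps x - 4 e positive, as the box estimates require.\<close>
  define e where "e = min s x / 8"
  have e: "0 < e" "6 * e < s" "6 * e < x" using s x unfolding e_def by auto
  define d where "d = r / 8"
  have d: "0 < d" using r unfolding d_def by simp
  obtain N1 where N1: "!!N. N1 \<le> N ==> whp d (\<lambda>i u. \<forall>p\<in>I. \<bar>A i u p - A i u (\<pi> N p)\<bar> \<le> e)"
   using equicont_onD[OF eA d e(1)] by blast
  obtain N2 where N2: "!!N. N2 \<le> N ==> whp d (\<lambda>i u. \<forall>p\<in>I. \<bar>G u p - G u (\<pi> N p)\<bar> \<le> e)"
   using equicont_onD[OF eG d e(1)] by blast
  define N where "N = max N1 N2"
  define Q where "Q = \<pi> N ` I"
  have Q: "finite Q" "Q \<subseteq> I" using \<pi> unfolding Q_def by auto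
  have piQ: "\<pi> N p \<in> Q" if "p \<in> I" for p using that unfolding Q_def by auto
  obtain EG where EG: "EG \<in> events" "prob EG \<le> d" "!!u p. u \<in> space M ==> u \<notin> EG ==> p \<in> I ==> \<bar>G u p - G u (\<pi> N p)\<bar> \<le> e"
   using N2[of N] unfolding N_def by auto
  have nA: "whp d (\<lambda>i u. \<forall>p\<in>I. \<bar>A i u p - A i u (\<pi> N p)\<bar> \<le> e)"
   by (rule N1) (simp add: N_def)
  have x1: "0 < x + e" "0 < x - 4 * e" using x e by auto
  have up: "\<forall>\<^sub>F i in sequentially. prob {u\<in>space M. \<forall>q\<in>I. \<bar>B i u q\<bar> \<le> x} \<le> F (x + 3 * e) + 3 * d"
   using box_probability(1)[OF Q x1(1) e(1) d tA tG] null_onD[OF null d e(1)]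
  proof eventually_elim
   case (elim i)
   then obtain E where E: "E \<in> events" "prob E \<le> d" "\<forall>u\<in>space M - E. \<forall>p\<in>I. \<bar>B i u p - A i u p\<bar> \<le> e" by blast
   have "prob {u\<in>space M. \<forall>q\<in>I. \<bar>B i u q\<bar> \<le> x} \<le> prob {u\<in>space M. \<forall>q\<in>Q. \<bar>A i u q\<bar> \<le> x + e} + prob E"
   proof (rule prob_le_outside[OF evB evA[OF Q(2)] E(1)], safe)
    fix u q assume w: "u \<in> space M" "u \<notin> E" "\<forall>q\<in>I. \<bar>B i u q\<bar> \<le> x" "q \<in> Q"
    then have "\<bar>B i u q\<bar> \<le> x" "\<bar>B i u q - A i u q\<bar> \<le> e" using Q E(3) by auto
    then show "\<bar>A i u q\<bar> \<le> x + e" by linarith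
   qed
   also have "... \<le> (prob {u\<in>space M. \<forall>q\<in>Q. \<bar>G u q\<bar> \<le> x + e + e} + d) + d" using elim(1) E(2) by (rule add_mono)
   also have "prob {u\<in>space M. \<forall>q\<in>Q. \<bar>G u q\<bar> \<le> x + e + e} \<le> F (x + 3 * e) + prob EG"
    unfolding F_def
   proof (rule prob_le_outside[OF evG[OF Q(2)] evG[OF order_refl] EG(1)], safe)
    fix u q assume w: "u \<in> space M" "u \<notin> EG" "\<forall>q\<in>Q. \<bar>G u q\<bar> \<le> x + e + e" "q \<in> I"
    then have "\<bar>G u (\<pi> N q)\<bar> \<le> x + e + e" "\<bar>G u q - G u (\<pi> N q)\<bar> \<le> e" using piQ EG(3) by auto
    then show "\<bar>G u q\<bar> \<le> x + 3 * e" by linarith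
   qed
   finally show ?case using EG(2) by simp
  qed
  have low: "\<forall>\<^sub>F i in sequentially. F (x - 4 * e) \<le> prob {u\<in>space M. \<forall>q\<in>I. \<bar>B i u q\<bar> \<le> x} + 3 * d"
   using box_probability(2)[OF Q x1(2) e(1) d tA tG] null_onD[OF null d e(1)] nA
  proof eventually_elim
   case (elim i)
   then obtain E where E: "E \<in> events" "prob E \<le> d" "\<forall>u\<in>space M - E. \<forall>p\<in>I. \<bar>B i u p - A i u p\<bar> \<le> e" by blast
   obtain E' where E': "E' \<in> events" "prob E' \<le> d" "\<forall>u\<in>space M - E'. \<forall>p\<in>I. \<bar>A i u p - A i u (\<pi> N p)\<bar> \<le> e" using elim by blast
   have "F (x - 4 * e) \<le> prob {u\<in>space M. \<forall>q\<in>Q. \<bar>G u q\<bar> \<le> x - 4 * e}"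
    unfolding F_def using evG[OF Q(2)] Q(2) by (intro finite_measure_mono) auto
   also have "... \<le> prob {u\<in>space M. \<forall>q\<in>Q. \<bar>A i u q\<bar> \<le> x - 4 * e + e} + d" by (rule elim)
   also have "prob {u\<in>space M. \<forall>q\<in>Q. \<bar>A i u q\<bar> \<le> x - 4 * e + e} \<le> prob {u\<in>space M. \<forall>q\<in>I. \<bar>B i u q\<bar> \<le> x} + prob (E \<union> E')"
   proof (rule prob_le_outside[OF evA[OF Q(2)] evB], use E(1) E'(1) in blast, safe)
    fix u q assume w: "u \<in> space M" "u \<notin> E" "u \<notin> E'" "\<forall>q\<in>Q. \<bar>A i u q\<bar> \<le> x - 4 * e + e" "q \<in> I"
    then have "\<bar>A i u (\<pi> N q)\<bar> \<le> x - 4 * e + e" "\<bar>A i u q - A i u (\<pi> N q)\<bar> \<le> e" "\<bar>B i u q - A i u q\<bar> \<le> e" using piQ E(3) E'(3) by auto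
    then show "\<bar>B i u q\<bar> \<le> x" using e by linarith
   qed
   finally show ?case using prob_Un_le[OF E(1) E'(1) E(2) E'(2)] by simp
  qed
  have F1: "\<bar>F (x + 3 * e) - F x\<bar> < r / 2" "\<bar>F (x - 4 * e) - F x\<bar> < r / 2" using e by (intro s(2); simp)+
  show ?thesis using up low
  proof eventually_elim
   case (elim i)
   then show ?case using F1 unfolding d_def by linarith
  qed
 qed
 then show ?thesis unfolding tendsto_iff dist_real_def F_def by blast
qed

end

section \<open>Gaussian sequences\<close>

text \<open>Gaussian elimination: entry (i, j) after k steps is the covariance left over once the
  first k variables are projected out. A zero pivot is harmless, since division by 0 yields 0 and a
  nonnegative definite matrix has a zero column there anyway.\<close>

fun schur :: "(nat => nat => real) => nat => nat => nat => real" where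
 "schur C 0 i j = C i j"
| "schur C (Suc k) i j = schur C k i j - schur C k i k * schur C k j k / schur C k k k"

definition psd :: "(nat => nat => real) => bool" where
 "psd C \<longleftrightarrow> (\<forall>i j. C i j = C j i) \<and> (\<forall>n t. 0 \<le> (\<Sum>i<n. \<Sum>j<n. t i * t j * C i j))"

lemma psdD:
 assumes "psd C"
 shows "C i j = C j i" "0 \<le> (\<Sum>i<n. \<Sum>j<n. t i * t j * C i j)"
 using assms unfolding psd_def by blast+

text \<open>The quadratic form at t - a e_k. Suitable a and t give the sign of the diagonal, the
  vanishing of a column under a zero diagonal entry, and the Schur step.\<close>

lemma psd_quadratic_update:
 assumes "psd C" "k < n"
 shows "(\<Sum>i<n. \<Sum>j<n. (t i - (if i = k then a else 0)) * (t j - (if j = k then a else 0)) * C i j)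
  = (\<Sum>i<n. \<Sum>j<n. t i * t j * C i j) - 2 * a * (\<Sum>i<n. t i * C i k) + a\<^sup>2 * C k k"
proof -
 define d where "d j = (if j = k then a else 0)" for j
 have D: "(\<Sum>j<n. d j * f j) = a * f k" for f :: "nat => real"
 proof -
  have "(\<Sum>j<n. d j * f j) = (\<Sum>j<n. if j = k then a * f j else 0)" unfolding d_def by (intro sum.cong) auto
  then show ?thesis using assms(2) by simp
 qed
 define h where "h i = (\<Sum>j<n. t j * C i j) - a * C i k" for i
 have "(\<Sum>j<n. (t i - d i) * (t j - d j) * C i j) = t i * h i - d i * h i" for i
 proof -
  have "(\<Sum>j<n. (t i - d i) * (t j - d j) * C i j) = (t i - d i) * ((\<Sum>j<n. t j * C i j) - (\<Sum>j<n. d j * C i j))"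
   by (subst sum_subtractf[symmetric]) (simp add: sum_distrib_left algebra_simps)
  then show ?thesis unfolding h_def D by (simp add: left_diff_distrib)
 qed
 then have "(\<Sum>i<n. \<Sum>j<n. (t i - d i) * (t j - d j) * C i j) = (\<Sum>i<n. t i * h i) - a * h k"
  by (simp add: sum_subtractf D)
 also have "(\<Sum>i<n. t i * h i) = (\<Sum>i<n. \<Sum>j<n. t i * t j * C i j) - a * (\<Sum>i<n. t i * C i k)"
  unfolding h_def by (simp add: right_diff_distrib sum_subtractf sum_distrib_left ac_simps)
 also have "h k = (\<Sum>i<n. t i * C i k) - a * C k k"
 proof -
  have "t j * C k j = t j * C j k" for j by (rule arg_cong[OF psdD(1)[OF assms(1)]])
  then show ?thesis unfolding h_def by (simp only:)
 qed
 finally show ?thesis unfolding d_def by (simp add: power2_eq_square algebra_simps)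
qed

lemma psd_diag_nonneg:
 assumes "psd C"
 shows "0 \<le> C k k"
proof -
 have "0 \<le> (\<Sum>i<Suc k. \<Sum>j<Suc k. (0 - (if i = k then 1 else 0)) * (0 - (if j = k then 1 else 0)) * C i j)"
  by (rule psdD(2)[OF assms])
 then show ?thesis unfolding psd_quadratic_update[OF assms lessI, where t = "\<lambda>_. 0"] by simp
qed

lemma psd_zero_diag:
 assumes "psd C" "C k k = 0"
 shows "C i k = 0"
proof (rule ccontr)
 assume nz: "C i k \<noteq> 0"
 define n where "n = Suc (max i k)"
 have n: "i < n" "k < n" unfolding n_def by auto
 \<comment> \<open>Makes 2 a C i k = 2 C i i + 2, so that the quadratic form at e_i - a e_k would be
   - C i i - 2 < 0.\<close>
 define a where "a = (C i i + 1) / C i k"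
 define t where "t j = 0 - (if j = i then - 1 else 0 :: real)" for j
 have s: "(\<Sum>j<n. t j * C j k) = C i k"
 proof -
  have "(\<Sum>j<n. t j * C j k) = (\<Sum>j<n. if j = i then C j k else 0)" unfolding t_def by (intro sum.cong) auto
  then show ?thesis using n by simp
 qed
 have d: "(\<Sum>i'<n. \<Sum>j<n. t i' * t j * C i' j) = C i i"
  unfolding t_def psd_quadratic_update[OF assms(1) n(1), where t = "\<lambda>_. 0"] by simp
 have "0 \<le> (\<Sum>i'<n. \<Sum>j<n. (t i' - (if i' = k then a else 0)) * (t j - (if j = k then a else 0)) * C i' j)"
  by (rule psdD(2)[OF assms(1)])
 also have "... = C i i - 2 * a * C i k" unfolding psd_quadratic_update[OF assms(1) n(2)] d s assms(2) by simp
 also have "2 * a * C i k = 2 * C i i + 2" unfolding a_def using nz by (simp add: field_simps)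
 finally show False using psd_diag_nonneg[OF assms(1), of i] by simp
qed

text \<open>For a nonzero pivot the new form at t is the minimum of the old one over the coefficient
  at k, attained at a = b / C k k, and so inherits nonnegativity. For a zero pivot the convention x
  / 0 = 0 leaves the form unchanged.\<close>

lemma psd_schur_step:
 assumes "psd C"
 shows "psd (\<lambda>i j. C i j - C i k * C j k / C k k)"
 unfolding psd_def
proof (intro conjI allI)
 show "C i j - C i k * C j k / C k k = C j i - C j k * C i k / C k k" for i j
  using psdD(1)[OF assms, of i j] by (simp add: mult.commute)
 fix n and t :: "nat => real"
 \<comment> \<open>Extension by zero, so that the index k lies in the range of summation even if n
   <= k.\<close>
 define t' where "t' i = (if i < n then t i else 0)" for i
 define N where "N = max n (Suc k)"
 have k: "k < N" unfolding N_def by simp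
 have ext: "(\<Sum>i<n. f i) = (\<Sum>i<N. if i < n then f i else 0)" for f :: "nat => real"
  unfolding N_def by (intro sum.mono_neutral_cong_left) auto
 have e2: "(\<Sum>i<n. \<Sum>j<n. t i * t j * F i j) = (\<Sum>i<N. \<Sum>j<N. t' i * t' j * F i j)" for F
  unfolding ext t'_def by (intro sum.cong refl) (auto intro!: sum.cong)
 define b where "b = (\<Sum>i<N. t' i * C i k)"
 define a where "a = b / C k k"
 have "0 \<le> (\<Sum>i<N. \<Sum>j<N. (t' i - (if i = k then a else 0)) * (t' j - (if j = k then a else 0)) * C i j)"
  by (rule psdD(2)[OF assms])
 also have "... = (\<Sum>i<N. \<Sum>j<N. t' i * t' j * C i j) - 2 * a * b + a\<^sup>2 * C k k"
  unfolding psd_quadratic_update[OF assms k] b_def ..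
 also have "... = (\<Sum>i<N. \<Sum>j<N. t' i * t' j * C i j) - b * b / C k k"
  unfolding a_def by (simp add: power2_eq_square)
 also have "b * b / C k k = (\<Sum>i<N. \<Sum>j<N. t' i * t' j * (C i k * C j k / C k k))"
  unfolding b_def sum_product by (simp add: sum_divide_distrib ac_simps)
 also have "(\<Sum>i<N. \<Sum>j<N. t' i * t' j * C i j) - ... = (\<Sum>i<N. \<Sum>j<N. t' i * t' j * (C i j - C i k * C j k / C k k))"
  by (simp add: sum_subtractf[symmetric] right_diff_distrib)
 finally show "0 \<le> (\<Sum>i<n. \<Sum>j<n. t i * t j * (C i j - C i k * C j k / C k k))" unfolding e2 .
qed

lemma psd_schur: "psd C ==> psd (schur C k)"
proof (induction k)
 case 0
 then show ?case by (simp add: psd_def)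
next
 case (Suc k)
 have "schur C (Suc k) = (\<lambda>i j. schur C k i j - schur C k i k * schur C k j k / schur C k k k)" by (simp add: fun_eq_iff)
 then show ?case using psd_schur_step[OF Suc.IH[OF Suc.prems]] by simp
qed

lemma schur_zero_row:
 assumes "psd C" "i < k"
 shows "schur C k i j = 0"
 using assms(2)
proof (induction k arbitrary: j)
 case (Suc k)
 have p: "psd (schur C k)" by (rule psd_schur[OF assms(1)])
 have sym: "schur C k a b = schur C k b a" for a b by (rule psdD(1)[OF p])
 show ?case
 proof (cases "i = k")
  case True
  show ?thesis
  proof (cases "schur C k k k = 0")
   case True
   then show ?thesis using psd_zero_diag[OF p True, of j] sym[of k j] \<open>i = k\<close> by simp
  next
   case False
   then show ?thesis using sym[of k j] \<open>i = k\<close> by simp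
  qed
 next
  case False
  then show ?thesis using Suc by simp
 qed
qed simp

definition cholesky :: "(nat => nat => real) => nat => nat => real" where
 "cholesky C i k = schur C k i k / sqrt (schur C k k k)"

lemma cholesky_upper: "psd C ==> i < k ==> cholesky C i k = 0"
 unfolding cholesky_def by (simp add: schur_zero_row)

text \<open>Each elimination step subtracts one term of rank one. After more than i steps row i of
  the remainder is zero, so the expansion is finite and exact.\<close>

lemma cholesky_product:
 assumes "psd C" "i < K"
 shows "C i j = (\<Sum>k<K. cholesky C i k * cholesky C j k)"
proof -
 have "C i j = (\<Sum>k<K. cholesky C i k * cholesky C j k) + schur C K i j" for K
 proof (induction K)
  case (Suc K)
  have "0 \<le> schur C K K K" by (rule psd_diag_nonneg[OF psd_schur[OF assms(1)]])
  then have "cholesky C i K * cholesky C j K = schur C K i K * schur C K j K / schur C K K K"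
   unfolding cholesky_def by simp
  then show ?case using Suc.IH by simp
 qed simp
 from this[of K] show ?thesis using schur_zero_row[OF assms] by simp
qed

section \<open>Independence and Gaussian linear combinations\<close>

context prob_space
begin

text \<open>Conditioning on \<open>Y\<close>, expressed as an iterated integral over two copies of
  the same space.\<close>

lemma indep_var_Fubini:
 assumes ind: "indep_var N1 Y N2 Z" and f[measurable]: "f \<in> borel_measurable (N1 \<Otimes>\<^sub>M N2)"
 shows "(\<integral>\<^sup>+w. f (Y w, Z w) \<partial>M) = (\<integral>\<^sup>+w. \<integral>\<^sup>+\<omega>'. f (Y w, Z \<omega>') \<partial>M \<partial>M)"
proof -
 have [measurable]: "Y \<in> measurable M N1" "Z \<in> measurable M N2"
  and eq: "distr M N1 Y \<Otimes>\<^sub>M distr M N2 Z = distr M (N1 \<Otimes>\<^sub>M N2) (\<lambda>x. (Y x, Z x))"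
  using ind unfolding indep_var_distribution_eq by auto
 interpret Z: prob_space "distr M N2 Z" by (rule prob_space_distr) simp
 interpret Y: prob_space "distr M N1 Y" by (rule prob_space_distr) simp
 have fs: "f \<in> borel_measurable (distr M N1 Y \<Otimes>\<^sub>M distr M N2 Z)" by (simp cong: measurable_cong_sets)
 have "(\<integral>\<^sup>+w. f (Y w, Z w) \<partial>M) = integral\<^sup>N (distr M (N1 \<Otimes>\<^sub>M N2) (\<lambda>x. (Y x, Z x))) f"
  by (subst nn_integral_distr) auto
 also have "... = (\<integral>\<^sup>+y. \<integral>\<^sup>+z. f (y, z) \<partial>distr M N2 Z \<partial>distr M N1 Y)"
  unfolding eq[symmetric] by (rule Z.nn_integral_fst[symmetric]) (rule fs)
 also have "... = (\<integral>\<^sup>+y. \<integral>\<^sup>+\<omega>'. f (y, Z \<omega>') \<partial>M \<partial>distr M N1 Y)"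
  by (intro nn_integral_cong nn_integral_distr) auto
 also have "... = (\<integral>\<^sup>+w. \<integral>\<^sup>+\<omega>'. f (Y w, Z \<omega>') \<partial>M \<partial>M)"
 proof -
  have "(\<lambda>y. \<integral>\<^sup>+\<omega>'. f (y, Z \<omega>') \<partial>M) \<in> borel_measurable N1" by measurable
  then show ?thesis by (subst nn_integral_distr) auto
 qed
 finally show ?thesis .
qed

lemma indep_var_Fubini_real:
 fixes f :: "_ => real"
 assumes ind: "indep_var N1 Y N2 Z" and f[measurable]: "f \<in> borel_measurable (N1 \<Otimes>\<^sub>M N2)" and B: "!!x. \<bar>f x\<bar> \<le> B"
 shows "(\<E> w. f (Y w, Z w)) = (\<E> w. expectation (\<lambda>\<omega>'. f (Y w, Z \<omega>')))"
proof -
 have [measurable]: "Y \<in> measurable M N1" "Z \<in> measurable M N2"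
  using ind unfolding indep_var_distribution_eq by auto
 have nn: "0 \<le> f x + B" for x using B[of x] by linarith
 have i: "integrable M (\<lambda>\<omega>'. f (y, Z \<omega>'))" if "y \<in> space N1" for y
 proof (rule integrable_const_bound[of _ B])
  have "(\<lambda>\<omega>'. (y, Z \<omega>')) \<in> measurable M (N1 \<Otimes>\<^sub>M N2)" using that by measurable
  then show "(\<lambda>\<omega>'. f (y, Z \<omega>')) \<in> borel_measurable M" by measurable
 qed (auto simp: B)
 have i2: "integrable M (\<lambda>w. f (Y w, Z w))" by (rule integrable_const_bound[of _ B]) (auto simp: B)
 have m: "(\<lambda>w. expectation (\<lambda>\<omega>'. f (Y w, Z \<omega>'))) \<in> borel_measurable M" by measurable
 have b: "\<bar>expectation (\<lambda>\<omega>'. f (Y w, Z \<omega>'))\<bar> \<le> B" if "w \<in> space M" for w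
 proof -
  have Yw: "Y w \<in> space N1" using that by (rule measurable_space[rotated]) simp
  have "\<bar>expectation (\<lambda>\<omega>'. f (Y w, Z \<omega>'))\<bar> \<le> expectation (\<lambda>\<omega>'. \<bar>f (Y w, Z \<omega>')\<bar>)"
   by (rule integral_abs_bound)
  also have "... \<le> expectation (\<lambda>\<omega>'. B)" by (rule integral_mono) (use i[OF Yw] B in auto)
  finally show ?thesis by (simp add: prob_space)
 qed
 have i3: "integrable M (\<lambda>w. expectation (\<lambda>\<omega>'. f (Y w, Z \<omega>')))"
  by (rule integrable_const_bound[of _ B]) (use b m in auto)
 have "ennreal ((\<E> w. f (Y w, Z w)) + B) = ennreal ((\<E> w. f (Y w, Z w) + B))"
  using i2 by (simp add: prob_space)
 also have "... = (\<integral>\<^sup>+w. ennreal (f (Y w, Z w) + B) \<partial>M)"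
  using i2 nn by (intro nn_integral_eq_integral[symmetric]) auto
 also have "... = (\<integral>\<^sup>+w. \<integral>\<^sup>+\<omega>'. ennreal (f (Y w, Z \<omega>') + B) \<partial>M \<partial>M)"
  using indep_var_Fubini[OF ind, of "\<lambda>x. ennreal (f x + B)"] by simp
 also have "... = (\<integral>\<^sup>+w. ennreal (expectation (\<lambda>\<omega>'. f (Y w, Z \<omega>')) + B) \<partial>M)"
 proof (rule nn_integral_cong)
  fix w assume "w \<in> space M"
  then have Yw: "Y w \<in> space N1" by (rule measurable_space[rotated]) simp
  show "(\<integral>\<^sup>+\<omega>'. ennreal (f (Y w, Z \<omega>') + B) \<partial>M) = ennreal (expectation (\<lambda>\<omega>'. f (Y w, Z \<omega>')) + B)"
   using i[OF Yw] nn by (subst nn_integral_eq_integral) (auto simp: prob_space)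
 qed
 also have "... = ennreal ((\<E> w. expectation (\<lambda>\<omega>'. f (Y w, Z \<omega>'))) + B)"
 proof -
  have "AE w in M. 0 \<le> expectation (\<lambda>\<omega>'. f (Y w, Z \<omega>')) + B"
  proof (rule AE_I2)
   fix w assume "w \<in> space M"
   from b[OF this] show "0 \<le> expectation (\<lambda>\<omega>'. f (Y w, Z \<omega>')) + B" by linarith
  qed
  then show ?thesis using i3 by (subst nn_integral_eq_integral) (auto simp: prob_space)
 qed
 finally have "ennreal ((\<E> w. f (Y w, Z w)) + B) = ennreal ((\<E> w. expectation (\<lambda>\<omega>'. f (Y w, Z \<omega>'))) + B)" .
 moreover have "\<bar>(\<E> w. g w)\<bar> \<le> B" if "integrable M g" "!!w. w \<in> space M ==> \<bar>g w\<bar> \<le> B" for g :: "'a => real"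
 proof -
  have "\<bar>expectation g\<bar> \<le> (\<E> w. \<bar>g w\<bar>)" by (rule integral_abs_bound)
  also have "... \<le> (\<E> w. B)" by (rule integral_mono) (use that in auto)
  finally show ?thesis by (simp add: prob_space)
 qed
 note this[OF i2 B] this[OF i3 b]
 ultimately show ?thesis by (simp add: abs_le_iff ennreal_inj)
qed

lemma std_normal_varD:
 assumes "std_normal_var M x"
 shows "x \<in> borel_measurable M" "distr M borel x = std_normal_distribution"
proof -
 show m: "x \<in> borel_measurable M" using distributed_measurable[OF assms[unfolded std_normal_var_def]] by simp
 have "distr M lborel x = density lborel (\<lambda>y. ennreal (std_normal_density y))"
  using assms unfolding std_normal_var_def by (rule distributed_distr_eq_density)
 then show "distr M borel x = std_normal_distribution"
  by (simp add: distr_cong[OF refl sets_lborel refl])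
qed

text \<open>By characteristic functions and uniqueness. The law is written as the image of the
  standard normal law under scaling, so that variance 0 needs no separate case.\<close>

lemma std_normal_linear_distr:
 fixes Z :: "'i => 'a => real"
 assumes ind: "indep_vars (\<lambda>_. borel) Z K" and n: "!!k. k \<in> K ==> std_normal_var M (Z k)"
 shows "distr M borel (\<lambda>w. \<Sum>k\<in>K. a k * Z k w) = distr std_normal_distribution borel (\<lambda>x. sqrt (\<Sum>k\<in>K. (a k)\<^sup>2) * x)"
proof (rule Levy_uniqueness)
 have m[measurable]: "Z k \<in> borel_measurable M" if "k \<in> K" for k using std_normal_varD[OF n[OF that]] by simp
 show "real_distribution (distr M borel (\<lambda>w. \<Sum>k\<in>K. a k * Z k w))" by (rule real_distribution_distr) measurable
 interpret N: real_distribution std_normal_distribution by (rule real_dist_normal_dist)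
 show "real_distribution (distr std_normal_distribution borel (\<lambda>x. sqrt (\<Sum>k\<in>K. (a k)\<^sup>2) * x))"
  by (rule N.real_distribution_distr) measurable
 show "char (distr M borel (\<lambda>w. \<Sum>k\<in>K. a k * Z k w)) = char (distr std_normal_distribution borel (\<lambda>x. sqrt (\<Sum>k\<in>K. (a k)\<^sup>2) * x))"
 proof
  fix t
  have c: "char (distr std_normal_distribution borel (\<lambda>x. s * x)) t = exp (- ((s * t)\<^sup>2 / 2))" for s
  proof -
   have "char (distr std_normal_distribution borel (\<lambda>x. s * x)) t = char std_normal_distribution (s * t)"
    unfolding char_def by (subst integral_distr) (auto simp: ac_simps)
   then show ?thesis unfolding char_std_normal_distribution by simp
  qed
  have "indep_vars (\<lambda>_. borel) (\<lambda>k w. a k * Z k w) K"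
   using indep_vars_compose2[OF ind, of "\<lambda>k x. a k * x" "\<lambda>_. borel"] by simp
  then have "char (distr M borel (\<lambda>w. \<Sum>k\<in>K. a k * Z k w)) t = (\<Prod>k\<in>K. char (distr M borel (\<lambda>w. a k * Z k w)) t)"
   by (rule char_distr_sum)
  also have "... = (\<Prod>k\<in>K. complex_of_real (exp (- ((a k * t)\<^sup>2 / 2))))"
  proof (rule prod.cong[OF refl])
   fix k assume k: "k \<in> K"
   have "distr M borel (\<lambda>w. a k * Z k w) = distr (distr M borel (Z k)) borel (\<lambda>x. a k * x)"
    using m[OF k] by (subst distr_distr) (auto simp: o_def)
   then show "char (distr M borel (\<lambda>w. a k * Z k w)) t = complex_of_real (exp (- ((a k * t)\<^sup>2 / 2)))"
    unfolding std_normal_varD(2)[OF n[OF k]] c[symmetric] by simp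
  qed
  also have "... = complex_of_real (\<Prod>k\<in>K. exp (- ((a k * t)\<^sup>2 / 2)))" by simp
  also have "(\<Prod>k\<in>K. exp (- ((a k * t)\<^sup>2 / 2))) = exp (- ((sqrt (\<Sum>k\<in>K. (a k)\<^sup>2) * t)\<^sup>2 / 2))"
  proof (cases "finite K")
   case True
   then show ?thesis by (simp add: exp_sum[symmetric] power_mult_distrib sum_nonneg sum_distrib_right sum_divide_distrib sum_negf)
  qed simp
  finally show "char (distr M borel (\<lambda>w. \<Sum>k\<in>K. a k * Z k w)) t = char (distr std_normal_distribution borel (\<lambda>x. sqrt (\<Sum>k\<in>K. (a k)\<^sup>2) * x)) t"
   unfolding c .
 qed
qed

lemma std_normal_linear_iexp:
 assumes ind: "indep_vars (\<lambda>_. borel) Z K" and n: "!!k. k \<in> K ==> std_normal_var M (Z k)"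
 shows "(\<E> w. iexp (\<Sum>k\<in>K. a k * Z k w)) = exp (- ((\<Sum>k\<in>K. (a k)\<^sup>2) / 2))"
proof -
 have [measurable]: "Z k \<in> borel_measurable M" if "k \<in> K" for k using std_normal_varD[OF n[OF that]] by simp
 have D: "distr M borel (\<lambda>w. \<Sum>k\<in>K. a k * Z k w) = distr std_normal_distribution borel (\<lambda>x. sqrt (\<Sum>k\<in>K. (a k)\<^sup>2) * x)"
  by (rule std_normal_linear_distr[OF ind n])
 have "(\<E> w. iexp (\<Sum>k\<in>K. a k * Z k w)) = char (distr M borel (\<lambda>w. \<Sum>k\<in>K. a k * Z k w)) 1"
  unfolding char_def by (subst integral_distr) auto
 also have "... = char std_normal_distribution (sqrt (\<Sum>k\<in>K. (a k)\<^sup>2))"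
  unfolding D char_def by (subst integral_distr) auto
 finally show ?thesis unfolding char_std_normal_distribution by (simp add: sum_nonneg)
qed

definition gauss_moment :: "nat => real" where
 "gauss_moment p = (LINT x|std_normal_distribution. \<bar>x\<bar> ^ p)"

lemma std_normal_linear_moment:
 assumes ind: "indep_vars (\<lambda>_. borel) Z K" and n: "!!k. k \<in> K ==> std_normal_var M (Z k)"
 shows "integrable M (\<lambda>w. \<bar>\<Sum>k\<in>K. a k * Z k w\<bar> ^ p)"
  and "(\<E> w. \<bar>\<Sum>k\<in>K. a k * Z k w\<bar> ^ p) = gauss_moment p * sqrt (\<Sum>k\<in>K. (a k)\<^sup>2) ^ p"
proof -
 have [measurable]: "Z k \<in> borel_measurable M" if "k \<in> K" for k using std_normal_varD[OF n[OF that]] by simp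
 have D: "distr M borel (\<lambda>w. \<Sum>k\<in>K. a k * Z k w) = distr std_normal_distribution borel (\<lambda>x. sqrt (\<Sum>k\<in>K. (a k)\<^sup>2) * x)"
  by (rule std_normal_linear_distr[OF ind n])
 have i: "integrable std_normal_distribution (\<lambda>x. \<bar>x\<bar> ^ p)"
  using integrable_std_normal_moment_abs[of p] by (subst integrable_density) (auto simp: normal_density_nonneg)
 have abs: "\<bar>sqrt (\<Sum>k\<in>K. (a k)\<^sup>2) * x\<bar> ^ p = sqrt (\<Sum>k\<in>K. (a k)\<^sup>2) ^ p * \<bar>x\<bar> ^ p" for x
  by (simp add: abs_mult power_mult_distrib sum_nonneg)
 have "integrable (distr M borel (\<lambda>w. \<Sum>k\<in>K. a k * Z k w)) (\<lambda>x. \<bar>x\<bar> ^ p)"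
  unfolding D using i by (subst integrable_distr_eq) (auto simp: abs)
 then show "integrable M (\<lambda>w. \<bar>\<Sum>k\<in>K. a k * Z k w\<bar> ^ p)" by (subst (asm) integrable_distr_eq) auto
 have "(\<E> w. \<bar>\<Sum>k\<in>K. a k * Z k w\<bar> ^ p) = (LINT x|distr M borel (\<lambda>w. \<Sum>k\<in>K. a k * Z k w). \<bar>x\<bar> ^ p)"
  by (subst integral_distr) auto
 also have "... = (LINT x|std_normal_distribution. sqrt (\<Sum>k\<in>K. (a k)\<^sup>2) ^ p * \<bar>x\<bar> ^ p)"
  unfolding D by (subst integral_distr) (auto simp: abs)
 finally show "(\<E> w. \<bar>\<Sum>k\<in>K. a k * Z k w\<bar> ^ p) = gauss_moment p * sqrt (\<Sum>k\<in>K. (a k)\<^sup>2) ^ p"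
  by (simp add: gauss_moment_def)
qed

lemma gauss_moment_nonneg: "0 \<le> gauss_moment p"
 unfolding gauss_moment_def by (intro integral_nonneg) simp

end

section \<open>Gaussian fields on the dyadic points\<close>

context prob_space
begin

lemma equicont_on_dyads:
 fixes X :: "nat => 'a => pt => real"
 assumes X: "!!i p. (\<lambda>w. X i w p) \<in> borel_measurable M"
  and m: "\<forall>\<^sub>F i in sequentially. \<forall>N p. integrable M (\<lambda>w. \<bar>X i w (dyad2 (Suc N) p) - X i w (dyad2 N p)\<bar> ^ k) \<and>
    (\<E> w. \<bar>X i w (dyad2 (Suc N) p) - X i w (dyad2 N p)\<bar> ^ k) \<le> C * (1 / 2 ^ N) powr g"
  and g: "2 < g" and k: "0 < k" and C: "0 \<le> C"
 shows "equicont_on dyad2 dyads X"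
 unfolding equicont_on_def
proof (intro allI impI)
 fix e :: real assume e: "0 < e"
 have "(\<lambda>N. C * chain_bound g k N / e ^ k) \<longlonglongrightarrow> C * 0 / e ^ k"
  using e by (intro tendsto_intros chain_bound_props g k) auto
 then have "\<forall>\<^sub>F N in sequentially. C * chain_bound g k N / e ^ k < e" using order_tendstoD(2) e by fastforce
 then obtain N0 where N0: "!!N. N0 \<le> N ==> C * chain_bound g k N / e ^ k < e" unfolding eventually_sequentially by blast
 show "\<exists>N0. \<forall>N\<ge>N0. whp e (\<lambda>i w. \<forall>p\<in>dyads. \<bar>X i w p - X i w (dyad2 N p)\<bar> \<le> e)"
 proof (intro exI allI impI)
  fix N assume N: "N0 \<le> N"
  show "whp e (\<lambda>i w. \<forall>p\<in>dyads. \<bar>X i w p - X i w (dyad2 N p)\<bar> \<le> e)"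
   using m
  proof eventually_elim
   case (elim i)
   obtain A where A: "A \<in> events" "prob A \<le> C * chain_bound g k N / e ^ k"
    "!!w p. w \<in> space M ==> w \<notin> A ==> p \<in> dyads ==> \<bar>X i w p - X i w (dyad2 N p)\<bar> \<le> e"
    using dyadic_chaining[of "X i", OF X _ _ g k e C, of N thesis] elim by blast
   with N0[OF N] show ?case by (intro bexI[of _ A]) auto
  qed
 qed
qed

lemma tight_on_pointwise_moment:
 fixes X :: "nat => 'a => 'q => real"
 assumes X: "!!i. (\<lambda>w. X i w q) \<in> borel_measurable M" and k: "0 < k"
  and m: "\<forall>\<^sub>F i in sequentially. integrable M (\<lambda>w. \<bar>X i w q\<bar> ^ k) \<and> (\<E> w. \<bar>X i w q\<bar> ^ k) \<le> C"
 shows "tight_on {q} X"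
 unfolding tight_on_def
proof (intro allI impI)
 fix e :: real assume e: "0 < e"
 \<comment> \<open>The level at which Markov's inequality gives e; the summand 1 keeps K positive
   when C = 0.\<close>
 define K where "K = root k (\<bar>C\<bar> / e + 1)"
 have K: "0 < K" "K ^ k = \<bar>C\<bar> / e + 1" unfolding K_def using e k by (auto intro!: real_root_gt_zero real_root_pow_pos2 add_nonneg_pos)
 have le: "C / K ^ k \<le> e"
 proof -
  have "e * K ^ k = \<bar>C\<bar> + e" unfolding K(2) using e by (simp add: distrib_left)
  then have "C \<le> e * K ^ k" using e by linarith
  then show ?thesis using K(1) by (simp add: divide_le_eq)
 qed
 show "\<exists>K. whp e (\<lambda>i w. \<forall>p\<in>{q}. \<bar>X i w p\<bar> \<le> K)"
 proof (rule exI[of _ K], use m in eventually_elim)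
  case (elim i)
  note [measurable] = X[of i]
  show ?case
  proof (intro bexI[of _ "{w\<in>space M. K < \<bar>X i w q\<bar>}"] conjI)
   have "prob {w\<in>space M. K < \<bar>X i w q\<bar>} \<le> (\<E> w. \<bar>X i w q\<bar> ^ k) / K ^ k"
    using elim K by (intro prob_power_Markov X) auto
   also have "... \<le> C / K ^ k" using elim K(1) by (intro divide_right_mono) auto
   finally show "prob {w\<in>space M. K < \<bar>X i w q\<bar>} \<le> e" using le by simp
  qed auto
 qed
qed

lemma tight_on_Un:
 assumes "tight_on I X" "tight_on J X"
 shows "tight_on (I \<union> J) X"
 unfolding tight_on_def
proof (intro allI impI)
 fix e :: real assume e: "0 < e"
 then have h: "0 < e / 2" by auto
 from assms(1)[unfolded tight_on_def, rule_format, OF h] obtain K where K: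
  "whp (e / 2) (\<lambda>i w. \<forall>p\<in>I. \<bar>X i w p\<bar> \<le> K)" by blast
 from assms(2)[unfolded tight_on_def, rule_format, OF h] obtain L where L:
  "whp (e / 2) (\<lambda>i w. \<forall>p\<in>J. \<bar>X i w p\<bar> \<le> L)" by blast
 show "\<exists>K. whp e (\<lambda>i w. \<forall>p\<in>I \<union> J. \<bar>X i w p\<bar> \<le> K)"
 proof (rule exI[of _ "max K L"], use K L in eventually_elim)
  case (elim i)
  then obtain A B where A: "A \<in> events" "prob A \<le> e / 2" "\<forall>w\<in>space M - A. \<forall>p\<in>I. \<bar>X i w p\<bar> \<le> K"
   and B: "B \<in> events" "prob B \<le> e / 2" "\<forall>w\<in>space M - B. \<forall>p\<in>J. \<bar>X i w p\<bar> \<le> L" by blast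
  show ?case
  proof (intro bexI[of _ "A \<union> B"] conjI ballI)
   show "prob (A \<union> B) \<le> e" using prob_Un_le[OF A(1) B(1) A(2) B(2)] by simp
   fix w p assume "w \<in> space M - (A \<union> B)" "p \<in> I \<union> J"
   then show "\<bar>X i w p\<bar> \<le> max K L" using A(3) B(3) by (auto simp: le_max_iff_disj)
  qed (use A B in auto)
 qed
qed

lemma tight_on_finite: "finite Q ==> (!!q. q \<in> Q ==> tight_on {q} X) ==> tight_on Q X"
proof (induction Q rule: finite_induct)
 case empty
 then show ?case unfolding tight_on_def by (intro allI impI exI[of _ 0] always_eventually bexI[of _ "{}"]) auto
next
 case (insert q Q)
 then show ?case using tight_on_Un[of "{q}" X Q] by simp
qed

text \<open>With high probability every coordinate is within 1 of a coordinate in a finite net, so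
  tightness at single points suffices.\<close>

lemma equicont_imp_tight:
 assumes e: "equicont_on \<pi> I X" and fin: "!!N. finite (\<pi> N ` I)" and t: "!!N q. q \<in> \<pi> N ` I ==> tight_on {q} X"
 shows "tight_on I X"
 unfolding tight_on_def
proof (intro allI impI)
 fix e :: real assume e0: "0 < e"
 then have h: "0 < e / 2" by auto
 obtain N where N: "whp (e / 2) (\<lambda>i w. \<forall>p\<in>I. \<bar>X i w p - X i w (\<pi> N p)\<bar> \<le> 1)"
 proof -
  obtain N0 where "\<forall>N\<ge>N0. whp (e / 2) (\<lambda>i w. \<forall>p\<in>I. \<bar>X i w p - X i w (\<pi> N p)\<bar> \<le> 1)"
   using equicont_onD[OF e h zero_less_one] ..
  then show ?thesis by (intro that[of N0]) simp
 qed
 have "tight_on (\<pi> N ` I) X" by (rule tight_on_finite[OF fin t])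
 from this[unfolded tight_on_def, rule_format, OF h] obtain K where K:
  "whp (e / 2) (\<lambda>i w. \<forall>p\<in>\<pi> N ` I. \<bar>X i w p\<bar> \<le> K)" by blast
 show "\<exists>K. whp e (\<lambda>i w. \<forall>p\<in>I. \<bar>X i w p\<bar> \<le> K)"
 proof (rule exI[of _ "K + 1"], use K N in eventually_elim)
  case (elim i)
  then obtain A B where A: "A \<in> events" "prob A \<le> e / 2" "\<forall>w\<in>space M - A. \<forall>p\<in>\<pi> N ` I. \<bar>X i w p\<bar> \<le> K"
   and B: "B \<in> events" "prob B \<le> e / 2" "\<forall>w\<in>space M - B. \<forall>p\<in>I. \<bar>X i w p - X i w (\<pi> N p)\<bar> \<le> 1" by blast
  show ?case
  proof (intro bexI[of _ "A \<union> B"] conjI ballI)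
   show "prob (A \<union> B) \<le> e" using prob_Un_le[OF A(1) B(1) A(2) B(2)] by simp
   fix w p assume "w \<in> space M - (A \<union> B)" "p \<in> I"
   then have "\<bar>X i w (\<pi> N p)\<bar> \<le> K" "\<bar>X i w p - X i w (\<pi> N p)\<bar> \<le> 1" using A B by auto
   then show "\<bar>X i w p\<bar> \<le> K + 1" by linarith
  qed (use A B in auto)
 qed
qed

end

text \<open>The normal density at x is at most that at x / \<open>\<sigma>\<close>, so the law of a
  standard normal Z is at most \<open>\<sigma>\<close> times the law of \<open>\<sigma>\<close>
  Z.\<close>

lemma std_normal_scaling_le:
 fixes f :: "real => ennreal"
 assumes [measurable]: "f \<in> borel_measurable borel" and s: "1 \<le> \<sigma>"
 shows "(\<integral>\<^sup>+x. f x \<partial>std_normal_distribution) \<le> ennreal \<sigma> * (\<integral>\<^sup>+x. f (\<sigma> * x) \<partial>std_normal_distribution)"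
proof -
 have "(\<integral>\<^sup>+x. f x \<partial>std_normal_distribution) = (\<integral>\<^sup>+x. ennreal (std_normal_density x) * f x \<partial>lborel)"
  by (subst nn_integral_density) auto
 also have "... \<le> (\<integral>\<^sup>+x. ennreal (std_normal_density (x / \<sigma>)) * f x \<partial>lborel)"
 proof (intro nn_integral_mono mult_right_mono ennreal_leI)
  fix x :: real
  have "\<bar>x / \<sigma>\<bar> \<le> \<bar>x\<bar>" using s by (simp add: divide_le_eq abs_divide mult_le_cancel_left1)
  then have "(x / \<sigma>)\<^sup>2 \<le> x\<^sup>2" by (simp only: abs_le_square_iff)
  then show "std_normal_density x \<le> std_normal_density (x / \<sigma>)"
   unfolding std_normal_density_def by (intro mult_left_mono) auto
 qed simp
 also have "... = \<bar>\<sigma>\<bar> * (\<integral>\<^sup>+x. ennreal (std_normal_density ((0 + \<sigma> * x) / \<sigma>)) * f (0 + \<sigma> * x) \<partial>lborel)"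
  using s by (intro nn_integral_real_affine) auto
 also have "... = ennreal \<sigma> * (\<integral>\<^sup>+x. f (\<sigma> * x) \<partial>std_normal_distribution)"
  using s by (subst nn_integral_density) auto
 finally show ?thesis .
qed

definition scale_first :: "real => nat => (nat => real) => nat => real" where
 "scale_first \<sigma> K z k = (if k < K then \<sigma> * z k else z k)"

locale gaussian_sequence = prob_space M for M :: "'a measure" +
 fixes Z :: "nat => 'a => real"
 assumes Z_indep: "indep_vars (\<lambda>_. borel) Z UNIV" and Z_normal: "!!k. std_normal_var M (Z k)"
begin

lemma Z_meas[measurable]: "Z k \<in> borel_measurable M"
 using std_normal_varD[OF Z_normal] by simp

lemma Z_indep_on: "indep_vars (\<lambda>_. borel) Z K"
 by (rule indep_vars_subset[OF Z_indep]) simp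

lemma Z_scaled_meas[measurable]: "(\<lambda>w. scale_first \<sigma> K (\<lambda>k. Z k w)) \<in> measurable M (\<Pi>\<^sub>M k\<in>UNIV. borel)"
 by (rule measurable_PiM_single') (auto simp: scale_first_def space_PiM PiE_def extensional_def)

text \<open>Fubini freezes all coordinates except \<open>K\<close>, and the one-dimensional
  comparison of laws is applied to that coordinate.\<close>

lemma scaling_step:
 assumes H[measurable]: "H \<in> sets (\<Pi>\<^sub>M k\<in>(UNIV::nat set). (borel::real measure))" and s: "1 \<le> \<sigma>"
 shows "prob {u\<in>space M. scale_first \<sigma> K (\<lambda>k. Z k u) \<in> H} \<le> \<sigma> * prob {u\<in>space M. scale_first \<sigma> (Suc K) (\<lambda>k. Z k u) \<in> H}"
proof -
 let ?N = "\<Pi>\<^sub>M k\<in>(UNIV - {K}). (borel::real measure)"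
 define V where "V u = restrict (\<lambda>k. Z k u) (UNIV - {K})" for u
 let ?N1 = "\<Pi>\<^sub>M k\<in>{K}. (borel::real measure)"
 define W where "W u = restrict (\<lambda>k. Z k u) {K}" for u
 have ind: "indep_var ?N V ?N1 W"
  unfolding V_def W_def by (rule indep_var_restrict[OF Z_indep]) auto
 have WK: "W u K = Z K u" for u unfolding W_def by simp
 have [measurable]: "(\<lambda>w. w K) \<in> borel_measurable ?N1" by (rule measurable_component_singleton) simp
 \<comment> \<open>Reassembles the sequence, already scaled below K, with coordinate K left open:
   inserting Z K means K scaled coordinates, inserting \<open>\<sigma>\<close> Z K means K +
   1.\<close>
 define m where "m v x = (\<lambda>k. if k = K then x else if k < K then \<sigma> * v k else v k)" for v x
 have mm[measurable]: "(\<lambda>y. m (fst y) (snd y)) \<in> measurable (?N \<Otimes>\<^sub>M borel) (\<Pi>\<^sub>M k\<in>UNIV. borel)"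
 proof (rule measurable_PiM_single')
  fix k
  show "(\<lambda>y. m (fst y) (snd y) k) \<in> borel_measurable (?N \<Otimes>\<^sub>M borel)"
  proof (cases "k = K")
   case False
   then have [measurable]: "(\<lambda>v. v k) \<in> borel_measurable ?N" by (intro measurable_component_singleton) auto
   show ?thesis using False unfolding m_def by (cases "k < K") (simp_all, measurable)
  qed (simp add: m_def)
 qed (auto simp: space_PiM)
 have e1: "scale_first \<sigma> K (\<lambda>k. Z k u) = m (V u) (Z K u)" for u unfolding scale_first_def m_def V_def by auto
 have e2: "scale_first \<sigma> (Suc K) (\<lambda>k. Z k u) = m (V u) (\<sigma> * Z K u)" for u unfolding scale_first_def m_def V_def by (auto simp: less_Suc_eq)
 define f where "f v x = (indicator H (m v x) :: ennreal)" for v x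
 have fm[measurable]: "(\<lambda>y. f (fst y) (snd y)) \<in> borel_measurable (?N \<Otimes>\<^sub>M borel)" unfolding f_def by measurable
 have [measurable]: "(\<lambda>y. f (fst y) (c * snd y K)) \<in> borel_measurable (?N \<Otimes>\<^sub>M ?N1)" for c
  using measurable_compose[where f = "\<lambda>y. (fst y, c * snd y K)", OF _ fm] by simp
 from this[of 1] have [measurable]: "(\<lambda>y. f (fst y) (snd y K)) \<in> borel_measurable (?N \<Otimes>\<^sub>M ?N1)" by simp
 have Vm[measurable]: "V \<in> measurable M ?N" using ind unfolding indep_var_distribution_eq by auto
 have fs[measurable]: "(\<lambda>x. f (V (fst x)) (\<sigma> * Z K (snd x))) \<in> borel_measurable (M \<Otimes>\<^sub>M M)"
  by (rule measurable_compose[where f = "\<lambda>x. (V (fst x), \<sigma> * Z K (snd x))", OF _ fm, simplified]) measurable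
 have ind_f: "(\<integral>\<^sup>+u. f (V u) (X u) \<partial>M) = emeasure M {u\<in>space M. m (V u) (X u) \<in> H}" if [measurable]: "X \<in> borel_measurable M" for X
 proof -
  have "(\<lambda>u. m (V u) (X u)) \<in> measurable M (\<Pi>\<^sub>M k\<in>UNIV. borel)"
   using measurable_compose[where f = "\<lambda>u. (V u, X u)", OF _ mm] by simp
  then have "{u\<in>space M. m (V u) (X u) \<in> H} \<in> events" by measurable
  then have "emeasure M {u\<in>space M. m (V u) (X u) \<in> H} = (\<integral>\<^sup>+u. indicator {u\<in>space M. m (V u) (X u) \<in> H} u \<partial>M)" by simp
  also have "... = (\<integral>\<^sup>+u. f (V u) (X u) \<partial>M)"
   unfolding f_def by (intro nn_integral_cong) (auto simp: indicator_def)
  finally show ?thesis by simp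
 qed
 have B: "(\<integral>\<^sup>+u. f (V u) (Z K u) \<partial>M) = (\<integral>\<^sup>+u. \<integral>\<^sup>+\<omega>'. f (V u) (Z K \<omega>') \<partial>M \<partial>M)"
  using indep_var_Fubini[OF ind, of "\<lambda>y. f (fst y) (snd y K)"] by (simp add: WK)
 have E: "(\<integral>\<^sup>+u. f (V u) (\<sigma> * Z K u) \<partial>M) = (\<integral>\<^sup>+u. \<integral>\<^sup>+\<omega>'. f (V u) (\<sigma> * Z K \<omega>') \<partial>M \<partial>M)"
  using indep_var_Fubini[OF ind, of "\<lambda>y. f (fst y) (\<sigma> * snd y K)"] by (simp add: WK)
 have C: "(\<integral>\<^sup>+\<omega>'. f (V u) (Z K \<omega>') \<partial>M) \<le> ennreal \<sigma> * (\<integral>\<^sup>+\<omega>'. f (V u) (\<sigma> * Z K \<omega>') \<partial>M)" if w: "u \<in> space M" for u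
 proof -
  have "V u \<in> space ?N" using w Vm by (rule measurable_space[rotated])
  then have "(\<lambda>x. (V u, x)) \<in> measurable borel (?N \<Otimes>\<^sub>M borel)" by measurable
  from measurable_compose[OF this fm] have fV[measurable]: "f (V u) \<in> borel_measurable borel" by simp
  have d: "(\<integral>\<^sup>+\<omega>'. h (Z K \<omega>') \<partial>M) = (\<integral>\<^sup>+x. h x \<partial>std_normal_distribution)" if [measurable]: "h \<in> borel_measurable borel" for h :: "real => ennreal"
   unfolding std_normal_varD(2)[OF Z_normal[of K], symmetric] by (subst nn_integral_distr) auto
  show ?thesis using std_normal_scaling_le[OF fV s] d[OF fV] d[of "\<lambda>x. f (V u) (\<sigma> * x)"] by simp
 qed
 have "emeasure M {u\<in>space M. scale_first \<sigma> K (\<lambda>k. Z k u) \<in> H} = (\<integral>\<^sup>+u. \<integral>\<^sup>+\<omega>'. f (V u) (Z K \<omega>') \<partial>M \<partial>M)"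
  unfolding e1 B[symmetric] by (rule ind_f[symmetric]) simp
 also have "... \<le> (\<integral>\<^sup>+u. ennreal \<sigma> * (\<integral>\<^sup>+\<omega>'. f (V u) (\<sigma> * Z K \<omega>') \<partial>M) \<partial>M)"
  by (intro nn_integral_mono C)
 also have "... = ennreal \<sigma> * (\<integral>\<^sup>+u. \<integral>\<^sup>+\<omega>'. f (V u) (\<sigma> * Z K \<omega>') \<partial>M \<partial>M)"
  by (rule nn_integral_cmult) measurable
 also have "... = ennreal \<sigma> * emeasure M {u\<in>space M. scale_first \<sigma> (Suc K) (\<lambda>k. Z k u) \<in> H}"
  unfolding e2 E[symmetric] by (subst ind_f) auto
 finally show ?thesis using s by (simp add: emeasure_eq_measure ennreal_mult[symmetric])
qed

lemma scaling_inequality: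
 assumes H: "H \<in> sets (\<Pi>\<^sub>M k\<in>(UNIV::nat set). (borel::real measure))" and s: "1 \<le> \<sigma>"
 shows "prob {w\<in>space M. (\<lambda>k. Z k w) \<in> H} \<le> \<sigma> ^ K * prob {w\<in>space M. scale_first \<sigma> K (\<lambda>k. Z k w) \<in> H}"
proof (induction K)
 case 0
 then show ?case by (simp add: scale_first_def)
next
 case (Suc K)
 have "\<sigma> ^ K * prob {w\<in>space M. scale_first \<sigma> K (\<lambda>k. Z k w) \<in> H} \<le> \<sigma> ^ K * (\<sigma> * prob {w\<in>space M. scale_first \<sigma> (Suc K) (\<lambda>k. Z k w) \<in> H})"
  using s by (intro mult_left_mono scaling_step[OF H s]) auto
 with Suc.IH show ?case by (simp add: ac_simps)
qed

end

text \<open>The field is realised as lower-triangular combinations of \<open>Z\<close> along an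
  enumeration of the dyadic points, so each value involves finitely many coordinates.
  \<open>cov_incr\<close> bounds the h-th power of the increment variance, which up to
  \<open>gauss_moment\<close> is the moment of order 2 h used in chaining.\<close>

locale gaussian_field = gaussian_sequence M Z for M :: "'a measure" and Z +
 fixes \<Gamma> :: "pt => pt => real" and C g :: real and h :: nat
 assumes cov_sym: "!!p q. \<Gamma> p q = \<Gamma> q p"
  and cov_psd: "!!n t x. 0 \<le> (\<Sum>i<n. \<Sum>j<n. t i * t j * \<Gamma> (x (i::nat)) (x j))"
  and cov_incr: "!!N p. (\<Gamma> (dyad2 (Suc N) p) (dyad2 (Suc N) p) - 2 * \<Gamma> (dyad2 (Suc N) p) (dyad2 N p) + \<Gamma> (dyad2 N p) (dyad2 N p)) ^ h \<le> C * (1 / 2 ^ N) powr g"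
  and g: "2 < g" and h: "1 \<le> h" and C: "0 \<le> C"
begin

definition idx :: "pt => nat" where
 "idx = to_nat_on dyads"

definition L :: "pt => nat => real" where
 "L p k = cholesky (\<lambda>i j. \<Gamma> (from_nat_into dyads i) (from_nat_into dyads j)) (idx p) k"

text \<open>The contribution of the coordinates from \<open>K\<close> on: \<open>res 0\<close> is
  the field itself, and \<open>res K\<close> is the part that scaling the first \<open>K\<close>
  coordinates leaves fixed.\<close>

definition res :: "nat => (nat => real) => pt => real" where
 "res K z p = (\<Sum>k\<in>{K..idx p}. L p k * z k)"

lemma psd_enumerated: "psd (\<lambda>i j. \<Gamma> (from_nat_into dyads i) (from_nat_into dyads j))"
 unfolding psd_def using cov_sym cov_psd by auto

lemma L_zero: "idx p < k ==> L p k = 0"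
 unfolding L_def by (rule cholesky_upper[OF psd_enumerated])

lemma cov_L:
 assumes "p \<in> dyads" "q \<in> dyads" "idx p < n"
 shows "\<Gamma> p q = (\<Sum>k<n. L p k * L q k)"
 using cholesky_product[OF psd_enumerated assms(3), of "idx q"] assms(1,2) countable_dyads
 unfolding L_def idx_def by (simp add: from_nat_into_to_nat_on)

lemma res_eq:
 assumes "idx p < n"
 shows "res K z p = (\<Sum>k\<in>{K..<n}. L p k * z k)"
 unfolding res_def using assms by (intro sum.mono_neutral_left) (auto intro!: L_zero)

lemma res_meas_PiM[measurable]: "(\<lambda>z. res K z p) \<in> borel_measurable (\<Pi>\<^sub>M k\<in>UNIV. borel)"
 unfolding res_def by measurable

lemma res_meas[measurable]: "(\<lambda>w. res K (\<lambda>k. Z k w) p) \<in> borel_measurable M"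
 unfolding res_def by measurable

lemma res_scale_first: "res K (scale_first \<sigma> K z) p = res K z p"
 unfolding res_def by (intro sum.cong) (auto simp: scale_first_def)

lemma res0_scale_first: "res 0 (scale_first \<sigma> K z) p = res K z p + \<sigma> * (res 0 z p - res K z p)"
proof -
 define n where "n = Suc (max K (idx p))"
 have n: "idx p < n" "K \<le> n" unfolding n_def by auto
 have s: "{0..<n} = {0..<K} \<union> {K..<n}" using n by auto
 have r: "res 0 z p = (\<Sum>k\<in>{0..<K}. L p k * z k) + res K z p" for z
  unfolding res_eq[OF n(1)] s by (rule sum.union_disjoint) auto
 have "(\<Sum>k\<in>{0..<K}. L p k * scale_first \<sigma> K z k) = \<sigma> * (\<Sum>k\<in>{0..<K}. L p k * z k)"
  unfolding sum_distrib_left by (intro sum.cong) (auto simp: scale_first_def)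
 then show ?thesis unfolding r res_scale_first by simp
qed

text \<open>Dropping coordinates only lowers the variance of an increment, so one moment bound
  serves all \<open>K\<close>. This uniformity yields equicontinuity even when \<open>K\<close>
  varies with the index.\<close>

lemma res_moment:
 shows "integrable M (\<lambda>w. \<bar>res K (\<lambda>k. Z k w) p - res K (\<lambda>k. Z k w) q\<bar> ^ (2 * h))"
  and "p \<in> dyads ==> q \<in> dyads ==> (\<E> w. \<bar>res K (\<lambda>k. Z k w) p - res K (\<lambda>k. Z k w) q\<bar> ^ (2 * h))
   \<le> gauss_moment (2 * h) * (\<Gamma> p p - 2 * \<Gamma> p q + \<Gamma> q q) ^ h"
proof -
 define n where "n = Suc (max (idx p) (idx q))"
 have n: "idx p < n" "idx q < n" unfolding n_def by auto
 have eq: "res K z p - res K z q = (\<Sum>k\<in>{K..<n}. (L p k - L q k) * z k)" for z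
  unfolding res_eq[OF n(1)] res_eq[OF n(2)] by (simp add: sum_subtractf left_diff_distrib)
 show "integrable M (\<lambda>w. \<bar>res K (\<lambda>k. Z k w) p - res K (\<lambda>k. Z k w) q\<bar> ^ (2 * h))"
  unfolding eq by (rule std_normal_linear_moment(1)[OF Z_indep_on Z_normal])
 assume pq: "p \<in> dyads" "q \<in> dyads"
 have "(\<E> w. \<bar>res K (\<lambda>k. Z k w) p - res K (\<lambda>k. Z k w) q\<bar> ^ (2 * h))
   = gauss_moment (2 * h) * sqrt (\<Sum>k\<in>{K..<n}. (L p k - L q k)\<^sup>2) ^ (2 * h)"
  unfolding eq by (rule std_normal_linear_moment(2)[OF Z_indep_on Z_normal])
 also have "... = gauss_moment (2 * h) * (\<Sum>k\<in>{K..<n}. (L p k - L q k)\<^sup>2) ^ h"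
  by (simp add: power_mult sum_nonneg)
 also have "... \<le> gauss_moment (2 * h) * (\<Sum>k<n. (L p k - L q k)\<^sup>2) ^ h"
  by (intro mult_left_mono power_mono sum_mono2 sum_nonneg gauss_moment_nonneg) auto
 also have "(\<Sum>k<n. (L p k - L q k)\<^sup>2) = \<Gamma> p p - 2 * \<Gamma> p q + \<Gamma> q q"
  unfolding cov_L[OF pq(1) pq(1) n(1)] cov_L[OF pq n(1)] cov_L[OF pq(2) pq(2) n(2)]
  by (simp add: sum_distrib_left sum_subtractf[symmetric] sum.distrib[symmetric] power2_eq_square algebra_simps)
 finally show "(\<E> w. \<bar>res K (\<lambda>k. Z k w) p - res K (\<lambda>k. Z k w) q\<bar> ^ (2 * h))
   \<le> gauss_moment (2 * h) * (\<Gamma> p p - 2 * \<Gamma> p q + \<Gamma> q q) ^ h" .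
qed

lemma res_equicont: "equicont_on dyad2 dyads (\<lambda>i w. res (K i) (\<lambda>k. Z k w))"
proof (rule equicont_on_dyads[OF _ _ g])
 show "\<forall>\<^sub>F i in sequentially. \<forall>N p. integrable M (\<lambda>w. \<bar>res (K i) (\<lambda>k. Z k w) (dyad2 (Suc N) p) - res (K i) (\<lambda>k. Z k w) (dyad2 N p)\<bar> ^ (2 * h)) \<and>
   (\<E> w. \<bar>res (K i) (\<lambda>k. Z k w) (dyad2 (Suc N) p) - res (K i) (\<lambda>k. Z k w) (dyad2 N p)\<bar> ^ (2 * h)) \<le> gauss_moment (2 * h) * C * (1 / 2 ^ N) powr g"
 proof (intro always_eventually allI conjI res_moment(1))
  fix i N p
  show "(\<E> w. \<bar>res (K i) (\<lambda>k. Z k w) (dyad2 (Suc N) p) - res (K i) (\<lambda>k. Z k w) (dyad2 N p)\<bar> ^ (2 * h)) \<le> gauss_moment (2 * h) * C * (1 / 2 ^ N) powr g"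
   using res_moment(2)[of "dyad2 (Suc N) p" "dyad2 N p" "K i"] mult_left_mono[OF cov_incr[of N p] gauss_moment_nonneg[of "2 * h"]]
   by (simp add: mult.assoc)
 qed
qed (use h C gauss_moment_nonneg in auto)

text \<open>Once \<open>K\<close> exceeds the indices of a finite net, the remainder vanishes
  exactly on the net; equicontinuity along growing \<open>K\<close> spreads the smallness to all
  dyadic points.\<close>

lemma res_small:
 assumes e: "0 < e" "0 < d"
 shows "\<exists>K. \<exists>A\<in>events. prob A \<le> d \<and> (\<forall>w\<in>space M - A. \<forall>p\<in>dyads. \<bar>res K (\<lambda>k. Z k w) p\<bar> \<le> e)"
proof -
 obtain N where N: "whp d (\<lambda>i w. \<forall>p\<in>dyads. \<bar>res i (\<lambda>k. Z k w) p - res i (\<lambda>k. Z k w) (dyad2 N p)\<bar> \<le> e)"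
 proof -
  obtain N0 where "\<forall>N\<ge>N0. whp d (\<lambda>i w. \<forall>p\<in>dyads. \<bar>res i (\<lambda>k. Z k w) p - res i (\<lambda>k. Z k w) (dyad2 N p)\<bar> \<le> e)"
   using equicont_onD[OF res_equicont[of "\<lambda>i. i"] e(2,1)] ..
  then show ?thesis by (intro that[of N0]) simp
 qed
 define m where "m = Suc (Max (idx ` range (dyad2 N)))"
 have m: "idx (dyad2 N p) < i" if "m \<le> i" for p i
 proof -
  have "idx (dyad2 N p) \<le> Max (idx ` range (dyad2 N))" using dyad2_range(1) by (intro Max_ge) auto
  then show ?thesis using that unfolding m_def by simp
 qed
 have "\<forall>\<^sub>F i in sequentially. m \<le> i" by (rule eventually_ge_at_top)
 with N have "\<forall>\<^sub>F i in sequentially. m \<le> i \<and> (\<exists>A\<in>events. prob A \<le> d \<and> (\<forall>w\<in>space M - A. \<forall>p\<in>dyads. \<bar>res i (\<lambda>k. Z k w) p - res i (\<lambda>k. Z k w) (dyad2 N p)\<bar> \<le> e))"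
  by eventually_elim simp
 then obtain i A where i: "m \<le> i" and A: "A \<in> events" "prob A \<le> d" "\<forall>w\<in>space M - A. \<forall>p\<in>dyads. \<bar>res i (\<lambda>k. Z k w) p - res i (\<lambda>k. Z k w) (dyad2 N p)\<bar> \<le> e"
  by (auto simp: eventually_sequentially)
 have z: "res i (\<lambda>k. Z k w) (dyad2 N p) = 0" for w p
  using m[OF i, of p] unfolding res_def by simp
 show ?thesis
  using A z by (intro exI[of _ i] bexI[of _ A]) auto
qed

definition G :: "'a => pt => real" where
 "G w = res 0 (\<lambda>k. Z k w)"

lemma G_meas[measurable]: "(\<lambda>w. G w p) \<in> borel_measurable M"
 unfolding G_def by measurable

lemma G_equicont: "equicont_on dyad2 dyads (\<lambda>_. G)"
 using res_equicont[of "\<lambda>_. 0"] unfolding G_def .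

lemma G_single:
 shows "G w p = (\<Sum>k\<le>idx p. L p k * Z k w)"
 unfolding G_def res_def by (simp add: atMost_atLeast0)

lemma G_tight: "tight_on dyads (\<lambda>_. G)"
proof (rule equicont_imp_tight[OF G_equicont])
 show "finite (dyad2 N ` dyads)" for N by (rule finite_subset[OF _ dyad2_range(1)]) auto
 fix q
 show "tight_on {q} (\<lambda>_. G)"
  by (rule tight_on_pointwise_moment[OF _ zero_less_one, where C = "(\<E> w. \<bar>G w q\<bar> ^ 1)"])
   (use std_normal_linear_moment(1)[OF Z_indep_on[of "{..idx q}"] Z_normal, of "L q" 1] in \<open>auto simp: G_single[abs_def]\<close>)
qed

lemma G_iexp:
 assumes Q: "finite Q" "Q \<subseteq> dyads"
 shows "(\<E> w. iexp (\<Sum>q\<in>Q. t q * G w q)) = exp (- ((\<Sum>p\<in>Q. \<Sum>q\<in>Q. t p * t q * \<Gamma> p q) / 2))"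
proof -
 obtain n where n: "!!q. q \<in> Q ==> idx q < n"
  using finite_nat_set_iff_bounded[of "idx ` Q"] Q(1) by auto
 have eq: "(\<Sum>q\<in>Q. t q * G w q) = (\<Sum>k\<in>{0..<n}. (\<Sum>q\<in>Q. t q * L q k) * Z k w)" for w
 proof -
  have "(\<Sum>q\<in>Q. t q * G w q) = (\<Sum>q\<in>Q. \<Sum>k\<in>{0..<n}. t q * (L q k * Z k w))"
   unfolding G_def sum_distrib_left[symmetric] by (intro sum.cong refl arg_cong2[of _ _ _ _ "(*)"] res_eq n)
  also have "... = (\<Sum>k\<in>{0..<n}. \<Sum>q\<in>Q. t q * (L q k * Z k w))" by (rule sum.swap)
  finally show ?thesis by (simp add: sum_distrib_right mult.assoc)
 qed
 have "(\<Sum>k\<in>{0..<n}. (\<Sum>q\<in>Q. t q * L q k)\<^sup>2) = (\<Sum>k\<in>{0..<n}. \<Sum>p\<in>Q. \<Sum>q\<in>Q. t p * t q * (L p k * L q k))"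
  unfolding power2_eq_square sum_product by (simp add: ac_simps)
 also have "... = (\<Sum>p\<in>Q. \<Sum>q\<in>Q. \<Sum>k\<in>{0..<n}. t p * t q * (L p k * L q k))"
  by (subst sum.swap, intro sum.cong refl, rule sum.swap)
 also have "... = (\<Sum>p\<in>Q. \<Sum>q\<in>Q. t p * t q * \<Gamma> p q)"
 proof (intro sum.cong refl)
  fix p q assume "p \<in> Q" "q \<in> Q"
  then have "\<Gamma> p q = (\<Sum>k<n. L p k * L q k)" using Q n by (intro cov_L) auto
  then show "(\<Sum>k\<in>{0..<n}. t p * t q * (L p k * L q k)) = t p * t q * \<Gamma> p q"
   by (simp add: sum_distrib_left lessThan_atLeast0)
 qed
 finally have s: "(\<Sum>k\<in>{0..<n}. (\<Sum>q\<in>Q. t q * L q k)\<^sup>2) = (\<Sum>p\<in>Q. \<Sum>q\<in>Q. t p * t q * \<Gamma> p q)" .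
 show ?thesis unfolding eq s[symmetric] by (rule std_normal_linear_iexp[OF Z_indep_on Z_normal])
qed

section \<open>Distribution function of the maximum of the Gaussian field\<close>

definition F :: "real => real" where
 "F x = prob {w\<in>space M. \<forall>p\<in>dyads. \<bar>G w p\<bar> \<le> x}"

lemma F_event[measurable]: "{w\<in>space M. \<forall>p\<in>dyads. \<bar>G w p\<bar> \<le> x} \<in> events"
 by (rule box_event[OF countable_dyads]) measurable

lemma F_mono: "x \<le> y ==> F x \<le> F y"
 unfolding F_def by (intro finite_measure_mono) force+

text \<open>A convex function that is below \<open>c\<close> at the origin takes the value \<open>c\<close> at most once on each ray.
 So the events obtained by scaling the first \<open>K\<close> coordinates are disjoint, while their
 probabilities are bounded below by a multiple of that of the original event.\<close>

lemma no_atom: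
 assumes c: "0 < c"
 shows "prob {u\<in>space M. (\<forall>p\<in>dyads. \<bar>G u p\<bar> \<le> c) \<and> (\<forall>n. \<exists>p\<in>dyads. c - 1 / real (Suc n) < \<bar>G u p\<bar>)} = 0"
proof -
 let ?E = "{u\<in>space M. (\<forall>p\<in>dyads. \<bar>G u p\<bar> \<le> c) \<and> (\<forall>n. \<exists>p\<in>dyads. c - 1 / real (Suc n) < \<bar>G u p\<bar>)}"
 let ?N = "\<Pi>\<^sub>M k\<in>(UNIV::nat set). (borel::real measure)"
 have ex: "{z\<in>space ?N. \<exists>p\<in>dyads. P p z} \<in> sets ?N" if "!!p. {z\<in>space ?N. P p z} \<in> sets ?N" for P
 proof -
  have "(\<Union>p\<in>dyads. {z\<in>space ?N. P p z}) \<in> sets ?N" using that by (intro sets.countable_UN'' countable_dyads)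
  moreover have "{z\<in>space ?N. \<exists>p\<in>dyads. P p z} = (\<Union>p\<in>dyads. {z\<in>space ?N. P p z})" by blast
  ultimately show ?thesis by simp
 qed
 have all: "{z\<in>space ?N. \<forall>p\<in>dyads. P p z} \<in> sets ?N" if "!!p. {z\<in>space ?N. P p z} \<in> sets ?N" for P
 proof -
  have "space ?N - {z\<in>space ?N. \<exists>p\<in>dyads. \<not> P p z} \<in> sets ?N"
   by (intro sets.compl_sets ex sets.sets_Collect_neg that)
  moreover have "{z\<in>space ?N. \<forall>p\<in>dyads. P p z} = space ?N - {z\<in>space ?N. \<exists>p\<in>dyads. \<not> P p z}" by blast
  ultimately show ?thesis by (simp only:)
 qed
 have E0: "?E = {u\<in>space M. \<forall>p\<in>dyads. \<bar>G u p\<bar> \<le> c} - (\<Union>n. {u\<in>space M. \<forall>p\<in>dyads. \<bar>G u p\<bar> \<le> c - 1 / real (Suc n)})"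
  unfolding not_le[symmetric] by blast
 have Eev: "?E \<in> events" unfolding E0 by (intro sets.Diff sets.countable_UN F_event) auto
 have "prob ?E \<le> d" if d: "0 < d" for d
 proof -
  have "0 < c / 2" using c by simp
  \<comment> \<open>The part that scaling leaves fixed stays below c / 2, so every ray starts well
    inside the level c.\<close>
  obtain K A where A: "A \<in> events" "prob A \<le> d" and Ar: "\<forall>u\<in>space M - A. \<forall>p\<in>dyads. \<bar>res K (\<lambda>k. Z k u) p\<bar> \<le> c / 2"
   using res_small[OF \<open>0 < c / 2\<close> d] by (elim exE bexE conjE)
  define H where "H = {z\<in>space ?N. (\<forall>p\<in>dyads. \<bar>res 0 z p\<bar> \<le> c) \<and> (\<forall>n. \<exists>p\<in>dyads. c - 1 / real (Suc n) < \<bar>res 0 z p\<bar>) \<and> (\<forall>p\<in>dyads. \<bar>res K z p\<bar> \<le> c / 2)}"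
  have H: "H \<in> sets ?N" unfolding H_def
  proof (intro sets.sets_Collect_conj all)
   show "{z\<in>space ?N. \<bar>res 0 z p\<bar> \<le> c} \<in> sets ?N" for p by measurable
   show "{z\<in>space ?N. \<bar>res K z p\<bar> \<le> c / 2} \<in> sets ?N" for p by measurable
   show "{z\<in>space ?N. \<forall>n. \<exists>p\<in>dyads. c - 1 / real (Suc n) < \<bar>res 0 z p\<bar>} \<in> sets ?N"
   proof (intro sets.sets_Collect_countable_All ex)
    show "{z\<in>space ?N. c - 1 / real (Suc n) < \<bar>res 0 z p\<bar>} \<in> sets ?N" for n p by measurable
   qed
  qed
  define S where "S \<sigma> = {u\<in>space M. scale_first \<sigma> K (\<lambda>k. Z k u) \<in> H}" for \<sigma>
  have Sev: "S \<sigma> \<in> events" for \<sigma> unfolding S_def using measurable_sets[OF Z_scaled_meas[of \<sigma> K] H] by (simp add: vimage_def Int_def conj_commute)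
  have disj: "S \<sigma> \<inter> S \<sigma>' = {}" if s: "1 \<le> \<sigma>" "\<sigma> < \<sigma>'" for \<sigma> \<sigma>'
  proof (rule ccontr)
   assume "S \<sigma> \<inter> S \<sigma>' \<noteq> {}"
   then obtain u where w: "u \<in> S \<sigma>" "u \<in> S \<sigma>'" by blast
   define z where "z = (\<lambda>k. Z k u)"
   define a where "a p = res 0 z p - res K z p" for p
   define b where "b p = res K z p" for p
   define l where "l = \<sigma> / \<sigma>'"
   have l: "0 < l" "l < 1" unfolding l_def using s by auto
   have zH: "scale_first \<sigma> K z \<in> H" "scale_first \<sigma>' K z \<in> H" using w unfolding S_def z_def by simp_all
   have up: "\<bar>b p + \<sigma>' * a p\<bar> \<le> c" and bb: "\<bar>b p\<bar> \<le> c / 2" if "p \<in> dyads" for p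
    using zH(2) that unfolding H_def a_def b_def by (simp_all add: res0_scale_first res_scale_first)
   have low: "\<exists>p\<in>dyads. c - 1 / real (Suc n) < \<bar>b p + \<sigma> * a p\<bar>" for n
    using zH(1) unfolding H_def a_def b_def by (simp add: res0_scale_first res_scale_first del: of_nat_Suc)
   \<comment> \<open>With l = \<open>\<sigma>\<close> / \<open>\<sigma>'\<close> the value at
     \<open>\<sigma>\<close> is a convex combination of the start, at most c / 2, and of the value
     at \<open>\<sigma>'\<close>, at most c. Hence it stays below c by (1 - l) c / 2 uniformly in p,
     against the condition in \<open>H\<close> that the maximum reaches c.\<close>
   have le: "\<bar>b p + \<sigma> * a p\<bar> \<le> (1 - l) * (c / 2) + l * c" if "p \<in> dyads" for p
   proof -
    have "b p + \<sigma> * a p = (1 - l) * b p + l * (b p + \<sigma>' * a p)" unfolding l_def using s by (simp add: field_simps)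
    also have "\<bar>...\<bar> \<le> (1 - l) * \<bar>b p\<bar> + l * \<bar>b p + \<sigma>' * a p\<bar>"
     using l by (intro order_trans[OF abs_triangle_ineq]) (simp add: abs_mult)
    also have "... \<le> (1 - l) * (c / 2) + l * c" using l up[OF that] bb[OF that] by (intro add_mono mult_left_mono) auto
    finally show ?thesis .
   qed
   have "0 < (1 - l) * (c / 2)" using l c by simp
   then obtain n where "1 / real (Suc n) < (1 - l) * (c / 2)" using nat_approx_posE by blast
   moreover obtain p where "p \<in> dyads" "c - 1 / real (Suc n) < \<bar>b p + \<sigma> * a p\<bar>" using low by blast
   moreover have "(1 - l) * (c / 2) + l * c = c - (1 - l) * (c / 2)" by (simp add: field_simps)
   ultimately show False using le[of p] by linarith
  qed
  \<comment> \<open>The n scales 1 + j / n in [1, 2) give disjoint events, each of probability at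
    least 2^(-K) times that for \<open>H\<close>; a bound for all n forces probability 0.\<close>
  have bound: "real n * prob {u\<in>space M. (\<lambda>k. Z k u) \<in> H} \<le> 2 ^ K" for n
  proof (cases "n = 0")
   case False
   define \<sigma> where "\<sigma> j = 1 + real j / real n" for j
   have s: "1 \<le> \<sigma> j" "\<sigma> j \<le> 2" if "j < n" for j using that unfolding \<sigma>_def by auto
   have mono: "\<sigma> i < \<sigma> j" if "i < j" for i j using that False unfolding \<sigma>_def by (simp add: divide_strict_right_mono)
   have "prob {u\<in>space M. (\<lambda>k. Z k u) \<in> H} \<le> 2 ^ K * prob (S (\<sigma> j))" if j: "j < n" for j
   proof -
    have "prob {u\<in>space M. (\<lambda>k. Z k u) \<in> H} \<le> \<sigma> j ^ K * prob (S (\<sigma> j))"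
     unfolding S_def by (rule scaling_inequality[OF H s(1)[OF j]])
    also have "... \<le> 2 ^ K * prob (S (\<sigma> j))" using s[OF j] by (intro mult_right_mono power_mono) auto
    finally show ?thesis .
   qed
   then have "(\<Sum>j<n. prob {u\<in>space M. (\<lambda>k. Z k u) \<in> H}) \<le> (\<Sum>j<n. 2 ^ K * prob (S (\<sigma> j)))" by (intro sum_mono) auto
   also have "... = 2 ^ K * prob (\<Union>j<n. S (\<sigma> j))"
   proof -
    have "disjoint_family_on (\<lambda>j. S (\<sigma> j)) {..<n}"
     unfolding disjoint_family_on_def
    proof (intro ballI impI)
     fix i j assume "i \<in> {..<n}" "j \<in> {..<n}" "i \<noteq> j"
     then show "S (\<sigma> i) \<inter> S (\<sigma> j) = {}"
      using disj[OF s(1) mono, of i j] disj[OF s(1) mono, of j i] by (cases "i < j") auto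
    qed
    then have "prob (\<Union>j<n. S (\<sigma> j)) = (\<Sum>j<n. prob (S (\<sigma> j)))" using Sev by (intro finite_measure_finite_Union) auto
    then show ?thesis by (simp add: sum_distrib_left)
   qed
   also have "... \<le> 2 ^ K * 1" by (intro mult_left_mono) auto
   finally show ?thesis by simp
  qed simp
  have PH: "prob {u\<in>space M. (\<lambda>k. Z k u) \<in> H} = 0"
  proof (rule ccontr)
   assume "prob {u\<in>space M. (\<lambda>k. Z k u) \<in> H} \<noteq> 0"
   then have p: "0 < prob {u\<in>space M. (\<lambda>k. Z k u) \<in> H}" using measure_nonneg[of M] by (simp add: less_le)
   obtain n where "2 ^ K / prob {u\<in>space M. (\<lambda>k. Z k u) \<in> H} < real n" using reals_Archimedean2 by blast
   then show False using bound[of n] p by (simp add: divide_less_eq)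
  qed
  have Hev: "{u\<in>space M. (\<lambda>k. Z k u) \<in> H} \<in> events"
   using Sev[of 1] unfolding S_def scale_first_def by (simp add: if_distrib cong: if_cong)
  have "prob ?E \<le> prob {u\<in>space M. (\<lambda>k. Z k u) \<in> H} + prob A"
  proof (rule prob_le_outside[OF Eev Hev A(1)])
   show "?E - A \<subseteq> {u\<in>space M. (\<lambda>k. Z k u) \<in> H}"
    using Ar unfolding H_def G_def by (auto simp: space_PiM)
  qed
  then show "prob ?E \<le> d" using PH A(2) by simp
 qed
 note le = this
 have "prob ?E \<le> 0"
 proof (rule field_le_epsilon)
  fix d :: real assume "0 < d"
  from le[OF this] show "prob ?E \<le> 0 + d" unfolding add_0 .
 qed
 then show ?thesis using measure_nonneg[of M ?E] by (rule antisym)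
qed

text \<open>Right continuity is continuity of the measure from above; a jump from the left would be
  an atom of the maximum.\<close>

lemma F_isCont:
 assumes x: "0 < x"
 shows "isCont F x"
proof -
 let ?S = "\<lambda>x. {w\<in>space M. \<forall>p\<in>dyads. \<bar>G w p\<bar> \<le> x}"
 have Fm: "F a \<le> F b" if "a \<le> b" for a b by (rule F_mono[OF that])
 have left: "(\<lambda>n. F (x - 1 / real (Suc n))) \<longlonglongrightarrow> F x"
 proof -
  let ?E = "{w\<in>space M. (\<forall>p\<in>dyads. \<bar>G w p\<bar> \<le> x) \<and> (\<forall>n. \<exists>p\<in>dyads. x - 1 / real (Suc n) < \<bar>G w p\<bar>)}"
  let ?U = "\<Union>n. ?S (x - 1 / real (Suc n))"
  have inc: "incseq (\<lambda>n. ?S (x - 1 / real (Suc n)))"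
  proof (rule incseq_SucI, safe)
   fix n w p assume a: "\<forall>p\<in>dyads. \<bar>G w p\<bar> \<le> x - 1 / real (Suc n)" "p \<in> dyads"
   have "1 / real (Suc (Suc n)) \<le> 1 / real (Suc n)" by (intro divide_left_mono) auto
   then show "\<bar>G w p\<bar> \<le> x - 1 / real (Suc (Suc n))" using a(1)[rule_format, OF a(2)] by linarith
  qed
  have "(\<lambda>n. F (x - 1 / real (Suc n))) \<longlonglongrightarrow> prob ?U"
   unfolding F_def by (rule finite_Lim_measure_incseq[OF _ inc]) (use F_event in auto)
  moreover have "prob ?U = F x"
  proof (rule antisym)
   show "prob ?U \<le> F x" unfolding F_def
   proof (intro finite_measure_mono F_event subsetI)
    fix w assume "w \<in> ?U"
    then obtain n where n: "w \<in> space M" "!!p. p \<in> dyads ==> \<bar>G w p\<bar> \<le> x - 1 / real (Suc n)" by blast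
    have "0 \<le> 1 / real (Suc n)" by simp
    then have "\<bar>G w p\<bar> \<le> x" if "p \<in> dyads" for p using n(2)[OF that] by linarith
    then show "w \<in> ?S x" using n(1) by blast
   qed
   have Eeq: "?E = ?S x - ?U" unfolding not_le[symmetric] by blast
   have Uev: "?U \<in> events" using F_event by (intro sets.countable_UN) auto
   have Eev: "?E \<in> events" unfolding Eeq using Uev F_event by (intro sets.Diff)
   have "F x \<le> prob ?U + prob ?E" unfolding F_def
    by (rule prob_le_outside[OF F_event Uev Eev]) (simp only: Eeq, blast)
   then show "F x \<le> prob ?U" using no_atom[OF x] by simp
  qed
  ultimately show ?thesis by simp
 qed
 have right: "(\<lambda>n. F (x + 1 / real (Suc n))) \<longlonglongrightarrow> F x"
 proof -
  have dec: "decseq (\<lambda>n. ?S (x + 1 / real (Suc n)))"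
  proof (rule decseq_SucI, safe)
   fix n w p assume a: "\<forall>p\<in>dyads. \<bar>G w p\<bar> \<le> x + 1 / real (Suc (Suc n))" "p \<in> dyads"
   have "1 / real (Suc (Suc n)) \<le> 1 / real (Suc n)" by (intro divide_left_mono) auto
   then show "\<bar>G w p\<bar> \<le> x + 1 / real (Suc n)" using a(1)[rule_format, OF a(2)] by linarith
  qed
  have "(\<lambda>n. F (x + 1 / real (Suc n))) \<longlonglongrightarrow> prob (\<Inter>n. ?S (x + 1 / real (Suc n)))"
   unfolding F_def by (rule finite_Lim_measure_decseq[OF _ dec]) (use F_event in auto)
  moreover have "(\<Inter>n. ?S (x + 1 / real (Suc n))) = ?S x"
  proof (intro equalityI subsetI)
   fix w assume a: "w \<in> (\<Inter>n. ?S (x + 1 / real (Suc n)))"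
   have "\<bar>G w p\<bar> \<le> x" if "p \<in> dyads" for p
   proof (rule ccontr)
    assume "\<not> \<bar>G w p\<bar> \<le> x"
    then have "0 < \<bar>G w p\<bar> - x" by simp
    then obtain n where "1 / real (Suc n) < \<bar>G w p\<bar> - x" using nat_approx_posE by blast
    moreover have "\<bar>G w p\<bar> \<le> x + 1 / real (Suc n)" using a that by blast
    ultimately show False by linarith
   qed
   then show "w \<in> ?S x" using a by blast
  next
   fix w assume a: "w \<in> ?S x"
   have "\<bar>G w p\<bar> \<le> x + 1 / real (Suc n)" if "p \<in> dyads" for n p
   proof -
    have "0 \<le> 1 / real (Suc n)" "\<bar>G w p\<bar> \<le> x" using a that by auto
    then show ?thesis by linarith
   qed
   then show "w \<in> (\<Inter>n. ?S (x + 1 / real (Suc n)))" using a by blast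
  qed
  ultimately show ?thesis unfolding F_def by simp
 qed
 show ?thesis unfolding continuous_at_eps_delta dist_real_def
 proof (intro allI impI)
  fix e :: real assume e: "0 < e"
  obtain n1 where n1: "\<bar>F (x - 1 / real (Suc n1)) - F x\<bar> < e" using LIMSEQ_D[OF left e] unfolding real_norm_def by blast
  obtain n2 where n2: "\<bar>F (x + 1 / real (Suc n2)) - F x\<bar> < e" using LIMSEQ_D[OF right e] unfolding real_norm_def by blast
  show "\<exists>d>0. \<forall>y. \<bar>y - x\<bar> < d \<longrightarrow> \<bar>F y - F x\<bar> < e"
  proof (intro exI[of _ "min (1 / real (Suc n1)) (1 / real (Suc n2))"] conjI allI impI)
   fix y assume "\<bar>y - x\<bar> < min (1 / real (Suc n1)) (1 / real (Suc n2))"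
   then have "\<bar>y - x\<bar> < 1 / real (Suc n1)" "\<bar>y - x\<bar> < 1 / real (Suc n2)" by auto
   then have "x - 1 / real (Suc n1) \<le> y" "y \<le> x + 1 / real (Suc n2)" by linarith+
   then have "F (x - 1 / real (Suc n1)) \<le> F y" "F y \<le> F (x + 1 / real (Suc n2))" by (auto intro: Fm)
   then show "\<bar>F y - F x\<bar> < e" using n1 n2 by linarith
  qed simp
 qed
qed

text \<open>One point with positive variance suffices: the normal density is at most 1, so an
  interval has mass at most its length.\<close>

lemma F_small:
 assumes p: "p \<in> dyads" "0 < \<Gamma> p p" and x: "0 < x"
 shows "F x \<le> 2 * x / sqrt (\<Gamma> p p)"
proof -
 let ?s = "sqrt (\<Gamma> p p)"
 have s: "0 < ?s" using p by simp
 have G: "G w p = (\<Sum>k\<in>{..idx p}. L p k * Z k w)" for w by (rule G_single)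
 have var: "(\<Sum>k\<in>{..idx p}. (L p k)\<^sup>2) = \<Gamma> p p"
  unfolding cov_L[OF p(1) p(1) lessI] by (simp add: power2_eq_square lessThan_Suc_atMost)
 have D: "distr M borel (\<lambda>w. G w p) = distr std_normal_distribution borel (\<lambda>y. ?s * y)"
  unfolding G using std_normal_linear_distr[OF Z_indep_on[of "{..idx p}"] Z_normal, of "L p"] unfolding var .
 have "F x \<le> prob {w\<in>space M. \<bar>G w p\<bar> \<le> x}" unfolding F_def using p by (intro finite_measure_mono) auto
 also have "... = measure (distr M borel (\<lambda>w. G w p)) {-x..x}"
  by (subst measure_distr) (auto intro!: arg_cong[where f = prob])
 also have "... = measure std_normal_distribution {- (x / ?s)..x / ?s}"
  unfolding D using s by (subst measure_distr) (auto intro!: arg_cong[where f = "measure std_normal_distribution"] simp: field_simps)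
 also have "... \<le> 2 * x / ?s"
 proof -
  have le1: "std_normal_density y \<le> 1" for y
  proof -
   have "1 \<le> sqrt (2 * pi)" using pi_gt3 by (intro real_le_rsqrt) simp
   then have "1 / sqrt (2 * pi) \<le> 1" by simp
   then have "1 / sqrt (2 * pi) * exp (- y\<^sup>2 / 2) \<le> 1 * 1" by (intro mult_mono) auto
   then show ?thesis unfolding std_normal_density_def by simp
  qed
  have "emeasure std_normal_distribution {- (x / ?s)..x / ?s} = (\<integral>\<^sup>+y. ennreal (std_normal_density y) * indicator {- (x / ?s)..x / ?s} y \<partial>lborel)"
   by (rule emeasure_density) auto
  also have "... \<le> (\<integral>\<^sup>+y. indicator {- (x / ?s)..x / ?s} y \<partial>lborel)"
   using le1 by (intro nn_integral_mono) (auto simp: indicator_def ennreal_le_1)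
  also have "... = ennreal (2 * x / ?s)" using s x by simp
  finally show ?thesis using s x unfolding measure_def by (intro enn2real_leI) auto
 qed
 finally show ?thesis .
qed

text \<open>Small values come from a single nondegenerate point, values near 1 from tightness, and
  continuity fills the range between. This is where nondegeneracy of the limit enters.\<close>

lemma F_attains:
 assumes p: "p \<in> dyads" "0 < \<Gamma> p p" and u: "0 < u" "u < 1"
 shows "\<exists>x>0. F x = u"
proof -
 let ?s = "sqrt (\<Gamma> p p)"
 have s: "0 < ?s" using p by simp
 define a where "a = ?s * u / 4"
 have a: "0 < a" unfolding a_def using s u by simp
 have Fa: "F a \<le> u" using F_small[OF p a] s u unfolding a_def by (simp add: mult.commute)
 have d: "0 < 1 - u" using u by simp
 obtain K where "whp (1 - u) (\<lambda>i w. \<forall>p\<in>dyads. \<bar>G w p\<bar> \<le> K)"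
  using G_tight d unfolding tight_on_def by blast
 then obtain A where A: "A \<in> events" "prob A \<le> 1 - u" "!!w p. w \<in> space M ==> w \<notin> A ==> p \<in> dyads ==> \<bar>G w p\<bar> \<le> K" by auto
 define b where "b = max a K"
 have "prob (space M) \<le> prob {w\<in>space M. \<forall>p\<in>dyads. \<bar>G w p\<bar> \<le> b} + prob A"
  using A(3) by (intro prob_le_outside A(1) F_event) (auto simp: b_def le_max_iff_disj)
 then have Fb: "u \<le> F b" using A(2) unfolding F_def prob_space by linarith
 have "\<exists>x. a \<le> x \<and> x \<le> b \<and> F x = u"
 proof (rule IVT[where f = F, OF Fa Fb])
  show "a \<le> b" unfolding b_def by simp
  show "\<forall>x. a \<le> x \<and> x \<le> b \<longrightarrow> isCont F x" using a by (intro allI impI F_isCont) linarith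
 qed
 then obtain x where "a \<le> x" "F x = u" by blast
 then show ?thesis using a by (intro exI[of _ x]) auto
qed

end

section \<open>Conditionally Gaussian multiplier sums\<close>

text \<open>The tangent of x^h at a, from Bernoulli's inequality. Averaging it with a equal to the
  mean gives Jensen's inequality both for finite sums and for expectations.\<close>

lemma power_tangent:
 fixes x a :: real
 assumes "0 \<le> x" "0 \<le> a"
 shows "a ^ h + real h * a ^ (h - 1) * (x - a) \<le> x ^ h"
proof (cases "a = 0 \<or> h = 0")
 case True
 then show ?thesis using assms by (cases h; cases "h - 1") (auto simp: power_0_left)
next
 case False
 then have a: "0 < a" using assms by simp
 obtain k where k: "h = Suc k" using False by (cases h) auto
 have "a ^ h * (1 + real h * (x / a - 1)) \<le> a ^ h * (1 + (x / a - 1)) ^ h"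
  using a assms by (intro mult_left_mono Bernoulli_inequality) auto
 also have "... = x ^ h" using a by (simp add: power_divide)
 also have "a ^ h * (1 + real h * (x / a - 1)) = a ^ h + real h * a ^ (h - 1) * (x - a)"
  using a by (simp add: k field_simps)
 finally show ?thesis .
qed

lemma mean_power_le:
 fixes y :: "nat => real"
 assumes y: "!!k. k \<in> K ==> 0 \<le> y k" and K: "finite K" "K \<noteq> {}"
 shows "((\<Sum>k\<in>K. y k) / real (card K)) ^ h \<le> (\<Sum>k\<in>K. y k ^ h) / real (card K)"
proof -
 define a where "a = (\<Sum>k\<in>K. y k) / real (card K)"
 have c: "0 < real (card K)" using K by (simp add: card_gt_0_iff)
 have a: "0 \<le> a" "(\<Sum>k\<in>K. y k) = real (card K) * a" unfolding a_def using y c by (auto intro!: divide_nonneg_pos sum_nonneg)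
 have "real (card K) * a ^ h = (\<Sum>k\<in>K. a ^ h + real h * a ^ (h - 1) * (y k - a))"
  by (simp add: sum.distrib sum_subtractf a(2) flip: sum_distrib_left)
 also have "... \<le> (\<Sum>k\<in>K. y k ^ h)" using y a by (intro sum_mono power_tangent) auto
 finally show ?thesis unfolding a_def[symmetric] using c by (simp add: le_divide_eq mult.commute)
qed

lemma (in prob_space) expectation_power_le:
 fixes X :: "'a => real"
 assumes X: "integrable M X" "!!w. 0 \<le> X w" and i: "integrable M (\<lambda>w. X w ^ h)"
 shows "expectation X ^ h \<le> (\<E> w. X w ^ h)"
proof -
 let ?a = "expectation X"
 have a: "0 \<le> ?a" by (intro integral_nonneg X(2))
 have "(\<E> w. ?a ^ h + real h * ?a ^ (h - 1) * (X w - ?a)) \<le> (\<E> w. X w ^ h)"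
  using X i a by (intro integral_mono power_tangent) auto
 then show ?thesis using X(1) by (simp add: prob_space)
qed

locale multipliers = prob_space P for P :: "'a measure" +
 fixes D :: "'a measure" and Z :: "'i => 'a => real" and I :: "'i set"
 assumes D: "subalgebra P D"
  and Z_indep: "indep_vars (\<lambda>_. borel) Z I" and Z_normal: "!!k. k \<in> I ==> std_normal_var P (Z k)"
  and DZ: "indep_set (sets D) (gen_sigma P Z I)"
begin

lemma Z_meas: "k \<in> I ==> Z k \<in> borel_measurable P"
 using std_normal_varD[OF Z_normal] by simp

lemma sub_Z: "subalgebra P (vsig P Z I)"
 by (rule subalgebra_vsig) (rule Z_meas)

text \<open>The identity of the sample space serves twice, as a map into the sigma-field of the data
  and into that of the multipliers. A function of data and multipliers becomes a function on the
  product, and Fubini replaces conditioning on the data.\<close>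

lemma indep_id: "indep_var D (\<lambda>x. x) (vsig P Z I) (\<lambda>x. x)"
proof -
 have m: "(\<lambda>x. x) \<in> measurable P D" "(\<lambda>x. x) \<in> measurable P (vsig P Z I)"
  using D sub_Z by (auto intro!: measurableI simp: subalgebra_def sets.sets_into_space)
 have e: "{(\<lambda>x. x) -` A \<inter> space P |A. A \<in> sets N} = sets N" if "subalgebra P N" for N
  using that sets.sets_into_space[of _ N] by (auto simp: subalgebra_def Int_absorb2)
 have s: "sigma_sets (space P) (sets N) = sets N" if "subalgebra P N" for N
  using that sets.sigma_sets_eq[of N] by (simp add: subalgebra_def)
 show ?thesis unfolding indep_var_eq e[OF D] e[OF sub_Z] s[OF D] s[OF sub_Z] using m DZ[folded sets_vsig] by simp
qed

lemma Z_indep_on: "K \<subseteq> I ==> indep_vars (\<lambda>_. borel) Z K"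
 by (rule indep_vars_subset[OF Z_indep])

lemma multiplier_measurable:
 assumes K: "K \<subseteq> I" and a: "!!k. k \<in> K ==> a k \<in> borel_measurable D"
 shows "(\<lambda>x. \<Sum>k\<in>K. a k (fst x) * Z k (snd x)) \<in> borel_measurable (D \<Otimes>\<^sub>M vsig P Z I)"
proof (intro bm_intros)
 fix k assume k: "k \<in> K"
 show "(\<lambda>x. a k (fst x)) \<in> borel_measurable (D \<Otimes>\<^sub>M vsig P Z I)" using a[OF k] by measurable
 have "Z k \<in> borel_measurable (vsig P Z I)" using k K by (intro measurable_vsig) auto
 then show "(\<lambda>x. Z k (snd x)) \<in> borel_measurable (D \<Otimes>\<^sub>M vsig P Z I)" by measurable
qed

text \<open>Given the data the sum is normal, with the sum of the squared coefficients as variance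
  V, so only the expectation of exp(- V / 2) remains. Cosine and sine are treated separately because
  the iterated integral is stated for real functions.\<close>

lemma multiplier_iexp:
 assumes K: "K \<subseteq> I" and a: "!!k. k \<in> K ==> a k \<in> borel_measurable D"
 shows "expectation (\<lambda>u. iexp (\<Sum>k\<in>K. a k u * Z k u)) = complex_of_real (expectation (\<lambda>u. exp (- ((\<Sum>k\<in>K. (a k u)\<^sup>2) / 2))))"
proof -
 have ZP: "Z k \<in> borel_measurable P" if "k \<in> K" for k using Z_meas K that by auto
 have aP: "a k \<in> borel_measurable P" if "k \<in> K" for k using measurable_from_subalg[OF D a[OF that]] .
 have sP: "(\<lambda>u. \<Sum>k\<in>K. a k w * Z k u) \<in> borel_measurable P" for w using ZP by measurable
 have sP': "(\<lambda>u. \<Sum>k\<in>K. a k u * Z k u) \<in> borel_measurable P" using ZP aP by measurable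
 note m = multiplier_measurable[OF K a]
 have part: "expectation (\<lambda>u. f (\<Sum>k\<in>K. a k u * Z k u)) = expectation (\<lambda>u. expectation (\<lambda>\<omega>'. f (\<Sum>k\<in>K. a k u * Z k \<omega>')))"
  if f: "f \<in> borel_measurable borel" "!!x. \<bar>f x\<bar> \<le> 1" for f :: "real => real"
  using indep_var_Fubini_real[where B = 1, OF indep_id measurable_compose[OF m f(1)]] f(2) by simp
 have ii: "integrable P (\<lambda>u. iexp (X u))" if "X \<in> borel_measurable P" for X using that by (rule integrable_iexp_measurable)
 have re: "Re (expectation (\<lambda>u. iexp (X u))) = expectation (\<lambda>u. cos (X u))"
  and im: "Im (expectation (\<lambda>u. iexp (X u))) = expectation (\<lambda>u. sin (X u))" if "X \<in> borel_measurable P" for X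
  using integral_Re[OF ii[OF that]] integral_Im[OF ii[OF that]] by (simp_all add: cos_of_real sin_of_real Re_exp Im_exp)
 have inner: "expectation (\<lambda>\<omega>'. iexp (\<Sum>k\<in>K. a k u * Z k \<omega>')) = complex_of_real (exp (- ((\<Sum>k\<in>K. (a k u)\<^sup>2) / 2)))" for u
  by (rule std_normal_linear_iexp[OF Z_indep_on[OF K] Z_normal]) (use K in auto)
 have c: "expectation (\<lambda>\<omega>'. cos (\<Sum>k\<in>K. a k u * Z k \<omega>')) = exp (- ((\<Sum>k\<in>K. (a k u)\<^sup>2) / 2))"
  and s: "expectation (\<lambda>\<omega>'. sin (\<Sum>k\<in>K. a k u * Z k \<omega>')) = 0" for u
  using re[OF sP[of u]] im[OF sP[of u]] unfolding inner by simp_all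
 show ?thesis
 proof (rule complex_eqI)
  show "Re (expectation (\<lambda>u. iexp (\<Sum>k\<in>K. a k u * Z k u))) = Re (complex_of_real (expectation (\<lambda>u. exp (- ((\<Sum>k\<in>K. (a k u)\<^sup>2) / 2)))))"
   unfolding re[OF sP'] using part[of cos] by (simp add: c)
  show "Im (expectation (\<lambda>u. iexp (\<Sum>k\<in>K. a k u * Z k u))) = Im (complex_of_real (expectation (\<lambda>u. exp (- ((\<Sum>k\<in>K. (a k u)\<^sup>2) / 2)))))"
   unfolding im[OF sP'] using part[of sin] by (simp add: s)
 qed
qed

text \<open>The moment is first computed as an integral of a nonnegative function, so that
  integrability comes out together with the value.\<close>

lemma multiplier_moment:
 assumes K: "K \<subseteq> I" and a: "!!k. k \<in> K ==> a k \<in> borel_measurable D"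
  and i: "integrable P (\<lambda>w. (\<Sum>k\<in>K. (a k w)\<^sup>2) ^ h)"
 shows "integrable P (\<lambda>w. \<bar>\<Sum>k\<in>K. a k w * Z k w\<bar> ^ (2 * h))"
  and "expectation (\<lambda>w. \<bar>\<Sum>k\<in>K. a k w * Z k w\<bar> ^ (2 * h)) = gauss_moment (2 * h) * expectation (\<lambda>w. (\<Sum>k\<in>K. (a k w)\<^sup>2) ^ h)"
proof -
 have ZP: "Z k \<in> borel_measurable P" if "k \<in> K" for k using Z_meas K that by auto
 have aP: "a k \<in> borel_measurable P" if "k \<in> K" for k using measurable_from_subalg[OF D a[OF that]] .
 have mP: "(\<lambda>w. \<bar>\<Sum>k\<in>K. a k w * Z k w\<bar> ^ (2 * h)) \<in> borel_measurable P" using ZP aP by measurable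
 have V0: "0 \<le> (\<Sum>k\<in>K. (a k w)\<^sup>2) ^ h" for w by (rule zero_le_power, rule sum_nonneg) simp
 have pw: "(\<lambda>x::real. ennreal (\<bar>x\<bar> ^ (2 * h))) \<in> borel_measurable borel" by measurable
 have inner: "(\<integral>\<^sup>+\<omega>'. ennreal (\<bar>\<Sum>k\<in>K. a k w * Z k \<omega>'\<bar> ^ (2 * h)) \<partial>P) = ennreal (gauss_moment (2 * h) * (\<Sum>k\<in>K. (a k w)\<^sup>2) ^ h)" for w
 proof -
  have n: "!!k. k \<in> K ==> std_normal_var P (Z k)" using K Z_normal by auto
  have "(\<integral>\<^sup>+\<omega>'. ennreal (\<bar>\<Sum>k\<in>K. a k w * Z k \<omega>'\<bar> ^ (2 * h)) \<partial>P) = ennreal (expectation (\<lambda>\<omega>'. \<bar>\<Sum>k\<in>K. a k w * Z k \<omega>'\<bar> ^ (2 * h)))"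
   by (rule nn_integral_eq_integral[OF std_normal_linear_moment(1)[OF Z_indep_on[OF K] n]]) auto
  then show ?thesis unfolding std_normal_linear_moment(2)[OF Z_indep_on[OF K] n, simplified] by (simp add: power_mult sum_nonneg)
 qed
 have "(\<integral>\<^sup>+w. ennreal (\<bar>\<Sum>k\<in>K. a k w * Z k w\<bar> ^ (2 * h)) \<partial>P) = (\<integral>\<^sup>+w. ennreal (gauss_moment (2 * h) * (\<Sum>k\<in>K. (a k w)\<^sup>2) ^ h) \<partial>P)"
  unfolding inner[symmetric] using indep_var_Fubini[OF indep_id measurable_compose[OF multiplier_measurable[OF K a] pw]] by simp
 also have "... = ennreal (expectation (\<lambda>w. gauss_moment (2 * h) * (\<Sum>k\<in>K. (a k w)\<^sup>2) ^ h))"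
  using i by (intro nn_integral_eq_integral) (auto intro!: AE_I2 mult_nonneg_nonneg gauss_moment_nonneg V0)
 finally have eq: "(\<integral>\<^sup>+w. ennreal (\<bar>\<Sum>k\<in>K. a k w * Z k w\<bar> ^ (2 * h)) \<partial>P) = ennreal (gauss_moment (2 * h) * expectation (\<lambda>w. (\<Sum>k\<in>K. (a k w)\<^sup>2) ^ h))" by simp
 show int: "integrable P (\<lambda>w. \<bar>\<Sum>k\<in>K. a k w * Z k w\<bar> ^ (2 * h))"
  using mP eq by (intro integrableI_nonneg) auto
 have "0 \<le> gauss_moment (2 * h) * expectation (\<lambda>w. (\<Sum>k\<in>K. (a k w)\<^sup>2) ^ h)"
  by (intro mult_nonneg_nonneg integral_nonneg V0 gauss_moment_nonneg)
 then show "expectation (\<lambda>w. \<bar>\<Sum>k\<in>K. a k w * Z k w\<bar> ^ (2 * h)) = gauss_moment (2 * h) * expectation (\<lambda>w. (\<Sum>k\<in>K. (a k w)\<^sup>2) ^ h)"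
  using eq unfolding nn_integral_eq_integral[OF int AE_I2[OF zero_le_power_abs]] by (subst (asm) ennreal_inj) (auto intro!: integral_nonneg)
qed

end

section \<open>Stationary mixing samples\<close>

definition fsum :: "(nat => 'a => 'b) => ('b => real) => nat => 'a => real" where
 "fsum \<eta> f n w = (\<Sum>j=1..n. f (\<eta> j w)) / sqrt (real n)"

text \<open>The multiplier sum for a functional that is already centred, without subtracting sample
  means; 1 / sqrt(n l) is sqrt n times 1 / n times 1 / sqrt l. The bootstrap process is later shown
  to differ from it negligibly.\<close>

definition bsum :: "(nat => 'a => 'b) => ('b => real) => nat => nat => (nat => 'a => real) => 'a => real" where
 "bsum \<eta> f n l x w = (\<Sum>k=1..n + 1 - l. (\<Sum>j=k..k + l - 1. f (\<eta> j w)) / sqrt (real n * real l) * x k w)"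

context stationary_mixing
begin

lemma fsum_moment:
 assumes f: "f \<in> borel_measurable borel" "(\<E> w. f (\<eta> 1 w)) = 0"
  and i: "integrable P (\<lambda>w. f (\<eta> 1 w) ^ (2 * h))" and K: "(\<E> w. f (\<eta> 1 w) ^ (2 * h)) \<le> K" and h: "1 \<le> h"
 shows "integrable P (\<lambda>w. \<bar>fsum \<eta> f n w\<bar> ^ (2 * h))" "(\<E> w. \<bar>fsum \<eta> f n w\<bar> ^ (2 * h)) \<le> moment_const (2 * h) * K"
  "integrable P (\<lambda>w. (\<Sum>j=a+1..a+n. f (\<eta> j w)) ^ (2 * h))"
  "(\<E> w. (\<Sum>j=a+1..a+n. f (\<eta> j w)) ^ (2 * h)) \<le> moment_const (2 * h) * K * real n ^ h"
proof -
 have J: "even (2 * h)" "2 \<le> 2 * h" using h by auto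
 have K0: "0 \<le> K" using K by (rule order_trans[rotated]) (auto intro!: integral_nonneg)
 have m: "(\<E> w. (\<Sum>j=a+1..a+n. f (\<eta> j w)) ^ (2 * h)) \<le> moment_const (2 * h) * real n ^ h * (K + e)" if "0 < e" for a n e
  using functional_moment(1)[OF J f i, of "K + e" a n] K K0 that by simp
 show mi: "integrable P (\<lambda>w. (\<Sum>j=a+1..a+n. f (\<eta> j w)) ^ (2 * h))" for a n
  using functional_moment(2)[OF J f i, of "K + 1" a n] K K0 by simp
 show me: "(\<E> w. (\<Sum>j=a+1..a+n. f (\<eta> j w)) ^ (2 * h)) \<le> moment_const (2 * h) * K * real n ^ h" for a n
 proof -
  \<comment> \<open>The moment inequality wants a positive bound; K + e with e decreasing to 0
    includes K = 0.\<close>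
  have "((\<lambda>e. moment_const (2 * h) * real n ^ h * (K + e)) \<longlongrightarrow> moment_const (2 * h) * real n ^ h * (K + 0)) (at_right 0)"
   by (intro tendsto_intros)
  moreover have "\<forall>\<^sub>F e in at_right 0. (\<E> w. (\<Sum>j=a+1..a+n. f (\<eta> j w)) ^ (2 * h)) \<le> moment_const (2 * h) * real n ^ h * (K + e)"
   using eventually_at_right_less[of 0] by eventually_elim (rule m)
  ultimately have "(\<E> w. (\<Sum>j=a+1..a+n. f (\<eta> j w)) ^ (2 * h)) \<le> moment_const (2 * h) * real n ^ h * (K + 0)"
   by (rule tendsto_lowerbound) simp
  then show ?thesis by (simp add: ac_simps)
 qed
 have eq: "\<bar>fsum \<eta> f n w\<bar> ^ (2 * h) = (\<Sum>j=0+1..0+n. f (\<eta> j w)) ^ (2 * h) / real n ^ h" for w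
  unfolding fsum_def by (simp add: power_even_abs power_divide power_mult)
 show "integrable P (\<lambda>w. \<bar>fsum \<eta> f n w\<bar> ^ (2 * h))" unfolding eq using mi[of 0 n] by simp
 have "(\<E> w. \<bar>fsum \<eta> f n w\<bar> ^ (2 * h)) = (\<E> w. (\<Sum>j=0+1..0+n. f (\<eta> j w)) ^ (2 * h)) / real n ^ h"
  unfolding eq by simp
 also have "... \<le> moment_const (2 * h) * K"
 proof (cases "n = 0")
  case True
  then show ?thesis using h K0 moment_const_nonneg[of "2 * h"] by (simp add: zero_power)
 next
  case False
  then show ?thesis using me[of 0 n] by (simp add: divide_le_eq)
 qed
 finally show "(\<E> w. \<bar>fsum \<eta> f n w\<bar> ^ (2 * h)) \<le> moment_const (2 * h) * K" .
qed

text \<open>A conditionally Gaussian moment of order 2 h is the h-th power of the conditional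
  variance, up to a constant. That variance is bounded by an average of squared block sums, since
  the number N of blocks is at most n, and Jensen's inequality over the blocks leaves the moments of
  order 2 h of single blocks.\<close>

lemma bsum_moment:
 assumes mult: "multipliers P D x {1..}" and DF: "!!j. 1 \<le> j ==> (\<lambda>w. f (\<eta> j w)) \<in> borel_measurable D"
  and f: "f \<in> borel_measurable borel" "(\<E> w. f (\<eta> 1 w)) = 0"
  and i: "integrable P (\<lambda>w. f (\<eta> 1 w) ^ (2 * h))" and K: "(\<E> w. f (\<eta> 1 w) ^ (2 * h)) \<le> K" and h: "1 \<le> h"
  and l: "1 \<le> l" "l \<le> n"
 shows "integrable P (\<lambda>w. \<bar>bsum \<eta> f n l x w\<bar> ^ (2 * h))"
  "(\<E> w. \<bar>bsum \<eta> f n l x w\<bar> ^ (2 * h)) \<le> gauss_moment (2 * h) * (moment_const (2 * h) * K)"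
proof -
 interpret multipliers P D x "{1..}" by (rule mult)
 define N where "N = n + 1 - l"
 have N: "1 \<le> N" "N \<le> n" unfolding N_def using l by auto
 define U where "U k w = (\<Sum>j=k..k + l - 1. f (\<eta> j w))" for k w
 define a where "a k w = U k w / sqrt (real n * real l)" for k w
 have K0: "0 \<le> K" using K by (rule order_trans[rotated]) (auto intro!: integral_nonneg)
 have UD: "U k \<in> borel_measurable D" if "1 \<le> k" for k
  unfolding U_def by (intro borel_measurable_sum DF) (use that in auto)
 have Ueq: "U k w = (\<Sum>j=(k-1)+1..(k-1)+l. f (\<eta> j w))" if "1 \<le> k" for k w
  unfolding U_def using that l by (intro sum.cong) auto
 have Um: "integrable P (\<lambda>w. U k w ^ (2 * h))" "(\<E> w. U k w ^ (2 * h)) \<le> moment_const (2 * h) * K * real l ^ h" if "1 \<le> k" for k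
  using fsum_moment(3,4)[OF f i K h, of "k - 1" l] Ueq[OF that] by simp_all
 let ?V = "\<lambda>w. (\<Sum>k=1..N. (a k w)\<^sup>2) ^ h"
 let ?W = "\<lambda>w. (\<Sum>k=1..N. U k w ^ (2 * h)) / (real N * real l ^ h)"
 have VW: "0 \<le> ?V w" "?V w \<le> ?W w" for w
 proof -
  have "(\<Sum>k=1..N. (a k w)\<^sup>2) = (\<Sum>k=1..N. (U k w)\<^sup>2 / real l) / real n"
   unfolding a_def power_divide using l by (simp add: sum_divide_distrib ac_simps)
  also have "... \<le> (\<Sum>k=1..N. (U k w)\<^sup>2 / real l) / real N"
   using N by (intro divide_left_mono sum_nonneg) auto
  finally have "?V w \<le> ((\<Sum>k=1..N. (U k w)\<^sup>2 / real l) / real N) ^ h" by (intro power_mono sum_nonneg) auto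
  also have "... \<le> (\<Sum>k=1..N. ((U k w)\<^sup>2 / real l) ^ h) / real N"
   using mean_power_le[of "{1..N}" "\<lambda>k. (U k w)\<^sup>2 / real l" h] N by simp
  also have "... = ?W w" unfolding power_divide power_mult by (simp add: mult.commute flip: sum_divide_distrib)
  finally show "?V w \<le> ?W w" .
  show "0 \<le> ?V w" by (rule zero_le_power, rule sum_nonneg) simp
 qed
 have aP: "a k \<in> borel_measurable P" if "k \<in> {1..N}" for k
  unfolding a_def using measurable_from_subalg[OF D UD, of k] that by auto
 have iW: "integrable P ?W" using Um by (intro integrable_divide_zero integrable_sum) auto
 have iV: "integrable P ?V"
  by (rule integrable_le[OF iW], use aP in measurable) (use VW in \<open>simp only: abs_of_nonneg\<close>)
 have eq: "bsum \<eta> f n l x w = (\<Sum>k\<in>{1..N}. a k w * x k w)" for w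
  unfolding bsum_def N_def a_def U_def ..
 have sub: "{1..N} \<subseteq> {1..}" by auto
 have aD: "!!k. k \<in> {1..N} ==> a k \<in> borel_measurable D" unfolding a_def using UD by auto
 show "integrable P (\<lambda>w. \<bar>bsum \<eta> f n l x w\<bar> ^ (2 * h))" unfolding eq by (rule multiplier_moment(1)[OF sub aD iV])
 have E2: "(\<E> w. \<bar>\<Sum>k\<in>{1..N}. a k w * x k w\<bar> ^ (2 * h)) = gauss_moment (2 * h) * expectation ?V"
  by (rule multiplier_moment(2)[OF sub aD iV])
 have "expectation ?V \<le> expectation ?W" by (intro integral_mono iV iW VW)
 also have "... = (\<Sum>k=1..N. (\<E> w. U k w ^ (2 * h))) / (real N * real l ^ h)"
  using Um by (simp add: integral_sum)
 also have "... \<le> (\<Sum>k=1..N. moment_const (2 * h) * K * real l ^ h) / (real N * real l ^ h)"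
  using Um by (intro divide_right_mono sum_mono) auto
 also have "... = moment_const (2 * h) * K" using N l by simp
 finally show "(\<E> w. \<bar>bsum \<eta> f n l x w\<bar> ^ (2 * h)) \<le> gauss_moment (2 * h) * (moment_const (2 * h) * K)"
  unfolding eq E2 by (intro mult_left_mono gauss_moment_nonneg)
qed

lemma centred_functional_power:
 assumes f: "f \<in> borel_measurable borel" and i: "integrable P (\<lambda>w. f (\<eta> 1 w) ^ (2 * h))" and h: "2 \<le> h"
  and e: "(\<E> w. f (\<eta> 1 w)) = 0"
 shows "centred_functional f"
proof -
 have m: "(\<lambda>w. f (\<eta> 1 w)) \<in> borel_measurable P" by (rule measurable_compose[OF meas_eta f]) simp
 have "integrable P (\<lambda>w. \<bar>f (\<eta> 1 w)\<bar> ^ (2 * h))" using i by (simp add: power_even_abs)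
 then have "integrable P (\<lambda>w. f (\<eta> 1 w) ^ 4)" by (rule integrable_power_le[OF m]) (use h in simp)
 then show ?thesis using f e by (simp add: centred_functional_def)
qed

lemma centred_functional_sum:
 assumes "finite Q" "!!i. i \<in> Q ==> centred_functional (f i)"
 shows "centred_functional (\<lambda>y. \<Sum>i\<in>Q. t i * f i y)"
proof -
 have m: "f i \<in> borel_measurable borel" if "i \<in> Q" for i using assms(2)[OF that] by (simp add: centred_functional_def)
 note D = centred_functionalD[OF assms(2) order_refl]
 have "integrable P (\<lambda>x. \<bar>\<Sum>i\<in>Q. t i * f i (\<eta> 1 x)\<bar> ^ 4)"
  using assms(1) D(3) D(5)[of _ 4] by (intro integrable_sum_power) (auto simp: power_mult_distrib power_even_abs)
 moreover have "(\<E> w. \<Sum>i\<in>Q. t i * f i (\<eta> 1 w)) = 0"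
  using D(4,6) by (subst integral_sum) auto
 ultimately show ?thesis using m unfolding centred_functional_def by (auto simp: power_even_abs)
qed

lemma fsum_meas:
 assumes "f \<in> borel_measurable borel"
 shows "fsum \<eta> f n \<in> borel_measurable P"
proof -
 have "(\<lambda>w. f (\<eta> j w)) \<in> borel_measurable P" if "j \<in> {1..n}" for j
  by (rule measurable_compose[OF meas_eta assms]) (use that in simp)
 then show ?thesis unfolding fsum_def by measurable
qed

lemma fsum_diff: "fsum \<eta> f n w - fsum \<eta> f' n w = fsum \<eta> (\<lambda>y. f y - f' y) n w"
 unfolding fsum_def by (simp add: sum_subtractf diff_divide_distrib)

lemma fsum_lincomb: "fsum \<eta> (\<lambda>y. \<Sum>i\<in>Q. t i * f i y) n w = (\<Sum>i\<in>Q. t i * fsum \<eta> (f i) n w)"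
 unfolding fsum_def by (subst sum.swap) (simp add: sum_distrib_left sum_divide_distrib)

lemma fsum_variance:
 assumes "centred_functional f"
 shows "(\<lambda>n. (\<E> w. (fsum \<eta> f n w)\<^sup>2)) \<longlonglongrightarrow> lrv f" "integrable P (\<lambda>w. (fsum \<eta> f n w)\<^sup>2)"
 using variance_limit[OF assms] variance_sum_step(2)[OF assms, of n] unfolding fsum_def by (simp_all add: power_divide)

text \<open>Polarisation of \<open>lrv\<close>, so that no two-sided series of cross-covariances has
  to be handled.\<close>

definition fcov :: "('b => real) => ('b => real) => real" where
 "fcov f f' = (lrv (\<lambda>y. f y + f' y) - lrv f - lrv f') / 2"

lemma fcov_limit:
 assumes f: "centred_functional f" "centred_functional f'"
 shows "(\<lambda>n. (\<E> w. fsum \<eta> f n w * fsum \<eta> f' n w)) \<longlonglongrightarrow> fcov f f'"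
  "integrable P (\<lambda>w. fsum \<eta> f n w * fsum \<eta> f' n w)"
proof -
 have c: "centred_functional (\<lambda>y. f y + f' y)"
  using centred_functional_sum[of "UNIV :: bool set" "\<lambda>b. if b then f else f'" "\<lambda>_. 1"] f by (simp add: UNIV_bool add.commute)
 have eq: "fsum \<eta> f n w * fsum \<eta> f' n w = ((fsum \<eta> (\<lambda>y. f y + f' y) n w)\<^sup>2 - (fsum \<eta> f n w)\<^sup>2 - (fsum \<eta> f' n w)\<^sup>2) / 2" for n w
  unfolding fsum_def by (simp add: sum.distrib add_divide_distrib power2_sum)
 note i = fsum_variance(2)[OF c] fsum_variance(2)[OF f(1)] fsum_variance(2)[OF f(2)]
 show "integrable P (\<lambda>w. fsum \<eta> f n w * fsum \<eta> f' n w)" unfolding eq using i by auto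
 show "(\<lambda>n. (\<E> w. fsum \<eta> f n w * fsum \<eta> f' n w)) \<longlonglongrightarrow> fcov f f'"
  unfolding eq fcov_def using i by (simp, intro tendsto_intros fsum_variance(1) c f) auto
qed

text \<open>Bilinearity is not visible from polarisation. It is inherited from the expectations of
  products of normalised sums, of which \<open>fcov\<close> is the limit.\<close>

lemma lrv_lincomb:
 assumes Q: "finite Q" "!!i. i \<in> Q ==> centred_functional (f i)"
 shows "lrv (\<lambda>y. \<Sum>i\<in>Q. t i * f i y) = (\<Sum>i\<in>Q. \<Sum>j\<in>Q. t i * t j * fcov (f i) (f j))"
proof (rule LIMSEQ_unique[OF fsum_variance(1)[OF centred_functional_sum[OF Q]]])
 have "(\<Sum>i\<in>Q. t i * x i)\<^sup>2 = (\<Sum>i\<in>Q. \<Sum>j\<in>Q. t i * t j * (x i * x j))" for x :: "_ => real"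
  unfolding power2_eq_square sum_product by (simp add: ac_simps)
 then have "(\<E> w. (fsum \<eta> (\<lambda>y. \<Sum>i\<in>Q. t i * f i y) n w)\<^sup>2) = (\<Sum>i\<in>Q. \<Sum>j\<in>Q. t i * t j * (\<E> w. fsum \<eta> (f i) n w * fsum \<eta> (f j) n w))" for n
  unfolding fsum_lincomb using fcov_limit(2)[OF Q(2) Q(2)]
  by (simp add: integral_sum integrable_sum)
 moreover have "(\<lambda>n. \<Sum>i\<in>Q. \<Sum>j\<in>Q. t i * t j * (\<E> w. fsum \<eta> (f i) n w * fsum \<eta> (f j) n w)) \<longlonglongrightarrow> (\<Sum>i\<in>Q. \<Sum>j\<in>Q. t i * t j * fcov (f i) (f j))"
  by (intro tendsto_sum tendsto_mult_left fcov_limit Q(2))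
 ultimately show "(\<lambda>n. (\<E> w. (fsum \<eta> (\<lambda>y. \<Sum>i\<in>Q. t i * f i y) n w)\<^sup>2)) \<longlonglongrightarrow> (\<Sum>i\<in>Q. \<Sum>j\<in>Q. t i * t j * fcov (f i) (f j))"
  by simp
qed

lemma fcov_sym: "fcov f f' = fcov f' f"
 unfolding fcov_def by (simp add: add.commute)

lemma lrv_diff:
 assumes "centred_functional f" "centred_functional f'"
 shows "lrv (\<lambda>y. f y - f' y) = fcov f f - 2 * fcov f f' + fcov f' f'" "centred_functional (\<lambda>y. f y - f' y)"
proof -
 have c: "!!b. centred_functional (if b then f else f')" using assms by simp
 show "lrv (\<lambda>y. f y - f' y) = fcov f f - 2 * fcov f f' + fcov f' f'"
  using lrv_lincomb[of "UNIV :: bool set" "\<lambda>b. if b then f else f'" "\<lambda>b. if b then 1 else - 1"] c fcov_sym[of f' f] by (simp add: UNIV_bool)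
 show "centred_functional (\<lambda>y. f y - f' y)"
  using centred_functional_sum[of "UNIV :: bool set" "\<lambda>b. if b then f else f'" "\<lambda>b. if b then 1 else - 1"] c by (simp add: UNIV_bool)
qed

text \<open>Jensen's inequality and the moment bound for normalised sums pass to the limit. Applied
  to differences, this bounds the increments of the limit covariance.\<close>

lemma lrv_power_le:
 assumes f: "f \<in> borel_measurable borel" "(\<E> w. f (\<eta> 1 w)) = 0"
  and i: "integrable P (\<lambda>w. f (\<eta> 1 w) ^ (2 * h))" and K: "(\<E> w. f (\<eta> 1 w) ^ (2 * h)) \<le> K" and h: "2 \<le> h"
 shows "lrv f ^ h \<le> moment_const (2 * h) * K"
proof (rule tendsto_upperbound)
 have c: "centred_functional f" by (rule centred_functional_power[OF f(1) i h f(2)])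
 show "(\<lambda>n. (\<E> w. (fsum \<eta> f n w)\<^sup>2) ^ h) \<longlonglongrightarrow> lrv f ^ h" by (intro tendsto_power fsum_variance(1) c)
 have h1: "1 \<le> h" using h by simp
 have "(\<E> w. (fsum \<eta> f n w)\<^sup>2) ^ h \<le> moment_const (2 * h) * K" for n
 proof -
  have eq: "((fsum \<eta> f n w)\<^sup>2) ^ h = \<bar>fsum \<eta> f n w\<bar> ^ (2 * h)" for w by (simp add: power_mult)
  have "(\<E> w. (fsum \<eta> f n w)\<^sup>2) ^ h \<le> (\<E> w. ((fsum \<eta> f n w)\<^sup>2) ^ h)"
   by (rule expectation_power_le) (use fsum_variance(2)[OF c] fsum_moment(1)[OF f i K h1] in \<open>simp_all add: eq\<close>)
  also have "... \<le> moment_const (2 * h) * K" unfolding eq by (rule fsum_moment(2)[OF f i K h1])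
  finally show ?thesis .
 qed
 then show "\<forall>\<^sub>F n in sequentially. (\<E> w. (fsum \<eta> f n w)\<^sup>2) ^ h \<le> moment_const (2 * h) * K" by simp
qed simp

text \<open>A family of centred functionals, indexed by the unit square, whose partial sums are
 controlled by the chaining bound.\<close>

definition field_functional :: "(pt => 'b => real) => nat => real => real => bool" where
 "field_functional f h K g \<longleftrightarrow> 2 \<le> h \<and> 2 < g \<and> 0 \<le> K \<and>
   (\<forall>p. f p \<in> borel_measurable borel \<and> (\<E> w. f p (\<eta> 1 w)) = 0 \<and>
    integrable P (\<lambda>w. f p (\<eta> 1 w) ^ (2 * h)) \<and> (\<E> w. f p (\<eta> 1 w) ^ (2 * h)) \<le> K) \<and>
   (\<forall>N p. (\<E> w. (f (dyad2 (Suc N) p) (\<eta> 1 w) - f (dyad2 N p) (\<eta> 1 w)) ^ (2 * h)) \<le> K * (1 / 2 ^ N) powr g)"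

lemma field_functionalD:
 assumes "field_functional f h K g"
 shows "2 \<le> h" "2 < g" "0 \<le> K" "f p \<in> borel_measurable borel" "(\<E> w. f p (\<eta> 1 w)) = 0"
  "integrable P (\<lambda>w. f p (\<eta> 1 w) ^ (2 * h))" "(\<E> w. f p (\<eta> 1 w) ^ (2 * h)) \<le> K"
  "(\<E> w. (f (dyad2 (Suc N) p) (\<eta> 1 w) - f (dyad2 N p) (\<eta> 1 w)) ^ (2 * h)) \<le> K * (1 / 2 ^ N) powr g"
  "centred_functional (f p)" "1 \<le> h"
  "(\<lambda>y. f p y - f q y) \<in> borel_measurable borel" "(\<E> w. f p (\<eta> 1 w) - f q (\<eta> 1 w)) = 0"
  "integrable P (\<lambda>w. (f p (\<eta> 1 w) - f q (\<eta> 1 w)) ^ (2 * h))"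
proof -
 show D: "2 \<le> h" "2 < g" "0 \<le> K" and m: "f p \<in> borel_measurable borel" and e: "(\<E> w. f p (\<eta> 1 w)) = 0"
  and i: "integrable P (\<lambda>w. f p (\<eta> 1 w) ^ (2 * h))" and "(\<E> w. f p (\<eta> 1 w) ^ (2 * h)) \<le> K"
  "(\<E> w. (f (dyad2 (Suc N) p) (\<eta> 1 w) - f (dyad2 N p) (\<eta> 1 w)) ^ (2 * h)) \<le> K * (1 / 2 ^ N) powr g" for p N
  using assms unfolding field_functional_def by blast+
 show c: "centred_functional (f p)" for p by (rule centred_functional_power[OF m i D(1) e])
 show "1 \<le> h" using D by simp
 show "(\<lambda>y. f p y - f q y) \<in> borel_measurable borel" using m by measurable
 show "(\<E> w. f p (\<eta> 1 w) - f q (\<eta> 1 w)) = 0"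
  using e centred_functionalD(6)[OF c order_refl] by simp
 have m1: "(\<lambda>w. f p (\<eta> 1 w)) \<in> borel_measurable P" for p by (rule measurable_compose[OF meas_eta m]) simp
 have "integrable P (\<lambda>w. \<bar>\<Sum>b\<in>UNIV. if b then f p (\<eta> 1 w) else - f q (\<eta> 1 w)\<bar> ^ (2 * h))"
 proof (rule integrable_sum_power)
  fix b :: bool
  show "(\<lambda>w. if b then f p (\<eta> 1 w) else - f q (\<eta> 1 w)) \<in> borel_measurable P"
   using m1[of p] m1[of q] by (cases b) simp_all
  show "integrable P (\<lambda>w. \<bar>if b then f p (\<eta> 1 w) else - f q (\<eta> 1 w)\<bar> ^ (2 * h))"
   using i[of p] i[of q] by (cases b) (simp_all add: power_even_abs)
 qed simp
 then show "integrable P (\<lambda>w. (f p (\<eta> 1 w) - f q (\<eta> 1 w)) ^ (2 * h))" by (simp add: UNIV_bool power_even_abs)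
qed

lemma fsum_field:
 assumes F: "field_functional f h K g"
 shows "equicont_on dyad2 dyads (\<lambda>n w p. fsum \<eta> (f p) n w)" "tight_on dyads (\<lambda>n w p. fsum \<eta> (f p) n w)"
  "tight_on {q} (\<lambda>n w p. fsum \<eta> (f p) n w)"
proof -
 note D = field_functionalD[OF F]
 show t: "tight_on {q} (\<lambda>n w p. fsum \<eta> (f p) n w)" for q
  by (rule tight_on_pointwise_moment[OF fsum_meas[OF D(4)], where k = "2 * h" and C = "moment_const (2 * h) * K"])
   (use fsum_moment(1,2)[OF D(4,5,6,7,10)] D(10) in auto)
 show e: "equicont_on dyad2 dyads (\<lambda>n w p. fsum \<eta> (f p) n w)"
 proof (rule equicont_on_dyads[OF fsum_meas[OF D(4)] _ D(2)])
  show "\<forall>\<^sub>F n in sequentially. \<forall>N p. integrable P (\<lambda>w. \<bar>fsum \<eta> (f (dyad2 (Suc N) p)) n w - fsum \<eta> (f (dyad2 N p)) n w\<bar> ^ (2 * h)) \<and>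
    (\<E> w. \<bar>fsum \<eta> (f (dyad2 (Suc N) p)) n w - fsum \<eta> (f (dyad2 N p)) n w\<bar> ^ (2 * h)) \<le> moment_const (2 * h) * K * (1 / 2 ^ N) powr g"
   using fsum_moment(1,2)[OF D(11,12,13,8,10)] unfolding fsum_diff by (simp add: mult.assoc)
 qed (use D(3,10) moment_const_nonneg in auto)
 show "tight_on dyads (\<lambda>n w p. fsum \<eta> (f p) n w)"
  by (rule equicont_imp_tight[OF e _ t]) (rule finite_subset[OF _ dyad2_range(1)], auto)
qed

lemma bsum_diff: "bsum \<eta> f n l x w - bsum \<eta> f' n l x w = bsum \<eta> (\<lambda>y. f y - f' y) n l x w"
 unfolding bsum_def by (simp add: sum_subtractf diff_divide_distrib left_diff_distrib)

lemma bsum_lincomb: "bsum \<eta> (\<lambda>y. \<Sum>i\<in>Q. t i * f i y) n l x w = (\<Sum>i\<in>Q. t i * bsum \<eta> (f i) n l x w)"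
proof -
 have "(\<Sum>j\<in>A. \<Sum>i\<in>Q. t i * f i (\<eta> j w)) / c * y = (\<Sum>i\<in>Q. t i * ((\<Sum>j\<in>A. f i (\<eta> j w)) / c * y))" for A c y
  by (subst sum.swap) (simp add: sum_distrib_left sum_distrib_right sum_divide_distrib ac_simps)
 then show ?thesis unfolding bsum_def sum_distrib_left by (simp only:) (rule sum.swap)
qed

lemma bsum_meas:
 assumes f: "f \<in> borel_measurable borel" and x: "!!k. 1 \<le> k ==> x k \<in> borel_measurable P"
 shows "bsum \<eta> f n l x \<in> borel_measurable P"
proof -
 have "(\<lambda>w. f (\<eta> j w)) \<in> borel_measurable P" if "1 \<le> j" for j
  by (rule measurable_compose[OF meas_eta f]) (use that in simp)
 then show ?thesis unfolding bsum_def using x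
  by (intro bm_intros) auto
qed

text \<open>The family \<open>x i\<close> may change with the index, so that later limits hold along
  arbitrary sequences of replicate numbers.\<close>

lemma bsum_field:
 assumes F: "field_functional f h K g"
  and mult: "!!i. multipliers P D (x i) {1..}" and DF: "!!p j. 1 \<le> j ==> (\<lambda>w. f p (\<eta> j w)) \<in> borel_measurable D"
  and l: "\<forall>\<^sub>F i in sequentially. 1 \<le> l i \<and> l i \<le> n i"
 shows "equicont_on dyad2 dyads (\<lambda>i w p. bsum \<eta> (f p) (n i) (l i) (x i) w)" "tight_on dyads (\<lambda>i w p. bsum \<eta> (f p) (n i) (l i) (x i) w)"
proof -
 note D = field_functionalD[OF F]
 have xm: "1 \<le> k ==> x i k \<in> borel_measurable P" for i k using multipliers.Z_meas[OF mult, of k] by simp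
 have DFd: "!!j. 1 \<le> j ==> (\<lambda>w. f p (\<eta> j w) - f q (\<eta> j w)) \<in> borel_measurable D" for p q using DF by simp
 note bm = bsum_moment[OF mult _ _ _ _ _ D(10)]
 show e: "equicont_on dyad2 dyads (\<lambda>i w p. bsum \<eta> (f p) (n i) (l i) (x i) w)"
 proof (rule equicont_on_dyads[OF bsum_meas[OF D(4) xm] _ D(2)])
  show "\<forall>\<^sub>F i in sequentially. \<forall>N p. integrable P (\<lambda>w. \<bar>bsum \<eta> (f (dyad2 (Suc N) p)) (n i) (l i) (x i) w - bsum \<eta> (f (dyad2 N p)) (n i) (l i) (x i) w\<bar> ^ (2 * h)) \<and>
    (\<E> w. \<bar>bsum \<eta> (f (dyad2 (Suc N) p)) (n i) (l i) (x i) w - bsum \<eta> (f (dyad2 N p)) (n i) (l i) (x i) w\<bar> ^ (2 * h))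
     \<le> gauss_moment (2 * h) * (moment_const (2 * h) * K) * (1 / 2 ^ N) powr g"
   using l
  proof eventually_elim
   case (elim i)
   show ?case unfolding bsum_diff using bm[OF DFd D(11,12,13,8)] elim by (simp add: mult.assoc)
  qed
 qed (use D(3,10) moment_const_nonneg gauss_moment_nonneg in auto)
 show "tight_on dyads (\<lambda>i w p. bsum \<eta> (f p) (n i) (l i) (x i) w)"
 proof (rule equicont_imp_tight[OF e])
  show "finite (dyad2 N ` dyads)" for N by (rule finite_subset[OF _ dyad2_range(1)]) auto
  fix q
  show "tight_on {q} (\<lambda>i w p. bsum \<eta> (f p) (n i) (l i) (x i) w)"
  proof (rule tight_on_pointwise_moment[OF bsum_meas[OF D(4) xm], where k = "2 * h" and C = "gauss_moment (2 * h) * (moment_const (2 * h) * K)"])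
   show "\<forall>\<^sub>F i in sequentially. integrable P (\<lambda>w. \<bar>bsum \<eta> (f q) (n i) (l i) (x i) w\<bar> ^ (2 * h)) \<and>
    (\<E> w. \<bar>bsum \<eta> (f q) (n i) (l i) (x i) w\<bar> ^ (2 * h)) \<le> gauss_moment (2 * h) * (moment_const (2 * h) * K)"
    using l by eventually_elim (use bm[OF DF D(4,5,6,7)] in auto)
  qed (use D(10) in auto)
 qed
qed

end

section \<open>Empirical covariance fields and their block multiplier versions\<close>

lemma eval_meas: "(\<lambda>y. apply_bcontfun y t) \<in> borel_measurable (borel :: C01 measure)"
proof (intro borel_measurable_continuous_onI continuous_at_imp_continuous_on ballI)
 fix y :: C01
 show "isCont (\<lambda>y. apply_bcontfun y t) y"
  unfolding continuous_at_eps_delta using order_le_less_trans[OF dist_bounded] by blast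
qed

lemma apply_bcontfun_sum: "apply_bcontfun (\<Sum>j\<in>A. f j) t = (\<Sum>j\<in>A. apply_bcontfun (f j :: 'a::topological_space \<Rightarrow>\<^sub>C real) t)"
 by (induction A rule: infinite_finite_induct) (auto simp: plus_bcontfun.rep_eq)

lemma abs_apply_le_norm: "\<bar>apply_bcontfun y t\<bar> \<le> norm (y :: 'a::topological_space \<Rightarrow>\<^sub>C real)"
 using norm_bounded[of y t] by simp

lemma dist_dyad_step: "dist (dyad (Suc N) s) (dyad N s) \<le> 1 / 2 ^ N"
 using dist_dyad[of N "dyad (Suc N) s"] by (simp add: dyad_dyad dist_commute)

text \<open>Instances have h = J / 2 and g = J \<open>\<theta>\<close>. Since (A3) bounds moments of
  the norm times M, it controls increments of products in order 2 h, but of single evaluations only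
  the squares of increments; hence the exponent 4 h at the same rate in
  \<open>incr1\<close>.\<close>

locale sample = stationary_mixing P \<eta> \<phi> for P :: "'a measure" and \<eta> :: "nat => 'a => C01" and \<phi> +
 fixes h :: nat and g K :: real
 assumes h: "2 \<le> h" and g: "2 < g" and K: "0 \<le> K"
  and centred: "!!t. (\<E> w. \<eta> 1 w t) = 0"
  and mom_int: "integrable P (\<lambda>w. norm (\<eta> 1 w) ^ (4 * h))" and mom: "(\<E> w. norm (\<eta> 1 w) ^ (4 * h)) \<le> K"
  and incr1: "!!N s s'. dist s s' \<le> 1 / 2 ^ N ==> (\<E> w. (\<eta> 1 w s - \<eta> 1 w s') ^ (4 * h)) \<le> K * (1 / 2 ^ N) powr g"
  and incr2: "!!N s t s' t'. dist s s' \<le> 1 / 2 ^ N ==> dist t t' \<le> 1 / 2 ^ N ==>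
   (\<E> w. (\<eta> 1 w s * \<eta> 1 w t - \<eta> 1 w s' * \<eta> 1 w t' - (cov_kernel P \<eta> s t - cov_kernel P \<eta> s' t')) ^ (2 * h)) \<le> K * (1 / 2 ^ N) powr g"
begin

definition wprod :: "pt => C01 => real" where
 "wprod p y = y (fst p) * y (snd p) - cov_kernel P \<eta> (fst p) (snd p)"

text \<open>Indexed by pairs although one coordinate matters, so that the evaluations fit the same
  chaining as \<open>wprod\<close>.\<close>

definition ev1 :: "pt => C01 => real" where "ev1 p y = y (fst p)"

definition ev2 :: "pt => C01 => real" where "ev2 p y = y (snd p)"

lemma eval_eta_meas[measurable]: "1 \<le> j ==> (\<lambda>w. \<eta> j w t) \<in> borel_measurable P"
 by (rule measurable_compose[OF meas_eta eval_meas])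

lemma eval_power_integrable:
 assumes "k \<le> 4 * h"
 shows "integrable P (\<lambda>w. \<bar>\<eta> 1 w t\<bar> ^ k)"
proof -
 have "integrable P (\<lambda>w. \<bar>\<eta> 1 w t\<bar> ^ (4 * h))"
  by (rule integrable_le[OF mom_int]) (simp_all add: power_abs power_mono abs_apply_le_norm)
 then show ?thesis using integrable_power_le[of "\<lambda>w. \<bar>\<eta> 1 w t\<bar>" "4 * h" k] assms by simp
qed

lemma eval_power_bound: "(\<E> w. (\<eta> 1 w t) ^ (4 * h)) \<le> K"
proof -
 have "(\<E> w. (\<eta> 1 w t) ^ (4 * h)) \<le> (\<E> w. norm (\<eta> 1 w) ^ (4 * h))"
 proof (rule integral_mono[OF _ mom_int])
  show "integrable P (\<lambda>w. (\<eta> 1 w t) ^ (4 * h))" using eval_power_integrable[of "4 * h" t] by (simp add: power_even_abs)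
  fix w
  have "\<bar>\<eta> 1 w t\<bar> ^ (4 * h) \<le> norm (\<eta> 1 w) ^ (4 * h)" by (intro power_mono abs_apply_le_norm) simp
  then show "(\<eta> 1 w t) ^ (4 * h) \<le> norm (\<eta> 1 w) ^ (4 * h)" by (simp add: power_even_abs)
 qed
 with mom show ?thesis by simp
qed

lemma prod_power_le: "\<bar>x * y\<bar> ^ n \<le> x ^ (2 * n) + y ^ (2 * n)" for x y :: real
proof -
 have "2 * (\<bar>x\<bar> ^ n * \<bar>y\<bar> ^ n) \<le> (\<bar>x\<bar> ^ n)\<^sup>2 + (\<bar>y\<bar> ^ n)\<^sup>2" using sum_squares_bound[of "\<bar>x\<bar> ^ n" "\<bar>y\<bar> ^ n"] by simp
 moreover have z: "(\<bar>z\<bar> ^ n)\<^sup>2 = z ^ (2 * n)" for z :: real by (simp add: power_mult[symmetric] mult.commute power_even_abs)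
 note z[of x] z[of y]
 moreover have "0 \<le> \<bar>x\<bar> ^ n * \<bar>y\<bar> ^ n" by simp
 ultimately show ?thesis unfolding abs_mult power_mult_distrib by linarith
qed

lemma prod_moments:
 shows "integrable P (\<lambda>w. \<eta> 1 w s * \<eta> 1 w t)" "integrable P (\<lambda>w. \<bar>\<eta> 1 w s * \<eta> 1 w t\<bar> ^ (2 * h))"
  "(\<E> w. \<bar>\<eta> 1 w s * \<eta> 1 w t\<bar> ^ (2 * h)) \<le> 2 * K" "\<bar>cov_kernel P \<eta> s t\<bar> \<le> 2 * K + 1"
proof -
 have i4: "integrable P (\<lambda>w. \<eta> 1 w t ^ (4 * h))" for t using eval_power_integrable[of "4 * h" t] by (simp add: power_even_abs)
 have i: "integrable P (\<lambda>w. \<eta> 1 w s ^ (4 * h) + \<eta> 1 w t ^ (4 * h))" using i4 by simp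
 have le: "\<bar>\<eta> 1 w s * \<eta> 1 w t\<bar> ^ (2 * h) \<le> \<eta> 1 w s ^ (4 * h) + \<eta> 1 w t ^ (4 * h)" for w
  using prod_power_le[of "\<eta> 1 w s" "\<eta> 1 w t" "2 * h"] by simp
 show i2: "integrable P (\<lambda>w. \<bar>\<eta> 1 w s * \<eta> 1 w t\<bar> ^ (2 * h))"
  by (rule integrable_le[OF i]) (use le in simp_all)
 have "(\<E> w. \<bar>\<eta> 1 w s * \<eta> 1 w t\<bar> ^ (2 * h)) \<le> (\<E> w. \<eta> 1 w s ^ (4 * h) + \<eta> 1 w t ^ (4 * h))"
  by (intro integral_mono i2 i le)
 also have "... \<le> 2 * K" using i4 eval_power_bound[of s] eval_power_bound[of t] by simp
 finally show b: "(\<E> w. \<bar>\<eta> 1 w s * \<eta> 1 w t\<bar> ^ (2 * h)) \<le> 2 * K" .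
 show i1: "integrable P (\<lambda>w. \<eta> 1 w s * \<eta> 1 w t)"
  using integrable_power_le[OF _ i2, of 1] h by simp
 have "\<bar>cov_kernel P \<eta> s t\<bar> \<le> (\<E> w. \<bar>\<eta> 1 w s * \<eta> 1 w t\<bar>)"
  unfolding cov_kernel_def by (rule integral_abs_bound)
 also have "... \<le> (\<E> w. \<bar>\<eta> 1 w s * \<eta> 1 w t\<bar> ^ (2 * h) + 1)"
 proof (rule integral_mono)
  fix w
  have "\<bar>z\<bar> \<le> \<bar>z\<bar> ^ (2 * h) + 1" for z :: real
  proof (cases "\<bar>z\<bar> \<le> 1")
   case False
   then have "\<bar>z\<bar> ^ 1 \<le> \<bar>z\<bar> ^ (2 * h)" using h by (intro power_increasing) auto
   then show ?thesis by simp
  qed (simp add: add_increasing)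
  then show "\<bar>\<eta> 1 w s * \<eta> 1 w t\<bar> \<le> \<bar>\<eta> 1 w s * \<eta> 1 w t\<bar> ^ (2 * h) + 1" .
 qed (use i1 i2 in auto)
 also have "... \<le> 2 * K + 1" using i2 b by (simp add: prob_space)
 finally show "\<bar>cov_kernel P \<eta> s t\<bar> \<le> 2 * K + 1" .
qed

text \<open>One constant for increments and for moments: the product of two values has moment of
  order 2 h at most 2 K, and its mean is at most 2 K + 1 in absolute value.\<close>

definition Kw :: real where "Kw = K + 2 ^ (2 * h) * (2 * K + (2 * K + 1) ^ (2 * h))"

lemma wprod_incr:
 assumes "dist (fst p) (fst q) \<le> 1 / 2 ^ N" "dist (snd p) (snd q) \<le> 1 / 2 ^ N"
 shows "(\<E> w. (wprod p (\<eta> 1 w) - wprod q (\<eta> 1 w)) ^ (2 * h)) \<le> Kw * (1 / 2 ^ N) powr g"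
proof -
 have "(\<E> w. (wprod p (\<eta> 1 w) - wprod q (\<eta> 1 w)) ^ (2 * h)) \<le> K * (1 / 2 ^ N) powr g"
  using incr2[OF assms] unfolding wprod_def by (simp add: algebra_simps)
 also have "... \<le> Kw * (1 / 2 ^ N) powr g" using K by (intro mult_right_mono) (auto simp: Kw_def)
 finally show ?thesis .
qed

lemma wprod_field: "field_functional wprod h Kw g"
proof -
 have Kw: "K \<le> Kw" "2 ^ (2 * h) * (2 * K + (2 * K + 1) ^ (2 * h)) \<le> Kw" unfolding Kw_def using K by auto
 have ip: "integrable P (\<lambda>w. wprod p (\<eta> 1 w) ^ (2 * h))" and bp: "(\<E> w. wprod p (\<eta> 1 w) ^ (2 * h)) \<le> Kw" for p
 proof -
  let ?x = "\<lambda>w. \<eta> 1 w (fst p) * \<eta> 1 w (snd p)" and ?c = "cov_kernel P \<eta> (fst p) (snd p)"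
  note PM = prod_moments[of "fst p" "snd p"]
  have le: "wprod p (\<eta> 1 w) ^ (2 * h) \<le> 2 ^ (2 * h) * (\<bar>?x w\<bar> ^ (2 * h) + (2 * K + 1) ^ (2 * h))" for w
  proof -
   have "wprod p (\<eta> 1 w) ^ (2 * h) = \<bar>?x w + - ?c\<bar> ^ (2 * h)" unfolding wprod_def by (simp add: power_even_abs)
   also have "... \<le> (\<bar>?x w\<bar> + \<bar>- ?c\<bar>) ^ (2 * h)" by (intro power_mono abs_triangle_ineq) simp
   also have "... \<le> 2 ^ (2 * h) * (\<bar>?x w\<bar> ^ (2 * h) + \<bar>- ?c\<bar> ^ (2 * h))" by (rule abs_add_power_le)
   also have "... \<le> 2 ^ (2 * h) * (\<bar>?x w\<bar> ^ (2 * h) + (2 * K + 1) ^ (2 * h))"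
    using PM(4) by (intro mult_left_mono add_left_mono power_mono) auto
   finally show ?thesis .
  qed
  have i: "integrable P (\<lambda>w. 2 ^ (2 * h) * (\<bar>?x w\<bar> ^ (2 * h) + (2 * K + 1) ^ (2 * h)))" using PM(2) by simp
  show ip: "integrable P (\<lambda>w. wprod p (\<eta> 1 w) ^ (2 * h))"
  proof (rule integrable_le[OF i])
   show "(\<lambda>w. wprod p (\<eta> 1 w) ^ (2 * h)) \<in> borel_measurable P" unfolding wprod_def by measurable
   show "\<bar>wprod p (\<eta> 1 w) ^ (2 * h)\<bar> \<le> 2 ^ (2 * h) * (\<bar>?x w\<bar> ^ (2 * h) + (2 * K + 1) ^ (2 * h))" for w
    using le[of w] by (simp add: zero_le_even_power)
  qed
  have "(\<E> w. wprod p (\<eta> 1 w) ^ (2 * h)) \<le> (\<E> w. 2 ^ (2 * h) * (\<bar>?x w\<bar> ^ (2 * h) + (2 * K + 1) ^ (2 * h)))"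
   by (intro integral_mono ip i le)
  also have "... = 2 ^ (2 * h) * ((\<E> w. \<bar>?x w\<bar> ^ (2 * h)) + (2 * K + 1) ^ (2 * h))" using PM(2) by (simp add: prob_space)
  also have "... \<le> 2 ^ (2 * h) * (2 * K + (2 * K + 1) ^ (2 * h))" using PM(3) by (intro mult_left_mono add_right_mono) auto
  finally show "(\<E> w. wprod p (\<eta> 1 w) ^ (2 * h)) \<le> Kw" using Kw(2) by simp
 qed
 have inc: "(\<E> w. (wprod (dyad2 (Suc N) p) (\<eta> 1 w) - wprod (dyad2 N p) (\<eta> 1 w)) ^ (2 * h)) \<le> Kw * (1 / 2 ^ N) powr g" for N p
  by (rule wprod_incr) (auto simp: dyad2_def dist_dyad_step)
 have bm: "wprod p \<in> borel_measurable borel" for p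
  unfolding wprod_def[abs_def] by (intro bm_intros eval_meas borel_measurable_const)
 have e0: "(\<E> w. wprod p (\<eta> 1 w)) = 0" for p
  unfolding wprod_def cov_kernel_def using prod_moments(1) by (simp add: prob_space)
 show ?thesis unfolding field_functional_def using h g K Kw ip bp inc bm e0 by auto
qed

lemma ev_field: "field_functional ev1 (2 * h) K g" "field_functional ev2 (2 * h) K g"
proof -
 have i4: "integrable P (\<lambda>w. \<eta> 1 w t ^ (4 * h))" for t using eval_power_integrable[of "4 * h" t] by (simp add: power_even_abs)
 have e: "2 * (2 * h) = 4 * h" by simp
 show "field_functional ev1 (2 * h) K g" "field_functional ev2 (2 * h) K g"
  unfolding field_functional_def e ev1_def[abs_def] ev2_def[abs_def]
  using h g K i4 eval_power_bound incr1[OF dist_dyad_step] centred eval_meas by (auto simp: dyad2_def)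
qed

section \<open>Limit covariance of the empirical covariance field\<close>

definition wcov :: "pt => pt => real" where
 "wcov p q = fcov (wprod p) (wprod q)"

lemma wcov_incr:
 "(wcov (dyad2 (Suc N) p) (dyad2 (Suc N) p) - 2 * wcov (dyad2 (Suc N) p) (dyad2 N p) + wcov (dyad2 N p) (dyad2 N p)) ^ h
   \<le> moment_const (2 * h) * Kw * (1 / 2 ^ N) powr g"
 using lrv_power_le[OF field_functionalD(11,12,13,8)[OF wprod_field] h] lrv_diff(1)[OF field_functionalD(9)[OF wprod_field] field_functionalD(9)[OF wprod_field]]
 unfolding wcov_def by (simp add: mult.assoc)

lemma centred_sq_apply:
 assumes X: "!!j w. X j w = \<mu> + \<eta> j w" and m: "1 \<le> m"
 shows "centred_sq X m j w p = (ev1 p (\<eta> j w) - fsum \<eta> (ev1 p) m w / sqrt (real m)) * (ev2 p (\<eta> j w) - fsum \<eta> (ev2 p) m w / sqrt (real m))"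
proof -
 have "(X j w - sample_mean X m w) t = \<eta> j w t - (\<Sum>i=1..m. \<eta> i w t) / real m" for t
  unfolding sample_mean_def X using m
  by (simp add: minus_bcontfun.rep_eq plus_bcontfun.rep_eq scaleR_bcontfun.rep_eq apply_bcontfun_sum sum.distrib add_divide_distrib)
 then show ?thesis unfolding centred_sq_def
  by (cases p) (simp add: tensor_sq_apply fsum_def ev1_def ev2_def)
qed

lemma wcov_self: "wcov p p = lrv (wprod p)"
 using lrv_lincomb[of "{()}" "\<lambda>_. wprod p" "\<lambda>_. 1"] field_functionalD(9)[OF wprod_field] unfolding wcov_def by simp

lemma long_run_var_eq: "long_run_var P \<eta> s t = wcov (s, t) (s, t)"
 unfolding wcov_self long_run_var_def lrv_def sq_cov_def lag_cov_def wprod_def by simp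

lemma wcov_self_nonneg: "0 \<le> wcov p p"
 unfolding wcov_self by (rule lrv_nonneg[OF field_functionalD(9)[OF wprod_field]])

text \<open>The long-run variance of the difference between \<open>wprod\<close> at p and at its
  projections tends to 0 with the grid size, so the variance cannot vanish at all dyadic points and
  be positive at p.\<close>

lemma wcov_dyads:
 assumes "0 < wcov p p"
 shows "\<exists>q\<in>dyads. 0 < wcov q q"
proof (rule ccontr)
 assume n: "\<not> (\<exists>q\<in>dyads. 0 < wcov q q)"
 let ?f = "wprod p"
 note c = field_functionalD(9)[OF wprod_field] and D = field_functionalD[OF wprod_field]
 have z: "wcov (dyad2 N p) (dyad2 N p) = 0" for N
 proof -
  have "\<not> 0 < wcov (dyad2 N p) (dyad2 N p)" using n dyad2_in_dyads by meson
  then show ?thesis using wcov_self_nonneg[of "dyad2 N p"] by simp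
 qed
 have le: "wcov p p ^ h \<le> 2 ^ h * (moment_const (2 * h) * (Kw * (1 / 2 ^ N) powr g))" for N
 proof -
  let ?q = "dyad2 N p"
  have d: "dist (fst p) (fst ?q) \<le> 1 / 2 ^ N" "dist (snd p) (snd ?q) \<le> 1 / 2 ^ N"
   using dist_dyad[of N "fst p"] dist_dyad[of N "snd p"] by (simp_all add: dyad2_def dist_commute)
  have c_if: "centred_functional (if b then wprod p else wprod ?q)" for b using c[of p] c[of ?q] by simp
  \<comment> \<open>Nonnegativity at f_p - 2 f_q, together with variance 0 at q, gives 4 wcov p q <=
    wcov p p and hence wcov p p <= 2 lrv (f_p - f_q).\<close>
  have "0 \<le> lrv (\<lambda>y. \<Sum>b\<in>(UNIV :: bool set). (if b then 1 else - 2) * (if b then wprod p else wprod ?q) y)"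
   by (intro lrv_nonneg centred_functional_sum finite c_if)
  also have "... = wcov p p - 4 * wcov p ?q + 4 * wcov ?q ?q"
   by (subst lrv_lincomb[OF finite c_if]) (simp add: UNIV_bool wcov_def fcov_sym[of "wprod ?q" "wprod p"])
  finally have "wcov p p \<le> 2 * lrv (\<lambda>y. wprod p y - wprod ?q y)"
   using z[of N] unfolding lrv_diff(1)[OF c c] wcov_def by simp
  then have "wcov p p ^ h \<le> (2 * lrv (\<lambda>y. wprod p y - wprod ?q y)) ^ h" by (intro power_mono wcov_self_nonneg)
  also have "... \<le> 2 ^ h * (moment_const (2 * h) * (Kw * (1 / 2 ^ N) powr g))"
   unfolding power_mult_distrib by (intro mult_left_mono lrv_power_le[OF D(11,12,13) wprod_incr[OF d] h]) simp
  finally show ?thesis .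
 qed
 have "(\<lambda>N. 2 ^ h * (moment_const (2 * h) * (Kw * (1 / 2 ^ N) powr g))) \<longlonglongrightarrow> 2 ^ h * (moment_const (2 * h) * (Kw * 0))"
  by (intro tendsto_intros) (use g in real_asymp)
 then have "wcov p p ^ h \<le> 0" using LIMSEQ_le_const[OF _ exI[of _ 0]] le by fastforce
 with zero_less_power[OF assms, of h] show False by simp
qed

text \<open>An exact identity: centring by the sample mean enters only through the product of two
  normalised sums of evaluations, and the divisor m - 1 through small multiples of the linear term
  and of the kernel. The remainder is a tight quantity times a factor of order m^(-1/2) or
  smaller.\<close>

lemma covariance_estimate:
 fixes m :: nat
 assumes X: "!!j u. X j u = \<mu> + \<eta> j u" and m: "2 \<le> m"
 shows "sqrt m * (apply_bcontfun ((1 / (real m - 1)) *\<^sub>R (\<Sum>j=1..m. centred_sq X m j u)) p - cov_kernel P \<eta> (fst p) (snd p)) - fsum \<eta> (wprod p) m u =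
  1 / (real m - 1) * fsum \<eta> (wprod p) m u + sqrt m / (real m - 1) * (cov_kernel P \<eta> (fst p) (snd p) - fsum \<eta> (ev1 p) m u * fsum \<eta> (ev2 p) m u)"
proof -
 let ?c = "cov_kernel P \<eta> (fst p) (snd p)" and ?W = "fsum \<eta> (wprod p) m u"
 define A B where "A = fsum \<eta> (ev1 p) m u" and "B = fsum \<eta> (ev2 p) m u"
 define S where "S = (\<Sum>j=1..m. ev1 p (\<eta> j u) * ev2 p (\<eta> j u))"
 have sq: "sqrt m * sqrt m = m" "sqrt m \<noteq> 0" using m by auto
 have s: "(\<Sum>j=1..m. ev1 p (\<eta> j u)) = sqrt m * A" "(\<Sum>j=1..m. ev2 p (\<eta> j u)) = sqrt m * B"
  unfolding A_def B_def fsum_def using sq by auto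
 have "S = (\<Sum>j=1..m. wprod p (\<eta> j u)) + m * ?c" unfolding S_def wprod_def ev1_def ev2_def by (simp add: sum_subtractf)
 then have S: "S = sqrt m * ?W + m * ?c" unfolding fsum_def using sq by simp
 have "(\<Sum>j=1..m. centred_sq X m j u p) = (\<Sum>j=1..m. ev1 p (\<eta> j u) * ev2 p (\<eta> j u) - A / sqrt m * ev2 p (\<eta> j u) - B / sqrt m * ev1 p (\<eta> j u) + A * B / m)"
 proof (intro sum.cong refl)
  fix j
  have "1 \<le> m" using m by simp
  from centred_sq_apply[where X = X, OF X this, of j u p]
  show "centred_sq X m j u p = ev1 p (\<eta> j u) * ev2 p (\<eta> j u) - A / sqrt m * ev2 p (\<eta> j u) - B / sqrt m * ev1 p (\<eta> j u) + A * B / m"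
   unfolding A_def[symmetric] B_def[symmetric] using sq by (simp add: algebra_simps)
 qed
 also have "... = S - A * B"
  unfolding sum.distrib sum_subtractf sum_distrib_left[symmetric] s S_def[symmetric] using sq m by simp
 finally have "apply_bcontfun ((1 / (real m - 1)) *\<^sub>R (\<Sum>j=1..m. centred_sq X m j u)) p = (S - A * B) / (real m - 1)"
  by (simp add: scaleR_bcontfun.rep_eq apply_bcontfun_sum)
 moreover have r: "r * ((r * w + r * r * c - x) / (r * r - 1) - c) - w = 1 / (r * r - 1) * w + r / (r * r - 1) * (c - x)" if "r * r - 1 \<noteq> 0" for r w c x :: real
  using that by (simp add: divide_simps) (simp add: algebra_simps)
 ultimately show ?thesis
  unfolding A_def[symmetric] B_def[symmetric] S using r[of "sqrt m" ?W ?c "A * B"] m unfolding sq(1) by simp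
qed

text \<open>Besides the dyadic points a single arbitrary point is allowed, because a point at which
  two different kernels disagree need not be dyadic.\<close>

lemma fields_tight:
 assumes I: "I = dyads \<or> I = {q}"
 shows "tight_on I (\<lambda>n w p. fsum \<eta> (wprod p) n w)" "tight_on I (\<lambda>n w p. fsum \<eta> (ev1 p) n w)" "tight_on I (\<lambda>n w p. fsum \<eta> (ev2 p) n w)"
 using I fsum_field(2)[OF wprod_field] fsum_field(2)[OF ev_field(1)] fsum_field(2)[OF ev_field(2)]
  fsum_field(3)[OF wprod_field, of q] fsum_field(3)[OF ev_field(1), of q] fsum_field(3)[OF ev_field(2), of q] by (elim disjE; simp)+

lemma covariance_estimate_null:
 assumes X: "!!j w. X j w = \<mu> + \<eta> j w" and I: "I = dyads \<or> I = {q}"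
 shows "null_on I (\<lambda>m w p. sqrt (real m) * (apply_bcontfun ((1 / (real m - 1)) *\<^sub>R (\<Sum>j=1..m. centred_sq X m j w)) p - cov_kernel P \<eta> (fst p) (snd p))
   - fsum \<eta> (wprod p) m w)" (is "null_on I ?T")
proof (rule null_on_cong)
 note t = fields_tight[OF I]
 have c: "tight_on I (\<lambda>m w p. cov_kernel P \<eta> (fst p) (snd p))" by (rule tight_on_deterministic[OF prod_moments(4)])
 have n: "null_on I (\<lambda>m w p. 1 / (real m - 1))" "null_on I (\<lambda>m w p. sqrt (real m) / (real m - 1))"
  by (rule null_on_deterministic, real_asymp)+
 let ?E = "\<lambda>m w p. 1 / (real m - 1) * fsum \<eta> (wprod p) m w + sqrt (real m) / (real m - 1) *
   (cov_kernel P \<eta> (fst p) (snd p) + - (fsum \<eta> (ev1 p) m w * fsum \<eta> (ev2 p) m w))"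
 show "null_on I ?E"
  by (intro null_on_add null_on_mult_tight[OF n(1)] null_on_mult_tight[OF n(2)] tight_on_add tight_on_uminus tight_on_mult t c)
 show "\<forall>\<^sub>F m in sequentially. \<forall>w\<in>space P. \<forall>p\<in>I. ?E m w p = ?T m w p"
  using eventually_ge_at_top[of 2]
 proof eventually_elim
  case (elim m)
  show ?case unfolding covariance_estimate[where X = X, OF X elim] by (intro ballI) (simp only: add_uminus_conv_diff)
 qed
qed

text \<open>Again exact. Expanding the centred squares, the cross terms with the sample means are
  multiplier sums of single evaluations, while the centring of the block sums is the same for all
  blocks and so multiplies the plain sum of the multipliers. The remainders carry sqrt(l / m) or
  m^(-1/2).\<close>

lemma multiplier_estimate:
 fixes m l :: nat
 assumes X: "!!j w. X j w = \<mu> + \<eta> j w" and l: "1 \<le> l" "l \<le> m"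
 shows "sqrt m * block_multiplier_sum X m l x w p - bsum \<eta> (wprod p) m l x w =
  sqrt l / sqrt m * ((\<Sum>k=1..m + 1 - l. x k w) / sqrt m * (2 / sqrt m * (fsum \<eta> (ev1 p) m w * fsum \<eta> (ev2 p) m w) + - fsum \<eta> (wprod p) m w))
  + 1 / sqrt m * (- (fsum \<eta> (ev1 p) m w * bsum \<eta> (ev2 p) m l x w + fsum \<eta> (ev2 p) m w * bsum \<eta> (ev1 p) m l x w))"
proof -
 define A B W where "A = fsum \<eta> (ev1 p) m w" and "B = fsum \<eta> (ev2 p) m w" and "W = fsum \<eta> (wprod p) m w"
 define U where "U f k = (\<Sum>j=k..k + l - 1. f (\<eta> j w))" for f :: "C01 => real" and k
 define r q where "r = sqrt m" and "q = sqrt l"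
 have r: "r * r = m" "r \<noteq> 0" and q: "q * q = l" "q \<noteq> 0" using l unfolding r_def q_def by auto
 \<comment> \<open>The part of the centred block sum that is the same for all blocks. The kernel
   value cancels against the overall mean, while A B occurs twice, once from the block and once from
   the overall mean.\<close>
 define \<kappa> where "\<kappa> = 2 * real l / real m * (A * B) - real l / r * W"
 have s: "(\<Sum>j=1..m. ev1 p (\<eta> j w)) = r * A" "(\<Sum>j=1..m. ev2 p (\<eta> j w)) = r * B" "(\<Sum>j=1..m. wprod p (\<eta> j w)) = r * W"
  unfolding A_def B_def W_def r_def fsum_def using r(2)[unfolded r_def] by auto
 have m: "1 \<le> m" using l by simp
 have v: "centred_sq X m j w p = wprod p (\<eta> j w) - A / r * ev2 p (\<eta> j w) - B / r * ev1 p (\<eta> j w) + (cov_kernel P \<eta> (fst p) (snd p) + A * B / m)" for j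
  using centred_sq_apply[where X = X, OF X m, of j w p] r unfolding A_def[symmetric] B_def[symmetric] r_def[symmetric]
  by (simp add: algebra_simps wprod_def ev1_def ev2_def)
 have "(\<Sum>j=k..k + l - 1. centred_sq X m j w p) - real l / real m * (\<Sum>i=1..m. centred_sq X m i w p) = U (wprod p) k - A / r * U (ev2 p) k - B / r * U (ev1 p) k + \<kappa>" for k
  unfolding v sum.distrib sum_subtractf sum_distrib_left[symmetric] s U_def[symmetric] \<kappa>_def using l r by (simp add: field_simps)
 then have "r * block_multiplier_sum X m l x w p =
  r * (1 / real m * (\<Sum>k=1..m + 1 - l. x k w * (1 / q * (U (wprod p) k - A / r * U (ev2 p) k - B / r * U (ev1 p) k + \<kappa>))))"
  unfolding block_multiplier_sum_def q_def by (simp add: scaleR_bcontfun.rep_eq minus_bcontfun.rep_eq apply_bcontfun_sum)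
 also have "... = (\<Sum>k=1..m + 1 - l. U (wprod p) k / (r * q) * x k w - A / r * (U (ev2 p) k / (r * q) * x k w)
   - B / r * (U (ev1 p) k / (r * q) * x k w) + \<kappa> / (r * q) * x k w)"
  unfolding sum_distrib_left r(1)[symmetric] using r(2) q(2) by (intro sum.cong) (auto simp: field_simps)
 also have "... = bsum \<eta> (wprod p) m l x w - A / r * bsum \<eta> (ev2 p) m l x w - B / r * bsum \<eta> (ev1 p) m l x w + \<kappa> / (r * q) * (\<Sum>k=1..m + 1 - l. x k w)"
  unfolding sum.distrib sum_subtractf sum_distrib_left[symmetric] bsum_def real_sqrt_mult r_def[symmetric] q_def[symmetric] U_def[symmetric] ..
 also have "\<kappa> / (r * q) = 2 * q / (r * r * r) * (A * B) - q / (r * r) * W"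
  unfolding \<kappa>_def q(1)[symmetric] r(1)[symmetric] using r(2) q(2) by (simp add: field_simps)
 finally show ?thesis
  unfolding A_def[symmetric] B_def[symmetric] W_def[symmetric] r_def[symmetric] q_def[symmetric]
  by (simp add: algebra_simps add_divide_distrib diff_divide_distrib)
qed

text \<open>The quantity depends on no point, so the bound for a one-point index set carries over to
  every \<open>I\<close>. Its second moment is the number of blocks over n, at most 1, times
  \<open>gauss_moment 2\<close>.\<close>

lemma multiplier_mean_tight:
 assumes mult: "!!i. multipliers P D (x i) {1..}" and l: "\<forall>\<^sub>F i in sequentially. 1 \<le> l i \<and> l i \<le> n i"
 shows "tight_on I (\<lambda>i w p. (\<Sum>k=1..n i + 1 - l i. x i k w) / sqrt (real (n i)))"
proof -
 have t: "tight_on {()} (\<lambda>i w p. (\<Sum>k=1..n i + 1 - l i. x i k w) / sqrt (real (n i)))"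
 proof (rule tight_on_pointwise_moment[where k = 2 and C = "gauss_moment 2"])
  fix i
  interpret multipliers P D "x i" "{1..}" by (rule mult)
  show "(\<lambda>w. (\<Sum>k=1..n i + 1 - l i. x i k w) / sqrt (real (n i))) \<in> borel_measurable P"
   by (intro bm_intros Z_meas) auto
 next
  show "\<forall>\<^sub>F i in sequentially. integrable P (\<lambda>w. \<bar>(\<Sum>k=1..n i + 1 - l i. x i k w) / sqrt (real (n i))\<bar> ^ 2) \<and>
   (\<E> w. \<bar>(\<Sum>k=1..n i + 1 - l i. x i k w) / sqrt (real (n i))\<bar> ^ 2) \<le> gauss_moment 2"
   using l
  proof eventually_elim
   case (elim i)
   interpret multipliers P D "x i" "{1..}" by (rule mult)
   have v: "(\<Sum>k\<in>{1..n i + 1 - l i}. (1 / sqrt (real (n i)))\<^sup>2) \<le> 1" using elim by (simp add: power_divide)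
   have e: "(\<Sum>k\<in>{1..n i + 1 - l i}. 1 / sqrt (real (n i)) * x i k w) = (\<Sum>k=1..n i + 1 - l i. x i k w) / sqrt (real (n i))" for w
    by (simp add: sum_divide_distrib)
   note mm = multiplier_moment[of "{1..n i + 1 - l i}" "\<lambda>_ _. 1 / sqrt (real (n i))" 1, unfolded e]
   have "gauss_moment 2 * (\<Sum>k\<in>{1..n i + 1 - l i}. (1 / sqrt (real (n i)))\<^sup>2) \<le> gauss_moment 2 * 1"
    by (intro mult_left_mono v gauss_moment_nonneg)
   then show ?case using mm by (auto simp: prob_space)
  qed
 qed simp
 show ?thesis
  unfolding tight_on_def
 proof (intro allI impI)
  fix e :: real assume "0 < e"
  from t[unfolded tight_on_def, rule_format, OF this] obtain K where K: "whp e (\<lambda>i w. \<forall>p\<in>{()}. \<bar>(\<Sum>k=1..n i + 1 - l i. x i k w) / sqrt (real (n i))\<bar> \<le> K)" ..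
  show "\<exists>K. whp e (\<lambda>i w. \<forall>p\<in>I. \<bar>(\<Sum>k=1..n i + 1 - l i. x i k w) / sqrt (real (n i))\<bar> \<le> K)"
   using K by (intro exI[of _ K]) (elim eventually_mono bexE, simp, blast)
 qed
qed

lemma multiplier_estimate_null:
 assumes X: "!!j w. X j w = \<mu> + \<eta> j w"
  and mult: "!!i. multipliers P D (x i) {1..}" and D: "!!j. 1 \<le> j ==> \<eta> j \<in> borel_measurable D"
  and l: "\<forall>\<^sub>F i in sequentially. 1 \<le> l i \<and> l i \<le> n i" and ln: "(\<lambda>i. real (l i) / real (n i)) \<longlonglongrightarrow> 0" and n: "filterlim n at_top sequentially"
 shows "null_on dyads (\<lambda>i w p. sqrt (real (n i)) * block_multiplier_sum X (n i) (l i) (x i) w p - bsum \<eta> (wprod p) (n i) (l i) (x i) w)" (is "null_on _ ?T")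
proof (rule null_on_cong)
 note t = fields_tight[where I = dyads and q = undefined, OF disjI1[OF refl], THEN tight_on_compose, OF n]
 have DF: "f \<in> borel_measurable borel ==> 1 \<le> j ==> (\<lambda>w. f (\<eta> j w)) \<in> borel_measurable D" for f :: "C01 => real" and j
  using measurable_compose[OF D] by blast
 note b = bsum_field(2)[OF _ mult DF l, OF _ field_functionalD(4)]
 note bt = b[OF ev_field(1) ev_field(1)] b[OF ev_field(2) ev_field(2)]
 have r: "filterlim (\<lambda>i. sqrt (real (n i))) at_top sequentially"
  by (rule filterlim_compose[OF sqrt_at_top filterlim_compose[OF filterlim_real_sequentially n]])
 have c: "(\<lambda>i. 1 / sqrt (real (n i))) \<longlonglongrightarrow> 0" by (rule tendsto_divide_0[OF tendsto_const filterlim_at_top_imp_at_infinity[OF r]])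
 have "(\<lambda>i. sqrt (real (l i) / real (n i))) \<longlonglongrightarrow> sqrt 0" by (intro tendsto_intros ln)
 then have q: "null_on dyads (\<lambda>i w p. sqrt (real (l i)) / sqrt (real (n i)))" by (intro null_on_deterministic) (simp add: real_sqrt_divide)
 have c2: "(\<lambda>i. 2 / sqrt (real (n i))) \<longlonglongrightarrow> 0" by (rule tendsto_divide_0[OF tendsto_const filterlim_at_top_imp_at_infinity[OF r]])
 let ?E = "\<lambda>i w p. sqrt (real (l i)) / sqrt (real (n i)) * ((\<Sum>k=1..n i + 1 - l i. x i k w) / sqrt (real (n i))
   * (2 / sqrt (real (n i)) * (fsum \<eta> (ev1 p) (n i) w * fsum \<eta> (ev2 p) (n i) w) + - fsum \<eta> (wprod p) (n i) w))
  + 1 / sqrt (real (n i)) * (- (fsum \<eta> (ev1 p) (n i) w * bsum \<eta> (ev2 p) (n i) (l i) (x i) w + fsum \<eta> (ev2 p) (n i) w * bsum \<eta> (ev1 p) (n i) (l i) (x i) w))"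
 show "null_on dyads ?E"
  by (intro null_on_add null_on_mult_tight[OF q] null_on_mult_tight[OF null_on_deterministic[OF c]] tight_on_mult tight_on_add tight_on_uminus t bt
    tight_on_convergent[OF c2] multiplier_mean_tight[OF mult l])
 show "\<forall>\<^sub>F i in sequentially. \<forall>w\<in>space P. \<forall>p\<in>dyads. ?E i w p = ?T i w p"
  using l
 proof eventually_elim
  case (elim i)
  show ?case unfolding multiplier_estimate[where X = X, OF X conjunct1[OF elim] conjunct2[OF elim]] by (intro ballI refl)
 qed
qed

end

section \<open>Consequences of (A1)--(A4)\<close>

context prob_space
begin

lemma gen_sigma_event: "(!!i. i \<in> I ==> Z i \<in> borel_measurable M) ==> A \<in> gen_sigma M Z I ==> A \<in> events"
 using subalgebra_vsig[of I Z M] unfolding subalgebra_def sets_vsig by auto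

text \<open>A real supremum has meaning only for a bounded set, so the bound 1 for the conditional
  differences comes first. Multiplying by the probability of the conditioning event removes the
  exception for null events.\<close>

lemma phi_dep_bounds:
 assumes F: "\<F> \<subseteq> events" "space M \<in> \<F>" and G: "\<G> \<subseteq> events" "space M \<in> \<G>"
 shows "0 \<le> phi_dep M \<F> \<G>" "phi_dep M \<F> \<G> \<le> 1"
  "A \<in> \<F> ==> B \<in> \<G> ==> \<bar>prob (A \<inter> B) - prob A * prob B\<bar> \<le> phi_dep M \<F> \<G> * prob A"
proof -
 let ?S = "{\<bar>prob (G \<inter> F) / prob F - prob G\<bar> |F G. F \<in> \<F> \<and> G \<in> \<G> \<and> prob F > 0}"
 have le: "x \<le> 1" if x: "x \<in> ?S" for x
 proof -
  from x obtain A B where AB: "x = \<bar>prob (B \<inter> A) / prob A - prob B\<bar>" "A \<in> \<F>" "B \<in> \<G>" "0 < prob A" by blast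
  have "prob (B \<inter> A) \<le> prob A" using AB F by (intro finite_measure_mono) auto
  then have "prob (B \<inter> A) / prob A \<le> 1" "0 \<le> prob (B \<inter> A) / prob A" using AB(4) by auto
  moreover have "0 \<le> prob B" "prob B \<le> 1" by auto
  ultimately show ?thesis unfolding AB(1) by linarith
 qed
 have bdd: "bdd_above ?S" using le by (intro bdd_aboveI)
 have z: "0 \<in> ?S" using F G prob_space by (intro CollectI exI[of _ "space M"]) auto
 show "0 \<le> phi_dep M \<F> \<G>" unfolding phi_dep_def by (rule cSup_upper[OF z bdd])
 show "phi_dep M \<F> \<G> \<le> 1" unfolding phi_dep_def by (rule cSup_least) (use z le in auto)
 assume AB: "A \<in> \<F>" "B \<in> \<G>"
 show "\<bar>prob (A \<inter> B) - prob A * prob B\<bar> \<le> phi_dep M \<F> \<G> * prob A"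
 proof (cases "prob A = 0")
  case True
  have "prob (A \<inter> B) \<le> prob A" using AB F by (intro finite_measure_mono) auto
  then show ?thesis using True measure_nonneg[of M "A \<inter> B"] by simp
 next
  case False
  then have pA: "0 < prob A" using measure_nonneg[of M A] by linarith
  have "\<bar>prob (B \<inter> A) / prob A - prob B\<bar> \<le> phi_dep M \<F> \<G>"
   unfolding phi_dep_def by (rule cSup_upper[OF _ bdd]) (use AB pA in blast)
  then have "\<bar>prob (B \<inter> A) / prob A - prob B\<bar> * prob A \<le> phi_dep M \<F> \<G> * prob A" by (rule mult_right_mono) simp
  moreover have "\<bar>prob (B \<inter> A) / prob A - prob B\<bar> * prob A = \<bar>(prob (B \<inter> A) / prob A - prob B) * prob A\<bar>"
   by (simp add: abs_mult)
  moreover have "(prob (B \<inter> A) / prob A - prob B) * prob A = prob (A \<inter> B) - prob A * prob B"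
   using pA by (simp add: field_simps Int_commute)
  ultimately show ?thesis by simp
 qed
qed

lemma phi_coeff_bounds:
 assumes \<eta>: "!!j. 1 \<le> j ==> \<eta> j \<in> borel_measurable M"
 shows "0 \<le> phi_coeff M \<eta> k" "phi_coeff M \<eta> k \<le> 1"
  "1 \<le> i ==> A \<in> gen_sigma M \<eta> {1..i} ==> B \<in> gen_sigma M \<eta> {i + k..} ==> \<bar>prob (A \<inter> B) - prob A * prob B\<bar> \<le> phi_coeff M \<eta> k * prob A"
proof -
 have ev: "gen_sigma M \<eta> I \<subseteq> events" if "I \<subseteq> {1..}" for I
  using gen_sigma_event[of I \<eta>] \<eta> that by auto
 have sp: "space M \<in> gen_sigma M \<eta> I" for I using sets.top[of "vsig M \<eta> I"] by (simp add: sets_vsig)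
 define d where "d k' = phi_dep M (gen_sigma M \<eta> {1..k'}) (gen_sigma M \<eta> {k' + k..})" for k'
 have b: "0 \<le> d k'" "d k' \<le> 1" "A \<in> gen_sigma M \<eta> {1..k'} ==> B \<in> gen_sigma M \<eta> {k' + k..} ==> \<bar>prob (A \<inter> B) - prob A * prob B\<bar> \<le> d k' * prob A"
  if "1 \<le> k'" for k' A B
  unfolding d_def using that by (intro phi_dep_bounds ev sp; auto)+
 have eq: "phi_coeff M \<eta> k = (SUP k'\<in>{1..}. d k')" unfolding phi_coeff_def d_def ..
 have bdd: "bdd_above (d ` {1..})" using b(2) by (intro bdd_aboveI[of _ 1]) auto
 have up: "d k' \<le> phi_coeff M \<eta> k" if "1 \<le> k'" for k' unfolding eq using that by (intro cSUP_upper bdd) auto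
 show "0 \<le> phi_coeff M \<eta> k" using b(1)[of 1] up[of 1] by simp
 show "phi_coeff M \<eta> k \<le> 1" unfolding eq using b(2) by (intro cSUP_least) auto
 assume i: "1 \<le> i" "A \<in> gen_sigma M \<eta> {1..i}" "B \<in> gen_sigma M \<eta> {i + k..}"
 show "\<bar>prob (A \<inter> B) - prob A * prob B\<bar> \<le> phi_coeff M \<eta> k * prob A"
  using b(3)[OF i] mult_right_mono[OF up[OF i(1)], of "prob A"] by simp
qed

end

text \<open>The exponent 1 / (1/2 - \<open>\<tau>\<close>) in (A4) is at least 1, so its weight
  dominates both 1 and k: the first gives summability of the square roots of the mixing
  coefficients, the second their decay after multiplication by k, as terms of a convergent
  series.\<close>

lemma stationary_mixing_conds_A:
 assumes P: "prob_space P" and \<eta>: "centred_stationary_process P \<eta>" and A: "conds_A P \<eta> \<rho> J \<nu> \<tau>"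
 shows "stationary_mixing P \<eta> (phi_coeff P \<eta>)"
proof -
 interpret prob_space P by (rule P)
 have m: "1 \<le> j ==> \<eta> j \<in> borel_measurable P" for j using \<eta> unfolding centred_stationary_process_def by auto
 note b = phi_coeff_bounds[where \<eta> = \<eta>, OF m]
 define e where "e = 1 / (1 / 2 - \<tau>)"
 have \<tau>: "1 / (2 + 2 * \<nu>) < \<tau>" "\<tau> < 1 / 2" "0 < \<nu>"
  and s: "summable (\<lambda>i. real (Suc i) powr e * phi_coeff P \<eta> (Suc i) powr (1 / 2))"
  using A unfolding conds_A_def cond_A4_def cond_A2_def e_def by (auto simp: Let_def)
 have "0 < 1 / (2 + 2 * \<nu>)" using \<tau>(3) by simp
 then have "1 / 2 - \<tau> \<le> 1" "0 < 1 / 2 - \<tau>" using \<tau> by linarith+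
 then have e: "1 \<le> e" unfolding e_def by (simp add: field_simps)
 have le: "real (Suc i) \<le> real (Suc i) powr e" for i using powr_mono[OF e, of "real (Suc i)"] by simp
 have le': "real (Suc i) * phi_coeff P \<eta> (Suc i) powr (1 / 2) \<le> real (Suc i) powr e * phi_coeff P \<eta> (Suc i) powr (1 / 2)" for i
  by (rule mult_right_mono[OF le]) simp
 have "summable (\<lambda>h. phi_coeff P \<eta> (Suc h) powr (1 / 2))"
 proof (rule summable_comparison_test'[OF s, of 0])
  fix i
  have "phi_coeff P \<eta> (Suc i) powr (1 / 2) * 1 \<le> phi_coeff P \<eta> (Suc i) powr (1 / 2) * real (Suc i)" by (rule mult_left_mono) auto
  then show "norm (phi_coeff P \<eta> (Suc i) powr (1 / 2)) \<le> real (Suc i) powr e * phi_coeff P \<eta> (Suc i) powr (1 / 2)"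
   using le'[of i] by (simp add: mult.commute)
 qed
 moreover have "(\<lambda>h. real h * phi_coeff P \<eta> h powr (1 / 2)) \<longlonglongrightarrow> 0"
  unfolding filterlim_sequentially_Suc[of "\<lambda>h. real h * phi_coeff P \<eta> h powr (1 / 2)", symmetric]
  by (rule tendsto_sandwich[OF _ _ tendsto_const summable_LIMSEQ_zero[OF s]]) (use le' in auto)
 moreover have "strictly_stationary P \<eta>" using \<eta> unfolding centred_stationary_process_def by auto
 ultimately show ?thesis
  unfolding stationary_mixing_def stationary_mixing_axioms_def mixing_process_def mixing_process_axioms_def strictly_stationary_def
  using P m b by auto
qed

lemma rho_theta_le: "dist s s' \<le> 1 / 2 ^ N ==> 0 < \<theta> ==> rho_theta \<theta> s s' \<le> (1 / 2 ^ N) powr \<theta>"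
 unfolding rho_theta_def dist_unit_interval_def by (intro powr_mono2) auto

text \<open>\<open>V\<close>, the norm times |M|, is the envelope whose J-th moment (A3) provides.
  Increments of products over a distance d are at most 2 d^\<open>\<theta>\<close> V, and centring
  adds the mean \<open>e\<close> of \<open>V\<close>; \<open>K\<close> collects the
  constants.\<close>

theorem sample_conds_A:
 assumes P: "prob_space P" and \<eta>: "centred_stationary_process P \<eta>" and A: "conds_A P \<eta> (rho_theta \<theta>) J \<nu> \<tau>"
  and \<theta>: "0 < \<theta>" "\<theta> \<le> 1" "2 < real J * \<theta>"
 shows "\<exists>K. sample P \<eta> (phi_coeff P \<eta>) (J div 2) (real J * \<theta>) K"
proof -
 interpret stationary_mixing P \<eta> "phi_coeff P \<eta>" by (rule stationary_mixing_conds_A[OF P \<eta> A])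
 note [measurable] = meas_eta[OF order_refl]
 have ev[measurable]: "(\<lambda>w. \<eta> 1 w t) \<in> borel_measurable P" for t by (rule measurable_compose[OF meas_eta[OF order_refl] eval_meas])
 have J: "even J" and iN: "integrable P (\<lambda>w. norm (\<eta> 1 w) ^ (2 * J))" using A unfolding conds_A_def cond_A1_def cond_A2_def by auto
 have "real J * \<theta> \<le> real J" using \<theta> by (simp add: mult_left_le)
 then have "2 < J" using \<theta> by linarith
 \<comment> \<open>Evenness lifts J > 2 to J >= 4. Hence h >= 2, and the functionals have the fourth
   moments required for the central limit theorem.\<close>
 then have h: "2 \<le> J div 2" "4 * (J div 2) = 2 * J" "2 * (J div 2) = J" using J by auto
 have "cond_A3 P \<eta> (rho_theta \<theta>) J" using A unfolding conds_A_def by simp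
 then obtain M L where M[measurable]: "M \<in> borel_measurable P"
  and L: "\<forall>j\<ge>1. integrable P (\<lambda>w. (norm (\<eta> j w) * M w) ^ J) \<and> (\<E> w. (norm (\<eta> j w) * M w) ^ J) < L \<and>
   (AE w in P. \<forall>t t'. \<bar>\<eta> j w t - \<eta> j w t'\<bar> \<le> M w * rho_theta \<theta> t t')"
  unfolding cond_A3_def by (elim exE conjE)
 have iM: "integrable P (\<lambda>w. (norm (\<eta> 1 w) * M w) ^ J)"
  and AE: "AE w in P. \<forall>t t'. \<bar>\<eta> 1 w t - \<eta> 1 w t'\<bar> \<le> M w * rho_theta \<theta> t t'"
  using conjunct1[OF L[rule_format, OF order_refl]] conjunct2[OF conjunct2[OF L[rule_format, OF order_refl]]] .
 define V where "V w = \<bar>norm (\<eta> 1 w) * M w\<bar>" for w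
 have [measurable]: "V \<in> borel_measurable P" unfolding V_def by measurable
 have V0: "0 \<le> V w" for w unfolding V_def by simp
 have iVJ: "integrable P (\<lambda>w. \<bar>V w\<bar> ^ J)" using iM J unfolding V_def by (simp add: power_even_abs)
 have iV: "integrable P V" using integrable_power_le[OF _ iVJ, of 1] \<open>2 < J\<close> by simp
 define e where "e = expectation V"
 have e0: "0 \<le> e" unfolding e_def by (rule integral_nonneg) (rule V0)
 have iVe: "integrable P (\<lambda>w. (V w + e) ^ J)"
 proof (rule integrable_le)
  show "integrable P (\<lambda>w. 2 ^ J * (\<bar>V w\<bar> ^ J + \<bar>e\<bar> ^ J))" using iVJ by simp
  show "\<bar>(V w + e) ^ J\<bar> \<le> 2 ^ J * (\<bar>V w\<bar> ^ J + \<bar>e\<bar> ^ J)" for w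
   using abs_add_power_le[of "V w" e J] V0 e0 by (simp add: power_abs)
 qed simp
 define K where "K = 2 ^ J * (\<E> w. (V w + e) ^ J) + (\<E> w. norm (\<eta> 1 w) ^ (2 * J))"
 have K0: "0 \<le> (\<E> w. (V w + e) ^ J)" "0 \<le> (\<E> w. norm (\<eta> 1 w) ^ (2 * J))"
  using V0 e0 by (auto intro!: integral_nonneg)
 have bound: "expectation X \<le> K * (1 / 2 ^ N) powr (real J * \<theta>)"
  if X: "AE w in P. X w \<le> (2 * (1 / 2 ^ N) powr \<theta> * (V w + e)) ^ J" "X \<in> borel_measurable P" "!!w. 0 \<le> X w" for X N
 proof -
  let ?d = "(1 / 2 ^ N) powr \<theta> :: real"
  have i: "integrable P (\<lambda>w. (2 * ?d * (V w + e)) ^ J)" using iVe unfolding power_mult_distrib by simp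
  have iX: "integrable P X"
   by (rule integrable_bound[OF i X(2)]) (use X(1,3) in \<open>auto elim!: eventually_mono intro: order_trans[OF _ abs_ge_self]\<close>)
  have "expectation X \<le> (\<E> w. (2 * ?d * (V w + e)) ^ J)" by (rule integral_mono_AE[OF iX i X(1)])
  also have "... = ?d ^ J * (2 ^ J * (\<E> w. (V w + e) ^ J))" unfolding power_mult_distrib by (simp add: ac_simps)
  also have "... \<le> ?d ^ J * K" unfolding K_def using K0 by (intro mult_left_mono) auto
  also have "?d ^ J = (1 / 2 ^ N) powr (real J * \<theta>)" by (simp add: powr_power)
  finally show ?thesis by (simp add: mult.commute)
 qed
 have prod: "AE w in P. \<bar>\<eta> 1 w t * (\<eta> 1 w s - \<eta> 1 w s')\<bar> \<le> (1 / 2 ^ N) powr \<theta> * V w" if d: "dist s s' \<le> 1 / 2 ^ N" for N t s s'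
  using AE
 proof eventually_elim
  case (elim w)
  have "\<bar>\<eta> 1 w s - \<eta> 1 w s'\<bar> \<le> \<bar>M w\<bar> * rho_theta \<theta> s s'"
   using elim[rule_format, of s s'] mult_right_mono[OF abs_ge_self[of "M w"], of "rho_theta \<theta> s s'"] by (simp add: rho_theta_def)
  also have "... \<le> \<bar>M w\<bar> * (1 / 2 ^ N) powr \<theta>" by (intro mult_left_mono rho_theta_le d \<theta>) simp
  finally have "\<bar>\<eta> 1 w t\<bar> * \<bar>\<eta> 1 w s - \<eta> 1 w s'\<bar> \<le> norm (\<eta> 1 w) * (\<bar>M w\<bar> * (1 / 2 ^ N) powr \<theta>)"
   by (intro mult_mono abs_apply_le_norm) auto
  then show ?case unfolding V_def abs_mult by (simp add: ac_simps)
 qed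
 have "sample P \<eta> (phi_coeff P \<eta>) (J div 2) (real J * \<theta>) K"
 proof unfold_locales
  show "2 \<le> J div 2" by (rule h)
  show "2 < real J * \<theta>" by (rule \<theta>)
  show "0 \<le> K" unfolding K_def using K0 by simp
  show "(\<E> w. \<eta> 1 w t) = 0" for t using \<eta> unfolding centred_stationary_process_def by auto
  show "integrable P (\<lambda>w. norm (\<eta> 1 w) ^ (4 * (J div 2)))" unfolding h using iN .
  show "(\<E> w. norm (\<eta> 1 w) ^ (4 * (J div 2))) \<le> K" unfolding h K_def using K0 by simp
 next
  fix N and s s' :: unit_interval assume d: "dist s s' \<le> 1 / 2 ^ N"
  show "(\<E> w. (\<eta> 1 w s - \<eta> 1 w s') ^ (4 * (J div 2))) \<le> K * (1 / 2 ^ N) powr (real J * \<theta>)"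
   unfolding h
  proof (rule bound)
   show "AE w in P. (\<eta> 1 w s - \<eta> 1 w s') ^ (2 * J) \<le> (2 * (1 / 2 ^ N) powr \<theta> * (V w + e)) ^ J"
    using prod[OF d, of s] prod[OF d, of s']
   proof eventually_elim
    case (elim w)
    \<comment> \<open>M alone has no assumed moments. Writing the square as a difference of two
      products of a value and an increment brings it under \<open>V\<close>.\<close>
    have "(\<eta> 1 w s - \<eta> 1 w s')\<^sup>2 = \<eta> 1 w s * (\<eta> 1 w s - \<eta> 1 w s') - \<eta> 1 w s' * (\<eta> 1 w s - \<eta> 1 w s')"
     by (simp add: power2_eq_square algebra_simps)
    also have "... \<le> 2 * (1 / 2 ^ N) powr \<theta> * V w" using elim by linarith
    also have "... \<le> 2 * (1 / 2 ^ N) powr \<theta> * (V w + e)" using e0 by (intro mult_left_mono) auto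
    finally show ?case unfolding power_mult by (rule power_mono) simp
   qed
  qed (intro bm_intros ev, simp add: zero_le_even_power)
 next
  fix N and s t s' t' :: unit_interval assume d: "dist s s' \<le> 1 / 2 ^ N" "dist t t' \<le> 1 / 2 ^ N"
  define Y where "Y w = \<eta> 1 w s * \<eta> 1 w t - \<eta> 1 w s' * \<eta> 1 w t'" for w
  have [measurable]: "Y \<in> borel_measurable P" unfolding Y_def by measurable
  have Y: "AE w in P. \<bar>Y w\<bar> \<le> 2 * (1 / 2 ^ N) powr \<theta> * V w"
   using prod[OF d(1), of t'] prod[OF d(2), of s]
  proof eventually_elim
   case (elim w)
   have "Y w = \<eta> 1 w t' * (\<eta> 1 w s - \<eta> 1 w s') + \<eta> 1 w s * (\<eta> 1 w t - \<eta> 1 w t')" unfolding Y_def by (simp add: algebra_simps)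
   then show ?case using elim by linarith
  qed
  have iN2: "integrable P (\<lambda>w. norm (\<eta> 1 w) ^ 2)"
   by (rule integrable_power_le[where n = "2 * J"], measurable, simp only: abs_norm_cancel iN, use \<open>2 < J\<close> in simp)
  have ip: "integrable P (\<lambda>w. \<eta> 1 w s * \<eta> 1 w t)" for s t
   by (rule integrable_le[OF iN2], measurable)
    (unfold power2_eq_square abs_mult, intro mult_mono abs_apply_le_norm, auto)
  have iY: "integrable P Y" unfolding Y_def using ip by simp
  have EY: "cov_kernel P \<eta> s t - cov_kernel P \<eta> s' t' = expectation Y" unfolding Y_def cov_kernel_def using ip by simp
  have "\<bar>expectation Y\<bar> \<le> (\<E> w. \<bar>Y w\<bar>)" by (rule integral_abs_bound)
  also have "... \<le> (\<E> w. 2 * (1 / 2 ^ N) powr \<theta> * V w)" using iY iV Y by (intro integral_mono_AE) auto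
  finally have EY': "\<bar>expectation Y\<bar> \<le> 2 * (1 / 2 ^ N) powr \<theta> * e" unfolding e_def by simp
  have "AE w in P. (Y w - expectation Y) ^ J \<le> (2 * (1 / 2 ^ N) powr \<theta> * (V w + e)) ^ J"
   using Y
  proof eventually_elim
   case (elim w)
   have "\<bar>Y w - expectation Y\<bar> \<le> 2 * (1 / 2 ^ N) powr \<theta> * (V w + e)" unfolding distrib_left using elim EY' by linarith
   then have "\<bar>Y w - expectation Y\<bar> ^ J \<le> (2 * (1 / 2 ^ N) powr \<theta> * (V w + e)) ^ J" by (rule power_mono) simp
   then show ?case using J by (simp add: power_even_abs)
  qed
  then show "(\<E> w. (\<eta> 1 w s * \<eta> 1 w t - \<eta> 1 w s' * \<eta> 1 w t' - (cov_kernel P \<eta> s t - cov_kernel P \<eta> s' t')) ^ (2 * (J div 2)))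
   \<le> K * (1 / 2 ^ N) powr (real J * \<theta>)"
   unfolding h EY Y_def[symmetric] using J by (intro bound) (assumption, intro bm_intros borel_measurable_const, simp_all add: zero_le_even_power)
 qed
 then show ?thesis ..
qed

section \<open>Two samples\<close>

context prob_space
begin

lemma bound_on_Times:
 fixes X :: "nat => 'a => 'd \<times> 'q => real"
 assumes D: "finite D" and e: "0 < e"
  and b: "!!d. d \<in> D ==> whp (e / card D) (\<lambda>i w. \<forall>p\<in>I. \<bar>X i w (d, p)\<bar> \<le> c)"
 shows "whp e (\<lambda>i w. \<forall>q\<in>D \<times> I. \<bar>X i w q\<bar> \<le> c)"
proof -
 have "\<forall>\<^sub>F i in sequentially. \<forall>d\<in>D. \<exists>A. A \<in> events \<and> prob A \<le> e / card D \<and> (\<forall>w\<in>space M - A. \<forall>p\<in>I. \<bar>X i w (d, p)\<bar> \<le> c)"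
  using b unfolding Bex_def by (intro eventually_ball_finite D) auto
 then show ?thesis
 proof eventually_elim
  case (elim i)
  from bchoice[OF elim] obtain A where A: "!!d. d \<in> D ==> A d \<in> events" "!!d. d \<in> D ==> prob (A d) \<le> e / card D"
   "!!d w p. d \<in> D ==> w \<in> space M - A d ==> p \<in> I ==> \<bar>X i w (d, p)\<bar> \<le> c" by blast
  have "prob (\<Union>d\<in>D. A d) \<le> (\<Sum>d\<in>D. prob (A d))" using A(1) by (intro finite_measure_subadditive_finite D) auto
  also have "... \<le> (\<Sum>d\<in>D. e / card D)" by (intro sum_mono A(2))
  also have "... \<le> e" using e by simp
  finally have "prob (\<Union>d\<in>D. A d) \<le> e" .
  moreover have "(\<Union>d\<in>D. A d) \<in> events" using A(1) D by auto
  ultimately show ?case using A(3) by (intro bexI[of _ "\<Union>d\<in>D. A d"]) auto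
 qed
qed

lemma divide_card_pos: "finite D ==> d \<in> D ==> 0 < e ==> 0 < e / real (card D)"
 by (intro divide_pos_pos) (auto simp: card_gt_0_iff)

lemma null_on_Times: "finite D ==> (!!d. d \<in> D ==> null_on I (\<lambda>i w p. X i w (d, p))) ==> null_on (D \<times> I) X"
 by (rule null_onI, rule bound_on_Times) (auto intro!: null_onD divide_card_pos)

lemma tight_on_Times:
 assumes D: "finite D" and t: "!!d. d \<in> D ==> tight_on I (\<lambda>i w p. X i w (d, p))"
 shows "tight_on (D \<times> I) X"
 unfolding tight_on_def
proof (intro allI impI)
 fix e :: real assume e: "0 < e"
 have "\<forall>d\<in>D. \<exists>K. whp (e / card D) (\<lambda>i w. \<forall>p\<in>I. \<bar>X i w (d, p)\<bar> \<le> K)"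
 proof
  fix d assume d: "d \<in> D"
  from divide_card_pos[OF D d e] show "\<exists>K. whp (e / card D) (\<lambda>i w. \<forall>p\<in>I. \<bar>X i w (d, p)\<bar> \<le> K)"
   using t[OF d] unfolding tight_on_def by (rule_tac allE[of _ "e / card D"]) auto
 qed
 from bchoice[OF this] obtain K where K: "!!d. d \<in> D ==> whp (e / card D) (\<lambda>i w. \<forall>p\<in>I. \<bar>X i w (d, p)\<bar> \<le> K d)" by blast
 define c where "c = (\<Sum>d\<in>D. \<bar>K d\<bar>)"
 have c: "K d \<le> c" if "d \<in> D" for d unfolding c_def using member_le_sum[of d D "\<lambda>d. \<bar>K d\<bar>"] D that by force
 show "\<exists>K. whp e (\<lambda>i w. \<forall>p\<in>D \<times> I. \<bar>X i w p\<bar> \<le> K)"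
 proof (intro exI, rule bound_on_Times[OF D e])
  fix d assume d: "d \<in> D"
  show "whp (e / card D) (\<lambda>i w. \<forall>p\<in>I. \<bar>X i w (d, p)\<bar> \<le> c)"
   using K[OF d] by eventually_elim (use c[OF d] in \<open>meson order_trans\<close>)
 qed
qed

lemma equicont_on_Times:
 assumes D: "finite D" and t: "!!d. d \<in> D ==> equicont_on \<pi> I (\<lambda>i w p. X i w (d, p))"
 shows "equicont_on (\<lambda>N. map_prod id (\<pi> N)) (D \<times> I) X"
 unfolding equicont_on_def
proof (intro allI impI)
 fix e :: real assume e: "0 < e"
 have "\<forall>d\<in>D. \<exists>N0. \<forall>N\<ge>N0. whp (e / card D) (\<lambda>i w. \<forall>p\<in>I. \<bar>X i w (d, p) - X i w (d, \<pi> N p)\<bar> \<le> e)"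
  using e D by (intro ballI equicont_onD[OF t]) (auto intro: divide_card_pos)
 from bchoice[OF this] obtain N0 where N0: "!!d N. d \<in> D ==> N0 d \<le> N ==> whp (e / card D) (\<lambda>i w. \<forall>p\<in>I. \<bar>X i w (d, p) - X i w (d, \<pi> N p)\<bar> \<le> e)" by blast
 have le: "N0 d \<le> sum N0 D" if "d \<in> D" for d using member_le_sum[of d D N0] D that by simp
 show "\<exists>N0. \<forall>N\<ge>N0. whp e (\<lambda>i w. \<forall>p\<in>D \<times> I. \<bar>X i w p - X i w (map_prod id (\<pi> N) p)\<bar> \<le> e)"
 proof (intro exI allI impI, rule bound_on_Times[OF D e])
  fix N d assume "sum N0 D \<le> N" "d \<in> D"
  then show "whp (e / card D) (\<lambda>i w. \<forall>p\<in>I. \<bar>X i w (d, p) - X i w (map_prod id (\<pi> N) (d, p))\<bar> \<le> e)"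
   using N0[of d N] le[of d] by simp
 qed
qed

lemma equicont_on_add:
 assumes "equicont_on \<pi> I X" "equicont_on \<pi> I Y"
 shows "equicont_on \<pi> I (\<lambda>i w p. X i w p + Y i w p)"
 unfolding equicont_on_def
proof (intro allI impI)
 fix e :: real assume "0 < e"
 then have h: "0 < e / 2" by simp
 obtain N1 where N1: "!!N. N1 \<le> N ==> whp (e / 2) (\<lambda>i w. \<forall>p\<in>I. \<bar>X i w p - X i w (\<pi> N p)\<bar> \<le> e / 2)"
  using equicont_onD[OF assms(1) h h] by (elim exE) auto
 obtain N2 where N2: "!!N. N2 \<le> N ==> whp (e / 2) (\<lambda>i w. \<forall>p\<in>I. \<bar>Y i w p - Y i w (\<pi> N p)\<bar> \<le> e / 2)"
  using equicont_onD[OF assms(2) h h] by (elim exE) auto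
 have "whp e (\<lambda>i w. \<forall>p\<in>I. \<bar>X i w p + Y i w p - (X i w (\<pi> N p) + Y i w (\<pi> N p))\<bar> \<le> e)" if "max N1 N2 \<le> N" for N
  by (rule whp_conj[OF N1[of N] N2[of N]]) (use that in simp, use that in simp, intro ballI, (drule (1) bspec)+, linarith, simp)
 then show "\<exists>N0. \<forall>N\<ge>N0. whp e (\<lambda>i w. \<forall>p\<in>I. \<bar>X i w p + Y i w p - (X i w (\<pi> N p) + Y i w (\<pi> N p))\<bar> \<le> e)"
  by (intro exI allI impI)
qed

lemma equicont_on_cmult:
 assumes "equicont_on \<pi> I X"
 shows "equicont_on \<pi> I (\<lambda>i w p. a * X i w p)"
 unfolding equicont_on_def
proof (intro allI impI)
 fix e :: real assume e: "0 < e"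
 then have d: "0 < e / (\<bar>a\<bar> + 1)" by (auto intro: divide_pos_pos)
 have le: "\<bar>a * x - a * y\<bar> \<le> e" if "\<bar>x - y\<bar> \<le> e / (\<bar>a\<bar> + 1)" for x y
 proof -
  have "\<bar>a * x - a * y\<bar> = \<bar>a\<bar> * \<bar>x - y\<bar>" by (simp add: abs_mult flip: right_diff_distrib)
  also have "... \<le> (\<bar>a\<bar> + 1) * (e / (\<bar>a\<bar> + 1))" using that by (intro mult_mono) auto
  finally show ?thesis by simp
 qed
 from equicont_onD[OF assms e d] obtain N0 where N0: "!!N. N0 \<le> N ==> whp e (\<lambda>i w. \<forall>p\<in>I. \<bar>X i w p - X i w (\<pi> N p)\<bar> \<le> e / (\<bar>a\<bar> + 1))"
  by (elim exE) auto
 show "\<exists>N0. \<forall>N\<ge>N0. whp e (\<lambda>i w. \<forall>p\<in>I. \<bar>a * X i w p - a * X i w (\<pi> N p)\<bar> \<le> e)"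
  by (intro exI[of _ N0] allI impI whp_mono[OF N0]) (auto intro: le)
qed

lemma null_on_scaled:
 assumes "null_on I (\<lambda>i w p. Y i w p - W i w p)" "tight_on I W" "c \<longlonglongrightarrow> (\<kappa> :: real)"
 shows "null_on I (\<lambda>i w p. c i * Y i w p - \<kappa> * W i w p)"
proof (rule null_on_cong)
 have "(\<lambda>i. c i - \<kappa>) \<longlonglongrightarrow> \<kappa> - \<kappa>" by (intro tendsto_intros assms)
 then have n: "null_on I (\<lambda>i w p. c i - \<kappa>)" by (intro null_on_deterministic) simp
 show "null_on I (\<lambda>i w p. c i * (Y i w p - W i w p) + (c i - \<kappa>) * W i w p)"
  by (rule null_on_add[OF null_on_mult_tight'[OF assms(1) tight_on_convergent[OF assms(3)]] null_on_mult_tight[OF n assms(2)]])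
qed (simp add: algebra_simps)

lemma indep_vars_subalgebras:
 assumes ind: "indep_sets H D" and sub: "!!d. d \<in> D ==> subalgebra M (S d)" "!!d. d \<in> D ==> sets (S d) \<subseteq> H d"
  and u: "!!d. d \<in> D ==> u d \<in> borel_measurable (S d)"
 shows "indep_vars (\<lambda>_. borel) u D"
 unfolding indep_vars_def2
proof (intro conjI ballI)
 show "random_variable borel (u d)" if "d \<in> D" for d using measurable_from_subalg[OF sub(1) u] that by simp
 show "indep_sets (\<lambda>d. {u d -` A \<inter> space M |A. A \<in> sets borel}) D"
 proof (rule indep_sets_mono_sets[OF ind])
  fix d assume d: "d \<in> D"
  have "space (S d) = space M" using sub(1)[OF d] by (simp add: subalgebra_def)
  then show "{u d -` A \<inter> space M |A. A \<in> sets borel} \<subseteq> H d" using measurable_sets[OF u[OF d]] sub(2)[OF d] by auto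
 qed
qed

lemma expectation_iexp_sum:
 fixes u :: "'d => 'a => real"
 assumes D: "finite D" and ind: "indep_vars (\<lambda>_. borel) u D"
 shows "(\<E> w. iexp (\<Sum>d\<in>D. u d w)) = (\<Prod>d\<in>D. (\<E> w. iexp (u d w)))"
proof -
 have m: "u d \<in> borel_measurable M" if "d \<in> D" for d using ind that by (auto simp: indep_vars_def)
 have "indep_vars (\<lambda>_. borel) (\<lambda>d w. iexp (u d w)) D"
  by (rule indep_vars_compose2[OF ind]) measurable
 moreover have "integrable M (\<lambda>w. iexp (u d w))" if "d \<in> D" for d
  using m[OF that] by (intro integrable_const_bound[of _ 1]) auto
 ultimately show ?thesis
  using indep_vars_lebesgue_integral[OF D, of "\<lambda>d w. iexp (u d w)"] by (simp add: sum_distrib_left exp_sum[OF D])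
qed

end

lemma gen_sigma_reindex: "f ` J \<subseteq> I ==> gen_sigma P (\<lambda>j. Z (f j)) J \<subseteq> gen_sigma P Z I"
 unfolding gen_sigma_def by (intro sigma_sets_mono') blast

text \<open>Injectivity keeps different indices attached to different multipliers, hence
  independent; this selects single replicates and finite families of them.\<close>

lemma multipliers_reindex:
 assumes m: "multipliers P D Z I" and f: "inj_on f J" "f ` J \<subseteq> I"
 shows "multipliers P D (\<lambda>j. Z (f j)) J"
proof -
 interpret multipliers P D Z I by (rule m)
 show ?thesis
 proof unfold_locales
  show "indep_vars (\<lambda>_. borel) (\<lambda>j. Z (f j)) J"
   unfolding indep_vars_def2
  proof (intro conjI ballI indep_setsI)
   show "random_variable borel (Z (f j))" if "j \<in> J" for j using Z_meas f(2) that by auto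
   then show "{Z (f j) -` A \<inter> space P |A. A \<in> sets borel} \<subseteq> events" if "j \<in> J" for j using that by (auto intro: measurable_sets)
   fix A K assume K: "K \<noteq> {}" "K \<subseteq> J" "finite K" "\<forall>j\<in>K. A j \<in> {Z (f j) -` A \<inter> space P |A. A \<in> sets borel}"
   have inj: "inj_on f K" using f(1) K(2) inj_on_subset by blast
   define A' where "A' i = A (the_inv_into K f i)" for i
   have A': "A' (f j) = A j" if "j \<in> K" for j unfolding A'_def using the_inv_into_f_f[OF inj that] by simp
   have "prob (\<Inter>i\<in>f ` K. A' i) = (\<Prod>i\<in>f ` K. prob (A' i))"
    by (rule indep_setsD[OF Z_indep[unfolded indep_vars_def2, THEN conjunct2]]) (use K(1,3,4) A' image_mono[OF K(2), of f] f(2) in \<open>auto dest: subset_trans\<close>)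
   then show "prob (\<Inter>j\<in>K. A j) = (\<Prod>j\<in>K. prob (A j))" using A' by (simp add: prod.reindex[OF inj])
  qed
  show "std_normal_var P (Z (f j))" if "j \<in> J" for j using Z_normal f(2) that by auto
  show "indep_set (sets D) (gen_sigma P (\<lambda>j. Z (f j)) J)"
   using DZ unfolding indep_set_def by (rule indep_sets_mono_sets) (use gen_sigma_reindex[OF f(2)] in \<open>auto split: bool.splits\<close>)
 qed (rule D)
qed

context prob_space
begin

lemma bool_sum_fields:
 fixes F :: "bool => nat => 'a => 'q => real"
 shows "(!!b. null_on I (F b)) ==> null_on I (\<lambda>i w p. \<Sum>b\<in>UNIV. F b i w p)"
  "(!!b. tight_on I (F b)) ==> tight_on I (\<lambda>i w p. \<Sum>b\<in>UNIV. F b i w p)"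
  "(!!b. equicont_on \<pi> I (F b)) ==> equicont_on \<pi> I (\<lambda>i w p. \<Sum>b\<in>UNIV. F b i w p)"
 by (simp_all add: UNIV_bool null_on_add tight_on_add equicont_on_add)

text \<open>exp(- x / 2) is Lipschitz on [0, infinity), so convergence of the random variances in
  mean suffices.\<close>

lemma expectation_exp_tendsto:
 fixes V :: "nat => 'a => real"
 assumes V: "!!i. V i \<in> borel_measurable M" "!!i w. 0 \<le> V i w" and v: "0 \<le> v"
  and i: "!!i. integrable M (\<lambda>w. \<bar>V i w - v\<bar>)" and lim: "(\<lambda>i. (\<E> w. \<bar>V i w - v\<bar>)) \<longlonglongrightarrow> 0"
 shows "(\<lambda>i. (\<E> w. exp (- (V i w / 2)))) \<longlonglongrightarrow> exp (- (v / 2))"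
proof -
 have le: "exp (- (x / 2)) - exp (- (y / 2)) \<le> \<bar>x - y\<bar>" if "0 \<le> x" "0 \<le> y" for x y :: real
 proof (cases "x \<le> y")
  case True
  have "exp (- (x / 2)) - exp (- (y / 2)) = exp (- (x / 2)) * (1 - exp (- ((y - x) / 2)))" by (simp add: right_diff_distrib flip: exp_add) (simp add: field_simps)
  also have "... \<le> 1 * ((y - x) / 2)"
  proof (rule mult_mono)
   show "1 - exp (- ((y - x) / 2)) \<le> (y - x) / 2" using exp_ge_add_one_self[of "- ((y - x) / 2)"] by linarith
  qed (use that True in auto)
  finally show ?thesis using True by simp
 next
  case False
  then have "exp (- (x / 2)) \<le> exp (- (y / 2))" by simp
  then show ?thesis by linarith
 qed
 have le': "\<bar>exp (- (V i w / 2)) - exp (- (v / 2))\<bar> \<le> \<bar>V i w - v\<bar>" for i w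
  using le[OF V(2)[of i w] v] le[OF v V(2)[of i w]] by (simp add: abs_le_iff abs_minus_commute)
 have ie: "integrable M (\<lambda>w. exp (- (V i w / 2)))" for i using V by (intro integrable_const_bound[of _ 1]) auto
 have "(\<lambda>i. (\<E> w. exp (- (V i w / 2))) - exp (- (v / 2))) \<longlonglongrightarrow> 0"
 proof (rule Lim_null_comparison[OF always_eventually lim], rule allI)
  fix i
  have "(\<E> w. exp (- (V i w / 2))) - exp (- (v / 2)) = (\<E> w. exp (- (V i w / 2)) - exp (- (v / 2)))"
   using ie by (simp add: prob_space)
  also have "norm ... \<le> (\<E> w. \<bar>exp (- (V i w / 2)) - exp (- (v / 2))\<bar>)" unfolding real_norm_def by (rule integral_abs_bound)
  also have "... \<le> (\<E> w. \<bar>V i w - v\<bar>)" using ie i le' by (intro integral_mono) auto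
  finally show "norm ((\<E> w. exp (- (V i w / 2))) - exp (- (v / 2))) \<le> (\<E> w. \<bar>V i w - v\<bar>)" by simp
 qed
 then show ?thesis by (simp add: LIM_zero_iff)
qed

end

context sample
begin

lemma centred_sq_meas:
 assumes X: "!!j w. X j w = \<mu> + \<eta> j w" and j: "1 \<le> j"
 shows "(\<lambda>w. centred_sq X m j w p) \<in> borel_measurable P"
proof -
 have "(\<lambda>w. \<mu> t + \<eta> j w t - 1 / real m * (\<Sum>i=1..m. \<mu> t + \<eta> i w t)) \<in> borel_measurable P" for t
  using j by (intro bm_intros eval_eta_meas) auto
 then show ?thesis unfolding centred_sq_def X sample_mean_def
  by (cases p) (simp add: tensor_sq_apply minus_bcontfun.rep_eq plus_bcontfun.rep_eq scaleR_bcontfun.rep_eq apply_bcontfun_sum)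
qed

lemma estimates_meas:
 assumes X: "!!j w. X j w = \<mu> + \<eta> j w"
 shows "(\<lambda>w. apply_bcontfun ((1 / (real m - 1)) *\<^sub>R (\<Sum>j=1..m. centred_sq X m j w)) p) \<in> borel_measurable P"
  "(!!k. 1 \<le> k ==> x k \<in> borel_measurable P) ==> (\<lambda>w. block_multiplier_sum X m l x w p) \<in> borel_measurable P"
 unfolding block_multiplier_sum_def
 by (auto simp: minus_bcontfun.rep_eq plus_bcontfun.rep_eq scaleR_bcontfun.rep_eq apply_bcontfun_sum
   intro!: bm_intros centred_sq_meas[where X = X, OF X])

lemma block_variance:
 fixes k :: "nat => nat"
 assumes f: "centred_functional f" and l: "filterlim l at_top sequentially" "(\<lambda>m. real (l m) / real m) \<longlonglongrightarrow> 0" and k: "filterlim k at_top sequentially"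
 shows "(\<lambda>i. (\<E> w. \<bar>(\<Sum>j=1..k i + 1 - l (k i). ((\<Sum>j=j..j + l (k i) - 1. f (\<eta> j w)) / sqrt (real (k i) * real (l (k i))))\<^sup>2) - lrv f\<bar>)) \<longlonglongrightarrow> 0"
  "integrable P (\<lambda>w. \<bar>(\<Sum>j=1..m + 1 - a. ((\<Sum>j=j..j + a - 1. f (\<eta> j w)) / sqrt (real m * real a))\<^sup>2) - lrv f\<bar>)"
proof -
 have "(\<Sum>j=1..m + 1 - a. ((\<Sum>j=j..j + a - 1. f (\<eta> j w)) / sqrt (real m * real a))\<^sup>2) = (\<Sum>j=1..m + 1 - a. (\<Sum>j=j..j + a - 1. f (\<eta> j w))\<^sup>2 / real a) / real m" for w m a
  unfolding sum_divide_distrib[of _ _ "real m"] by (intro sum.cong refl) (simp add: power_divide mult.commute)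
 then show "(\<lambda>i. (\<E> w. \<bar>(\<Sum>j=1..k i + 1 - l (k i). ((\<Sum>j=j..j + l (k i) - 1. f (\<eta> j w)) / sqrt (real (k i) * real (l (k i))))\<^sup>2) - lrv f\<bar>)) \<longlonglongrightarrow> 0"
  using filterlim_compose[OF block_variance_limit[OF f l] k] by simp
 have "integrable P (\<lambda>w. (\<Sum>j=i..i + a - 1. f (\<eta> j w))\<^sup>2)" if "1 \<le> i" for i
  using integrable_sum_power[of "{i..i + a - 1}" "\<lambda>j w. f (\<eta> j w)" 2] centred_functionalD(3)[OF f] centred_functionalD(5)[OF f, of _ 2] that by auto
 then show "integrable P (\<lambda>w. \<bar>(\<Sum>j=1..m + 1 - a. ((\<Sum>j=j..j + a - 1. f (\<eta> j w)) / sqrt (real m * real a))\<^sup>2) - lrv f\<bar>)"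
  unfolding power_divide by (intro integrable_abs integrable_diff integrable_sum integrable_divide_zero integrable_const) auto
qed

end

text \<open>The two samples are indexed by \<open>bool\<close>; the multiplier \<open>Z (b, r, k)\<close> belongs to sample \<open>b\<close>, replicate \<open>r\<close> and block \<open>k\<close>.
 The weights \<open>c b i\<close> are \<open>\<plusminus> sqrt ((m + n) / m)\<close> and \<open>\<plusminus> sqrt ((m + n) / n)\<close>.\<close>

locale two_samples = prob_space P for P :: "'a measure" +
 fixes \<eta> X :: "bool => nat => 'a => C01" and \<phi> :: "bool => nat => real" and h :: nat and g :: real and K \<kappa> :: "bool => real"
  and n l :: "bool => nat => nat" and c :: "bool => nat => real" and \<mu> :: "bool => C01"
  and D :: "'a measure" and Z :: "bool \<times> nat \<times> nat => 'a => real"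
 assumes sample: "sample P (\<eta> b) (\<phi> b) h g (K b)"
  and indep: "indep_set (gen_sigma P (\<eta> True) {1..}) (gen_sigma P (\<eta> False) {1..})"
  and n: "filterlim (n b) at_top sequentially" and c: "c b \<longlonglongrightarrow> \<kappa> b"
  and X: "X b j w = \<mu> b + \<eta> b j w"
  and l: "filterlim (l b) at_top sequentially" "(\<lambda>m. real (l b m) / real m) \<longlonglongrightarrow> 0"
  and mult: "multipliers P D Z (UNIV \<times> {1..} \<times> {1..})" and eta_D: "1 \<le> j ==> \<eta> b j \<in> borel_measurable D"
begin

sublocale S: sample P "\<eta> b" "\<phi> b" h g "K b" for b
 by (rule sample)

definition \<Gamma> :: "pt => pt => real" where
 "\<Gamma> p q = (\<Sum>b\<in>UNIV. (\<kappa> b)\<^sup>2 * S.wcov b p q)"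

definition A :: "nat => 'a => pt => real" where
 "A i w p = (\<Sum>b\<in>UNIV. \<kappa> b * fsum (\<eta> b) (S.wprod b p) (n b i) w)"

definition B :: "nat => nat => 'a => pt => real" where
 "B r i w p = (\<Sum>b\<in>UNIV. \<kappa> b * bsum (\<eta> b) (S.wprod b p) (n b i) (l b (n b i)) (\<lambda>k. Z (b, r, k)) w)"

text \<open>\<open>SA\<close> and \<open>SB\<close> are the statistic and a replicate in the form
  used for limits; \<open>A\<close> and \<open>B\<close> are their linear parts with the weights
  replaced by their limits. The sign carried by \<open>c\<close> turns the difference of the samples
  into a sum over \<open>bool\<close>.\<close>

definition SA :: "nat => 'a => pt => real" where
 "SA i w p = (\<Sum>b\<in>UNIV. c b i * (sqrt (real (n b i)) * (apply_bcontfun ((1 / (real (n b i) - 1)) *\<^sub>R (\<Sum>j=1..n b i. centred_sq (X b) (n b i) j w)) p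
   - cov_kernel P (\<eta> b) (fst p) (snd p))))"

definition SB :: "nat => nat => 'a => pt => real" where
 "SB r i w p = (\<Sum>b\<in>UNIV. c b i * (sqrt (real (n b i)) * block_multiplier_sum (X b) (n b i) (l b (n b i)) (\<lambda>k. Z (b, r, k)) w p))"

lemma wprod_cf: "S.centred_functional b (S.wprod b p)"
 by (rule S.field_functionalD(9)[OF S.wprod_field])

lemma lincomb_cf: "finite Q ==> S.centred_functional b (\<lambda>y. \<Sum>p\<in>Q. t p * S.wprod b p y)"
 by (intro S.centred_functional_sum wprod_cf)

lemma quadratic_form: "finite Q ==> (\<Sum>p\<in>Q. \<Sum>q\<in>Q. t p * t q * \<Gamma> p q) = (\<Sum>b\<in>UNIV. (\<kappa> b)\<^sup>2 * S.lrv b (\<lambda>y. \<Sum>p\<in>Q. t p * S.wprod b p y))"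
 unfolding S.lrv_lincomb[OF _ wprod_cf] \<Gamma>_def S.wcov_def UNIV_bool by (simp add: sum.distrib sum_distrib_left algebra_simps)

lemma A_iexp:
 assumes Q: "finite Q"
 shows "(\<lambda>i. (\<E> w. iexp (\<Sum>q\<in>Q. t q * A i w q))) \<longlonglongrightarrow> exp (- ((\<Sum>p\<in>Q. \<Sum>q\<in>Q. t p * t q * \<Gamma> p q) / 2))"
proof -
 define f where "f b = (\<lambda>y. \<Sum>q\<in>Q. t q * S.wprod b q y)" for b
 define u where "u i b w = \<kappa> b * fsum (\<eta> b) (f b) (n b i) w" for i b w
 have cf: "S.centred_functional b (f b)" for b unfolding f_def by (rule lincomb_cf[OF Q])
 have "(\<Sum>q\<in>Q. t q * A i w q) = (\<Sum>b\<in>UNIV. u i b w)" for i w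
  unfolding A_def u_def f_def S.fsum_lincomb sum_distrib_left by (subst sum.swap) (simp add: ac_simps)
 moreover have "indep_vars (\<lambda>_. borel) (u i) UNIV" for i
 proof (rule indep_vars_subalgebras[where S = "\<lambda>b. vsig P (\<eta> b) {1..}"])
  show "indep_sets (case_bool (gen_sigma P (\<eta> True) {1..}) (gen_sigma P (\<eta> False) {1..})) UNIV" using indep unfolding indep_set_def .
  show "subalgebra P (vsig P (\<eta> b) {1..})" for b by (rule S.subalgebra_eta) simp
  show "sets (vsig P (\<eta> b) {1..}) \<subseteq> case_bool (gen_sigma P (\<eta> True) {1..}) (gen_sigma P (\<eta> False) {1..}) b" for b
   by (cases b) (auto simp: sets_vsig)
  have "f b \<in> borel_measurable borel" for b by (rule S.centred_functionalD(1)[OF cf order_refl])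
  then have "(\<lambda>w. f b (\<eta> b j w)) \<in> borel_measurable (vsig P (\<eta> b) {1..})" if "1 \<le> j" for b j
   using that by (intro measurable_compose[OF measurable_vsig]) auto
  then show "u i b \<in> borel_measurable (vsig P (\<eta> b) {1..})" for b
   unfolding u_def fsum_def by (intro bm_intros) auto
 qed
 ultimately have e: "(\<E> w. iexp (\<Sum>q\<in>Q. t q * A i w q)) = (\<Prod>b\<in>UNIV. (\<E> w. iexp (u i b w)))" for i
  using expectation_iexp_sum[of UNIV "u i"] by simp
 have "(\<lambda>i. (\<E> w. iexp (u i b w))) \<longlonglongrightarrow> exp (- ((\<kappa> b)\<^sup>2 * S.lrv b (f b) / 2))" for b
  unfolding u_def fsum_def by (rule filterlim_compose[OF S.central_limit[OF cf] n])
 then have "(\<lambda>i. \<Prod>b\<in>UNIV. (\<E> w. iexp (u i b w))) \<longlonglongrightarrow> (\<Prod>b\<in>UNIV. complex_of_real (exp (- ((\<kappa> b)\<^sup>2 * S.lrv b (f b) / 2))))"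
  by (intro tendsto_prod) simp
 moreover have "(\<Prod>b\<in>UNIV. complex_of_real (exp (- ((\<kappa> b)\<^sup>2 * S.lrv b (f b) / 2)))) = exp (- ((\<Sum>p\<in>Q. \<Sum>q\<in>Q. t p * t q * \<Gamma> p q) / 2))"
  unfolding quadratic_form[OF Q] f_def of_real_prod[symmetric] exp_sum[OF finite, symmetric] by (simp add: sum_negf sum_divide_distrib)
 ultimately show ?thesis unfolding e by simp
qed

text \<open>A Gaussian sequence is indexed from 0, replicates and blocks from 1, hence the two
  successors. The multipliers of one sample supply all the limit fields, so the given probability
  space is large enough.\<close>

lemma Gaussian_multipliers: "multipliers P D (\<lambda>(d, k). Z (True, Suc d, Suc k)) UNIV"
 using multipliers_reindex[OF mult, of "\<lambda>(d, k). (True, Suc d, Suc k)" UNIV] by (auto simp: inj_on_def case_prod_unfold)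

definition C\<Gamma> :: real where
 "C\<Gamma> = 2 ^ h * (\<Sum>b\<in>UNIV. ((\<kappa> b)\<^sup>2) ^ h * (S.moment_const b (2 * h) * S.Kw b))"

text \<open>One limit field for each \<open>d\<close>, with common covariance, built from the
  multipliers of replicate d + 1. Disjoint families of multipliers make the fields
  independent.\<close>

sublocale Gd: gaussian_field P "\<lambda>k. Z (True, Suc d, Suc k)" \<Gamma> C\<Gamma> g h for d
proof
 interpret m: multipliers P D "\<lambda>k. Z (True, Suc d, Suc k)" UNIV
  using multipliers_reindex[OF Gaussian_multipliers, of "\<lambda>k. (d, k)" UNIV] by (simp add: inj_on_def)
 show "indep_vars (\<lambda>_. borel) (\<lambda>k. Z (True, Suc d, Suc k)) UNIV" "std_normal_var P (Z (True, Suc d, Suc k))" for k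
  using m.Z_indep m.Z_normal by auto
 show "\<Gamma> p q = \<Gamma> q p" for p q unfolding \<Gamma>_def S.wcov_def using S.fcov_sym by simp
 show "0 \<le> (\<Sum>i<n. \<Sum>j<n. t i * t j * \<Gamma> (x i) (x j))" for n t and x :: "nat => _"
 proof -
  have "(\<Sum>i<n. \<Sum>j<n. t i * t j * \<Gamma> (x i) (x j)) = (\<Sum>b\<in>UNIV. (\<kappa> b)\<^sup>2 * S.lrv b (\<lambda>y. \<Sum>i<n. t i * S.wprod b (x i) y))"
   unfolding S.lrv_lincomb[OF finite_lessThan wprod_cf] \<Gamma>_def S.wcov_def UNIV_bool by (simp add: sum.distrib sum_distrib_left algebra_simps)
  also have "0 \<le> ..." by (intro sum_nonneg mult_nonneg_nonneg S.lrv_nonneg S.centred_functional_sum wprod_cf) auto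
  finally show ?thesis .
 qed
 have mk: "0 \<le> S.moment_const b (2 * h) * S.Kw b" for b
  using S.field_functionalD(3)[OF S.wprod_field] S.moment_const_nonneg by (intro mult_nonneg_nonneg) auto
 show "(\<Gamma> (dyad2 (Suc N) p) (dyad2 (Suc N) p) - 2 * \<Gamma> (dyad2 (Suc N) p) (dyad2 N p) + \<Gamma> (dyad2 N p) (dyad2 N p)) ^ h \<le> C\<Gamma> * (1 / 2 ^ N) powr g" for N p
 proof -
  define v where "v b = S.wcov b (dyad2 (Suc N) p) (dyad2 (Suc N) p) - 2 * S.wcov b (dyad2 (Suc N) p) (dyad2 N p) + S.wcov b (dyad2 N p) (dyad2 N p)" for b
  have v0: "0 \<le> v b" for b
   unfolding v_def S.wcov_def S.lrv_diff(1)[OF wprod_cf wprod_cf, symmetric] by (intro S.lrv_nonneg S.lrv_diff(2) wprod_cf)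
  have "\<Gamma> (dyad2 (Suc N) p) (dyad2 (Suc N) p) - 2 * \<Gamma> (dyad2 (Suc N) p) (dyad2 N p) + \<Gamma> (dyad2 N p) (dyad2 N p) = (\<kappa> True)\<^sup>2 * v True + (\<kappa> False)\<^sup>2 * v False"
   unfolding \<Gamma>_def v_def UNIV_bool by (simp add: algebra_simps)
  also have "... ^ h \<le> 2 ^ h * (\<bar>(\<kappa> True)\<^sup>2 * v True\<bar> ^ h + \<bar>(\<kappa> False)\<^sup>2 * v False\<bar> ^ h)"
   using abs_add_power_le[of "(\<kappa> True)\<^sup>2 * v True" "(\<kappa> False)\<^sup>2 * v False" h] v0 by simp
  also have "... = 2 ^ h * (\<Sum>b\<in>UNIV. ((\<kappa> b)\<^sup>2) ^ h * v b ^ h)" using v0 by (simp add: UNIV_bool power_mult_distrib add.commute)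
  also have "... \<le> 2 ^ h * (\<Sum>b\<in>UNIV. ((\<kappa> b)\<^sup>2) ^ h * (S.moment_const b (2 * h) * S.Kw b * (1 / 2 ^ N) powr g))"
   unfolding v_def by (intro mult_left_mono sum_mono S.wcov_incr) auto
  finally show ?thesis unfolding C\<Gamma>_def sum_distrib_right sum_distrib_left by (simp add: ac_simps)
 qed
 show "2 < g" "1 \<le> h" using S.g S.h by auto
 show "0 \<le> C\<Gamma>" unfolding C\<Gamma>_def by (rule mult_nonneg_nonneg, simp, rule sum_nonneg, rule mult_nonneg_nonneg[OF _ mk], simp)
qed

abbreviation "GA d \<equiv> vsig P (\<lambda>k. Z (True, Suc d, Suc k)) UNIV"

lemma GA_indep: "indep_sets (\<lambda>d. sets (GA d)) R"
proof -
 interpret m: multipliers P D "\<lambda>(d, k). Z (True, Suc d, Suc k)" UNIV by (rule Gaussian_multipliers)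
 let ?E = "\<lambda>x. {(\<lambda>(d, k). Z (True, Suc d, Suc k)) x -` A \<inter> space P |A. A \<in> sets borel}"
 have "indep_sets (\<lambda>d. sigma_sets (space P) (\<Union>x\<in>{d} \<times> UNIV. ?E x)) R"
 proof (rule indep_sets_collect_sigma)
  show "indep_sets ?E (\<Union>d\<in>R. {d} \<times> UNIV)"
   by (rule indep_sets_mono_index[OF _ m.Z_indep[unfolded indep_vars_def2, THEN conjunct2]]) simp
  show "Int_stable (?E x)" for x
   unfolding Int_stable_def
  proof (intro ballI)
   fix a b assume "a \<in> ?E x" "b \<in> ?E x"
   then obtain A B where AB: "a = (\<lambda>(d, k). Z (True, Suc d, Suc k)) x -` A \<inter> space P" "b = (\<lambda>(d, k). Z (True, Suc d, Suc k)) x -` B \<inter> space P"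
    "A \<in> sets borel" "B \<in> sets borel" by blast
   show "a \<inter> b \<in> ?E x" using AB(3,4) by (intro CollectI exI[of _ "A \<inter> B"]) (auto simp: AB(1,2))
  qed
  show "disjoint_family_on (\<lambda>d. {d} \<times> UNIV) R" by (auto simp: disjoint_family_on_def)
 qed
 moreover have "(\<Union>x\<in>{d} \<times> UNIV. ?E x) = (\<Union>k. {Z (True, Suc d, Suc k) -` A \<inter> space P |A. A \<in> sets borel})"
  for d
 proof -
  have r: "{d} \<times> UNIV = range (Pair d)" by auto
  show ?thesis unfolding r by simp
 qed
 ultimately show ?thesis unfolding sets_vsig gen_sigma_def by simp
qed

lemma GA_sub: "subalgebra P (GA d)"
 by (rule subalgebra_vsig) (rule Gd.Z_meas)

lemma G_meas_GA: "(\<lambda>w. Gd.G d w p) \<in> borel_measurable (GA d)"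
 unfolding Gd.G_single
 by (intro bm_intros measurable_vsig[of _ UNIV "\<lambda>k. Z (True, Suc d, Suc k)"]) simp

lemma G_iexp:
 assumes R: "finite R" and Q: "finite Q" "Q \<subseteq> R \<times> dyads"
 shows "(\<E> w. iexp (\<Sum>q\<in>Q. t q * Gd.G (fst q) w (snd q))) =
  complex_of_real (exp (- ((\<Sum>d\<in>R. \<Sum>p\<in>{p. (d, p) \<in> Q}. \<Sum>q\<in>{p. (d, p) \<in> Q}. t (d, p) * t (d, q) * \<Gamma> p q) / 2)))"
proof -
 let ?Q = "\<lambda>d. {p. (d, p) \<in> Q}"
 have f: "finite (?Q d)" for d using finite_imageI[OF Q(1), of snd] by (rule finite_subset[rotated]) force
 have QS: "Q = Sigma R ?Q" using Q by auto
 have e: "(\<Sum>q\<in>Q. t q * Gd.G (fst q) w (snd q)) = (\<Sum>d\<in>R. \<Sum>p\<in>?Q d. t (d, p) * Gd.G d w p)" for w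
  by (subst QS, subst sum.Sigma) (use R f in \<open>auto simp: case_prod_beta\<close>)
 have "indep_vars (\<lambda>_. borel) (\<lambda>d w. \<Sum>p\<in>?Q d. t (d, p) * Gd.G d w p) R"
  by (rule indep_vars_subalgebras[OF GA_indep GA_sub order_refl]) (intro bm_intros G_meas_GA)
 then have "(\<E> w. iexp (\<Sum>q\<in>Q. t q * Gd.G (fst q) w (snd q))) = (\<Prod>d\<in>R. (\<E> w. iexp (\<Sum>p\<in>?Q d. t (d, p) * Gd.G d w p)))"
  unfolding e by (rule expectation_iexp_sum[OF R])
 also have "... = (\<Prod>d\<in>R. complex_of_real (exp (- ((\<Sum>p\<in>?Q d. \<Sum>q\<in>?Q d. t (d, p) * t (d, q) * \<Gamma> p q) / 2))))"
  using Gd.G_iexp[OF f, of _ "\<lambda>p. t (_, p)"] Q(2) by (intro prod.cong refl) auto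
 finally show ?thesis unfolding of_real_prod[symmetric] exp_sum[OF R, symmetric] by (simp add: sum_negf sum_divide_distrib)
qed

lemma G_box:
 assumes R: "finite R" "R \<noteq> {}"
 shows "prob {w\<in>space P. \<forall>q\<in>R \<times> dyads. \<bar>Gd.G (fst q) w (snd q)\<bar> \<le> x} = (\<Prod>d\<in>R. Gd.F d x)"
proof -
 let ?E = "\<lambda>d. {w\<in>space P. \<forall>p\<in>dyads. \<bar>Gd.G d w p\<bar> \<le> x}"
 have "?E d \<in> sets (GA d)" for d
  using box_event[OF countable_dyads G_meas_GA, where z = x] by simp
 then have "prob (\<Inter>d\<in>R. ?E d) = (\<Prod>d\<in>R. prob (?E d))" by (intro indep_setsD[OF GA_indep[of R]] R) auto
 moreover have "(\<Inter>d\<in>R. ?E d) = {w\<in>space P. \<forall>q\<in>R \<times> dyads. \<bar>Gd.G (fst q) w (snd q)\<bar> \<le> x}" using R by auto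
 ultimately show ?thesis unfolding Gd.F_def by simp
qed

end

section \<open>Limit distributions of the statistic and of the replicates\<close>

lemma (in prob_space) equicont_on_compose:
 assumes "equicont_on \<pi> I X" "filterlim m sequentially sequentially"
 shows "equicont_on \<pi> I (\<lambda>i. X (m i))"
 unfolding equicont_on_def
proof (intro allI impI)
 fix e :: real assume "0 < e"
 with assms(1) obtain N0 where N0: "\<forall>N\<ge>N0. whp e (\<lambda>i w. \<forall>p\<in>I. \<bar>X i w p - X i w (\<pi> N p)\<bar> \<le> e)"
  unfolding equicont_on_def by (elim allE[of _ e] impE) auto
 show "\<exists>N0. \<forall>N\<ge>N0. whp e (\<lambda>i w. \<forall>p\<in>I. \<bar>X (m i) w p - X (m i) w (\<pi> N p)\<bar> \<le> e)"
 proof (intro exI allI impI)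
  fix N assume "N0 \<le> N"
  then show "whp e (\<lambda>i w. \<forall>p\<in>I. \<bar>X (m i) w p - X (m i) w (\<pi> N p)\<bar> \<le> e)"
   using eventually_compose_filterlim[OF N0[rule_format] assms(2)] by simp
 qed
qed

context two_samples
begin

lemma replicate_multipliers: "1 \<le> r ==> multipliers P D (\<lambda>k. Z (b, r, k)) {1..}"
 using multipliers_reindex[OF mult, of "\<lambda>k. (b, r, k)" "{1..}"] by (auto simp: inj_on_def)

lemma block_length: "\<forall>\<^sub>F i in sequentially. 1 \<le> l b (n b i) \<and> l b (n b i) \<le> n b i"
proof -
 have "\<forall>\<^sub>F m in sequentially. real (l b m) / real m < 1" by (rule order_tendstoD(2)[OF l(2)]) simp
 moreover have "\<forall>\<^sub>F m in sequentially. 1 \<le> l b m" using l(1)[of b] unfolding filterlim_at_top by blast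
 ultimately have "\<forall>\<^sub>F m in sequentially. 1 \<le> l b m \<and> l b m \<le> m"
  using eventually_ge_at_top[of 1] by eventually_elim (simp add: divide_less_eq)
 from eventually_compose_filterlim[OF this n[of b]] show ?thesis .
qed

lemma wprod_D: "1 \<le> j ==> (\<lambda>w. S.wprod b p (\<eta> b j w)) \<in> borel_measurable D"
 by (rule measurable_compose[OF eta_D S.field_functionalD(4)[OF S.wprod_field]])

lemma A_fields: "equicont_on dyad2 dyads A" "I = dyads \<or> I = {q} ==> tight_on I A"
proof -
 show "equicont_on dyad2 dyads A"
  unfolding A_def[abs_def] by (intro bool_sum_fields equicont_on_cmult equicont_on_compose[OF S.fsum_field(1)[OF S.wprod_field] n])
 show "tight_on I A" if "I = dyads \<or> I = {q}"
  unfolding A_def[abs_def] by (intro bool_sum_fields tight_on_mult tight_on_convergent[OF tendsto_const] tight_on_compose[OF S.fields_tight(1)[OF that] n])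
qed

lemma B_fields:
 assumes r: "!!i. 1 \<le> r i"
 shows "equicont_on dyad2 dyads (\<lambda>i. B (r i) i)" "tight_on dyads (\<lambda>i. B (r i) i)"
proof -
 note b = S.bsum_field[OF S.wprod_field replicate_multipliers[OF r] wprod_D block_length]
 show "equicont_on dyad2 dyads (\<lambda>i. B (r i) i)" unfolding B_def[abs_def] by (intro bool_sum_fields equicont_on_cmult b)
 show "tight_on dyads (\<lambda>i. B (r i) i)" unfolding B_def[abs_def] by (intro bool_sum_fields tight_on_mult tight_on_convergent[OF tendsto_const] b)
qed

lemma SA_null: "I = dyads \<or> I = {q} ==> null_on I (\<lambda>i w p. SA i w p - A i w p)"
 unfolding SA_def A_def sum_subtractf[symmetric]
 by (intro bool_sum_fields null_on_scaled[OF _ _ c] null_on_compose[OF S.covariance_estimate_null[where X = "X _", OF X] n] tight_on_compose[OF S.fields_tight(1) n])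

lemma SB_null:
 assumes r: "!!i. 1 \<le> r i"
 shows "null_on dyads (\<lambda>i w p. SB (r i) i w p - B (r i) i w p)"
 unfolding SB_def B_def sum_subtractf[symmetric]
 by (intro bool_sum_fields null_on_scaled[OF _ _ c] S.bsum_field(2)[OF S.wprod_field replicate_multipliers[OF r] wprod_D block_length]
   S.multiplier_estimate_null[where X = "X _", OF X replicate_multipliers[OF r] eta_D block_length filterlim_compose[OF l(2) n] n])

lemma SA_meas: "(\<lambda>w. SA i w p) \<in> borel_measurable P"
 unfolding SA_def by (intro bm_intros S.estimates_meas(1)[where X = "X _", OF X])

lemma SB_meas: "1 \<le> r ==> (\<lambda>w. SB r i w p) \<in> borel_measurable P"
 unfolding SB_def
 by (intro bm_intros S.estimates_meas(2)[where X = "X _", OF X] multipliers.Z_meas[OF replicate_multipliers]) auto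

text \<open>All replicates together form one multiplier sum over triples of replicate, sample and
  block. Distinct replicate numbers make the multipliers distinct, so the conditional variance
  contains no cross terms between replicates, and it converges in mean by the block
  variances.\<close>

lemma B_iexp:
 assumes R: "finite R" and r: "!!i. inj_on (\<lambda>d. r d i) R" "!!d i. 1 \<le> r d i" and Q: "finite Q" "Q \<subseteq> R \<times> dyads"
 shows "(\<lambda>i. (\<E> w. iexp (\<Sum>q\<in>Q. t q * B (r (fst q) i) i w (snd q)))) \<longlonglongrightarrow>
  complex_of_real (exp (- ((\<Sum>d\<in>R. \<Sum>p\<in>{p. (d, p) \<in> Q}. \<Sum>q\<in>{p. (d, p) \<in> Q}. t (d, p) * t (d, q) * \<Gamma> p q) / 2)))"
proof -
 let ?Q = "\<lambda>d. {p. (d, p) \<in> Q}"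
 have fQ: "finite (?Q d)" for d using finite_imageI[OF Q(1), of snd] by (rule finite_subset[rotated]) force
 have QS: "Q = Sigma R ?Q" using Q by auto
 define f where "f d b = (\<lambda>y. \<Sum>p\<in>?Q d. t (d, p) * S.wprod b p y)" for d b
 have cf: "S.centred_functional b (f d b)" for d b unfolding f_def by (rule lincomb_cf[OF fQ])
 define N where "N b i = n b i + 1 - l b (n b i)" for b i
 define s where "s d b i k w = (\<Sum>j=k..k + l b (n b i) - 1. f d b (\<eta> b j w)) / sqrt (real (n b i) * real (l b (n b i)))" for d b i k w
 define a where "a i x w = \<kappa> (fst (snd x)) * s (fst x) (fst (snd x)) i (snd (snd x)) w" for i and x :: "'b \<times> bool \<times> nat" and w
 define Z' where "Z' i x = Z (fst (snd x), r (fst x) i, snd (snd x))" for i and x :: "'b \<times> bool \<times> nat"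
 define Ks where "Ks i = (SIGMA d:R. SIGMA b:UNIV. {1..N b i})" for i
 have Ks: "(\<Sum>x\<in>Ks i. F (fst x) (fst (snd x)) (snd (snd x))) = (\<Sum>d\<in>R. \<Sum>b\<in>UNIV. \<Sum>k=1..N b i. F d b k)" for i and F :: "'b => bool => nat => real"
  unfolding Ks_def using R by (simp add: sum.Sigma case_prod_unfold)
 have "(\<Sum>q\<in>Q. t q * B (r (fst q) i) i w (snd q)) = (\<Sum>x\<in>Ks i. a i x w * Z' i x w)" for i w
 proof -
  have "(\<Sum>q\<in>Q. t q * B (r (fst q) i) i w (snd q)) = (\<Sum>d\<in>R. \<Sum>p\<in>?Q d. t (d, p) * B (r d i) i w p)"
   by (subst QS, subst sum.Sigma) (use R fQ in \<open>auto simp: case_prod_beta\<close>)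
  also have "... = (\<Sum>d\<in>R. \<Sum>b\<in>UNIV. \<kappa> b * bsum (\<eta> b) (f d b) (n b i) (l b (n b i)) (\<lambda>k. Z (b, r d i, k)) w)"
   unfolding B_def f_def S.bsum_lincomb sum_distrib_left by (intro sum.cong refl, subst sum.swap) (simp add: ac_simps)
  also have "... = (\<Sum>x\<in>Ks i. a i x w * Z' i x w)"
   unfolding a_def Z'_def Ks[of "\<lambda>d b k. \<kappa> b * s d b i k w * Z (b, r d i, k) w"]
   unfolding bsum_def N_def s_def sum_distrib_left by (simp add: mult.assoc)
  finally show ?thesis .
 qed
 moreover have "multipliers P D (Z' i) (R \<times> UNIV \<times> {1..})" for i
  unfolding Z'_def by (rule multipliers_reindex[OF mult]) (use r in \<open>force simp: inj_on_def\<close>)+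
 moreover have "Ks i \<subseteq> R \<times> UNIV \<times> {1..}" for i unfolding Ks_def by auto
 moreover have "a i x \<in> borel_measurable D" if "x \<in> Ks i" for i x
 proof -
  have "f d b \<in> borel_measurable borel" for d b by (rule S.centred_functionalD(1)[OF cf order_refl])
  then have "(\<lambda>w. f d b (\<eta> b j w)) \<in> borel_measurable D" if "1 \<le> j" for d b j by (rule measurable_compose[OF eta_D[OF that]])
  then show ?thesis unfolding a_def s_def using that
   by (intro bm_intros) (auto simp: Ks_def)
 qed
 ultimately have e: "(\<E> w. iexp (\<Sum>q\<in>Q. t q * B (r (fst q) i) i w (snd q))) = complex_of_real ((\<E> w. exp (- ((\<Sum>x\<in>Ks i. (a i x w)\<^sup>2) / 2))))" for i
  using multipliers.multiplier_iexp[of P D "Z' i" "R \<times> UNIV \<times> {1..}" "Ks i" "a i"] by simp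
 define W where "W d b i w = (\<Sum>k=1..N b i. (s d b i k w)\<^sup>2)" for d b i w
 define v where "v d b = S.lrv b (f d b)" for d b
 have V: "(\<Sum>x\<in>Ks i. (a i x w)\<^sup>2) = (\<Sum>d\<in>R. \<Sum>b\<in>UNIV. (\<kappa> b)\<^sup>2 * W d b i w)" for i w
  unfolding a_def W_def Ks[of "\<lambda>d b k. (\<kappa> b * s d b i k w)\<^sup>2"] by (simp add: power_mult_distrib sum_distrib_left)
 have Wi: "integrable P (\<lambda>w. \<bar>W d b i w - v d b\<bar>)" for d b i
  unfolding W_def v_def s_def N_def by (rule S.block_variance(2)[OF cf l n])
 have Wl: "(\<lambda>i. (\<E> w. \<bar>W d b i w - v d b\<bar>)) \<longlonglongrightarrow> 0" for d b
  unfolding W_def v_def s_def N_def by (rule S.block_variance(1)[OF cf l n])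
 have Wm: "W d b i \<in> borel_measurable P" for d b i
 proof -
  have "(\<lambda>w. f d b (\<eta> b j w)) \<in> borel_measurable P" if "1 \<le> j" for j by (rule S.centred_functionalD(3)[OF cf that])
  then show ?thesis unfolding W_def s_def by (intro bm_intros) auto
 qed
 let ?V = "\<lambda>i w. \<Sum>d\<in>R. \<Sum>b\<in>UNIV. (\<kappa> b)\<^sup>2 * W d b i w" and ?v = "\<Sum>d\<in>R. \<Sum>b\<in>UNIV. (\<kappa> b)\<^sup>2 * v d b"
 let ?D = "\<lambda>i w. \<Sum>d\<in>R. \<Sum>b\<in>UNIV. (\<kappa> b)\<^sup>2 * \<bar>W d b i w - v d b\<bar>"
 have le: "\<bar>?V i w - ?v\<bar> \<le> ?D i w" for i w
  unfolding sum_subtractf[symmetric] right_diff_distrib[symmetric]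
  by (rule order_trans[OF sum_abs], intro sum_mono, rule order_trans[OF sum_abs]) (simp add: abs_mult)
 have iD: "integrable P (?D i)" for i using Wi by (intro integrable_sum integrable_mult_right) auto
 have mV: "?V i \<in> borel_measurable P" for i by (intro bm_intros Wm)
 have iV: "integrable P (\<lambda>w. \<bar>?V i w - ?v\<bar>)" for i
  by (rule integrable_bound[OF iD]) (use mV order_trans[OF le abs_ge_self] in auto)
 have "(\<lambda>i. (\<E> w. exp (- (?V i w / 2)))) \<longlonglongrightarrow> exp (- (?v / 2))"
 proof (rule expectation_exp_tendsto[OF mV _ _ iV])
  show "0 \<le> ?V i w" for i w unfolding W_def by (intro sum_nonneg mult_nonneg_nonneg) auto
  show "0 \<le> ?v" unfolding v_def by (intro sum_nonneg mult_nonneg_nonneg S.lrv_nonneg cf) auto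
  show "(\<lambda>i. (\<E> w. \<bar>?V i w - ?v\<bar>)) \<longlonglongrightarrow> 0"
  proof (rule Lim_null_comparison[OF always_eventually], rule allI)
   fix i
   have "(\<E> w. \<bar>?V i w - ?v\<bar>) \<le> expectation (?D i)" by (intro integral_mono iV iD le)
   also have "... = (\<Sum>d\<in>R. \<Sum>b\<in>UNIV. (\<kappa> b)\<^sup>2 * (\<E> w. \<bar>W d b i w - v d b\<bar>))"
    using Wi by (simp add: integral_sum integrable_sum)
   finally show "norm ((\<E> w. \<bar>?V i w - ?v\<bar>)) \<le> (\<Sum>d\<in>R. \<Sum>b\<in>UNIV. (\<kappa> b)\<^sup>2 * (\<E> w. \<bar>W d b i w - v d b\<bar>))"
    by (simp add: integral_nonneg_AE)
  next
   have "(\<lambda>i. \<Sum>d\<in>R. \<Sum>b\<in>UNIV. (\<kappa> b)\<^sup>2 * (\<E> w. \<bar>W d b i w - v d b\<bar>)) \<longlonglongrightarrow> (\<Sum>d\<in>R. \<Sum>b\<in>(UNIV :: bool set). (\<kappa> b)\<^sup>2 * 0)"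
    by (intro tendsto_sum tendsto_mult_left Wl)
   then show "(\<lambda>i. \<Sum>d\<in>R. \<Sum>b\<in>UNIV. (\<kappa> b)\<^sup>2 * (\<E> w. \<bar>W d b i w - v d b\<bar>)) \<longlonglongrightarrow> 0" by simp
  qed
 qed
 moreover have "?v = (\<Sum>d\<in>R. \<Sum>p\<in>?Q d. \<Sum>q\<in>?Q d. t (d, p) * t (d, q) * \<Gamma> p q)"
  unfolding v_def f_def by (intro sum.cong refl quadratic_form[OF fQ, symmetric])
 ultimately show ?thesis unfolding e V by (simp add: tendsto_of_real_iff)
qed

lemma SA_limit:
 assumes x: "0 < x"
 shows "(\<lambda>i. prob {w\<in>space P. \<forall>p\<in>dyads. \<bar>SA i w p\<bar> \<le> x}) \<longlonglongrightarrow> Gd.F d x"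
proof -
 have Am: "(\<lambda>w. A i w p) \<in> borel_measurable P" for i p
  unfolding A_def by (intro bm_intros S.fsum_meas S.field_functionalD(4)[OF S.wprod_field])
 interpret fdd_convergence P A "Gd.G d" dyads
 proof
  fix Q :: "(pt) set" and t assume Q: "finite Q" "Q \<subseteq> dyads"
  show "(\<lambda>i. (\<E> w. iexp (\<Sum>q\<in>Q. t q * A i w q))) \<longlonglongrightarrow> (\<E> w. iexp (\<Sum>q\<in>Q. t q * Gd.G d w q))"
   using A_iexp[OF Q(1)] unfolding Gd.G_iexp[OF Q] .
 qed (rule Am Gd.G_meas)+
 show ?thesis
  unfolding Gd.F_def
  by (rule sup_convergence[where \<pi> = dyad2, OF countable_dyads _ _ SA_meas A_fields(2) Gd.G_tight A_fields(1) Gd.G_equicont SA_null x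
     Gd.F_isCont[OF x, unfolded Gd.F_def[abs_def]]])
   (auto intro: finite_subset[OF _ dyad2_range(1)])
qed

text \<open>Finitely many replicates are treated as one field on the product of \<open>R\<close>
  with \<open>dyads\<close>. Its limit consists of independent copies, so the limiting box
  probability factorises.\<close>

lemma SB_limit_product:
 assumes R: "finite R" "R \<noteq> {}" and r: "!!i. inj_on (\<lambda>d. r d i) R" "!!d i. 1 \<le> r d i" and x: "0 < x"
 shows "(\<lambda>i. prob {w\<in>space P. \<forall>d\<in>R. \<forall>p\<in>dyads. \<bar>SB (r d i) i w p\<bar> \<le> x}) \<longlonglongrightarrow> (\<Prod>d\<in>R. Gd.F d x)"
proof -
 let ?A = "\<lambda>i w q. B (r (fst q) i) i w (snd q)" and ?G = "\<lambda>w q. Gd.G (fst q) w (snd q)"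
 let ?S = "\<lambda>i w q. SB (r (fst q) i) i w (snd q)"
 have Bm: "(\<lambda>w. B (r d i) i w p) \<in> borel_measurable P" for d i p
  unfolding B_def
  by (intro bm_intros S.bsum_meas S.field_functionalD(4)[OF S.wprod_field]
    multipliers.Z_meas[OF replicate_multipliers[OF r(2)]]) auto
 interpret fdd_convergence P ?A ?G "R \<times> dyads"
 proof
  fix Q and t :: "nat \<times> pt => real" assume Q: "finite Q" "Q \<subseteq> R \<times> dyads"
  show "(\<lambda>i. (\<E> w. iexp (\<Sum>q\<in>Q. t q * ?A i w q))) \<longlonglongrightarrow> (\<E> w. iexp (\<Sum>q\<in>Q. t q * ?G w q))"
   unfolding G_iexp[OF R(1) Q] by (rule B_iexp[OF R(1) r Q])
 qed (rule Bm Gd.G_meas)+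
 have "isCont (\<lambda>x. \<Prod>d\<in>R. Gd.F d x) x" by (intro continuous_intros Gd.F_isCont x)
 then have cont: "isCont (\<lambda>x. prob {w\<in>space P. \<forall>q\<in>R \<times> dyads. \<bar>?G w q\<bar> \<le> x}) x" unfolding G_box[OF R] .
 have "(\<lambda>i. prob {w\<in>space P. \<forall>q\<in>R \<times> dyads. \<bar>?S i w q\<bar> \<le> x}) \<longlonglongrightarrow> prob {w\<in>space P. \<forall>q\<in>R \<times> dyads. \<bar>?G w q\<bar> \<le> x}"
 proof (rule sup_convergence[where \<pi> = "\<lambda>N. map_prod id (dyad2 N)", OF _ _ _ SB_meas[OF r(2)] _ _ _ _ _ x cont])
  show "countable (R \<times> dyads)" using R(1) countable_dyads by (intro countable_SIGMA) (auto intro: countable_finite)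
  show "map_prod id (dyad2 N) ` (R \<times> dyads) \<subseteq> R \<times> dyads" for N by auto
  have "map_prod id (dyad2 N) ` (R \<times> dyads) \<subseteq> R \<times> range (dyad2 N)" for N by auto
  then show "finite (map_prod id (dyad2 N) ` (R \<times> dyads))" for N
   using finite_subset finite_cartesian_product[OF R(1) dyad2_range(1)] by metis
  show "tight_on (R \<times> dyads) ?A" "tight_on (R \<times> dyads) (\<lambda>_. ?G)"
   by (rule tight_on_Times[OF R(1)], simp add: B_fields(2)[OF r(2)] Gd.G_tight)+
  show "equicont_on (\<lambda>N. map_prod id (dyad2 N)) (R \<times> dyads) ?A" "equicont_on (\<lambda>N. map_prod id (dyad2 N)) (R \<times> dyads) (\<lambda>_. ?G)"
   by (rule equicont_on_Times[OF R(1)], simp add: B_fields(1)[OF r(2)] Gd.G_equicont)+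
  show "null_on (R \<times> dyads) (\<lambda>i w q. ?S i w q - ?A i w q)"
   by (rule null_on_Times[OF R(1)]) (simp add: SB_null[OF r(2)])
 qed
 then show ?thesis unfolding G_box[OF R] by simp
qed

text \<open>Both sides are limits of the same probabilities, those of the statistic, whichever copy
  of the field represents the limit.\<close>

lemma Gd_F_eq: "0 < x ==> Gd.F d x = Gd.F 0 x"
 by (rule LIMSEQ_unique[OF SA_limit SA_limit])

lemma SB_limit:
 assumes r: "!!i. 1 \<le> r i" and x: "0 < x"
 shows "(\<lambda>i. prob {w\<in>space P. \<forall>p\<in>dyads. \<bar>SB (r i) i w p\<bar> \<le> x}) \<longlonglongrightarrow> Gd.F 0 x"
 using SB_limit_product[of "{0}" "\<lambda>_. r" x] r x by simp

lemma SB_limit_pair: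
 assumes r: "!!i. 1 \<le> r i" "!!i. 1 \<le> r' i" "!!i. r i \<noteq> r' i" and x: "0 < x"
 shows "(\<lambda>i. prob {w\<in>space P. (\<forall>p\<in>dyads. \<bar>SB (r i) i w p\<bar> \<le> x) \<and> (\<forall>p\<in>dyads. \<bar>SB (r' i) i w p\<bar> \<le> x)}) \<longlonglongrightarrow> (Gd.F 0 x)\<^sup>2"
 using SB_limit_product[of "{0, 1}" "\<lambda>d. if d = 0 then r else r'" x] r Gd_F_eq[OF x, of 1] x by (simp add: power2_eq_square)

end

section \<open>Empirical quantiles\<close>

lemma sort_nth_le_iff:
 fixes xs :: "real list"
 assumes k: "k < length xs"
 shows "sort xs ! k \<le> x \<longleftrightarrow> k < length (filter (\<lambda>y. y \<le> x) xs)"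
proof -
 let ?ys = "sort xs"
 have "mset (filter (\<lambda>y. y \<le> x) xs) = mset (filter (\<lambda>y. y \<le> x) ?ys)" by (simp add: mset_filter)
 then have "length (filter (\<lambda>y. y \<le> x) xs) = length (filter (\<lambda>y. y \<le> x) ?ys)" by (rule mset_eq_length)
 then have c: "length (filter (\<lambda>y. y \<le> x) xs) = card {i. i < length xs \<and> ?ys ! i \<le> x}" by (simp add: length_filter_conv_card)
 have mono: "?ys ! i \<le> ?ys ! j" if "i \<le> j" "j < length xs" for i j using that by (intro sorted_nth_mono) auto
 show ?thesis
 proof
  assume "?ys ! k \<le> x"
  then have "{..k} \<subseteq> {i. i < length xs \<and> ?ys ! i \<le> x}" using mono[OF _ k] k by (auto intro: order_trans)
  from card_mono[OF _ this] show "k < length (filter (\<lambda>y. y \<le> x) xs)" unfolding c by simp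
 next
  assume l: "k < length (filter (\<lambda>y. y \<le> x) xs)"
  show "?ys ! k \<le> x"
  proof (rule ccontr)
   assume "\<not> ?ys ! k \<le> x"
   then have lt: "x < ?ys ! k" by simp
   have "{i. i < length xs \<and> ?ys ! i \<le> x} \<subseteq> {..<k}"
   proof
    fix i assume "i \<in> {i. i < length xs \<and> ?ys ! i \<le> x}"
    then have "i < length xs" "?ys ! i \<le> x" by auto
    then show "i \<in> {..<k}" using mono[of k i] lt by (cases "i < k") auto
   qed
   from card_mono[OF _ this] l show False unfolding c by simp
  qed
 qed
qed

text \<open>The order statistic is rewritten as a count, a sum of indicators to which Chebyshev's
  inequality applies; its measurability follows from the same equivalence.\<close>

lemma boot_quantile_le_iff:
 assumes R: "1 \<le> R" and \<alpha>: "0 < \<alpha>"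
 shows "boot_quantile T R \<alpha> w \<le> x \<longleftrightarrow> nat \<lfloor>real R * (1 - \<alpha>)\<rfloor> - 1 < card {r \<in> {1..R}. T r w \<le> x}"
proof -
 have "real R * (1 - \<alpha>) \<le> real R * 1" using \<alpha> by (intro mult_left_mono) auto
 then have "nat \<lfloor>real R * (1 - \<alpha>)\<rfloor> \<le> R" by linarith
 then have k: "nat \<lfloor>real R * (1 - \<alpha>)\<rfloor> - 1 < length (map (\<lambda>r. T r w) [1..<R + 1])" using R by simp
 have "length (filter (\<lambda>y. y \<le> x) (map (\<lambda>r. T r w) [1..<R + 1])) = length (filter (\<lambda>r. T r w \<le> x) [1..<R + 1])"
  by (simp add: filter_map comp_def)
 also have "... = card (set (filter (\<lambda>r. T r w \<le> x) [1..<R + 1]))" by (simp only: distinct_card distinct_filter distinct_upt)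
 also have "set (filter (\<lambda>r. T r w \<le> x) [1..<R + 1]) = {r \<in> {1..R}. T r w \<le> x}" by auto
 finally show ?thesis unfolding boot_quantile_def sort_nth_le_iff[OF k] by simp
qed

section \<open>Concentration of the bootstrap distribution\<close>

context prob_space
begin

lemma card_le_meas:
 fixes T :: "nat => 'a => real"
 assumes T: "!!r. 1 \<le> r ==> T r \<in> borel_measurable M"
 shows "(\<lambda>w. real (card {r \<in> {1..R}. T r w \<le> x})) \<in> borel_measurable M"
proof -
 have m: "(\<lambda>w. \<Sum>r=1..R. indicator {w. T r w \<le> x} w :: real) \<in> borel_measurable M"
 proof (intro borel_measurable_sum)
  fix r assume "r \<in> {1..R}"
  then have [measurable]: "T r \<in> borel_measurable M" using T by simp
  show "(\<lambda>w. indicator {w. T r w \<le> x} w :: real) \<in> borel_measurable M" unfolding indicator_def by measurable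
 qed
 have c: "real (card {r \<in> {1..R}. T r w \<le> x}) = (\<Sum>r=1..R. indicator {w. T r w \<le> x} w)" for w
  by (simp add: indicator_def sum.If_cases Int_def)
 show ?thesis unfolding c by (rule m)
qed

lemma boot_quantile_meas:
 assumes T: "!!r. 1 \<le> r ==> T r \<in> borel_measurable M" and R: "1 \<le> R" and \<alpha>: "0 < \<alpha>"
 shows "boot_quantile T R \<alpha> \<in> borel_measurable M"
proof (rule borel_measurableI_le)
 fix x
 have eq: "{w \<in> space M. boot_quantile T R \<alpha> w \<le> x} = {w \<in> space M. real (nat \<lfloor>real R * (1 - \<alpha>)\<rfloor> - 1) < real (card {r \<in> {1..R}. T r w \<le> x})}"
  unfolding boot_quantile_le_iff[OF R \<alpha>] of_nat_less_iff ..
 show "{w \<in> space M. boot_quantile T R \<alpha> w \<le> x} \<in> events"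
  unfolding eq by (rule borel_measurable_less[OF borel_measurable_const card_le_meas[OF T]])
qed

text \<open>The bound on the covariances is uniform in the pair of replicates because the limits hold along arbitrary sequences of pairs.\<close>

lemma empirical_concentration:
 fixes T :: "nat => nat => 'a => real" and R :: "nat => nat" and u :: real
 assumes T: "!!i r. 1 \<le> r ==> T i r \<in> borel_measurable M" and u: "0 \<le> u" "u \<le> 1"
  and single: "!!r. (!!i. 1 \<le> r i) ==> (\<lambda>i. prob {w\<in>space M. T i (r i) w \<le> x}) \<longlonglongrightarrow> u"
  and pair: "!!r r'. (!!i. 1 \<le> r i) ==> (!!i. 1 \<le> r' i) ==> (!!i. r i \<noteq> r' i) ==>
   (\<lambda>i. prob {w\<in>space M. T i (r i) w \<le> x \<and> T i (r' i) w \<le> x}) \<longlonglongrightarrow> u\<^sup>2"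
  and R: "filterlim R at_top sequentially" and e: "0 < e" "0 < d"
 shows "\<forall>\<^sub>F i in sequentially. prob {w\<in>space M. e * real (R i) < \<bar>real (card {r \<in> {1..R i}. T i r w \<le> x}) - real (R i) * u\<bar>} \<le> d"
proof -
 define Y where "Y i r w = indicator {w. T i r w \<le> x} w - u" for i r w
 have Ym: "Y i r \<in> borel_measurable M" if "1 \<le> r" for i r
 proof -
  note [measurable] = T[OF that]
  show ?thesis unfolding Y_def indicator_def by measurable
 qed
 have Y1: "\<bar>Y i r w\<bar> \<le> 1" for i r w unfolding Y_def indicator_def using u by auto
 have YY1: "\<bar>Y i r w * Y i r' w\<bar> \<le> 1" for i r r' w using mult_mono[OF Y1 Y1] by (simp add: abs_mult)
 have Yi: "integrable M (\<lambda>w. Y i r w * Y i r' w)" if "1 \<le> r" "1 \<le> r'" for i r r'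
  using Ym[OF that(1)] Ym[OF that(2)] YY1 by (intro integrable_const_bound[of _ 1]) auto
 have cov: "(\<E> w. Y i r w * Y i r' w) = prob {w\<in>space M. T i r w \<le> x \<and> T i r' w \<le> x}
   - u * prob {w\<in>space M. T i r w \<le> x} - u * prob {w\<in>space M. T i r' w \<le> x} + u\<^sup>2" if "1 \<le> r" "1 \<le> r'" for i r r'
 proof -
  note [measurable] = T[OF that(1)] T[OF that(2)]
  let ?I = "\<lambda>A w. indicator A w :: real"
  let ?A = "{w\<in>space M. T i r w \<le> x}" and ?B = "{w\<in>space M. T i r' w \<le> x}" and ?C = "{w\<in>space M. T i r w \<le> x \<and> T i r' w \<le> x}"
  have "(\<E> w. Y i r w * Y i r' w) = (\<E> w. ?I ?C w - u * ?I ?A w - u * ?I ?B w + u\<^sup>2)"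
   by (rule integral_cong) (auto simp: Y_def indicator_def algebra_simps power2_eq_square)
  also have "... = prob ?C - u * prob ?A - u * prob ?B + u\<^sup>2"
   by (simp add: prob_space less_top[symmetric])
  finally show ?thesis .
 qed
 \<comment> \<open>In Chebyshev's inequality the pairs of different replicates then contribute e' /
   e^2 = d / 2, and the diagonal 1 / (e^2 R), which is below d / 2 for large R.\<close>
 define e' where "e' = e\<^sup>2 * d / 2"
 have e': "0 < e'" unfolding e'_def using e by simp
 have small: "\<forall>\<^sub>F i in sequentially. \<forall>r r'. 1 \<le> r \<longrightarrow> 1 \<le> r' \<longrightarrow> r \<noteq> r' \<longrightarrow> (\<E> w. Y i r w * Y i r' w) \<le> e'"
 proof -
  define bad where "bad i q \<longleftrightarrow> 1 \<le> fst q \<and> 1 \<le> snd q \<and> fst q \<noteq> snd q \<and> e' < (\<E> w. Y i (fst q) w * Y i (snd q) w)" for i and q :: "nat \<times> nat"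
  \<comment> \<open>A bad pair is selected wherever one exists, and (1, 2) otherwise, so
    \<open>s\<close> is an admissible sequence of pairs; the limit along it rules out bad pairs from
    some index on.\<close>
  define s where "s i = (if \<exists>q. bad i q then SOME q. bad i q else (1, 2))" for i
  have s: "1 \<le> fst (s i)" "1 \<le> snd (s i)" "fst (s i) \<noteq> snd (s i)" for i
   using someI_ex[of "bad i"] unfolding s_def bad_def by (auto split: if_splits)
  have "(\<lambda>i. (\<E> w. Y i (fst (s i)) w * Y i (snd (s i)) w)) \<longlonglongrightarrow> u\<^sup>2 - u * u - u * u + u\<^sup>2"
   unfolding cov[OF s(1,2)] using s by (intro tendsto_intros single pair) auto
  then have "(\<lambda>i. (\<E> w. Y i (fst (s i)) w * Y i (snd (s i)) w)) \<longlonglongrightarrow> 0" by (simp add: power2_eq_square)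
  from order_tendstoD(2)[OF this e'] show ?thesis
  proof eventually_elim
   case (elim i)
   have nb: "\<not> bad i q" for q
   proof
    assume q: "bad i q"
    have ex: "\<exists>q. bad i q" by (rule exI, rule q)
    then have "bad i (s i)" unfolding s_def using someI_ex[OF ex] by (simp only: if_True)
    with elim show False unfolding bad_def by simp
   qed
   show ?case
   proof (intro allI impI)
    fix r r' :: nat assume "1 \<le> r" "1 \<le> r'" "r \<noteq> r'"
    then show "(\<E> w. Y i r w * Y i r' w) \<le> e'" using nb[of "(r, r')"] by (simp add: bad_def not_less)
   qed
  qed
 qed
 have "(\<lambda>i. 1 / (e\<^sup>2 * real (R i))) \<longlonglongrightarrow> 0"
  by (rule tendsto_divide_0[OF tendsto_const filterlim_at_top_imp_at_infinity])
   (rule filterlim_tendsto_pos_mult_at_top[OF tendsto_const _ filterlim_compose[OF filterlim_real_sequentially R]], use e in simp)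
 then have "\<forall>\<^sub>F i in sequentially. 1 / (e\<^sup>2 * real (R i)) < d / 2" by (rule order_tendstoD(2)) (use e in simp)
 moreover have "\<forall>\<^sub>F i in sequentially. 1 \<le> R i" using R unfolding filterlim_at_top by blast
 ultimately show ?thesis using small
 proof eventually_elim
  case (elim i)
  let ?R = "real (R i)" and ?Z = "\<lambda>w. \<Sum>r=1..R i. Y i r w"
  have R0: "0 < ?R" using elim by simp
  have Z: "?Z w = real (card {r \<in> {1..R i}. T i r w \<le> x}) - ?R * u" for w
   unfolding Y_def sum_subtractf by (simp add: indicator_def sum.If_cases Int_def)
  have mZ: "?Z \<in> borel_measurable M" by (intro borel_measurable_sum Ym) auto
  have Z2: "\<bar>?Z w\<bar> ^ 2 = (\<Sum>r=1..R i. \<Sum>r'=1..R i. Y i r w * Y i r' w)" for w by (simp add: power2_eq_square sum_product)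
  have iZ: "integrable M (\<lambda>w. \<bar>?Z w\<bar> ^ 2)" unfolding Z2 by (intro integrable_sum Yi) auto
  have "(\<E> w. \<bar>?Z w\<bar> ^ 2) = (\<Sum>r=1..R i. \<Sum>r'=1..R i. (\<E> w. Y i r w * Y i r' w))"
   unfolding Z2 using Yi by (subst integral_sum; (intro integrable_sum sum.cong refl integral_sum)?) auto
  also have "... \<le> (\<Sum>r=1..R i. \<Sum>r'=1..R i. (if r' = r then 1 else 0) + e')"
  proof (intro sum_mono)
   fix r r' assume r: "r \<in> {1..R i}" "r' \<in> {1..R i}"
   show "(\<E> w. Y i r w * Y i r' w) \<le> (if r' = r then 1 else 0) + e'"
   proof (cases "r' = r")
    case True
    have "(\<E> w. Y i r w * Y i r' w) \<le> (\<E> w. 1)"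
     using r by (intro integral_mono Yi) (auto intro: order_trans[OF abs_ge_self YY1])
    then show ?thesis using True e' by (simp add: prob_space)
   next
    case False
    then show ?thesis using elim(3)[rule_format, of r r'] r by simp
   qed
  qed
  also have "... = ?R + ?R * ?R * e'" by (simp add: sum.distrib distrib_left)
  finally have E: "(\<E> w. \<bar>?Z w\<bar> ^ 2) \<le> ?R + ?R * ?R * e'" .
  have "prob {w\<in>space M. e * ?R < \<bar>?Z w\<bar>} \<le> (\<E> w. \<bar>?Z w\<bar> ^ 2) / (e * ?R) ^ 2"
   by (rule prob_power_Markov[OF mZ iZ]) (use e R0 in simp)
  also have "... \<le> (?R + ?R * ?R * e') / (e * ?R) ^ 2" by (rule divide_right_mono[OF E]) simp
  also have "... = 1 / (e\<^sup>2 * ?R) + e' / e\<^sup>2" using e R0 by (simp add: field_simps power2_eq_square)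
  also have "... \<le> d" using elim(1) e unfolding e'_def by simp
  finally show ?case unfolding Z .
 qed
qed

text \<open>At points x1 and x2 with F = 1 - \<open>\<alpha>\<close> + e and F = 1 -
  \<open>\<alpha>\<close> - e the empirical distribution function of the replicates is within e / 2
  of F, so the quantile lies between x2 and x1. The statistic exceeds these points with limiting
  probabilities \<open>\<alpha>\<close> - e and \<open>\<alpha>\<close> + e.\<close>

theorem bootstrap_level:
 fixes T :: "nat => nat => 'a => real" and S :: "nat => 'a => real" and R :: "nat => nat" and F :: "real => real"
 assumes T: "!!i r. 1 \<le> r ==> T i r \<in> borel_measurable M" and S: "!!i. S i \<in> borel_measurable M"
  and single: "!!r x. (!!i. 1 \<le> r i) ==> 0 < x ==> (\<lambda>i. prob {w\<in>space M. T i (r i) w \<le> x}) \<longlonglongrightarrow> F x"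
  and pair: "!!r r' x. (!!i. 1 \<le> r i) ==> (!!i. 1 \<le> r' i) ==> (!!i. r i \<noteq> r' i) ==> 0 < x ==>
   (\<lambda>i. prob {w\<in>space M. T i (r i) w \<le> x \<and> T i (r' i) w \<le> x}) \<longlonglongrightarrow> (F x)\<^sup>2"
  and stat: "!!x. 0 < x ==> (\<lambda>i. prob {w\<in>space M. S i w \<le> x}) \<longlonglongrightarrow> F x"
  and F: "!!u. 0 < u ==> u < 1 ==> \<exists>x>0. F x = u"
  and R: "filterlim R at_top sequentially" and \<alpha>: "0 < \<alpha>" "\<alpha> < 1"
 shows "(\<lambda>i. prob {w\<in>space M. boot_quantile (T i) (R i) \<alpha> w < S i w}) \<longlonglongrightarrow> \<alpha>"
 unfolding tendsto_iff
proof (intro allI impI)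
 fix \<epsilon> :: real assume \<epsilon>: "0 < \<epsilon>"
 define e where "e = min (\<epsilon> / 4) (min (\<alpha> / 2) ((1 - \<alpha>) / 2))"
 have e: "0 < e" "e \<le> \<epsilon> / 4" "e \<le> \<alpha> / 2" "e \<le> (1 - \<alpha>) / 2" unfolding e_def using \<epsilon> \<alpha> by (simp, linarith+)
 have "0 < 1 - \<alpha> + e" "1 - \<alpha> + e < 1" using e \<alpha> by linarith+
 from F[OF this] obtain x1 where x1: "0 < x1" "F x1 = 1 - \<alpha> + e" by blast
 have "e * 2 \<le> 1 - \<alpha>" using e(4) by simp
 then have "0 < 1 - \<alpha> - e" "1 - \<alpha> - e < 1" using e(1) \<alpha> by auto
 from F[OF this] obtain x2 where x2: "0 < x2" "F x2 = 1 - \<alpha> - e" by blast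
 have u: "0 \<le> F x1" "F x1 \<le> 1" "0 \<le> F x2" "F x2 \<le> 1" unfolding x1(2) x2(2) using e(1,3) \<open>e * 2 \<le> 1 - \<alpha>\<close> \<alpha> by auto
 have e2: "0 < e / 2" using e by simp
 let ?N = "\<lambda>i x w. real (card {r \<in> {1..R i}. T i r w \<le> x})"
 let ?bad = "\<lambda>i x. {w\<in>space M. e / 2 * real (R i) < \<bar>?N i x w - real (R i) * F x\<bar>}"
 have b1: "\<forall>\<^sub>F i in sequentially. prob (?bad i x1) \<le> e" using empirical_concentration[OF T u(1,2) single[OF _ x1(1)] pair[OF _ _ _ x1(1)] R e2 e(1)] .
 have b2: "\<forall>\<^sub>F i in sequentially. prob (?bad i x2) \<le> e" using empirical_concentration[OF T u(3,4) single[OF _ x2(1)] pair[OF _ _ _ x2(1)] R e2 e(1)] .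
 have s1: "\<forall>\<^sub>F i in sequentially. \<bar>prob {w\<in>space M. S i w \<le> x1} - F x1\<bar> < e" using tendstoD[OF stat[OF x1(1)] e(1)] by (simp add: dist_real_def)
 have s2: "\<forall>\<^sub>F i in sequentially. \<bar>prob {w\<in>space M. S i w \<le> x2} - F x2\<bar> < e" using tendstoD[OF stat[OF x2(1)] e(1)] by (simp add: dist_real_def)
 have "\<forall>\<^sub>F i in sequentially. nat \<lceil>4 / e\<rceil> + 1 \<le> R i" using R unfolding filterlim_at_top by blast
 with b1 b2 s1 s2 show "\<forall>\<^sub>F i in sequentially. dist (prob {w\<in>space M. boot_quantile (T i) (R i) \<alpha> w < S i w}) \<alpha> < \<epsilon>"
 proof eventually_elim
  case (elim i)
  let ?R = "real (R i)" and ?q = "boot_quantile (T i) (R i) \<alpha>" and ?k = "nat \<lfloor>real (R i) * (1 - \<alpha>)\<rfloor> - 1"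
  have R1: "1 \<le> R i" using elim by simp
  \<comment> \<open>For such R the margin e R / 2 is at least 2, which covers the loss from rounding
    down and from counting list positions from 0.\<close>
  have "4 / e \<le> ?R" using elim by linarith
  then have Re: "2 \<le> e / 2 * ?R" using e by (simp add: field_simps)
  note q = boot_quantile_le_iff[OF R1 \<alpha>(1), of "T i"]
  have [measurable]: "?q \<in> borel_measurable M" by (rule boot_quantile_meas[OF T R1 \<alpha>(1)])
  note [measurable] = S[of i]
  have bm: "?bad i x \<in> events" for x
   by (intro borel_measurable_less bm_intros card_le_meas T)
  have k: "real ?k \<le> ?R * (1 - \<alpha>)" "?R * (1 - \<alpha>) - 2 \<le> real ?k"
  proof -
   have "0 \<le> ?R * (1 - \<alpha>)" using \<alpha> by simp
   then show "real ?k \<le> ?R * (1 - \<alpha>)" "?R * (1 - \<alpha>) - 2 \<le> real ?k" by linarith+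
  qed
  have g1: "?q w \<le> x1" if "w \<in> space M" "w \<notin> ?bad i x1" for w
  proof -
   have "\<bar>?N i x1 w - ?R * (1 - \<alpha> + e)\<bar> \<le> e / 2 * ?R" using that unfolding x1(2) by (simp add: not_less)
   moreover have "?R * (1 - \<alpha> + e) = ?R * (1 - \<alpha>) + 2 * (e / 2 * ?R)" by (simp add: algebra_simps)
   ultimately have "?R * (1 - \<alpha>) + e / 2 * ?R \<le> ?N i x1 w" by linarith
   then have "real ?k < ?N i x1 w" using k(1) Re by linarith
   then show ?thesis unfolding q by simp
  qed
  have g2: "x2 < ?q w" if "w \<in> space M" "w \<notin> ?bad i x2" for w
  proof -
   have "\<bar>?N i x2 w - ?R * (1 - \<alpha> - e)\<bar> \<le> e / 2 * ?R" using that unfolding x2(2) by (simp add: not_less)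
   moreover have "?R * (1 - \<alpha> - e) = ?R * (1 - \<alpha>) - 2 * (e / 2 * ?R)" by (simp add: algebra_simps)
   ultimately have "?N i x2 w \<le> ?R * (1 - \<alpha>) - e / 2 * ?R" by linarith
   then have "?N i x2 w \<le> real ?k" using k(2) Re by linarith
   then have "\<not> ?q w \<le> x2" unfolding q by simp
   then show ?thesis by simp
  qed
  let ?E = "{w\<in>space M. ?q w < S i w}"
  have compl: "prob {w\<in>space M. \<not> S i w \<le> x} = 1 - prob {w\<in>space M. S i w \<le> x}" for x by (rule prob_neg) measurable
  have "prob {w\<in>space M. \<not> S i w \<le> x1} \<le> prob ?E + prob (?bad i x1)"
   by (rule prob_le_outside[OF _ _ bm]) (use g1 in force)+
  moreover have "prob ?E \<le> prob {w\<in>space M. \<not> S i w \<le> x2} + prob (?bad i x2)"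
   by (rule prob_le_outside[OF _ _ bm]) (use g2 in force)+
  ultimately show ?case using elim(1-4) e unfolding compl x1(2) x2(2) dist_real_def by linarith
 qed
qed

end

section \<open>The bootstrap test\<close>

text \<open>Density of the dyadic points and continuity of f: the bridge from sup-norms to countably
  many evaluations.\<close>

lemma norm_le_iff_dyads: "norm f \<le> x \<longleftrightarrow> (\<forall>p\<in>dyads. \<bar>apply_bcontfun f p\<bar> \<le> x)" for f :: C01sq
proof
 assume d: "\<forall>p\<in>dyads. \<bar>apply_bcontfun f p\<bar> \<le> x"
 show "norm f \<le> x"
 proof (rule norm_bound)
  fix p
  have "(\<lambda>N. dyad N s) \<longlonglongrightarrow> s" for s
  proof (rule metric_LIMSEQ_I)
   fix e :: real assume e: "0 < e"
   have "(\<lambda>N. 1 / 2 ^ N :: real) \<longlonglongrightarrow> 0" by real_asymp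
   from order_tendstoD(2)[OF this e] obtain N0 where "!!N. N0 \<le> N ==> 1 / 2 ^ N < e" unfolding eventually_sequentially by blast
   then show "\<exists>N0. \<forall>N\<ge>N0. dist (dyad N s) s < e" using dist_dyad[of _ s] by (meson order_le_less_trans)
  qed
  then have "(\<lambda>N. (dyad N (fst p), dyad N (snd p))) \<longlonglongrightarrow> (fst p, snd p)" by (intro tendsto_Pair)
  then have "(\<lambda>N. dyad2 N p) \<longlonglongrightarrow> p" by (simp add: dyad2_def map_prod_def case_prod_unfold)
  then have "(\<lambda>N. \<bar>apply_bcontfun f (dyad2 N p)\<bar>) \<longlonglongrightarrow> \<bar>apply_bcontfun f p\<bar>"
   by (intro tendsto_rabs continuous_on_tendsto_compose[OF continuous_on_apply_bcontfun[of UNIV f]]) auto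
  then have "\<bar>apply_bcontfun f p\<bar> \<le> x" by (rule LIMSEQ_le_const2) (use d in auto)
  then show "norm (apply_bcontfun f p) \<le> x" by simp
 qed
qed (meson abs_apply_le_norm order_trans)

text \<open>Sublevel sets of the norm are countable intersections of events about evaluations, so no
  measurability of f as a map into the function space is involved.\<close>

lemma norm_C01sq_meas:
 fixes f :: "'a => C01sq"
 assumes "!!p. (\<lambda>w. apply_bcontfun (f w) p) \<in> borel_measurable M"
 shows "(\<lambda>w. norm (f w)) \<in> borel_measurable M"
 by (rule borel_measurableI_le) (unfold norm_le_iff_dyads, rule box_event[OF countable_dyads assms])

text \<open>With this choice \<open>c b i\<close> times sqrt(n b i) is plus or minus sqrt(m + n), so
  the sums over \<open>bool\<close> are exactly the scaled differences of the two
  estimators.\<close>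

locale bootstrap_test = two_samples +
 assumes c_eq: "c b i = (if b then 1 else - 1) * (sqrt (real (n True i) + real (n False i)) / sqrt (real (n b i)))"
begin

abbreviation "T i \<equiv> T_boot (X True) (X False) (n True i) (n False i) (l True (n True i)) (l False (n False i)) (\<lambda>r k. Z (True, r, k)) (\<lambda>r k. Z (False, r, k))"
abbreviation "S i w \<equiv> sqrt (real (n True i) + real (n False i)) * d_hat (X True) (X False) (n True i) (n False i) w"
abbreviation "rej i \<equiv> rejection_prob P (X True) (X False) (n True i) (n False i) (l True (n True i)) (l False (n False i)) (\<lambda>r k. Z (True, r, k)) (\<lambda>r k. Z (False, r, k))"

lemma T_meas: "1 \<le> r ==> T i r \<in> borel_measurable P"
 unfolding T_boot_def[abs_def] scaleR_bcontfun.rep_eq minus_bcontfun.rep_eq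
 by (intro norm_C01sq_meas)
  (auto simp: scaleR_bcontfun.rep_eq minus_bcontfun.rep_eq intro!: bm_intros borel_measurable_const
   S.estimates_meas(2)[where X = "X _", OF X] multipliers.Z_meas[OF replicate_multipliers])

lemma S_meas: "S i \<in> borel_measurable P"
 unfolding d_hat_def
 by (intro bm_intros norm_C01sq_meas, unfold minus_bcontfun.rep_eq)
  (intro borel_measurable_diff S.estimates_meas(1)[where X = "X _", OF X])

lemma sizes: "\<forall>\<^sub>F i in sequentially. N \<le> n True i \<and> N \<le> n False i"
 using n[of True] n[of False] unfolding filterlim_at_top by (intro eventually_conj) auto

lemma c_sqrt: "1 \<le> n b i ==> c b i * (sqrt (real (n b i)) * y) = (if b then 1 else - 1) * (sqrt (real (n True i) + real (n False i)) * y)"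
 unfolding c_eq by simp

lemma T_le_iff: "1 \<le> n True i ==> 1 \<le> n False i ==> T i r w \<le> x \<longleftrightarrow> (\<forall>p\<in>dyads. \<bar>SB r i w p\<bar> \<le> x)"
 unfolding T_boot_def norm_le_iff_dyads SB_def UNIV_bool
 by (simp add: c_sqrt scaleR_bcontfun.rep_eq minus_bcontfun.rep_eq algebra_simps)

definition est :: "bool => nat => 'a => C01sq" where
 "est b i w = (1 / (real (n b i) - 1)) *\<^sub>R (\<Sum>j=1..n b i. centred_sq (X b) (n b i) j w)"

lemma SA_eq:
 assumes "1 \<le> n True i" "1 \<le> n False i"
 shows "SA i w p = sqrt (real (n True i) + real (n False i)) * (est True i w p - est False i w p
  - (cov_kernel P (\<eta> True) (fst p) (snd p) - cov_kernel P (\<eta> False) (fst p) (snd p)))"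
 unfolding SA_def UNIV_bool est_def using assms by (simp add: c_sqrt algebra_simps)

lemma S_le_iff:
 assumes "1 \<le> n True i" "1 \<le> n False i" and C: "cov_kernel P (\<eta> True) = cov_kernel P (\<eta> False)"
 shows "S i w \<le> x \<longleftrightarrow> (\<forall>p\<in>dyads. \<bar>SA i w p\<bar> \<le> x)"
proof -
 have "S i w = norm (sqrt (real (n True i) + real (n False i)) *\<^sub>R (est True i w - est False i w))" unfolding d_hat_def est_def by simp
 then show ?thesis unfolding SA_eq[OF assms(1,2)] C by (simp only: norm_le_iff_dyads) (simp add: scaleR_bcontfun.rep_eq minus_bcontfun.rep_eq)
qed

lemma rejection_eq:
 assumes "1 \<le> n True i"
 shows "rej i R \<alpha> = prob {w\<in>space P. boot_quantile (T i) R \<alpha> w < S i w}"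
proof -
 have "0 < sqrt (real (n True i) + real (n False i))" using assms by simp
 then show ?thesis unfolding rejection_prob_def by (simp add: divide_less_eq mult.commute)
qed

theorem level:
 assumes C: "cov_kernel P (\<eta> True) = cov_kernel P (\<eta> False)" and nd: "\<exists>p. 0 < \<Gamma> p p"
  and R: "filterlim R at_top sequentially" and \<alpha>: "0 < \<alpha>" "\<alpha> < 1"
 shows "(\<lambda>i. rej i (R i) \<alpha>) \<longlonglongrightarrow> \<alpha>"
proof -
 have ev: "\<forall>\<^sub>F i in sequentially. 1 \<le> n True i \<and> 1 \<le> n False i" by (rule sizes)
 \<comment> \<open>Some sample contributes a positive variance at the given point; the same sample
   then has positive variance at a dyadic point, and the other one cannot cancel it.\<close>
 obtain q where q: "q \<in> dyads" "0 < \<Gamma> q q"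
 proof -
  obtain p where p: "0 < \<Gamma> p p" using nd ..
  have "\<exists>b. 0 < (\<kappa> b)\<^sup>2 * S.wcov b p p"
  proof (rule ccontr)
   assume "\<not> (\<exists>b. 0 < (\<kappa> b)\<^sup>2 * S.wcov b p p)"
   then have "\<Gamma> p p \<le> 0" unfolding \<Gamma>_def by (intro sum_nonpos) (simp add: not_less)
   with p show False by simp
  qed
  then obtain b where b: "0 < (\<kappa> b)\<^sup>2 * S.wcov b p p" ..
  then have "0 < S.wcov b p p" by (simp add: zero_less_mult_iff)
  from S.wcov_dyads[OF this] obtain q where q: "q \<in> dyads" "0 < S.wcov b q q" ..
  have "0 < (\<kappa> b)\<^sup>2 * S.wcov b q q" using b q(2) by (simp add: zero_less_mult_iff)
  also have "... \<le> \<Gamma> q q" unfolding \<Gamma>_def by (rule member_le_sum) (use S.wcov_self_nonneg in auto)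
  finally show ?thesis using that q(1) by blast
 qed
 have "(\<lambda>i. prob {w\<in>space P. boot_quantile (T i) (R i) \<alpha> w < S i w}) \<longlonglongrightarrow> \<alpha>"
 proof (rule bootstrap_level[where F = "Gd.F 0", OF T_meas S_meas _ _ _ Gd.F_attains[OF q] R \<alpha>])
  fix r :: "nat => nat" and x :: real assume r: "!!i. 1 \<le> r i" and x: "0 < x"
  show "(\<lambda>i. prob {w\<in>space P. T i (r i) w \<le> x}) \<longlonglongrightarrow> Gd.F 0 x"
   by (rule Lim_transform_eventually[OF SB_limit[OF r x] eventually_mono[OF ev]]) (simp add: T_le_iff)
 next
  fix r r' :: "nat => nat" and x :: real assume r: "!!i. 1 \<le> r i" "!!i. 1 \<le> r' i" "!!i. r i \<noteq> r' i" and x: "0 < x"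
  show "(\<lambda>i. prob {w\<in>space P. T i (r i) w \<le> x \<and> T i (r' i) w \<le> x}) \<longlonglongrightarrow> (Gd.F 0 x)\<^sup>2"
   by (rule Lim_transform_eventually[OF SB_limit_pair[OF r x] eventually_mono[OF ev]]) (simp add: T_le_iff)
 next
  fix x :: real assume x: "0 < x"
  show "(\<lambda>i. prob {w\<in>space P. S i w \<le> x}) \<longlonglongrightarrow> Gd.F 0 x"
   by (rule Lim_transform_eventually[OF SA_limit[OF x] eventually_mono[OF ev]]) (simp add: S_le_iff[OF _ _ C])
 qed
 then show ?thesis by (rule Lim_transform_eventually[OF _ eventually_mono[OF ev]]) (simp add: rejection_eq)
qed

text \<open>\<open>SA\<close> is centred at the true kernels and stays tight under the alternative
  too. Hence the statistic is at least sqrt(m + n) |d| minus a bounded term, while all R replicates,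
  and with them the quantile, stay below a constant, up to small probability.\<close>

theorem power:
 assumes C: "cov_kernel P (\<eta> True) \<noteq> cov_kernel P (\<eta> False)" and R: "1 \<le> R" and \<alpha>: "0 < \<alpha>"
 shows "(\<lambda>i. rej i R \<alpha>) \<longlonglongrightarrow> 1"
 unfolding tendsto_iff
proof (intro allI impI)
 fix e :: real assume e: "0 < e"
 then have e4: "0 < e / 4" by simp
 obtain s t where st: "cov_kernel P (\<eta> True) s t \<noteq> cov_kernel P (\<eta> False) s t" using C by (metis ext)
 define p where "p = (s, t)"
 define d where "d = cov_kernel P (\<eta> True) s t - cov_kernel P (\<eta> False) s t"
 have d: "0 < \<bar>d\<bar>" unfolding d_def using st by simp
 have "tight_on {p} (\<lambda>i u p. (SA i u p - A i u p) + A i u p)"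
  by (intro tight_on_add null_on_imp_tight_on[OF SA_null[where q = p]] A_fields(2)[where q = p] disjI2 refl)
 from this[unfolded tight_on_def, rule_format, OF e4] obtain K1 where
  K1: "whp (e / 4) (\<lambda>i u. \<bar>SA i u p\<bar> \<le> K1)" by auto
 have "tight_on ({1..R} \<times> dyads) (\<lambda>i u q. (SB (fst q) i u (snd q) - B (fst q) i u (snd q)) + B (fst q) i u (snd q))"
 proof (rule tight_on_Times)
  fix r assume "r \<in> {1..R}"
  then show "tight_on dyads (\<lambda>i u p. (SB (fst (r, p)) i u (snd (r, p)) - B (fst (r, p)) i u (snd (r, p))) + B (fst (r, p)) i u (snd (r, p)))"
   using tight_on_add[OF null_on_imp_tight_on[OF SB_null[of "\<lambda>_. r"]] B_fields(2)[of "\<lambda>_. r"]] by simp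
 qed simp
 from this[unfolded tight_on_def, rule_format, OF e4] obtain K2 where
  K2: "whp (e / 4) (\<lambda>i u. \<forall>r\<in>{1..R}. \<forall>p\<in>dyads. \<bar>SB r i u p\<bar> \<le> K2)" by auto
 have "filterlim (\<lambda>i. sqrt (real (n True i))) at_top sequentially"
  by (rule filterlim_compose[OF sqrt_at_top filterlim_compose[OF filterlim_real_sequentially n]])
 then have "\<forall>\<^sub>F i in sequentially. (K1 + K2) / \<bar>d\<bar> < sqrt (real (n True i))" unfolding filterlim_at_top_dense by blast
 moreover have "whp (e / 2) (\<lambda>i u. \<bar>SA i u p\<bar> \<le> K1 \<and> (\<forall>r\<in>{1..R}. \<forall>p\<in>dyads. \<bar>SB r i u p\<bar> \<le> K2))"
  by (rule whp_conj[OF K1 K2]) simp_all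
 moreover note sizes[of 1]
 ultimately
 show "\<forall>\<^sub>F i in sequentially. dist (rej i R \<alpha>) 1 < e"
 proof eventually_elim
  case (elim i)
  from elim(2) obtain A where A: "A \<in> events" "prob A \<le> e / 2" "!!u. u \<in> space P - A ==> \<bar>SA i u p\<bar> \<le> K1 \<and> (\<forall>r\<in>{1..R}. \<forall>p\<in>dyads. \<bar>SB r i u p\<bar> \<le> K2)" by blast
  have n1: "1 \<le> n True i" "1 \<le> n False i" using elim(3) by auto
  let ?E = "{u\<in>space P. boot_quantile (T i) R \<alpha> u < S i u}" and ?M = "sqrt (real (n True i) + real (n False i))"
  have E: "?E \<in> events" by (rule borel_measurable_less[OF boot_quantile_meas[OF T_meas R \<alpha>] S_meas])
  have "sqrt (real (n True i)) \<le> ?M" by simp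
  with elim(1) have "(K1 + K2) / \<bar>d\<bar> < ?M" by linarith
  then have big: "K1 + K2 < ?M * \<bar>d\<bar>" using d by (simp add: divide_less_eq)
  have "space P - A \<subseteq> ?E"
  proof
   fix u assume w: "u \<in> space P - A"
   then have "{r \<in> {1..R}. T i r u \<le> K2} = {1..R}" using A(3)[of u] by (auto simp: T_le_iff[OF n1])
   moreover have "real R * (1 - \<alpha>) \<le> real R * 1" using \<alpha> by (intro mult_left_mono) auto
   then have "nat \<lfloor>real R * (1 - \<alpha>)\<rfloor> \<le> R" by linarith
   ultimately have q: "boot_quantile (T i) R \<alpha> u \<le> K2" unfolding boot_quantile_le_iff[OF R \<alpha>] using R by simp
   have "?M * \<bar>d\<bar> - K1 \<le> \<bar>SA i u p + ?M * d\<bar>"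
   proof -
    have "\<bar>?M * d\<bar> = ?M * \<bar>d\<bar>" by (simp add: abs_mult)
    moreover have "\<bar>SA i u p\<bar> \<le> K1" using A(3) w by blast
    ultimately show ?thesis by linarith
   qed
   also have "SA i u p + ?M * d = ?M * (est True i u - est False i u) p"
    unfolding SA_eq[OF n1] d_def p_def by (simp add: minus_bcontfun.rep_eq algebra_simps)
   also have "\<bar>...\<bar> \<le> S i u"
    unfolding d_hat_def est_def[symmetric] abs_mult by (intro mult_mono abs_apply_le_norm) auto
   finally show "u \<in> ?E" using q big w by auto
  qed
  then have "prob (space P - A) \<le> prob ?E" by (rule finite_measure_mono[OF _ E])
  moreover have "prob (space P - A) = 1 - prob A" by (rule prob_compl[OF A(1)])
  moreover have "prob ?E \<le> 1" by simp
  ultimately show ?case unfolding rejection_eq[OF n1(1)] dist_real_def using e A(2) by linarith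
 qed
qed

end

section \<open>From the stated assumptions to the abstract setting\<close>

lemma rounded_power_lim:
 assumes l: "rounded_power l \<beta>" and \<beta>: "0 < \<beta>" "\<beta> < \<nu> / (2 + \<nu>)" and \<nu>: "0 < \<nu>"
 shows "filterlim l at_top sequentially" "(\<lambda>m. real (l m) / real m) \<longlonglongrightarrow> 0"
proof -
 have \<beta>1: "\<beta> < 1" by (rule order_less_le_trans[OF \<beta>(2)]) (use \<nu> in \<open>simp add: divide_le_eq\<close>)
 have b: "real m powr \<beta> - 1 \<le> real (l m)" "real (l m) \<le> real m powr \<beta> + 1" if "1 \<le> m" for m
  using l[unfolded rounded_power_def, rule_format, OF that] by linarith+
 have "filterlim (\<lambda>m. real (l m)) at_top sequentially"
 proof (rule filterlim_at_top_mono)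
  show "filterlim (\<lambda>m. real m powr \<beta> - 1) at_top sequentially" using \<beta>(1) by real_asymp
  show "\<forall>\<^sub>F m in sequentially. real m powr \<beta> - 1 \<le> real (l m)" using eventually_ge_at_top[of 1] by eventually_elim (rule b)
 qed
 then show "filterlim l at_top sequentially" by (simp add: filterlim_sequentially_iff_filterlim_real)
 show "(\<lambda>m. real (l m) / real m) \<longlonglongrightarrow> 0"
 proof (rule tendsto_sandwich[OF _ _ tendsto_const])
  show "(\<lambda>m. (real m powr \<beta> + 1) / real m) \<longlonglongrightarrow> 0" using \<beta>(1) \<beta>1 by real_asymp
  show "\<forall>\<^sub>F m in sequentially. real (l m) / real m \<le> (real m powr \<beta> + 1) / real m"
   using eventually_ge_at_top[of 1] by eventually_elim (intro divide_right_mono b, auto)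
 qed auto
qed

lemma translation_meas: "Y \<in> borel_measurable N ==> (\<lambda>w. a + Y w) \<in> borel_measurable N" for a :: C01
 by (rule measurable_compose[OF _ borel_measurable_continuous_onI]) (auto intro: continuous_intros)

text \<open>The sum type that indexes the multipliers is recoded by \<open>bool\<close>, so that
  both samples can be addressed by one variable; \<open>D\<close> is generated by both samples
  together.\<close>

lemma bootstrap_multipliers_imp:
 assumes P: "prob_space P" and b: "bootstrap_multipliers P X Y \<xi> \<zeta>" and X: "!!j. 1 \<le> j ==> X j \<in> borel_measurable P" "!!j. 1 \<le> j ==> Y j \<in> borel_measurable P"
 defines "D \<equiv> vsig P (case_sum X Y) ({1..} <+> {1..})"
 shows "multipliers P D (\<lambda>(b, r, k). if b then \<xi> r k else \<zeta> r k) (UNIV \<times> {1..} \<times> {1..})"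
proof -
 interpret prob_space P by (rule P)
 have "multipliers P D (all_multipliers \<xi> \<zeta>) mult_index"
 proof unfold_locales
  show "subalgebra P D" unfolding D_def by (rule subalgebra_vsig) (use X in auto)
  show "std_normal_var P (all_multipliers \<xi> \<zeta> k)" if "k \<in> mult_index" for k
   using b that unfolding bootstrap_multipliers_def all_multipliers_def by auto
 qed (use b in \<open>simp_all add: bootstrap_multipliers_def sets_vsig D_def\<close>)
 moreover define f :: "bool \<times> nat \<times> nat => _" where "f = (\<lambda>(b, r, k). if b then Inl (r, k) else Inr (r, k))"
 have "inj_on f (UNIV \<times> {1..} \<times> {1..})" by (auto simp: inj_on_def f_def split: if_splits)
 moreover have "f ` (UNIV \<times> {1..} \<times> {1..}) \<subseteq> mult_index" by (auto simp: f_def)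
 ultimately have "multipliers P D (\<lambda>x. all_multipliers \<xi> \<zeta> (f x)) (UNIV \<times> {1..} \<times> {1..})"
  by (rule multipliers_reindex)
 moreover have "(\<lambda>x. all_multipliers \<xi> \<zeta> (f x)) = (\<lambda>(b, r, k). if b then \<xi> r k else \<zeta> r k)"
  by (auto simp: all_multipliers_def f_def)
 ultimately show ?thesis by simp
qed

text \<open>Joint limits are read along arbitrary sequences of sample sizes with the prescribed
  ratio and, for the level, arbitrary numbers of replicates tending to infinity along with
  them.\<close>

theorem theorem3p1:
  fixes P :: "'a measure"
    and \<mu>1 \<mu>2 :: C01
    and \<eta>1 \<eta>2 X Y :: "nat \<Rightarrow> 'a \<Rightarrow> C01"
    and \<xi> \<zeta> :: "nat \<Rightarrow> nat \<Rightarrow> 'a \<Rightarrow> real"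
    and \<theta> \<nu>1 \<nu>2 \<tau>1 \<tau>2 \<beta>1 \<beta>2 lam \<alpha> :: real
    and J :: nat
    and l1 l2 m n :: "nat \<Rightarrow> nat"
  assumes "prob_space P" and "complete_measure P"
    and "\<And>j \<omega>. X j \<omega> = \<mu>1 + \<eta>1 j \<omega>"
    and "\<And>j \<omega>. Y j \<omega> = \<mu>2 + \<eta>2 j \<omega>"
    and "centred_stationary_process P \<eta>1" and "centred_stationary_process P \<eta>2"
    and "independent_processes P \<eta>1 \<eta>2"
    and "0 < \<theta>" and "\<theta> \<le> 1" and "real J * \<theta> > 2"
    and "conds_A P \<eta>1 (rho_theta \<theta>) J \<nu>1 \<tau>1"
    and "conds_A P \<eta>2 (rho_theta \<theta>) J \<nu>2 \<tau>2"
    and "bootstrap_multipliers P X Y \<xi> \<zeta>"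
    and "0 < \<alpha>" and "\<alpha> < 1"
    and "0 < \<beta>1" and "\<beta>1 < \<nu>1 / (2 + \<nu>1)" and "\<tau>1 > (\<beta>1 * (2 + \<nu>1) + 1) / (2 + 2 * \<nu>1)"
    and "0 < \<beta>2" and "\<beta>2 < \<nu>2 / (2 + \<nu>2)" and "\<tau>2 > (\<beta>2 * (2 + \<nu>2) + 1) / (2 + 2 * \<nu>2)"
    and "rounded_power l1 \<beta>1" and "rounded_power l2 \<beta>2"
    and "0 < lam" and "lam < 1"
    and "filterlim m at_top sequentially" and "filterlim n at_top sequentially"
    and "(\<lambda>i. real (m i) / (real (m i) + real (n i))) \<longlonglongrightarrow> lam"
  shows "(cov_kernel P \<eta>1 = cov_kernel P \<eta>2 \<and> nondegenerate_limit P \<eta>1 \<eta>2 lam \<longrightarrow>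
           (\<forall>R. filterlim R at_top sequentially \<longrightarrow>
             (\<lambda>i. rejection_prob P X Y (m i) (n i) (l1 (m i)) (l2 (n i)) \<xi> \<zeta> (R i) \<alpha>) \<longlonglongrightarrow> \<alpha>))
       \<and> (cov_kernel P \<eta>1 \<noteq> cov_kernel P \<eta>2 \<longrightarrow>
           (\<forall>R\<ge>1. liminf (\<lambda>i. ereal (rejection_prob P X Y (m i) (n i) (l1 (m i)) (l2 (n i)) \<xi> \<zeta> R \<alpha>)) = 1))"
proof -
 interpret prob_space P by (rule assms(1))
 have \<nu>: "0 < \<nu>1" "0 < \<nu>2" using assms(11,12) unfolding conds_A_def cond_A2_def by auto
 have em: "\<eta>1 j \<in> borel_measurable P" "\<eta>2 j \<in> borel_measurable P" if "1 \<le> j" for j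
  using assms(5,6) that unfolding centred_stationary_process_def by auto
 have XY: "X j = (\<lambda>w. \<mu>1 + \<eta>1 j w)" "Y j = (\<lambda>w. \<mu>2 + \<eta>2 j w)" for j using assms(3,4) by auto
 have XYm: "X j \<in> borel_measurable P" "Y j \<in> borel_measurable P" if "1 \<le> j" for j unfolding XY by (intro translation_meas em that)+
 obtain K1 K2 where K: "sample P \<eta>1 (phi_coeff P \<eta>1) (J div 2) (real J * \<theta>) K1" "sample P \<eta>2 (phi_coeff P \<eta>2) (J div 2) (real J * \<theta>) K2"
  using sample_conds_A[OF assms(1,5,11,8,9,10)] sample_conds_A[OF assms(1,6,12,8,9,10)] by (elim exE)
 have M: "\<forall>\<^sub>F i in sequentially. 0 < real (m i) + real (n i)"
  using assms(26)[unfolded filterlim_at_top, rule_format, of 1] by eventually_elim simp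
 have "(\<lambda>i. 1 - real (m i) / (real (m i) + real (n i))) \<longlonglongrightarrow> 1 - lam" by (intro tendsto_intros assms(28))
 then have ratio2: "(\<lambda>i. real (n i) / (real (m i) + real (n i))) \<longlonglongrightarrow> 1 - lam"
  by (rule Lim_transform_eventually[OF _ eventually_mono[OF M]]) (simp add: field_simps)
 have lim: "(\<lambda>i. sqrt (real (m i) + real (n i)) / sqrt (real (k i))) \<longlonglongrightarrow> 1 / sqrt a"
  if "(\<lambda>i. real (k i) / (real (m i) + real (n i))) \<longlonglongrightarrow> a" "0 < a" for k :: "nat => nat" and a
 proof -
  have "(\<lambda>i. 1 / sqrt (real (k i) / (real (m i) + real (n i)))) \<longlonglongrightarrow> 1 / sqrt a" using that(2) by (intro tendsto_intros that(1)) auto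
  then show ?thesis by (simp add: real_sqrt_divide)
 qed
 \<comment> \<open>The weights sqrt(m + n) / sqrt m and sqrt(m + n) / sqrt n tend to 1 / sqrt lam
   and 1 / sqrt(1 - lam); the second sample enters with a minus sign.\<close>
 interpret bootstrap_test P "\<lambda>b. if b then \<eta>1 else \<eta>2" "\<lambda>b. if b then X else Y" "\<lambda>b. phi_coeff P (if b then \<eta>1 else \<eta>2)"
  "J div 2" "real J * \<theta>" "\<lambda>b. if b then K1 else K2" "\<lambda>b. if b then 1 / sqrt lam else - (1 / sqrt (1 - lam))"
  "\<lambda>b. if b then m else n" "\<lambda>b. if b then l1 else l2"
  "\<lambda>b i. (if b then 1 else - 1) * (sqrt (real (m i) + real (n i)) / sqrt (real ((if b then m else n) i)))" "\<lambda>b. if b then \<mu>1 else \<mu>2"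
  "vsig P (case_sum X Y) ({1..} <+> {1..})" "\<lambda>(b, r, k). if b then \<xi> r k else \<zeta> r k"
 proof (intro bootstrap_test.intro two_samples.intro two_samples_axioms.intro bootstrap_test_axioms.intro assms(1), goal_cases)
  case (1 b)
  then show ?case using K by simp
 next
  case 2
  then show ?case using assms(7) unfolding independent_processes_def by simp
 next
  case (3 b)
  then show ?case using assms(26,27) by simp
 next
  case (4 b)
  then show ?case using lim[OF assms(28,24)] tendsto_minus[OF lim[OF ratio2]] assms(25) by simp
 next
  case (5 b j w)
  then show ?case using assms(3,4) by simp
 next
  case (6 b)
  then show ?case using rounded_power_lim(1)[OF assms(22,16,17) \<nu>(1)] rounded_power_lim(1)[OF assms(23,19,20) \<nu>(2)] by simp
 next
  case (7 b)
  then show ?case using rounded_power_lim(2)[OF assms(22,16,17) \<nu>(1)] rounded_power_lim(2)[OF assms(23,19,20) \<nu>(2)] by simp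
 next
  case 8
  show ?case by (rule bootstrap_multipliers_imp[OF assms(1,13) XYm])
 next
  case (9 j b)
  \<comment> \<open>The sigma-field is generated by the observations; subtracting the constant means
    recovers the centred processes.\<close>
  have "X j \<in> borel_measurable (vsig P (case_sum X Y) ({1..} <+> {1..}))" "Y j \<in> borel_measurable (vsig P (case_sum X Y) ({1..} <+> {1..}))"
   using 9 measurable_vsig[of "Inl j" "{1..} <+> {1..}" "case_sum X Y" P] measurable_vsig[of "Inr j" "{1..} <+> {1..}" "case_sum X Y" P] by auto
  from this[THEN translation_meas, of "- \<mu>1"] this[THEN translation_meas, of "- \<mu>2"]
  show ?case unfolding XY by (cases b) simp_all
 next
  case (10 b i)
  show ?case by simp
 qed
 show ?thesis
 proof (intro conjI impI allI)
  fix R :: "nat => nat" assume C: "cov_kernel P \<eta>1 = cov_kernel P \<eta>2 \<and> nondegenerate_limit P \<eta>1 \<eta>2 lam" and R: "filterlim R at_top sequentially"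
  from C obtain s t where "0 < long_run_var P \<eta>1 s t / lam + long_run_var P \<eta>2 s t / (1 - lam)" unfolding nondegenerate_limit_def by blast
  \<comment> \<open>The squared limit weights are 1 / lam and 1 / (1 - lam), so the diagonal of
    \<open>\<Gamma>\<close> is exactly the variance in \<open>nondegenerate_limit\<close>.\<close>
  then have "\<exists>p. 0 < \<Gamma> p p"
   using S.long_run_var_eq[of True s t] S.long_run_var_eq[of False s t] assms(24,25)
   by (intro exI[of _ "(s, t)"]) (simp add: \<Gamma>_def UNIV_bool power_divide add.commute)
  from level[unfolded if_True if_False prod.case, OF conjunct1[OF C] this R assms(14,15)]
  show "(\<lambda>i. rejection_prob P X Y (m i) (n i) (l1 (m i)) (l2 (n i)) \<xi> \<zeta> (R i) \<alpha>) \<longlonglongrightarrow> \<alpha>" .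
 next
  fix R :: nat assume R: "cov_kernel P \<eta>1 \<noteq> cov_kernel P \<eta>2" "1 \<le> R"
  from power[unfolded if_True if_False prod.case, OF R assms(14)]
  have "(\<lambda>i. rejection_prob P X Y (m i) (n i) (l1 (m i)) (l2 (n i)) \<xi> \<zeta> R \<alpha>) \<longlonglongrightarrow> 1" .
  then have "(\<lambda>i. ereal (rejection_prob P X Y (m i) (n i) (l1 (m i)) (l2 (n i)) \<xi> \<zeta> R \<alpha>)) \<longlonglongrightarrow> ereal 1" by simp
  then show "liminf (\<lambda>i. ereal (rejection_prob P X Y (m i) (n i) (l1 (m i)) (l2 (n i)) \<xi> \<zeta> R \<alpha>)) = 1"
   by (simp add: lim_imp_Liminf one_ereal_def)
 qed
qed

end
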